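(* Let $\{X_{ij}:i,j\ge1\}$ be i.i.d. symmetric real random variables such that the law of $X_{11}$ is in the domain of attraction of the normal distribution, and let $\mathbf{Y}_n$ be the associated $n\times n$ self-normalized matrix. Let $(Z_k')_{k\ge1}$ be i.i.d. standard Gaussian random variables. Then: (i) for all integers $\ell\ge1$ and $k_1,\dots,k_\ell\ge1$, as $n\to\infty$, $$\big(\mathrm{Tr}[\mathbf{Y}_n^{k_1}],\dots,\mathrm{Tr}[\mathbf{Y}_n^{k_\ell}]\big)\to\big(\mathbf{1}_{\{2\mid k_1\}}+\sqrt{k_1}\,Z_{k_1}',\dots,\mathbf{1}_{\{2\mid k_\ell\}}+\sqrt{k_\ell}\,Z_{k_\ell}'\big)\quad\text{in distribution};$$ (ii) with $p_n(z)=\det(\mathbf{I}-z\mathbf{Y}_n)$, as $n\to\infty$, $p_n$ converges in distribution to the random holomorphic function $$z\mapsto\sqrt{1-z^2}\cdot\exp\Big(-\sum_{k\ge1}\frac{z^k}{\sqrt{k}}Z_k'\Big),\qquad z\in\mathbb{D}=\{z\in\mathbb{C}:|z|<1\},$$ as random elements of the space of holomorphic functions on $\mathbb{D}$ with the topology of uniform convergence on compact subsets.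
   Context: $\{X_{ij}\}_{i,j\ge1}$ are i.i.d., non-degenerate, symmetric ($X_{11}\overset{d}{=}-X_{11}$). The self-normalized matrix is $\mathbf{Y}_n=(Y_{ij})_{1\le i,j\le n}$ with $Y_{ij}=X_{ij}/\sqrt{X_{i1}^2+\cdots+X_{in}^2}$ (a row of $\mathbf Y_n$ is set to $0$ if the corresponding row $(X_{i1},\dots,X_{in})$ vanishes). The law of $X$ is in the domain of attraction of the normal distribution if, for i.i.d. copies $X_1,X_2,\dots$ of $X$, there are constants $a_n>0$ and $b_n\in\mathbb{R}$ such that $(X_1+\cdots+X_n-b_n)/a_n$ converges in distribution to a standard normal variable. The square root is the principal branch. *)

theory Defs
  imports "HOL-Probability.Probability" "Jordan_Normal_Form.Determinant"
begin

section \<open>Convergence in distribution in a topological space\<close>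

definition borel_of :: "'c topology \<Rightarrow> 'c measure" where
  "borel_of T = sigma (topspace T) {U. openin T U}"

text \<open>The measurability clauses say that the \<open>X n\<close> and \<open>Y\<close> are random elements of \<open>T\<close>; the limit
  may live on a different probability space.\<close>

definition conv_in_distribution ::
    "'c topology \<Rightarrow> 'a measure \<Rightarrow> (nat \<Rightarrow> 'a \<Rightarrow> 'c) \<Rightarrow> 'b measure \<Rightarrow> ('b \<Rightarrow> 'c) \<Rightarrow> bool" where
  "conv_in_distribution T M X N Y \<longleftrightarrow>
     (\<forall>n. X n \<in> measurable M (borel_of T)) \<and> Y \<in> measurable N (borel_of T) \<and>
     (\<forall>f :: 'c \<Rightarrow> real. continuous_map T euclideanreal f \<and> bounded (f ` topspace T) \<longrightarrow>
        (\<lambda>n. \<integral>\<omega>. f (X n \<omega>) \<partial>M) \<longlonglongrightarrow> (\<integral>\<omega>. f (Y \<omega>) \<partial>N))"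

text \<open>The i.i.d. copies of a variable with law \<open>\<mu>\<close> are the coordinates of the infinite product
  measure \<open>\<mu> \<otimes> \<mu> \<otimes> \<dots>\<close>.\<close>

definition normal_domain_of_attraction :: "real measure \<Rightarrow> bool" where
  "normal_domain_of_attraction \<mu> \<longleftrightarrow>
     (\<exists>a b :: nat \<Rightarrow> real. (\<forall>n. 0 < a n) \<and>
        weak_conv_m
          (\<lambda>n. distr (PiM (UNIV :: nat set) (\<lambda>_. \<mu>)) borel (\<lambda>x. ((\<Sum>i<n. x i) - b n) / a n))
          std_normal_distribution)"

section \<open>Self-normalized matrices\<close>

text \<open>Rows and columns are counted from \<open>0\<close>. As \<open>x / 0 = 0\<close>, the row of the self-normalized matrix
  belonging to a vanishing row of \<open>x\<close> is zero.\<close>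

definition self_normalized_mat :: "nat \<Rightarrow> (nat \<Rightarrow> nat \<Rightarrow> real) \<Rightarrow> real mat" where
  "self_normalized_mat n x = mat n n (\<lambda>(i, j). x i j / sqrt (\<Sum>l<n. (x i l)\<^sup>2))"

definition mat_trace :: "'a :: comm_monoid_add mat \<Rightarrow> 'a" where
  "mat_trace A = (\<Sum>i<dim_row A. A $$ (i, i))"

section \<open>The space of holomorphic functions on the unit disc\<close>

text \<open>Functions on the disc are represented by functions on \<open>\<complex>\<close> that are \<open>undefined\<close> outside the
  disc, so that two of them are equal iff they agree on the disc.\<close>

definition disc_holomorphic :: "(complex \<Rightarrow> complex) set" where
  "disc_holomorphic = {f. f holomorphic_on ball 0 1} \<inter> extensional (ball 0 1)"

text \<open>The topology of uniform convergence on compact subsets: the sets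
  \<open>{g. \<forall>z\<in>K. dist (f z) (g z) < e}\<close>, for \<open>K\<close> compact and \<open>e > 0\<close>, form a neighbourhood base at \<open>f\<close>.\<close>

definition openin_disc_holomorphic :: "(complex \<Rightarrow> complex) set \<Rightarrow> bool" where
  "openin_disc_holomorphic U \<longleftrightarrow> U \<subseteq> disc_holomorphic \<and>
     (\<forall>f\<in>U. \<exists>K e. compact K \<and> K \<subseteq> ball 0 1 \<and> 0 < e \<and>
        (\<forall>g\<in>disc_holomorphic. (\<forall>z\<in>K. dist (f z) (g z) < e) \<longrightarrow> g \<in> U))"

definition disc_holomorphic_topology :: "(complex \<Rightarrow> complex) topology" where
  "disc_holomorphic_topology = topology openin_disc_holomorphic"

lemma istopology_openin_disc_holomorphic: "istopology openin_disc_holomorphic"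
  unfolding istopology_def
proof (intro conjI allI impI)
  fix S T assume S: "openin_disc_holomorphic S" and T: "openin_disc_holomorphic T"
  have "\<exists>K e. compact K \<and> K \<subseteq> ball 0 1 \<and> 0 < e \<and>
        (\<forall>g\<in>disc_holomorphic. (\<forall>z\<in>K. dist (f z) (g z) < e) \<longrightarrow> g \<in> S \<inter> T)"
    if f: "f \<in> S \<inter> T" for f
  proof -
    obtain K e where 1: "compact K" "K \<subseteq> ball 0 1" "0 < e"
      "\<And>g. g \<in> disc_holomorphic \<Longrightarrow> (\<forall>z\<in>K. dist (f z) (g z) < e) \<Longrightarrow> g \<in> S"
      using S f unfolding openin_disc_holomorphic_def by (metis IntD1)
    obtain L d where 2: "compact L" "L \<subseteq> ball 0 1" "0 < d"
      "\<And>g. g \<in> disc_holomorphic \<Longrightarrow> (\<forall>z\<in>L. dist (f z) (g z) < d) \<Longrightarrow> g \<in> T"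
      using T f unfolding openin_disc_holomorphic_def by (metis IntD2)
    show ?thesis
      using 1 2 by (intro exI[of _ "K \<union> L"] exI[of _ "min e d"]) auto
  qed
  then show "openin_disc_holomorphic (S \<inter> T)"
    using S by (auto simp: openin_disc_holomorphic_def)
next
  fix \<K> assume *: "\<forall>K\<in>\<K>. openin_disc_holomorphic K"
  have "\<exists>K e. compact K \<and> K \<subseteq> ball 0 1 \<and> 0 < e \<and>
        (\<forall>g\<in>disc_holomorphic. (\<forall>z\<in>K. dist (f z) (g z) < e) \<longrightarrow> g \<in> \<Union>\<K>)"
    if "f \<in> \<Union>\<K>" for f
  proof -
    from that obtain U where "U \<in> \<K>" "f \<in> U" by blast
    with * obtain K e where "compact K" "K \<subseteq> ball 0 1" "0 < e"
      "\<forall>g\<in>disc_holomorphic. (\<forall>z\<in>K. dist (f z) (g z) < e) \<longrightarrow> g \<in> U"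
      unfolding openin_disc_holomorphic_def by meson
    with \<open>U \<in> \<K>\<close> show ?thesis by blast
  qed
  then show "openin_disc_holomorphic (\<Union>\<K>)"
    using * unfolding openin_disc_holomorphic_def by blast
qed

lemma openin_disc_holomorphic_topology:
  "openin disc_holomorphic_topology U \<longleftrightarrow> openin_disc_holomorphic U"
  by (simp add: disc_holomorphic_topology_def istopology_openin_disc_holomorphic)

lemma topspace_disc_holomorphic_topology: "topspace disc_holomorphic_topology = disc_holomorphic"
proof -
  have "openin_disc_holomorphic disc_holomorphic"
    unfolding openin_disc_holomorphic_def
    by (auto intro!: exI[of _ "{}"] exI[of _ "1::real"])
  then show ?thesis
    unfolding topspace_def openin_disc_holomorphic_topology
    by (auto simp: openin_disc_holomorphic_def)
qed

lemma limitin_disc_holomorphic_topology: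
  "limitin disc_holomorphic_topology f l F \<longleftrightarrow>
     l \<in> disc_holomorphic \<and> (\<forall>\<^sub>F x in F. f x \<in> disc_holomorphic) \<and>
     (\<forall>K. compact K \<and> K \<subseteq> ball 0 1 \<longrightarrow> uniform_limit K f l F)"
proof (intro iffI conjI allI impI)
  assume lim: "limitin disc_holomorphic_topology f l F"
  show l: "l \<in> disc_holomorphic"
    using lim by (simp add: limitin_def topspace_disc_holomorphic_topology)
  show "\<forall>\<^sub>F x in F. f x \<in> disc_holomorphic"
    using lim l openin_topspace[of disc_holomorphic_topology]
    unfolding limitin_def topspace_disc_holomorphic_topology by blast
  fix K :: "complex set" assume K: "compact K \<and> K \<subseteq> ball 0 1"
  show "uniform_limit K f l F"
    unfolding uniform_limit_iff
  proof (intro allI impI)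
    fix e :: real assume e: "e > 0"
    define U where "U = {g\<in>disc_holomorphic. \<exists>d<e. \<forall>z\<in>K. dist (g z) (l z) \<le> d}"
    have "openin_disc_holomorphic U"
      unfolding openin_disc_holomorphic_def
    proof (intro conjI ballI)
      fix g assume "g \<in> U"
      then obtain d where d: "d < e" "\<And>z. z \<in> K \<Longrightarrow> dist (g z) (l z) \<le> d"
        by (auto simp: U_def)
      have "h \<in> U" if h: "h \<in> disc_holomorphic" "\<forall>z\<in>K. dist (g z) (h z) < (e - d) / 2" for h
      proof -
        have "dist (h z) (l z) \<le> (e + d) / 2" if "z \<in> K" for z
          using d(2)[OF that] h(2) that dist_triangle[of "h z" "l z" "g z"]
          by (fastforce simp: dist_commute field_simps)
        moreover have "(e + d) / 2 < e" using d by simp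
        ultimately show ?thesis using h(1) unfolding U_def by blast
      qed
      then show "\<exists>K e. compact K \<and> K \<subseteq> ball 0 1 \<and> 0 < e \<and>
          (\<forall>h\<in>disc_holomorphic. (\<forall>z\<in>K. dist (g z) (h z) < e) \<longrightarrow> h \<in> U)"
        using K d by (intro exI[of _ K] exI[of _ "(e - d) / 2"]) auto
    qed (auto simp: U_def)
    moreover have "l \<in> U"
      using l e by (auto simp: U_def intro!: exI[of _ "0::real"])
    ultimately have "\<forall>\<^sub>F x in F. f x \<in> U"
      using lim by (simp add: limitin_def openin_disc_holomorphic_topology)
    then show "\<forall>\<^sub>F x in F. \<forall>z\<in>K. dist (f x z) (l z) < e"
      by eventually_elim (force simp: U_def)
  qed
next
  assume *: "l \<in> disc_holomorphic \<and> (\<forall>\<^sub>F x in F. f x \<in> disc_holomorphic) \<and>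
     (\<forall>K. compact K \<and> K \<subseteq> ball 0 1 \<longrightarrow> uniform_limit K f l F)"
  show "limitin disc_holomorphic_topology f l F"
    unfolding limitin_def topspace_disc_holomorphic_topology openin_disc_holomorphic_topology
  proof (intro conjI allI impI)
    fix U assume "openin_disc_holomorphic U \<and> l \<in> U"
    then obtain K e where K: "compact K" "K \<subseteq> ball 0 1" "0 < e"
      "\<And>g. g \<in> disc_holomorphic \<Longrightarrow> (\<forall>z\<in>K. dist (l z) (g z) < e) \<Longrightarrow> g \<in> U"
      unfolding openin_disc_holomorphic_def by meson
    have "\<forall>\<^sub>F x in F. f x \<in> disc_holomorphic" using * by blast
    moreover have "\<forall>\<^sub>F x in F. \<forall>z\<in>K. dist (f x z) (l z) < e"
      using * K unfolding uniform_limit_iff by blast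
    ultimately show "\<forall>\<^sub>F x in F. f x \<in> U"
      by eventually_elim (auto intro: K(4) simp: dist_commute)
  qed (use * in auto)
qed

section \<open>The limiting random function\<close>

text \<open>For i.i.d. standard Gaussian \<open>\<zeta> 1, \<zeta> 2, \<dots>\<close> the series below converges on the whole disc only
  almost surely (see \<open>AE_summable_gaussian_series\<close>); on the exceptional null event the limiting function
  is set to \<open>0\<close>, so that it is a holomorphic function at every sample point.\<close>

definition gaussian_series_term :: "(nat \<Rightarrow> real) \<Rightarrow> complex \<Rightarrow> nat \<Rightarrow> complex" where
  "gaussian_series_term \<zeta> z m = (let k = Suc m in z ^ k / of_real (sqrt (real k)) * of_real (\<zeta> k))"

definition limit_function :: "(nat \<Rightarrow> real) \<Rightarrow> complex \<Rightarrow> complex" where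
  "limit_function \<zeta> =
     (if \<forall>z\<in>ball 0 1. summable (gaussian_series_term \<zeta> z)
      then (\<lambda>z\<in>ball 0 1. csqrt (1 - z\<^sup>2) * exp (- (\<Sum>m. gaussian_series_term \<zeta> z m)))
      else (\<lambda>z\<in>ball 0 1. 0))"

lemma AE_summable_gaussian_series:
  fixes N :: "'b measure" and Z :: "nat \<Rightarrow> 'b \<Rightarrow> real"
  assumes Z: "\<And>k. k \<ge> 1 \<Longrightarrow> Z k \<in> borel_measurable N"
    and law: "\<And>k. k \<ge> 1 \<Longrightarrow> distr N borel (Z k) = std_normal_distribution"
  shows "AE \<omega> in N. \<forall>z\<in>ball 0 1. summable (gaussian_series_term (\<lambda>k. Z k \<omega>) z)"
proof -
  have moment: "(\<integral>\<^sup>+\<omega>. ennreal \<bar>Z (Suc m) \<omega>\<bar> \<partial>N) = ennreal (sqrt (2 / pi))" for m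
  proof -
    have "(\<integral>\<^sup>+\<omega>. ennreal \<bar>Z (Suc m) \<omega>\<bar> \<partial>N) = (\<integral>\<^sup>+x. ennreal \<bar>x\<bar> \<partial>distr N borel (Z (Suc m)))"
      by (subst nn_integral_distr) (auto intro: Z)
    also have "\<dots> = (\<integral>\<^sup>+x. ennreal \<bar>x\<bar> \<partial>std_normal_distribution)"
      by (simp add: law)
    also have "\<dots> = ennreal (\<integral>x. \<bar>x\<bar> \<partial>std_normal_distribution)"
      using integrable_std_normal_distribution_moment[of 1]
      by (intro nn_integral_eq_integral) auto
    also have "(\<integral>x. \<bar>x\<bar> \<partial>std_normal_distribution) = sqrt (2 / pi)"
      using std_normal_distribution_odd_moments_abs[of 0] by simp
    finally show ?thesis .
  qed
  have conv: "AE \<omega> in N. summable (\<lambda>m. r ^ Suc m * \<bar>Z (Suc m) \<omega>\<bar>)" if r: "0 \<le> r" "r < 1" for r :: real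
  proof -
    have sr: "summable (\<lambda>m. r ^ Suc m * sqrt (2 / pi))"
      using r by (intro summable_mult2 summable_Suc_iff[THEN iffD2] summable_geometric) auto
    have "(\<integral>\<^sup>+\<omega>. (\<Sum>m. ennreal (r ^ Suc m * \<bar>Z (Suc m) \<omega>\<bar>)) \<partial>N)
        = (\<Sum>m. \<integral>\<^sup>+\<omega>. ennreal (r ^ Suc m * \<bar>Z (Suc m) \<omega>\<bar>) \<partial>N)"
      using Z by (intro nn_integral_suminf) auto
    also have "\<dots> = (\<Sum>m. ennreal (r ^ Suc m * sqrt (2 / pi)))"
      using Z r by (subst ennreal_mult) (auto simp: nn_integral_cmult moment ennreal_mult)
    also have "\<dots> < \<infinity>"
      using sr r by (subst suminf_ennreal2) auto
    finally have "AE \<omega> in N. (\<Sum>m. ennreal (r ^ Suc m * \<bar>Z (Suc m) \<omega>\<bar>)) \<noteq> \<infinity>"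
      using Z by (intro nn_integral_PInf_AE) auto
    then show ?thesis
    proof eventually_elim
      case (elim \<omega>)
      have nonneg: "0 \<le> r ^ Suc m * \<bar>Z (Suc m) \<omega>\<bar>" for m
        using r by (intro mult_nonneg_nonneg zero_le_power abs_ge_zero)
      show ?case
        by (rule summable_suminf_not_top[OF nonneg]) (use elim in \<open>simp only: infinity_ennreal_def not_False_eq_True\<close>)
    qed
  qed
  have "AE \<omega> in N. \<forall>j::nat. summable (\<lambda>m. (1 - 1 / (real j + 1)) ^ Suc m * \<bar>Z (Suc m) \<omega>\<bar>)"
    unfolding AE_all_countable by (intro allI conv) (auto simp: field_simps)
  then show ?thesis
  proof eventually_elim
    case (elim \<omega>)
    show ?case
    proof
      fix z :: complex assume "z \<in> ball 0 1"
      then have "norm z < 1" by simp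
      then obtain j where j: "inverse (real (Suc j)) < 1 - norm z"
        using reals_Archimedean[of "1 - norm z"] by auto
      let ?r = "1 - 1 / (real j + 1)"
      have r: "norm z \<le> ?r" using j by (simp add: inverse_eq_divide add.commute)
      show "summable (gaussian_series_term (\<lambda>k. Z k \<omega>) z)"
      proof (rule summable_comparison_test'[where N = 0])
        show "summable (\<lambda>m. ?r ^ Suc m * \<bar>Z (Suc m) \<omega>\<bar>)" using elim by blast
        fix m :: nat
        have "norm z ^ Suc m / sqrt (real (Suc m)) \<le> norm z ^ Suc m / 1"
          by (intro divide_left_mono) auto
        also have "\<dots> = norm z ^ Suc m"
          by (simp only: div_by_1)
        also have "\<dots> \<le> ?r ^ Suc m"
          using r by (intro power_mono) auto
        finally have "norm z ^ Suc m / sqrt (real (Suc m)) * \<bar>Z (Suc m) \<omega>\<bar> \<le> ?r ^ Suc m * \<bar>Z (Suc m) \<omega>\<bar>"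
          by (rule mult_right_mono) simp
        then show "norm (gaussian_series_term (\<lambda>k. Z k \<omega>) z m) \<le> ?r ^ Suc m * \<bar>Z (Suc m) \<omega>\<bar>"
          unfolding gaussian_series_term_def Let_def
          by (simp add: norm_mult norm_divide norm_power del: power_Suc of_nat_Suc)
      qed
    qed
  qed
qed

end

theory Submission
  imports Defs "HOL-Complex_Analysis.Complex_Analysis" "HOL-Real_Asymp.Real_Asymp"
    "Jordan_Normal_Form.Schur_Decomposition" "HOL-Computational_Algebra.Polynomial_FPS"
begin

text \<open>
  In the normal domain of attraction \<open>n E Y\<^sub>1\<^sub>1\<^sup>4 \<rightarrow> 0\<close> while \<open>n E Y\<^sub>1\<^sub>1\<^sup>2 = 1 + o(1)\<close>, and by symmetry a product of
  entries has mean \<open>0\<close> as soon as one entry occurs an odd number of times. Expanding \<open>Tr Y\<^sup>k\<close> over closed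
  walks, the doubled cycles of length \<open>k / 2\<close> concentrate at \<open>1\<close> for even \<open>k\<close>, the simple cycles of length
  \<open>k\<close> form the Gaussian part, and all other walks are negligible in \<open>L\<^sup>1\<close>. A real linear combination
  \<open>S\<close> of the sums over simple cycles is treated by Stein's method: reversing the signs in one row
  decouples the cycles through that row, so the characteristic function \<open>\<psi>\<close> of \<open>S\<close> satisfies
  \<open>\<psi>' s = - \<sigma>\<^sup>2 s \<psi> s + o(1)\<close>.

  The coefficients of \<open>det (I - z Y)\<close> are the Newton polynomials in the traces, and distinct minors are
  uncorrelated by parity, so every coefficient has second moment at most \<open>1\<close>. This makes the truncation of
  the power series uniform on compact subsets of the disc, and Newton's identities identify the limit.
\<close>

section \<open>Convergence in distribution from characteristic functions\<close>

inductive_set trig_poly :: "nat set \<Rightarrow> ((nat \<Rightarrow> real) \<Rightarrow> complex) set" for I where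
  cis: "(\<lambda>x. cis (\<Sum>i\<in>I. t i * x i)) \<in> trig_poly I"
| add: "f \<in> trig_poly I \<Longrightarrow> g \<in> trig_poly I \<Longrightarrow> (\<lambda>x. f x + g x) \<in> trig_poly I"
| scale: "f \<in> trig_poly I \<Longrightarrow> (\<lambda>x. c * f x) \<in> trig_poly I"

text \<open>The product of two characters is the character of the summed frequencies, and two nested
  inductions extend this bilinearly. So the linear span of the characters is an algebra, which is
  the form that Stone-Weierstrass requires.\<close>

lemma trig_poly_mult:
  assumes "f \<in> trig_poly I" "g \<in> trig_poly I"
  shows "(\<lambda>x. f x * g x) \<in> trig_poly I"
  using assms(1)
proof induction
  case (cis t)
  from assms(2) show ?case
  proof induction
    case (cis s)
    have "(\<lambda>x. cis (\<Sum>i\<in>I. (t i + s i) * x i)) \<in> trig_poly I"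
      by (rule trig_poly.cis)
    then show ?case
      by (simp add: cis_mult sum.distrib distrib_right)
  next
    case (add f g)
    from trig_poly.add[OF add.IH] show ?case by (simp add: algebra_simps)
  next
    case (scale f c)
    from trig_poly.scale[OF scale.IH, of c] show ?case by (simp add: algebra_simps)
  qed
next
  case (add f h)
  from trig_poly.add[OF add.IH] show ?case by (simp add: algebra_simps)
next
  case (scale f c)
  from trig_poly.scale[OF scale.IH, of c] show ?case by (simp add: algebra_simps)
qed

lemma trig_poly_const: "(\<lambda>_. c) \<in> trig_poly I"
  using trig_poly.scale[OF trig_poly.cis[where t = "\<lambda>_. 0" and I = I], of c] by simp

text \<open>Euler's formula, with the frequencies \<open>w\<close> and \<open>- w\<close> in
  coordinate \<open>i\<close> alone. The sines serve as bounded coordinates that map the whole space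
  into a compact cube.\<close>

lemma trig_poly_sin:
  assumes "finite I" "i \<in> I"
  shows "(\<lambda>x. complex_of_real (sin (w * x i))) \<in> trig_poly I"
proof -
  have s: "(\<Sum>j\<in>I. (if j = i then u else 0) * x j) = u * x i" for u :: real and x :: "nat \<Rightarrow> real"
    using assms by (subst sum.remove[of I i]) (auto intro: sum.neutral)
  have e: "(\<lambda>x. cis (u * x i)) \<in> trig_poly I" for u
    using trig_poly.cis[where t = "\<lambda>j. if j = i then u else 0" and I = I] unfolding s .
  have "(\<lambda>x. (- \<i> / 2) * cis (w * x i) + (\<i> / 2) * cis (- w * x i)) \<in> trig_poly I"
    by (intro trig_poly.add trig_poly.scale e)
  also have "(\<lambda>x. (- \<i> / 2) * cis (w * x i) + (\<i> / 2) * cis (- w * x i)) =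
      (\<lambda>x. complex_of_real (sin (w * x i)))"
    by (auto simp: fun_eq_iff complex_eq_iff)
  finally show ?thesis .
qed

lemma trig_poly_bounded_measurable:
  assumes "f \<in> trig_poly I" "finite I" "\<And>i. i \<in> I \<Longrightarrow> (\<lambda>\<omega>. V \<omega> i) \<in> borel_measurable M"
  shows "(\<lambda>\<omega>. f (V \<omega>)) \<in> borel_measurable M \<and> (\<exists>B. \<forall>\<omega>. norm (f (V \<omega>)) \<le> B)"
  using assms(1)
proof induction
  case (cis t)
  have "(\<lambda>\<omega>. \<Sum>i\<in>I. t i * V \<omega> i) \<in> borel_measurable M" using assms by auto
  then have "(\<lambda>\<omega>. cis (\<Sum>i\<in>I. t i * V \<omega> i)) \<in> borel_measurable M"
    unfolding cis_conv_exp by measurable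
  then show ?case by (auto intro!: exI[of _ 1])
next
  case (add f g)
  from add.IH obtain A B where "\<And>\<omega>. norm (f (V \<omega>)) \<le> A" "\<And>\<omega>. norm (g (V \<omega>)) \<le> B" by blast
  then have "norm (f (V \<omega>) + g (V \<omega>)) \<le> A + B" for \<omega>
    by (meson add_mono norm_triangle_le)
  then have "\<exists>B. \<forall>\<omega>. norm (f (V \<omega>) + g (V \<omega>)) \<le> B" by blast
  moreover have "(\<lambda>\<omega>. f (V \<omega>) + g (V \<omega>)) \<in> borel_measurable M"
    using add.IH by (intro borel_measurable_add) simp_all
  ultimately show ?case by blast
next
  case (scale f c)
  from scale.IH obtain A where "\<And>\<omega>. norm (f (V \<omega>)) \<le> A" by blast
  then have "norm (c * f (V \<omega>)) \<le> norm c * A" for \<omega>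
    by (simp add: norm_mult mult_left_mono)
  then have "\<exists>B. \<forall>\<omega>. norm (c * f (V \<omega>)) \<le> B" by blast
  moreover have "(\<lambda>\<omega>. c * f (V \<omega>)) \<in> borel_measurable M"
    using scale.IH by (intro borel_measurable_times) simp_all
  ultimately show ?case by blast
qed

text \<open>Linearity extends the hypothesis on characteristic functions to their span; boundedness
  makes all the integrals exist.\<close>

lemma trig_poly_tendsto:
  assumes f: "f \<in> trig_poly I" and I: "finite I"
    and M: "prob_space M" and N: "prob_space N"
    and V: "\<And>n i. i \<in> I \<Longrightarrow> (\<lambda>\<omega>. V n \<omega> i) \<in> borel_measurable M"
    and L: "\<And>i. i \<in> I \<Longrightarrow> (\<lambda>\<omega>. L \<omega> i) \<in> borel_measurable N"
    and char: "\<And>t. (\<lambda>n. \<integral>\<omega>. cis (\<Sum>i\<in>I. t i * V n \<omega> i) \<partial>M) \<longlonglongrightarrow> (\<integral>\<omega>. cis (\<Sum>i\<in>I. t i * L \<omega> i) \<partial>N)"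
  shows "(\<lambda>n. \<integral>\<omega>. f (V n \<omega>) \<partial>M) \<longlonglongrightarrow> (\<integral>\<omega>. f (L \<omega>) \<partial>N)"
proof -
  interpret M: prob_space M by (rule M)
  interpret N: prob_space N by (rule N)
  have iM: "integrable M (\<lambda>\<omega>. f (V n \<omega>))" if "f \<in> trig_poly I" for f n
  proof -
    have m: "(\<lambda>\<omega>. f (V n \<omega>)) \<in> borel_measurable M \<and> (\<exists>B. \<forall>\<omega>. norm (f (V n \<omega>)) \<le> B)"
      by (rule trig_poly_bounded_measurable[OF that I]) (rule V)
    then obtain B where "\<forall>\<omega>. norm (f (V n \<omega>)) \<le> B" by auto
    with m show ?thesis by (intro M.integrable_const_bound[where B = B]) simp_all
  qed
  have iN: "integrable N (\<lambda>\<omega>. f (L \<omega>))" if "f \<in> trig_poly I" for f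
  proof -
    have m: "(\<lambda>\<omega>. f (L \<omega>)) \<in> borel_measurable N \<and> (\<exists>B. \<forall>\<omega>. norm (f (L \<omega>)) \<le> B)"
      by (rule trig_poly_bounded_measurable[OF that I]) (rule L)
    then obtain B where "\<forall>\<omega>. norm (f (L \<omega>)) \<le> B" by auto
    with m show ?thesis by (intro N.integrable_const_bound[where B = B]) simp_all
  qed
  from f show ?thesis
  proof induction
    case (cis t)
    show ?case by (rule char)
  next
    case (add f g)
    then show ?case by (simp add: iM iN tendsto_add)
  next
    case (scale f c)
    then show ?case by (simp add: iM iN tendsto_mult_left)
  qed
qed

section \<open>Continuous functions on a compact cube\<close>

lemma compact_PiE_fun:
  fixes S :: "nat \<Rightarrow> real set"
  assumes "\<And>i. i \<in> I \<Longrightarrow> compact (S i)"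
  shows "compact (PiE I S)"
proof -
  \<comment> \<open>The type \<open>nat \<Rightarrow> real\<close> carries the product topology over
    all indices. Extensional functions are \<open>undefined\<close> off \<open>I\<close>, so the set
    is a full product whose remaining factors are singletons, and Tychonoff's theorem
    applies.\<close>
  have "compactin (product_topology (\<lambda>_. euclidean) UNIV)
      (PiE UNIV (\<lambda>i. if i \<in> I then S i else {undefined}))"
    using assms by (subst compactin_PiE) auto
  also have "PiE UNIV (\<lambda>i. if i \<in> I then S i else {undefined}) = PiE I S"
    by (auto simp: PiE_def Pi_def extensional_def split: if_splits)
  finally show ?thesis by (simp add: euclidean_product_topology flip: compactin_euclidean_iff)
qed

lemma expectation_diff_le_integral:
  fixes f g k :: "'a \<Rightarrow> real"
  assumes f: "integrable M f" and g: "integrable M g" and k: "integrable M k"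
    and le: "\<And>x. \<bar>f x - g x\<bar> \<le> k x"
  shows "\<bar>integral\<^sup>L M f - integral\<^sup>L M g\<bar> \<le> integral\<^sup>L M k"
proof -
  have "\<bar>integral\<^sup>L M f - integral\<^sup>L M g\<bar> = \<bar>\<integral>x. f x - g x \<partial>M\<bar>"
    using f g by simp
  also have "\<dots> \<le> (\<integral>x. \<bar>f x - g x\<bar> \<partial>M)"
    by (rule integral_abs_bound)
  also have "\<dots> \<le> integral\<^sup>L M k"
    using f g k le by (intro integral_mono) auto
  finally show ?thesis .
qed

lemma (in prob_space) expectation_diff_le:
  fixes f g :: "'a \<Rightarrow> real"
  assumes f: "integrable M f" and g: "integrable M g" and le: "\<And>x. \<bar>f x - g x\<bar> \<le> c"
  shows "\<bar>expectation f - expectation g\<bar> \<le> c"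
  using expectation_diff_le_integral[OF f g _ le] by (simp add: prob_space)

text \<open>On the cube, the continuous functions whose composition with the sine coordinates is a
  trigonometric polynomial form an algebra. It separates points because the coordinates themselves
  belong to it. Uniform approximation then transfers convergence from trigonometric polynomials to
  every continuous \<open>F\<close>.\<close>

lemma cube_expectation_tendsto:
  fixes F :: "(nat \<Rightarrow> real) \<Rightarrow> real"
  assumes I: "finite I"
    and M: "prob_space M" and N: "prob_space N"
    and V: "\<And>n i. i \<in> I \<Longrightarrow> (\<lambda>\<omega>. V n \<omega> i) \<in> borel_measurable M"
    and L: "\<And>i. i \<in> I \<Longrightarrow> (\<lambda>\<omega>. L \<omega> i) \<in> borel_measurable N"
    and char: "\<And>t. (\<lambda>n. \<integral>\<omega>. cis (\<Sum>i\<in>I. t i * V n \<omega> i) \<partial>M) \<longlonglongrightarrow> (\<integral>\<omega>. cis (\<Sum>i\<in>I. t i * L \<omega> i) \<partial>N)"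
    and F: "continuous_on (PiE I (\<lambda>_. {-1..1})) F"
    and FV: "\<And>n. (\<lambda>\<omega>. F (\<lambda>i\<in>I. sin (w * V n \<omega> i))) \<in> borel_measurable M"
    and FL: "(\<lambda>\<omega>. F (\<lambda>i\<in>I. sin (w * L \<omega> i))) \<in> borel_measurable N"
  shows "(\<lambda>n. \<integral>\<omega>. F (\<lambda>i\<in>I. sin (w * V n \<omega> i)) \<partial>M) \<longlonglongrightarrow> (\<integral>\<omega>. F (\<lambda>i\<in>I. sin (w * L \<omega> i)) \<partial>N)"
proof -
  interpret M: prob_space M by (rule M)
  interpret N: prob_space N by (rule N)
  define S :: "(nat \<Rightarrow> real) set" where "S = PiE I (\<lambda>_. {-1..1})"
  define u where "u x = (\<lambda>i\<in>I. sin (w * x i))" for x :: "nat \<Rightarrow> real"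
  define R where "R = {h. continuous_on S h \<and> (\<lambda>x. complex_of_real (h (u x))) \<in> trig_poly I}"
  have cS: "compact S" unfolding S_def by (rule compact_PiE_fun) auto
  have uS: "u x \<in> S" for x unfolding u_def S_def by auto
  interpret function_ring_on R S
  proof
    fix f g assume f: "f \<in> R" and g: "g \<in> R"
    show "(\<lambda>x. f x + g x) \<in> R"
      using f g trig_poly.add[of "\<lambda>x. complex_of_real (f (u x))" I "\<lambda>x. complex_of_real (g (u x))"]
      by (auto simp: R_def intro: continuous_intros)
    show "(\<lambda>x. f x * g x) \<in> R"
      using f g trig_poly_mult[of "\<lambda>x. complex_of_real (f (u x))" I "\<lambda>x. complex_of_real (g (u x))"]
      by (auto simp: R_def intro: continuous_intros)
  next
    show "(\<lambda>_. c) \<in> R" for c by (auto simp: R_def trig_poly_const)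
  next
    fix x y assume xy: "x \<in> S" "y \<in> S" "x \<noteq> y"
    then obtain i where i: "i \<in> I" "x i \<noteq> y i"
      unfolding S_def by (metis PiE_ext)
    have "continuous_on S (\<lambda>x. x i)"
      by (rule continuous_on_subset[OF continuous_on_product_coordinates]) auto
    then have "(\<lambda>x. x i) \<in> R"
      using i trig_poly_sin[OF I i(1), of w] by (auto simp: R_def u_def)
    then show "\<exists>f\<in>R. f x \<noteq> f y" by (rule bexI[rotated]) (rule i(2))
  qed (use cS in \<open>auto simp: R_def\<close>)
  define a where "a n = (\<integral>\<omega>. F (u (V n \<omega>)) \<partial>M)" for n
  define b where "b = (\<integral>\<omega>. F (u (L \<omega>)) \<partial>N)"
  from compact_continuous_image[OF F[folded S_def] cS] have "bounded (F ` S)"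
    by (rule compact_imp_bounded)
  then obtain B where B: "\<And>x. x \<in> S \<Longrightarrow> norm (F x) \<le> B" by (auto simp: bounded_iff)
  have iF: "integrable M (\<lambda>\<omega>. F (u (V n \<omega>)))" for n
    using FV B uS unfolding u_def[symmetric] by (intro M.integrable_const_bound[where B = B]) auto
  have iFL: "integrable N (\<lambda>\<omega>. F (u (L \<omega>)))"
    using FL B uS unfolding u_def[symmetric] by (intro N.integrable_const_bound[where B = B]) auto
  have "\<exists>n0. \<forall>n\<ge>n0. dist (a n) b < e" if e: "e > 0" for e
  proof -
    obtain g where g: "g \<in> R" "\<And>x. x \<in> S \<Longrightarrow> \<bar>F x - g x\<bar> < e / 3"
      using Stone_Weierstrass_basic[OF F[folded S_def], of "e / 3"] e by auto
    have gT: "(\<lambda>x. complex_of_real (g (u x))) \<in> trig_poly I" using g by (simp add: R_def)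
    have gM: "(\<lambda>\<omega>. g (u (V n \<omega>))) \<in> borel_measurable M" for n
    proof -
      have "(\<lambda>\<omega>. complex_of_real (g (u (V n \<omega>)))) \<in> borel_measurable M"
        by (rule conjunct1[OF trig_poly_bounded_measurable[OF gT I]]) (rule V)
      from measurable_compose[OF this borel_measurable_Re] show ?thesis by simp
    qed
    have gN: "(\<lambda>\<omega>. g (u (L \<omega>))) \<in> borel_measurable N"
    proof -
      have "(\<lambda>\<omega>. complex_of_real (g (u (L \<omega>)))) \<in> borel_measurable N"
        by (rule conjunct1[OF trig_poly_bounded_measurable[OF gT I]]) (rule L)
      from measurable_compose[OF this borel_measurable_Re] show ?thesis by simp
    qed
    have gB: "norm (g (u x)) \<le> B + e / 3" for x
      using g(2)[OF uS, of x] B[OF uS, of x] unfolding real_norm_def by linarith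
    have ig: "integrable M (\<lambda>\<omega>. g (u (V n \<omega>)))" for n
      using gM gB by (intro M.integrable_const_bound[where B = "B + e / 3"]) auto
    have igL: "integrable N (\<lambda>\<omega>. g (u (L \<omega>)))"
      using gN gB by (intro N.integrable_const_bound[where B = "B + e / 3"]) auto
    have "(\<lambda>n. \<integral>\<omega>. complex_of_real (g (u (V n \<omega>))) \<partial>M) \<longlonglongrightarrow> (\<integral>\<omega>. complex_of_real (g (u (L \<omega>))) \<partial>N)"
      by (rule trig_poly_tendsto[OF gT I M N, of V L]) (fact V L char)+
    then have "(\<lambda>n. \<integral>\<omega>. g (u (V n \<omega>)) \<partial>M) \<longlonglongrightarrow> (\<integral>\<omega>. g (u (L \<omega>)) \<partial>N)"
      by (simp add: tendsto_of_real_iff)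
    then obtain n0 where n0: "\<And>n. n \<ge> n0 \<Longrightarrow> \<bar>(\<integral>\<omega>. g (u (V n \<omega>)) \<partial>M) - (\<integral>\<omega>. g (u (L \<omega>)) \<partial>N)\<bar> < e / 3"
      using e unfolding lim_sequentially dist_real_def by (metis divide_pos_pos zero_less_numeral)
    have 1: "\<bar>a n - (\<integral>\<omega>. g (u (V n \<omega>)) \<partial>M)\<bar> \<le> e / 3" for n
      unfolding a_def by (rule M.expectation_diff_le[OF iF ig]) (use g(2)[OF uS] in \<open>auto intro: less_imp_le\<close>)
    have 2: "\<bar>b - (\<integral>\<omega>. g (u (L \<omega>)) \<partial>N)\<bar> \<le> e / 3"
      unfolding b_def by (rule N.expectation_diff_le[OF iFL igL]) (use g(2)[OF uS] in \<open>auto intro: less_imp_le\<close>)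
    have "dist (a n) b < e" if "n \<ge> n0" for n
      using 1[of n] 2 n0[OF that] unfolding dist_real_def by linarith
    then show ?thesis by blast
  qed
  then show ?thesis unfolding lim_sequentially a_def b_def u_def by blast
qed

section \<open>Borel measurability, and passage from the cube to the whole space\<close>

lemma measurable_product_borel_of:
  fixes W :: "'a \<Rightarrow> nat \<Rightarrow> real"
  assumes I: "finite I" and W: "\<And>i. i \<in> I \<Longrightarrow> (\<lambda>\<omega>. W \<omega> i) \<in> borel_measurable M"
  shows "(\<lambda>\<omega>. \<lambda>i\<in>I. W \<omega> i) \<in> measurable M (borel_of (product_topology (\<lambda>_. euclideanreal) I))"
  unfolding borel_of_def
proof (rule measurable_measure_of)
  let ?T = "product_topology (\<lambda>_. euclideanreal) I" and ?W = "\<lambda>\<omega>. \<lambda>i\<in>I. W \<omega> i"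
  show "{U. openin ?T U} \<subseteq> Pow (topspace ?T)"
    using openin_subset[of ?T] by blast
  show "?W \<in> space M \<rightarrow> topspace ?T" by auto
  fix U assume "U \<in> {U. openin ?T U}"
  then have U: "openin ?T U" by simp
  obtain \<B> :: "real set set" where \<B>: "countable \<B>" "topological_basis \<B>"
    by (metis ex_countable_basis)
  \<comment> \<open>\<open>borel_of\<close> is generated by all open sets and not by boxes. As
    \<open>I\<close> is finite, there are only countably many boxes with sides in a countable base,
    and an open set is the union of those that it contains.\<close>
  define \<C> where "\<C> = {X \<in> PiE I (\<lambda>_. \<B>). PiE I X \<subseteq> U}"
  have c: "countable \<C>"
    unfolding \<C>_def using countable_PiE[OF I, of "\<lambda>_. \<B>"] \<B>(1) by (auto intro: countable_subset[rotated])
  have "U = (\<Union>X\<in>\<C>. PiE I X)"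
  proof (intro equalityI subsetI)
    fix x assume x: "x \<in> U"
    from product_topology_open_contains_basis[OF U x] obtain X where
      X: "x \<in> PiE I X" "\<And>i. open (X i)" "PiE I X \<subseteq> U" by auto
    have "\<exists>B. B \<in> \<B> \<and> x i \<in> B \<and> B \<subseteq> X i" if "i \<in> I" for i
      using topological_basisE[OF \<B>(2) X(2), of "x i" i] X(1) that by (metis PiE_mem)
    then obtain B where B: "\<And>i. i \<in> I \<Longrightarrow> B i \<in> \<B> \<and> x i \<in> B i \<and> B i \<subseteq> X i" by metis
    have "PiE I (restrict B I) \<subseteq> PiE I X" by (rule PiE_mono) (use B in auto)
    then have "restrict B I \<in> \<C>" "x \<in> PiE I (restrict B I)"
      using B X by (auto simp: \<C>_def PiE_iff)
    then show "x \<in> (\<Union>X\<in>\<C>. PiE I X)" by blast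
  qed (auto simp: \<C>_def)
  then have UE: "U = (\<Union>X\<in>\<C>. PiE I X)" .
  have "?W -` U \<inter> space M = (\<Union>X\<in>\<C>. {\<omega>\<in>space M. \<forall>i\<in>I. W \<omega> i \<in> X i})"
    unfolding UE by (force simp: PiE_iff)
  also have "\<dots> \<in> sets M"
  proof (rule sets.countable_UN'[OF c], safe)
    fix X assume "X \<in> \<C>"
    then have X: "X i \<in> sets borel" if "i \<in> I" for i
      using topological_basis_open[OF \<B>(2)] that by (auto simp: \<C>_def PiE_iff)
    show "{\<omega>\<in>space M. \<forall>i\<in>I. W \<omega> i \<in> X i} \<in> sets M"
      by (rule sets.sets_Collect_finite_All[OF _ I]) (use W X in \<open>auto intro!: measurable_sets_Collect\<close>)
  qed
  finally show "?W -` U \<inter> space M \<in> sets M" .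
qed

lemma measurable_continuous_map_borel_of:
  assumes W: "W \<in> measurable M (borel_of T)" and f: "continuous_map T euclideanreal f"
  shows "(\<lambda>\<omega>. f (W \<omega>)) \<in> borel_measurable M"
proof -
  have "f \<in> measurable (borel_of T) borel"
  proof (rule borel_measurableI)
    fix S :: "real set" assume "open S"
    then have "openin T {x \<in> topspace T. f x \<in> S}"
      using f by (simp add: openin_continuous_map_preimage)
    moreover have "f -` S \<inter> space (borel_of T) = {x \<in> topspace T. f x \<in> S}"
      by (auto simp: borel_of_def space_measure_of_conv)
    moreover have "{U. openin T U} \<subseteq> Pow (topspace T)" using openin_subset by auto
    ultimately show "f -` S \<inter> space (borel_of T) \<in> sets (borel_of T)"
      by (simp add: borel_of_def sets_measure_of sigma_sets.Basic)
  qed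
  from measurable_compose[OF W this] show ?thesis .
qed

lemma measurable_continuous_map_product:
  fixes W :: "'a \<Rightarrow> nat \<Rightarrow> real"
  assumes I: "finite I" and "continuous_map (product_topology (\<lambda>_. euclideanreal) I) euclideanreal f"
    and "\<And>i. i \<in> I \<Longrightarrow> (\<lambda>\<omega>. W \<omega> i) \<in> borel_measurable M"
  shows "(\<lambda>\<omega>. f (\<lambda>i\<in>I. W \<omega> i)) \<in> borel_measurable M"
  by (rule measurable_continuous_map_borel_of[OF measurable_product_borel_of[OF I]]) (use assms in auto)

text \<open>A bounded continuous \<open>f\<close> is compared with a function on the cube:
  \<open>A * arcsin (sin (x / A))\<close> equals \<open>x\<close> as long as
  \<open>\<bar>x\<bar> \<le> A\<close>. The error is bounded by the mass outside a box, and
  convergence of the one-dimensional marginals keeps that mass small for all large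
  \<open>n\<close>.\<close>

lemma conv_in_distribution_if_char_tendsto:
  fixes V :: "nat \<Rightarrow> 'a \<Rightarrow> nat \<Rightarrow> real" and L :: "'b \<Rightarrow> nat \<Rightarrow> real"
  assumes I: "finite I"
    and M: "prob_space M" and N: "prob_space N"
    and V: "\<And>n i. i \<in> I \<Longrightarrow> (\<lambda>\<omega>. V n \<omega> i) \<in> borel_measurable M"
    and L: "\<And>i. i \<in> I \<Longrightarrow> (\<lambda>\<omega>. L \<omega> i) \<in> borel_measurable N"
    and char: "\<And>t. (\<lambda>n. \<integral>\<omega>. cis (\<Sum>i\<in>I. t i * V n \<omega> i) \<partial>M) \<longlonglongrightarrow> (\<integral>\<omega>. cis (\<Sum>i\<in>I. t i * L \<omega> i) \<partial>N)"
  shows "conv_in_distribution (product_topology (\<lambda>_. euclideanreal) I)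
    M (\<lambda>n \<omega>. \<lambda>i\<in>I. V n \<omega> i) N (\<lambda>\<omega>. \<lambda>i\<in>I. L \<omega> i)"
  unfolding conv_in_distribution_def
proof (intro conjI allI impI)
  show "(\<lambda>\<omega>. \<lambda>i\<in>I. V n \<omega> i) \<in> measurable M (borel_of (product_topology (\<lambda>_. euclideanreal) I))" for n
    using I V by (rule measurable_product_borel_of)
  show "(\<lambda>\<omega>. \<lambda>i\<in>I. L \<omega> i) \<in> measurable N (borel_of (product_topology (\<lambda>_. euclideanreal) I))"
    using I L by (rule measurable_product_borel_of)
next
  interpret M: prob_space M by (rule M)
  interpret N: prob_space N by (rule N)
  let ?T = "product_topology (\<lambda>_. euclideanreal) I"
  let ?V = "\<lambda>n \<omega>. \<lambda>i\<in>I. V n \<omega> i" and ?L = "\<lambda>\<omega>. \<lambda>i\<in>I. L \<omega> i"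
  fix f :: "(nat \<Rightarrow> real) \<Rightarrow> real"
  assume "continuous_map ?T euclideanreal f \<and> bounded (f ` topspace ?T)"
  then have fc: "continuous_map ?T euclideanreal f" and "bounded (f ` topspace ?T)" by auto
  then obtain B where B: "\<And>x. x \<in> extensional I \<Longrightarrow> \<bar>f x\<bar> \<le> B" and B0: "B > 0"
    unfolding bounded_pos by (auto simp: PiE_def)
  have mM: "(\<lambda>\<omega>. f (\<lambda>i\<in>I. W \<omega> i)) \<in> borel_measurable M"
    if "\<And>i. i \<in> I \<Longrightarrow> (\<lambda>\<omega>. W \<omega> i) \<in> borel_measurable M" for W
    by (rule measurable_continuous_map_product[OF I fc]) (rule that)
  have mN: "(\<lambda>\<omega>. f (\<lambda>i\<in>I. W \<omega> i)) \<in> borel_measurable N"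
    if "\<And>i. i \<in> I \<Longrightarrow> (\<lambda>\<omega>. W \<omega> i) \<in> borel_measurable N" for W
    by (rule measurable_continuous_map_product[OF I fc]) (rule that)
  show "(\<lambda>n. \<integral>\<omega>. f (?V n \<omega>) \<partial>M) \<longlonglongrightarrow> (\<integral>\<omega>. f (?L \<omega>) \<partial>N)"
  proof (rule LIMSEQ_I)
    fix e :: real assume e: "e > 0"
    \<comment> \<open>A continuous ramp, 0 for \<open>\<bar>x\<bar> \<le> A - 1\<close> and 1 for
      \<open>\<bar>x\<bar> \<ge> A\<close>. It replaces the indicator of a tail because weak
      convergence tests continuous functions only.\<close>
    define h where "h A x = min 1 (max 0 (\<bar>x\<bar> - A + 1))" for A x :: real
    have h_cont: "continuous_on UNIV (h A)" for A
      unfolding h_def by (intro continuous_intros)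
    have h_meas: "h A \<in> borel_measurable borel" for A
      by (rule borel_measurable_continuous_onI[OF h_cont])
    have h01: "0 \<le> h A x" "h A x \<le> 1" for A x by (auto simp: h_def)
    have h_tend: "(\<lambda>n. \<integral>\<omega>. h A (V n \<omega> i) \<partial>M) \<longlonglongrightarrow> (\<integral>\<omega>. h A (L \<omega> i) \<partial>N)" if i: "i \<in> I" for A i
    proof -
      note [measurable] = V[OF i] L[OF i] h_meas
      have s: "(\<Sum>j\<in>I. (if j = i then u else 0) * x j) = u * x i" for u :: real and x :: "nat \<Rightarrow> real"
        using I i by (subst sum.remove[of I i]) (auto intro: sum.neutral)
      have "weak_conv_m (\<lambda>n. distr M borel (\<lambda>\<omega>. V n \<omega> i)) (distr N borel (\<lambda>\<omega>. L \<omega> i))"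
      proof (rule levy_continuity)
        show "real_distribution (distr M borel (\<lambda>\<omega>. V n \<omega> i))" for n
          by (rule M.real_distribution_distr) measurable
        show "real_distribution (distr N borel (\<lambda>\<omega>. L \<omega> i))"
          by (rule N.real_distribution_distr) measurable
        show "(\<lambda>n. char (distr M borel (\<lambda>\<omega>. V n \<omega> i)) t) \<longlonglongrightarrow> char (distr N borel (\<lambda>\<omega>. L \<omega> i)) t" for t
          using char[of "\<lambda>j. if j = i then t else 0"] unfolding s
          by (simp add: char_def integral_distr cis_conv_exp)
      qed
      from weak_conv_imp_integral_bdd_continuous_conv[OF _ _ this, of "h A" 1]
      have "(\<lambda>n. integral\<^sup>L (distr M borel (\<lambda>\<omega>. V n \<omega> i)) (h A)) \<longlonglongrightarrow> integral\<^sup>L (distr N borel (\<lambda>\<omega>. L \<omega> i)) (h A)"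
        using h_cont h01 by (auto simp: continuous_on_eq_continuous_at intro!: M.real_distribution_distr N.real_distribution_distr)
      then show ?thesis by (simp add: integral_distr)
    qed
    \<comment> \<open>Chosen such that tails below \<open>d\<close> in all coordinates contribute at
      most \<open>e / 6\<close> after multiplication by \<open>2 * B\<close>; the added 1 covers an
      empty \<open>I\<close>.\<close>
    define d where "d = e / (12 * B * (1 + real (card I)))"
    have d: "d > 0" using e B0 by (simp add: d_def)
    have "\<exists>A::nat. \<forall>i\<in>I. (\<integral>\<omega>. h (real A) (L \<omega> i) \<partial>N) < d"
    proof -
      have "\<forall>\<^sub>F A in sequentially. (\<integral>\<omega>. h (real A) (L \<omega> i) \<partial>N) < d" if i: "i \<in> I" for i
      proof -
        note [measurable] = L[OF i] h_meas
        have "(\<lambda>A. \<integral>\<omega>. h (real A) (L \<omega> i) \<partial>N) \<longlonglongrightarrow> (\<integral>\<omega>. 0 \<partial>N)"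
        proof (rule integral_dominated_convergence[where w = "\<lambda>_. 1"])
          show "AE \<omega> in N. (\<lambda>A. h (real A) (L \<omega> i)) \<longlonglongrightarrow> 0"
          proof (intro AE_I2 tendsto_eventually)
            fix \<omega>
            obtain k :: nat where k: "\<bar>L \<omega> i\<bar> + 1 \<le> real k" using real_arch_simple by blast
            show "\<forall>\<^sub>F A in sequentially. h (real A) (L \<omega> i) = 0"
              using eventually_ge_at_top[of k] by eventually_elim (use k in \<open>auto simp: h_def\<close>)
          qed
        qed (use h01 in auto)
        then show ?thesis using d by (auto dest!: order_tendstoD(2)[of _ _ _ d])
      qed
      then have "\<forall>\<^sub>F A in sequentially. \<forall>i\<in>I. (\<integral>\<omega>. h (real A) (L \<omega> i) \<partial>N) < d"
        using I by (simp add: eventually_ball_finite)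
      then show ?thesis by (auto dest: eventually_happens)
    qed
    then obtain A0 :: nat where A0: "\<And>i. i \<in> I \<Longrightarrow> (\<integral>\<omega>. h (real A0) (L \<omega> i) \<partial>N) < d" by blast
    define A where "A = real A0 + 1"
    have A1: "A \<ge> 1" by (simp add: A_def)
    have hind: "1 \<le> h (real A0) x" if "\<bar>x\<bar> > A" for x
      using that by (auto simp: h_def A_def)
    have hVi: "integrable M (\<lambda>\<omega>. h (real A0) (V n \<omega> i))" if "i \<in> I" for i n
      using h01 measurable_compose[OF V[OF that] h_meas] by (intro M.integrable_const_bound[where B = 1]) auto
    have hLi: "integrable N (\<lambda>\<omega>. h (real A0) (L \<omega> i))" if "i \<in> I" for i
      using h01 measurable_compose[OF L[OF that] h_meas] by (intro N.integrable_const_bound[where B = 1]) auto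
    define F where "F u = f (\<lambda>i\<in>I. A * arcsin (u i))" for u :: "nat \<Rightarrow> real"
    define s where "s x = (\<lambda>i\<in>I. sin (1 / A * x i))" for x :: "nat \<Rightarrow> real"
    have Fs: "F (s x) = f (\<lambda>i\<in>I. A * arcsin (sin (1 / A * x i)))" for x
      unfolding F_def s_def by (rule arg_cong[where f = f]) auto
    have FsM: "(\<lambda>\<omega>. F (s (V n \<omega>))) \<in> borel_measurable M" for n
      unfolding Fs
    proof (rule mM)
      fix i assume "i \<in> I"
      note [measurable] = V[OF this]
      have "(\<lambda>\<omega>. arcsin (sin (1 / A * V n \<omega> i))) \<in> borel_measurable M"
        by (rule measurable_compose[where f = "\<lambda>\<omega>. 1 / A * V n \<omega> i"])
          (auto intro!: borel_measurable_continuous_onI continuous_on_arcsin continuous_intros)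
      then show "(\<lambda>\<omega>. A * arcsin (sin (1 / A * V n \<omega> i))) \<in> borel_measurable M" by simp
    qed
    have FsN: "(\<lambda>\<omega>. F (s (L \<omega>))) \<in> borel_measurable N"
      unfolding Fs
    proof (rule mN)
      fix i assume "i \<in> I"
      note [measurable] = L[OF this]
      have "(\<lambda>\<omega>. arcsin (sin (1 / A * L \<omega> i))) \<in> borel_measurable N"
        by (rule measurable_compose[where f = "\<lambda>\<omega>. 1 / A * L \<omega> i"])
          (auto intro!: borel_measurable_continuous_onI continuous_on_arcsin continuous_intros)
      then show "(\<lambda>\<omega>. A * arcsin (sin (1 / A * L \<omega> i))) \<in> borel_measurable N" by simp
    qed
    have Fc: "continuous_on (PiE I (\<lambda>_. {-1..1})) F"
    proof -
      let ?S = "PiE I (\<lambda>_. {-1..1::real})"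
      have "continuous_map (top_of_set ?S) ?T (\<lambda>u. \<lambda>i\<in>I. A * arcsin (u i))"
        unfolding continuous_map_componentwise
      proof (intro conjI ballI)
        fix i assume i: "i \<in> I"
        have "continuous_on ?S (\<lambda>u. u i)"
          by (rule continuous_on_subset[OF continuous_on_product_coordinates]) auto
        then have "continuous_on ?S (\<lambda>u. A * arcsin (u i))"
          by (intro continuous_intros) (use i in auto)
        then show "continuous_map (top_of_set ?S) euclideanreal (\<lambda>u. (\<lambda>i\<in>I. A * arcsin (u i)) i)"
          using i by simp
      qed auto
      from continuous_map_compose[OF this fc] show ?thesis
        by (simp add: F_def o_def)
    qed
    have tend: "(\<lambda>n. \<integral>\<omega>. F (s (V n \<omega>)) \<partial>M) \<longlonglongrightarrow> (\<integral>\<omega>. F (s (L \<omega>)) \<partial>N)"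
      unfolding s_def
      by (rule cube_expectation_tendsto[OF I M N]) (fact V L char Fc FsM[unfolded s_def] FsN[unfolded s_def])+
    \<comment> \<open>Inside the box the arcsine undoes the sine, since
      \<open>\<bar>x i / A\<bar> \<le> 1 \<le> pi / 2\<close>. Outside, one of the ramps equals 1
      and pays for the trivial bound \<open>2 * B\<close>.\<close>
    have diff: "\<bar>f (\<lambda>i\<in>I. x i) - F (s x)\<bar> \<le> 2 * B * (\<Sum>i\<in>I. h (real A0) (x i))" for x
    proof (cases "\<forall>i\<in>I. \<bar>x i\<bar> \<le> A")
      case True
      have "A * arcsin (sin (1 / A * x i)) = x i" if "i \<in> I" for i
      proof -
        have "\<bar>1 / A * x i\<bar> \<le> 1" using True that A1 by (auto simp: abs_mult field_simps)
        moreover have "1 \<le> pi / 2" using pi_gt3 by simp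
        ultimately have "arcsin (sin (1 / A * x i)) = 1 / A * x i"
          by (intro arcsin_sin) linarith+
        then show ?thesis using A1 by simp
      qed
      then have "F (s x) = f (\<lambda>i\<in>I. x i)"
        unfolding Fs by (intro arg_cong[where f = f]) auto
      then show ?thesis using B0 h01 by (auto intro!: mult_nonneg_nonneg sum_nonneg)
    next
      case False
      then obtain j where j: "j \<in> I" "\<bar>x j\<bar> > A" by auto
      have "1 \<le> h (real A0) (x j)" using hind j by blast
      also have "\<dots> \<le> (\<Sum>i\<in>I. h (real A0) (x i))"
        using j I h01 by (intro member_le_sum) auto
      finally have "2 * B * 1 \<le> 2 * B * (\<Sum>i\<in>I. h (real A0) (x i))"
        using B0 by (intro mult_left_mono) auto
      moreover have "\<bar>f (\<lambda>i\<in>I. x i)\<bar> \<le> B" "\<bar>F (s x)\<bar> \<le> B" unfolding Fs by (auto intro!: B)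
      ultimately show ?thesis by linarith
    qed
    have dM: "\<bar>(\<integral>\<omega>. f (?V n \<omega>) \<partial>M) - (\<integral>\<omega>. F (s (V n \<omega>)) \<partial>M)\<bar>
        \<le> 2 * B * (\<Sum>i\<in>I. \<integral>\<omega>. h (real A0) (V n \<omega> i) \<partial>M)" for n
    proof -
      have i1: "integrable M (\<lambda>\<omega>. f (?V n \<omega>))"
        using B mM[of "\<lambda>\<omega>. V n \<omega>", OF V] by (intro M.integrable_const_bound[where B = B]) auto
      have i2: "integrable M (\<lambda>\<omega>. F (s (V n \<omega>)))"
        using B FsM by (intro M.integrable_const_bound[where B = B]) (auto simp: Fs)
      have i3: "integrable M (\<lambda>\<omega>. 2 * B * (\<Sum>i\<in>I. h (real A0) ((V n \<omega>) i)))"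
        using hVi by auto
      from expectation_diff_le_integral[OF i1 i2 i3 diff] show ?thesis using hVi by simp
    qed
    have dN: "\<bar>(\<integral>\<omega>. f (?L \<omega>) \<partial>N) - (\<integral>\<omega>. F (s (L \<omega>)) \<partial>N)\<bar>
        \<le> 2 * B * (\<Sum>i\<in>I. \<integral>\<omega>. h (real A0) (L \<omega> i) \<partial>N)"
    proof -
      have i1: "integrable N (\<lambda>\<omega>. f (?L \<omega>))"
        using B mN[of "\<lambda>\<omega>. L \<omega>", OF L] by (intro N.integrable_const_bound[where B = B]) auto
      have i2: "integrable N (\<lambda>\<omega>. F (s (L \<omega>)))"
        using B FsN by (intro N.integrable_const_bound[where B = B]) (auto simp: Fs)
      have i3: "integrable N (\<lambda>\<omega>. 2 * B * (\<Sum>i\<in>I. h (real A0) ((L \<omega>) i)))"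
        using hLi by auto
      from expectation_diff_le_integral[OF i1 i2 i3 diff] show ?thesis using hLi by simp
    qed
    have sum_small: "2 * B * (\<Sum>i\<in>I. q i) \<le> e / 6" if "\<And>i. i \<in> I \<Longrightarrow> q i < d" for q :: "nat \<Rightarrow> real"
    proof -
      have "(\<Sum>i\<in>I. q i) \<le> real (card I) * d"
        using that by (intro sum_bounded_above) (auto intro: less_imp_le)
      also have "\<dots> \<le> (1 + real (card I)) * d" using d by (intro mult_right_mono) auto
      also have "\<dots> = e / (12 * B)"
        by (simp add: d_def divide_simps add_eq_0_iff)
      finally have "2 * B * (\<Sum>i\<in>I. q i) \<le> 2 * B * (e / (12 * B))" using B0 by (intro mult_left_mono) auto
      then show ?thesis using B0 by simp
    qed
    have "\<forall>\<^sub>F n in sequentially. \<forall>i\<in>I. (\<integral>\<omega>. h (real A0) (V n \<omega> i) \<partial>M) < d"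
      using I A0 h_tend by (auto intro!: eventually_ball_finite order_tendstoD(2))
    moreover have "\<forall>\<^sub>F n in sequentially. \<bar>(\<integral>\<omega>. F (s (V n \<omega>)) \<partial>M) - (\<integral>\<omega>. F (s (L \<omega>)) \<partial>N)\<bar> < e / 3"
      using tendstoD[OF tend, of "e / 3"] e by (simp add: dist_real_def)
    ultimately have "\<forall>\<^sub>F n in sequentially. norm ((\<integral>\<omega>. f (?V n \<omega>) \<partial>M) - (\<integral>\<omega>. f (?L \<omega>) \<partial>N)) < e"
    proof eventually_elim
      case (elim n)
      have "2 * B * (\<Sum>i\<in>I. \<integral>\<omega>. h (real A0) (V n \<omega> i) \<partial>M) \<le> e / 6"
        using elim(1) by (intro sum_small) auto
      moreover have "2 * B * (\<Sum>i\<in>I. \<integral>\<omega>. h (real A0) (L \<omega> i) \<partial>N) \<le> e / 6"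
        using A0 by (intro sum_small) auto
      ultimately show ?case using elim(2) dM[of n] dN e unfolding real_norm_def by linarith
    qed
    then show "\<exists>n0. \<forall>n\<ge>n0. norm ((\<integral>\<omega>. f (?V n \<omega>) \<partial>M) - (\<integral>\<omega>. f (?L \<omega>) \<partial>N)) < e"
      by (simp add: eventually_sequentially)
  qed
qed

section \<open>Self-normalized rows in the normal domain of attraction\<close>

text \<open>For a symmetric law this is the whole characteristic function, because the sine part
  integrates to 0; see \<open>char_eq_cchar\<close>.\<close>

definition cchar :: "real measure \<Rightarrow> real \<Rightarrow> real" where
  "cchar \<mu> t = (\<integral>x. cos (t * x) \<partial>\<mu>)"

locale symmetric_distribution = real_distribution \<mu> for \<mu> :: "real measure" +
  assumes symmetric: "distr \<mu> borel uminus = \<mu>"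
begin

lemma integrable_bounded_borel:
  fixes f :: "real \<Rightarrow> real"
  assumes "f \<in> borel_measurable borel" "\<And>x. \<bar>f x\<bar> \<le> B"
  shows "integrable \<mu> f"
  using assms by (intro integrable_const_bound[where B = B]) auto

lemma integrable_cos: "integrable \<mu> (\<lambda>x. cos (t * x))"
  by (rule integrable_bounded_borel[where B = 1]) auto

lemma char_eq_cchar: "char \<mu> t = complex_of_real (cchar \<mu> t)"
proof -
  have s: "integrable \<mu> (\<lambda>x. sin (t * x))"
    by (rule integrable_bounded_borel[where B = 1]) auto
  have "(\<integral>x. sin (t * x) \<partial>\<mu>) = (\<integral>x. sin (t * x) \<partial>distr \<mu> borel uminus)"
    by (simp add: symmetric)
  also have "\<dots> = - (\<integral>x. sin (t * x) \<partial>\<mu>)"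
    by (subst integral_distr) auto
  finally have 0: "(\<integral>x. sin (t * x) \<partial>\<mu>) = 0" by simp
  have "char \<mu> t = (\<integral>x. complex_of_real (cos (t * x)) + \<i> * complex_of_real (sin (t * x)) \<partial>\<mu>)"
    unfolding char_def by (intro Bochner_Integration.integral_cong) (auto simp: exp_Euler simp flip: cos_of_real sin_of_real)
  also have "\<dots> = complex_of_real (cchar \<mu> t)"
    using s integrable_cos 0 by (simp add: cchar_def)
  finally show ?thesis .
qed

lemma abs_cchar_le_1: "\<bar>cchar \<mu> t\<bar> \<le> 1"
  using cmod_char_le_1[of t] by (simp add: char_eq_cchar)

lemma one_minus_cchar: "(\<integral>x. 1 - cos (t * x) \<partial>\<mu>) = 1 - cchar \<mu> t"
  using integrable_cos prob_space by (simp add: cchar_def)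

text \<open>The variance of the cosine is nonnegative, and the double-angle formula rewrites its
  second moment. The inequality will turn a modulus close to 1 into a value close to 1.\<close>

lemma cchar_double: "2 * (cchar \<mu> t)\<^sup>2 - 1 \<le> cchar \<mu> (2 * t)"
proof -
  have i2: "integrable \<mu> (\<lambda>x. (cos (t * x))\<^sup>2)"
    by (rule integrable_bounded_borel[where B = 1]) (auto simp: abs_square_le_1)
  have "(\<integral>x. (cos (t * x) - cchar \<mu> t)\<^sup>2 \<partial>\<mu>) = (\<integral>x. (cos (t * x))\<^sup>2 - 2 * cchar \<mu> t * cos (t * x) + (cchar \<mu> t)\<^sup>2 \<partial>\<mu>)"
    by (simp add: power2_diff algebra_simps)
  also have "\<dots> = (\<integral>x. (cos (t * x))\<^sup>2 \<partial>\<mu>) - (cchar \<mu> t)\<^sup>2"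
    using i2 integrable_cos prob_space by (simp add: cchar_def power2_eq_square)
  finally have "(\<integral>x. (cos (t * x))\<^sup>2 \<partial>\<mu>) - (cchar \<mu> t)\<^sup>2 = (\<integral>x. (cos (t * x) - cchar \<mu> t)\<^sup>2 \<partial>\<mu>)" ..
  also have "0 \<le> \<dots>" by (rule Bochner_Integration.integral_nonneg) auto
  finally have "(cchar \<mu> t)\<^sup>2 \<le> (\<integral>x. (cos (t * x))\<^sup>2 \<partial>\<mu>)" by simp
  moreover have "cos (2 * t * x) = 2 * (cos (t * x))\<^sup>2 - 1" for x
    using cos_double_cos[of "t * x"] by (simp add: mult.assoc)
  then have "cchar \<mu> (2 * t) = (\<integral>x. 2 * (cos (t * x))\<^sup>2 - 1 \<partial>\<mu>)"
    by (simp add: cchar_def)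
  ultimately show ?thesis using i2 prob_space by simp
qed

text \<open>Expansion of the square by the double-angle formula. In the combination of
  \<open>1 - cchar\<close> at \<open>t\<close> and at \<open>2 * t\<close> the quadratic behaviour
  near the origin cancels, which is why \<open>q\<close> will tend to 0.\<close>

lemma one_minus_cos_squared:
  "(\<integral>x. (1 - cos (t * x))\<^sup>2 \<partial>\<mu>) = 2 * (1 - cchar \<mu> t) - (1 - cchar \<mu> (2 * t)) / 2"
proof -
  have "(1 - cos (t * x))\<^sup>2 = 2 * (1 - cos (t * x)) - (1 - cos (2 * t * x)) / 2" for x
    using cos_double_cos[of "t * x"] by (simp add: power2_eq_square field_simps)
  then show ?thesis
    using integrable_cos[of "2 * t"] integrable_cos[of t] prob_space by (simp add: cchar_def)
qed

lemma coordinates_indep: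
  "prob_space.indep_vars (PiM (UNIV :: nat set) (\<lambda>_. \<mu>)) (\<lambda>_. borel) (\<lambda>i x. x i) UNIV"
proof -
  interpret P: product_prob_space "\<lambda>_. \<mu>" "UNIV :: nat set" ..
  have s: "sets (PiM UNIV (\<lambda>_::nat. \<mu>)) = sets (PiM UNIV (\<lambda>_. borel))"
    by (rule sets_PiM_cong) auto
  have c: "distr (PiM UNIV (\<lambda>_::nat. \<mu>)) borel (\<lambda>x. x i) = \<mu>" for i
  proof -
    have "distr (PiM UNIV (\<lambda>_::nat. \<mu>)) borel (\<lambda>x. x i) = distr (PiM UNIV (\<lambda>_. \<mu>)) \<mu> (\<lambda>x. x i)"
      by (rule distr_cong) auto
    then show ?thesis by (simp add: P.PiM_component)
  qed
  have "distr (PiM UNIV (\<lambda>_::nat. \<mu>)) (PiM UNIV (\<lambda>_. borel)) (\<lambda>x. \<lambda>i\<in>UNIV. x i) = PiM UNIV (\<lambda>_. \<mu>)"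
    unfolding restrict_UNIV by (rule distr_id2[OF s[symmetric]])
  then show ?thesis
    by (subst P.indep_vars_iff_distr_eq_PiM') (auto simp: c intro: measurable_component_singleton)
qed

end

text \<open>Only the modulus of the characteristic function of the normalized sum is retained. The
  centring constants contribute a phase of modulus 1, so they disappear at this point.\<close>

locale attracted_distribution = symmetric_distribution +
  fixes a :: "nat \<Rightarrow> real"
  assumes a_pos: "\<And>n. 0 < a n"
    and abs_cchar_power_tendsto: "\<And>t. (\<lambda>n. \<bar>cchar \<mu> (t / a n)\<bar> ^ n) \<longlonglongrightarrow> exp (- t\<^sup>2 / 2)"

lemma (in symmetric_distribution) attracted_distributionI:
  assumes "normal_domain_of_attraction \<mu>"
  obtains a where "attracted_distribution \<mu> a"
proof -
  obtain a b :: "nat \<Rightarrow> real" where a: "\<And>n. 0 < a n" and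
    w: "weak_conv_m (\<lambda>n. distr (PiM (UNIV :: nat set) (\<lambda>_. \<mu>)) borel (\<lambda>x. ((\<Sum>i<n. x i) - b n) / a n))
          std_normal_distribution"
    using assms by (auto simp: normal_domain_of_attraction_def)
  interpret P: product_prob_space "\<lambda>_. \<mu>" "UNIV :: nat set" ..
  have m [measurable]: "(\<lambda>x. x i) \<in> borel_measurable (PiM (UNIV :: nat set) (\<lambda>_. \<mu>))" for i
    using measurable_component_singleton[of i UNIV "\<lambda>_. \<mu>"] by (simp add: measurable_cong_sets[OF refl M_is_borel])
  have c: "distr (PiM UNIV (\<lambda>_::nat. \<mu>)) borel (\<lambda>x. x i) = \<mu>" for i
  proof -
    have "distr (PiM UNIV (\<lambda>_::nat. \<mu>)) borel (\<lambda>x. x i) = distr (PiM UNIV (\<lambda>_. \<mu>)) \<mu> (\<lambda>x. x i)"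
      by (rule distr_cong) auto
    then show ?thesis by (simp add: P.PiM_component)
  qed
  have ch: "norm (char (distr (PiM (UNIV :: nat set) (\<lambda>_. \<mu>)) borel (\<lambda>x. ((\<Sum>i<n. x i) - b n) / a n)) t)
      = \<bar>cchar \<mu> (t / a n)\<bar> ^ n" for n t
  proof -
    have "char (distr (PiM UNIV (\<lambda>_::nat. \<mu>)) borel (\<lambda>x. ((\<Sum>i<n. x i) - b n) / a n)) t
       = (\<integral>x. iexp (- (t * b n / a n)) * iexp (t / a n * (\<Sum>i<n. x i)) \<partial>PiM UNIV (\<lambda>_::nat. \<mu>))"
      unfolding char_def
      by (subst integral_distr) (auto intro!: Bochner_Integration.integral_cong simp: mult_exp_exp algebra_simps diff_divide_distrib)
    also have "\<dots> = iexp (- (t * b n / a n)) * char (distr (PiM UNIV (\<lambda>_::nat. \<mu>)) borel (\<lambda>x. \<Sum>i<n. x i)) (t / a n)"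
      by (simp add: char_def integral_distr)
    also have "char (distr (PiM UNIV (\<lambda>_::nat. \<mu>)) borel (\<lambda>x. \<Sum>i<n. x i)) (t / a n) = char \<mu> (t / a n) ^ n"
      using P.indep_vars_subset[OF coordinates_indep, of "{..<n}"]
      by (subst P.char_distr_sum) (auto simp: c)
    finally show ?thesis by (simp add: norm_mult norm_power char_eq_cchar)
  qed
  have "attracted_distribution \<mu> a"
  proof
    fix t
    have "(\<lambda>n. char (distr (PiM (UNIV :: nat set) (\<lambda>_. \<mu>)) borel (\<lambda>x. ((\<Sum>i<n. x i) - b n) / a n)) t)
        \<longlonglongrightarrow> char std_normal_distribution t"
      by (rule levy_continuity1[OF P.real_distribution_distr real_dist_normal_dist w]) measurable
    from tendsto_norm[OF this] show "(\<lambda>n. \<bar>cchar \<mu> (t / a n)\<bar> ^ n) \<longlonglongrightarrow> exp (- t\<^sup>2 / 2)"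
      unfolding ch by (simp add: char_std_normal_distribution)
  qed (rule a)
  then show ?thesis by (rule that)
qed

section \<open>The characteristic function at scale \<open>a n\<close>\<close>

context attracted_distribution
begin

text \<open>The \<open>n\<close>-th powers converge to a positive limit, so they eventually exceed a
  fixed \<open>c > 0\<close>, and \<open>root n c\<close> tends to 1.\<close>

lemma abs_cchar_tendsto_1: "(\<lambda>n. \<bar>cchar \<mu> (t / a n)\<bar>) \<longlonglongrightarrow> 1"
proof -
  define c where "c = exp (- t\<^sup>2 / 2) / 2"
  have c: "0 < c" "c < exp (- t\<^sup>2 / 2)" by (auto simp: c_def)
  have c1: "(\<lambda>n. root n c) \<longlonglongrightarrow> 1" using c by (intro LIMSEQ_root_const) auto
  show ?thesis
  proof (rule tendsto_sandwich[OF _ _ c1 tendsto_const])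
    show "\<forall>\<^sub>F n in sequentially. root n c \<le> \<bar>cchar \<mu> (t / a n)\<bar>"
      using order_tendstoD(1)[OF abs_cchar_power_tendsto c(2)] eventually_gt_at_top[of 0]
    proof eventually_elim
      case (elim n)
      have "root n c \<le> root n (\<bar>cchar \<mu> (t / a n)\<bar> ^ n)"
        using elim by (intro real_root_le_mono) auto
      also have "\<dots> = \<bar>cchar \<mu> (t / a n)\<bar>" using elim by (intro real_root_power_cancel) auto
      finally show ?case .
    qed
  qed (auto simp: abs_cchar_le_1)
qed

text \<open>A modulus near 1 leaves the sign open. The doubling inequality at \<open>t / 2\<close>
  bounds the value itself from below by an expression in the modulus that tends to 1.\<close>

lemma cchar_tendsto_1: "(\<lambda>n. cchar \<mu> (t / a n)) \<longlonglongrightarrow> 1"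
proof (rule tendsto_sandwich[OF _ _ _ tendsto_const])
  have "(\<lambda>n. 2 * \<bar>cchar \<mu> ((t / 2) / a n)\<bar>\<^sup>2 - 1) \<longlonglongrightarrow> 2 * 1\<^sup>2 - 1"
    by (intro tendsto_intros abs_cchar_tendsto_1)
  then show "(\<lambda>n. 2 * (cchar \<mu> ((t / 2) / a n))\<^sup>2 - 1) \<longlonglongrightarrow> 1" by simp
  show "\<forall>\<^sub>F n in sequentially. 2 * (cchar \<mu> ((t / 2) / a n))\<^sup>2 - 1 \<le> cchar \<mu> (t / a n)"
    using cchar_double[of "(t / 2) / a n" for n] by (intro always_eventually) simp
  show "\<forall>\<^sub>F n in sequentially. cchar \<mu> (t / a n) \<le> 1"
    using abs_cchar_le_1 by (intro always_eventually) (auto simp: abs_le_iff)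
qed

text \<open>For \<open>u > 0\<close> one has \<open>u * (- ln u) \<le> 1 - u \<le> - ln u\<close>.
  Multiplied by \<open>n\<close>, with \<open>u\<close> the value at \<open>t / a n\<close>, both
  bounds converge to \<open>t\<^sup>2 / 2\<close>, since \<open>u\<close> tends to 1 and
  \<open>u ^ n\<close> to the Gaussian limit.\<close>

lemma n_one_minus_cchar_tendsto: "(\<lambda>n. real n * (1 - cchar \<mu> (t / a n))) \<longlonglongrightarrow> t\<^sup>2 / 2"
proof -
  let ?u = "\<lambda>n. cchar \<mu> (t / a n)"
  have pos: "\<forall>\<^sub>F n in sequentially. 0 < ?u n"
    using order_tendstoD(1)[OF cchar_tendsto_1, of 0] by simp
  have "(\<lambda>n. - ln (\<bar>?u n\<bar> ^ n)) \<longlonglongrightarrow> - ln (exp (- t\<^sup>2 / 2))"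
    by (intro tendsto_intros abs_cchar_power_tendsto) auto
  then have A: "(\<lambda>n. - ln (\<bar>?u n\<bar> ^ n)) \<longlonglongrightarrow> t\<^sup>2 / 2" by simp
  have B: "(\<lambda>n. ?u n * - ln (\<bar>?u n\<bar> ^ n)) \<longlonglongrightarrow> t\<^sup>2 / 2"
    using tendsto_mult[OF cchar_tendsto_1 A] by simp
  show ?thesis
  proof (rule tendsto_sandwich[OF _ _ B A])
    show "\<forall>\<^sub>F n in sequentially. real n * (1 - ?u n) \<le> - ln (\<bar>?u n\<bar> ^ n)"
      using pos
    proof eventually_elim
      case (elim n)
      have "1 - ?u n \<le> - ln (?u n)" using ln_le_minus_one[OF elim] by simp
      then have "real n * (1 - ?u n) \<le> real n * - ln (?u n)" by (intro mult_left_mono) auto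
      then show ?case using elim by (simp add: ln_realpow)
    qed
    show "\<forall>\<^sub>F n in sequentially. ?u n * - ln (\<bar>?u n\<bar> ^ n) \<le> real n * (1 - ?u n)"
      using pos
    proof eventually_elim
      case (elim n)
      have "- ln (?u n) \<le> 1 / ?u n - 1" using ln_le_minus_one[of "1 / ?u n"] elim by (simp add: ln_div)
      then have "?u n * - ln (?u n) \<le> ?u n * (1 / ?u n - 1)" using elim by (intro mult_left_mono) auto
      also have "\<dots> = 1 - ?u n" using elim by (simp add: algebra_simps)
      finally have "real n * (?u n * - ln (?u n)) \<le> real n * (1 - ?u n)" by (intro mult_left_mono) auto
      then show ?case using elim by (simp add: ln_realpow algebra_simps)
    qed
  qed
qed

section \<open>Tails at scale \<open>a n\<close> and the moments of a self-normalized row\<close>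

definition q :: "nat \<Rightarrow> real \<Rightarrow> real" where
  "q n t = real n * (\<integral>x. (1 - cos (t / a n * x))\<^sup>2 \<partial>\<mu>)"

lemma q_nonneg: "0 \<le> q n t"
  unfolding q_def by (intro mult_nonneg_nonneg Bochner_Integration.integral_nonneg) auto

lemma q_tendsto_0: "(\<lambda>n. q n t) \<longlonglongrightarrow> 0"
proof -
  \<comment> \<open>Both terms have limit \<open>t\<^sup>2\<close>: in the second one the doubled
    frequency quadruples the quadratic term \<open>t\<^sup>2 / 2\<close>, which is then
    halved.\<close>
  have "(\<lambda>n. 2 * (real n * (1 - cchar \<mu> (t / a n))) - real n * (1 - cchar \<mu> ((2 * t) / a n)) / 2)
      \<longlonglongrightarrow> 2 * (t\<^sup>2 / 2) - ((2 * t)\<^sup>2 / 2) / 2"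
    by (intro tendsto_intros n_one_minus_cchar_tendsto) auto
  then show ?thesis
    unfolding q_def one_minus_cos_squared by (simp add: algebra_simps)
qed

text \<open>Jensen's inequality for the square: under a Gaussian \<open>t\<close> the mean of
  \<open>1 - cos (t * y)\<close> is \<open>1 - exp (- y\<^sup>2 / 2)\<close>. This is increasing in
  \<open>\<bar>y\<bar>\<close>, hence bounded below on a tail.\<close>

lemma std_normal_expectation_one_minus_cos:
  "(1 - exp (- y\<^sup>2 / 2))\<^sup>2 \<le> (\<integral>t. (1 - cos (t * y))\<^sup>2 \<partial>std_normal_distribution)"
proof -
  interpret G: real_distribution std_normal_distribution by (rule real_dist_normal_dist)
  let ?f = "\<lambda>t. 1 - cos (t * y)" and ?m = "1 - exp (- y\<^sup>2 / 2)"
  have fb: "\<bar>?f t\<bar> \<le> 2" for t using cos_le_one[of "t * y"] cos_ge_minus_one[of "t * y"] by linarith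
  have i: "integrable std_normal_distribution ?f"
    using fb by (intro G.integrable_const_bound[where B = 2]) auto
  have ic: "integrable std_normal_distribution (\<lambda>t. cos (t * y))"
    by (rule G.integrable_const_bound[where B = 1]) auto
  have i2: "integrable std_normal_distribution (\<lambda>t. (?f t)\<^sup>2)"
    using power_mono[OF fb abs_ge_zero, where n = 2] by (intro G.integrable_const_bound[where B = 4]) auto
  have "(\<integral>t. iexp (y * t) \<partial>std_normal_distribution) = complex_of_real (exp (- y\<^sup>2 / 2))"
    using fun_cong[OF char_std_normal_distribution, of y] by (simp add: char_def)
  then have "Re (\<integral>t. iexp (y * t) \<partial>std_normal_distribution) = exp (- y\<^sup>2 / 2)" by simp
  moreover have "Re (\<integral>t. iexp (y * t) \<partial>std_normal_distribution) = (\<integral>t. Re (iexp (y * t)) \<partial>std_normal_distribution)"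
    by (rule integral_Re[symmetric]) (rule G.integrable_iexp, auto)
  ultimately have "(\<integral>t. cos (t * y) \<partial>std_normal_distribution) = exp (- y\<^sup>2 / 2)"
    by (simp add: Re_exp mult.commute)
  then have m: "(\<integral>t. ?f t \<partial>std_normal_distribution) = ?m"
    using ic G.prob_space by simp
  have cst: "(\<integral>t. K \<partial>std_normal_distribution) = K" for K :: real
    using G.prob_space by simp
  have "0 \<le> (\<integral>t. (?f t - ?m)\<^sup>2 \<partial>std_normal_distribution)" by (rule Bochner_Integration.integral_nonneg) auto
  also have "\<dots> = (\<integral>t. (?f t)\<^sup>2 - 2 * ?m * ?f t + ?m\<^sup>2 \<partial>std_normal_distribution)"
    by (intro Bochner_Integration.integral_cong) (auto simp: power2_eq_square algebra_simps)
  also have "\<dots> = (\<integral>t. (?f t)\<^sup>2 \<partial>std_normal_distribution) - 2 * ?m * (\<integral>t. ?f t \<partial>std_normal_distribution) + ?m\<^sup>2"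
    by (simp only: Bochner_Integration.integral_add Bochner_Integration.integral_diff i i2 integral_mult_right_zero
        Bochner_Integration.integrable_diff integrable_mult_right G.integrable_const cst)
  finally have "0 \<le> (\<integral>t. (?f t)\<^sup>2 \<partial>std_normal_distribution) - 2 * ?m * ?m + ?m\<^sup>2" unfolding m .
  moreover have "2 * ?m * ?m = ?m\<^sup>2 + ?m\<^sup>2" by (simp add: power2_eq_square)
  ultimately show ?thesis by linarith
qed

text \<open>A lower bound for the values \<open>(1 - cos (t y))\<^sup>2\<close> that is uniform in \<open>\<bar>y\<bar> > \<epsilon>\<close> is only available
  after averaging over \<open>t\<close>; the truncation at \<open>1\<close> supplies the dominating function.\<close>

lemma tail_tendsto_0:
  assumes e: "\<epsilon> > 0"
  shows "(\<lambda>n. real n * prob {x. \<epsilon> * a n < \<bar>x\<bar>}) \<longlonglongrightarrow> 0"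
proof -
  interpret G: real_distribution std_normal_distribution by (rule real_dist_normal_dist)
  interpret GM: pair_sigma_finite \<mu> std_normal_distribution ..
  interpret GMp: pair_prob_space \<mu> std_normal_distribution ..
  define c where "c = (1 - exp (- \<epsilon>\<^sup>2 / 2))\<^sup>2"
  have c: "c > 0" using e by (simp add: c_def)
  define B where "B n = {x. \<epsilon> * a n < \<bar>x\<bar>}" for n
  have B [measurable]: "B n \<in> sets borel" for n unfolding B_def by measurable
  define p where "p n = real n * prob (B n)" for n
  define r where "r n = (\<integral>t. min (q n t) 1 \<partial>std_normal_distribution)" for n
  have q_meas: "q n \<in> borel_measurable borel" for n
  proof -
    have "(\<lambda>t. \<integral>x. (1 - cos (t / a n * x))\<^sup>2 \<partial>\<mu>) \<in> borel_measurable borel"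
      by (rule borel_measurable_lebesgue_integral) measurable
    then show ?thesis unfolding q_def by measurable
  qed
  have cosb: "(1 - cos y)\<^sup>2 \<le> 4" for y :: real
    using power_mono[of "1 - cos y" 2 2] cos_le_one[of y] cos_ge_minus_one[of y] by simp
  \<comment> \<open>The integral \<open>m t\<close> over the tail event satisfies
    \<open>n * m t \<le> q n t\<close> and \<open>m t \<le> 4 * prob (B n)\<close>. The first
    estimate goes with \<open>p n\<close>, the second with the cap \<open>1 / 4\<close>, and
    together they produce the bounded \<open>min (q n t) 1\<close>. A common factor
    \<open>prob (B n)\<close> is cancelled at the end.\<close>
  have key: "min (p n) (1 / 4) * c \<le> r n" for n
  proof (cases "prob (B n) = 0")
    case True
    have "0 \<le> r n" unfolding r_def by (rule Bochner_Integration.integral_nonneg) (auto simp: q_nonneg)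
    with True show ?thesis by (simp add: p_def)
  next
    case False
    then have pB: "prob (B n) > 0" using measure_nonneg[of \<mu> "B n"] by linarith
    define f where "f x t = indicator (B n) x * (1 - cos (t / a n * x))\<^sup>2" for x t
    define m where "m t = (\<integral>x. f x t \<partial>\<mu>)" for t
    have fi: "integrable (\<mu> \<Otimes>\<^sub>M std_normal_distribution) (\<lambda>(x, t). f x t)"
      unfolding f_def using cosb
      by (intro GMp.integrable_const_bound[where B = 4]) (auto simp: indicator_def split: prod.splits)
    have fx: "integrable \<mu> (\<lambda>x. f x t)" for t
      unfolding f_def using cosb by (intro integrable_const_bound[where B = 4]) (auto simp: indicator_def)
    have ind: "integrable \<mu> (indicat_real (B n))"
      by (rule integrable_const_bound[where B = 1]) auto
    have "prob (B n) * c = (\<integral>x. indicator (B n) x * c \<partial>\<mu>)"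
      using ind by simp
    also have "\<dots> \<le> (\<integral>x. (\<integral>t. f x t \<partial>std_normal_distribution) \<partial>\<mu>)"
    proof (rule integral_mono)
      show "integrable \<mu> (\<lambda>x. indicator (B n) x * c)" using ind by simp
      show "integrable \<mu> (\<lambda>x. \<integral>t. f x t \<partial>std_normal_distribution)"
        by (rule GM.integrable_fst[OF fi])
      fix x
      show "indicator (B n) x * c \<le> (\<integral>t. f x t \<partial>std_normal_distribution)"
      proof (cases "x \<in> B n")
        case True
        then have "\<epsilon> * a n < \<bar>x\<bar>" by (simp add: B_def)
        then have "\<epsilon> < \<bar>x / a n\<bar>" using a_pos[of n] by (simp add: pos_less_divide_eq)
        then have "\<epsilon>\<^sup>2 \<le> (x / a n)\<^sup>2" using e by (simp add: abs_le_square_iff[symmetric])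
        then have "c \<le> (1 - exp (- (x / a n)\<^sup>2 / 2))\<^sup>2"
          unfolding c_def by (intro power_mono) auto
        also have "\<dots> \<le> (\<integral>t. (1 - cos (t * (x / a n)))\<^sup>2 \<partial>std_normal_distribution)"
          by (rule std_normal_expectation_one_minus_cos)
        finally show ?thesis using True by (simp add: f_def)
      qed (simp add: f_def)
    qed
    also have "\<dots> = (\<integral>t. m t \<partial>std_normal_distribution)"
      unfolding m_def by (rule GM.Fubini_integral[OF fi, symmetric])
    finally have 1: "prob (B n) * c \<le> (\<integral>t. m t \<partial>std_normal_distribution)" .
    have m0: "0 \<le> m t" for t unfolding m_def f_def by (rule Bochner_Integration.integral_nonneg) auto
    have m4: "m t \<le> 4 * prob (B n)" for t
    proof -
      have "m t \<le> (\<integral>x. 4 * indicator (B n) x \<partial>\<mu>)"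
        unfolding m_def
      proof (rule integral_mono[OF fx])
        show "integrable \<mu> (\<lambda>x. 4 * indicat_real (B n) x)" using ind by simp
      qed (auto simp: f_def cosb indicator_def)
      then show ?thesis by simp
    qed
    have mq: "real n * m t \<le> q n t" for t
      unfolding m_def q_def
    proof (intro mult_left_mono integral_mono[OF fx])
      show "integrable \<mu> (\<lambda>x. (1 - cos (t / a n * x))\<^sup>2)"
        using cosb by (intro integrable_const_bound[where B = 4]) auto
    qed (auto simp: f_def indicator_def)
    have 2: "min (p n) (1 / 4) * m t \<le> prob (B n) * min (q n t) 1" for t
    proof -
      have "min (p n) (1 / 4) * m t \<le> p n * m t" using m0 by (intro mult_right_mono) auto
      also have "\<dots> = prob (B n) * (real n * m t)" by (simp add: p_def)
      also have "\<dots> \<le> prob (B n) * q n t" using mq by (intro mult_left_mono) auto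
      finally have A: "min (p n) (1 / 4) * m t \<le> prob (B n) * q n t" .
      have "min (p n) (1 / 4) * m t \<le> (1 / 4) * m t" using m0 by (intro mult_right_mono) auto
      also have "\<dots> \<le> prob (B n)" using m4[of t] by simp
      finally show ?thesis using A by (simp add: min_def)
    qed
    have mi: "integrable std_normal_distribution m"
      unfolding m_def using GM.integrable_snd[OF fi] by simp
    have "prob (B n) * (min (p n) (1 / 4) * c) = min (p n) (1 / 4) * (prob (B n) * c)" by simp
    also have "\<dots> \<le> min (p n) (1 / 4) * (\<integral>t. m t \<partial>std_normal_distribution)"
      using 1 pB by (intro mult_left_mono) (auto simp: p_def)
    also have "\<dots> = (\<integral>t. min (p n) (1 / 4) * m t \<partial>std_normal_distribution)" by simp
    also have "\<dots> \<le> (\<integral>t. prob (B n) * min (q n t) 1 \<partial>std_normal_distribution)"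
    proof (rule integral_mono)
      have "integrable std_normal_distribution (\<lambda>t. min (q n t) 1)"
        using q_meas q_nonneg by (intro G.integrable_const_bound[where B = 1]) auto
      then show "integrable std_normal_distribution (\<lambda>t. prob (B n) * min (q n t) 1)" by simp
    qed (use mi 2 in auto)
    also have "\<dots> = prob (B n) * r n" by (simp add: r_def)
    finally show ?thesis using pB by simp
  qed
  have r: "r \<longlonglongrightarrow> 0"
  proof -
    have "(\<lambda>n. \<integral>t. min (q n t) 1 \<partial>std_normal_distribution) \<longlonglongrightarrow> (\<integral>t. 0 \<partial>std_normal_distribution)"
    proof (rule integral_dominated_convergence[where w = "\<lambda>_. 1"])
      show "AE t in std_normal_distribution. (\<lambda>n. min (q n t) 1) \<longlonglongrightarrow> 0"
        using tendsto_min[OF q_tendsto_0 tendsto_const[of 1]] by simp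
    qed (use q_meas q_nonneg in auto)
    then show ?thesis unfolding r_def by simp
  qed
  have rc: "(\<lambda>n. r n / c) \<longlonglongrightarrow> 0"
    using tendsto_divide[OF r tendsto_const[of c]] c by simp
  \<comment> \<open>Once the bound is below \<open>1 / 4\<close>, the minimum in \<open>key\<close>
    cannot be attained by the cap, so it is \<open>p n\<close> that is bounded.\<close>
  have "\<forall>\<^sub>F n in sequentially. r n / c < 1 / 4"
    by (rule order_tendstoD(2)[OF rc]) simp
  then have le: "\<forall>\<^sub>F n in sequentially. p n \<le> r n / c"
  proof eventually_elim
    case (elim n)
    have "min (p n) (1 / 4) \<le> r n / c" using key[of n] c by (simp add: pos_le_divide_eq)
    with elim show ?case unfolding min_def by (auto split: if_splits)
  qed
  have "p \<longlonglongrightarrow> 0"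
    by (rule tendsto_sandwich[OF _ le tendsto_const rc]) (auto simp: p_def)
  then show ?thesis by (simp add: p_def[abs_def] B_def)
qed

text \<open>With \<open>H = \<Sum>\<^sub>j (1 - cos (V\<^sub>j / a\<^sub>n))\<close>, which concentrates at \<open>1/2\<close>, one has
  \<open>\<Sum>\<^sub>j V\<^sub>j\<^sup>2 \<ge> 2 a\<^sub>n\<^sup>2 H\<close>; this replaces a law of large numbers for truncated squares.\<close>

lemma self_normalized_moments:
  fixes V :: "nat \<Rightarrow> 'b \<Rightarrow> real"
  assumes M: "prob_space M" and ind: "prob_space.indep_vars M (\<lambda>_. borel) V UNIV"
    and law: "\<And>j. distr M borel (V j) = \<mu>"
  shows "(\<lambda>n. \<integral>\<omega>. (\<Sum>j<n. (V j \<omega> / sqrt (\<Sum>l<n. (V l \<omega>)\<^sup>2)) ^ 4) \<partial>M) \<longlonglongrightarrow> 0" (is ?A)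
    and "(\<lambda>n. \<integral>\<omega>. (\<Sum>j<n. (V j \<omega> / sqrt (\<Sum>l<n. (V l \<omega>)\<^sup>2))\<^sup>2) \<partial>M) \<longlonglongrightarrow> 1" (is ?B)
proof -
  interpret M: prob_space M by (rule M)
  have V [measurable]: "V j \<in> borel_measurable M" for j
    using ind by (auto simp: M.indep_vars_def)
  define H where "H n \<omega> = (\<Sum>j<n. 1 - cos (1 / a n * V j \<omega>))" for n \<omega>
  define D where "D n = (\<integral>\<omega>. (H n \<omega> - 1 / 2)\<^sup>2 \<partial>M)" for n
  define y where "y n j \<omega> = V j \<omega> / sqrt (\<Sum>l<n. (V l \<omega>)\<^sup>2)" for n j \<omega>
  have [measurable]: "H n \<in> borel_measurable M" "y n j \<in> borel_measurable M" for n j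
    unfolding H_def y_def by measurable
  have transfer: "(\<integral>\<omega>. f (V j \<omega>) \<partial>M) = (\<integral>x. f x \<partial>\<mu>)" if "f \<in> borel_measurable borel" for f :: "real \<Rightarrow> real" and j
    using that by (subst law[of j, symmetric], subst integral_distr) auto
  have H_bound: "\<bar>H n \<omega>\<bar> \<le> 2 * real n" for n \<omega>
  proof -
    have "\<bar>H n \<omega>\<bar> \<le> (\<Sum>j<n. \<bar>1 - cos (1 / a n * V j \<omega>)\<bar>)" unfolding H_def by (rule sum_abs)
    also have "\<dots> \<le> (\<Sum>j<n. 2)"
    proof (rule sum_mono)
      show "\<bar>1 - cos (1 / a n * V j \<omega>)\<bar> \<le> 2" for j
        using cos_le_one[of "1 / a n * V j \<omega>"] cos_ge_minus_one[of "1 / a n * V j \<omega>"] by linarith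
    qed
    finally show ?thesis by simp
  qed
  have HD: "integrable M (\<lambda>\<omega>. (H n \<omega> - c)\<^sup>2)" for n c
  proof (rule M.integrable_const_bound[where B = "(2 * real n + \<bar>c\<bar>)\<^sup>2"])
    have "\<bar>H n \<omega> - c\<bar>\<^sup>2 \<le> (2 * real n + \<bar>c\<bar>)\<^sup>2" for \<omega>
      using H_bound[of n \<omega>] by (intro power_mono) linarith+
    then show "AE \<omega> in M. norm ((H n \<omega> - c)\<^sup>2) \<le> (2 * real n + \<bar>c\<bar>)\<^sup>2" by simp
  qed measurable
  \<comment> \<open>Bias and variance: \<open>H n\<close> is a sum of independent terms with mean
    \<open>v n\<close>, its variance is at most \<open>q n 1\<close>, and \<open>n * v n\<close>
    tends to \<open>1 / 2\<close>.\<close>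
  have D: "D \<longlonglongrightarrow> 0"
  proof -
    define v where "v n = 1 - cchar \<mu> (1 / a n)" for n
    define W where "W n j \<omega> = (1 - cos (1 / a n * V j \<omega>)) - v n" for n j \<omega>
    have Wb: "\<bar>W n j \<omega>\<bar> \<le> 4" for n j \<omega>
      using cos_le_one[of "1 / a n * V j \<omega>"] cos_ge_minus_one[of "1 / a n * V j \<omega>"] abs_cchar_le_1[of "1 / a n"]
      unfolding W_def v_def by linarith
    have [measurable]: "W n j \<in> borel_measurable M" for n j unfolding W_def by measurable
    have Wi: "integrable M (W n j)" for n j
      using Wb by (intro M.integrable_const_bound[where B = 4]) auto
    have WWb: "\<bar>W n i \<omega> * W n j \<omega>\<bar> \<le> 16" for n i j \<omega>
      using mult_mono[OF Wb[of n i \<omega>] Wb[of n j \<omega>]] by (simp add: abs_mult)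
    have WWi: "integrable M (\<lambda>\<omega>. W n i \<omega> * W n j \<omega>)" for n i j
      using WWb by (intro M.integrable_const_bound[where B = 16]) auto
    have W0: "(\<integral>\<omega>. W n j \<omega> \<partial>M) = 0" for n j
    proof -
      have "(\<integral>\<omega>. W n j \<omega> \<partial>M) = (\<integral>x. (1 - cos (1 / a n * x)) - v n \<partial>\<mu>)"
        unfolding W_def by (rule transfer) measurable
      also have "\<dots> = (1 - cchar \<mu> (1 / a n)) - v n"
        using integrable_cos[of "1 / a n"] prob_space by (simp add: cchar_def)
      finally show ?thesis by (simp add: v_def)
    qed
    have W2: "(\<integral>\<omega>. W n j \<omega> * W n j \<omega> \<partial>M) \<le> (\<integral>x. (1 - cos (1 / a n * x))\<^sup>2 \<partial>\<mu>)" for n j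
    proof -
      have c2: "(1 - cos z)\<^sup>2 \<le> 4" for z :: real
        using power_mono[of "1 - cos z" 2 2] cos_le_one[of z] cos_ge_minus_one[of z] by simp
      have i2: "integrable \<mu> (\<lambda>x. (1 - cos (1 / a n * x))\<^sup>2)"
        using c2 by (intro integrable_bounded_borel[where B = 4]) auto
      have "(\<integral>\<omega>. W n j \<omega> * W n j \<omega> \<partial>M) = (\<integral>x. ((1 - cos (1 / a n * x)) - v n) * ((1 - cos (1 / a n * x)) - v n) \<partial>\<mu>)"
        unfolding W_def by (rule transfer) measurable
      also have "\<dots> = (\<integral>x. (1 - cos (1 / a n * x))\<^sup>2 - 2 * v n * (1 - cos (1 / a n * x)) + (v n)\<^sup>2 \<partial>\<mu>)"
        by (intro Bochner_Integration.integral_cong) (auto simp: power2_eq_square algebra_simps)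
      also have "\<dots> = (\<integral>x. (1 - cos (1 / a n * x))\<^sup>2 \<partial>\<mu>) - 2 * v n * v n + (v n)\<^sup>2"
        using i2 integrable_cos[of "1 / a n"] one_minus_cchar[of "1 / a n"] prob_space by (simp add: v_def)
      also have "\<dots> \<le> (\<integral>x. (1 - cos (1 / a n * x))\<^sup>2 \<partial>\<mu>)" by (simp add: power2_eq_square)
      finally show ?thesis .
    qed
    have Wij: "(\<integral>\<omega>. W n i \<omega> * W n j \<omega> \<partial>M) = 0" if "i \<noteq> j" for n i j
    proof -
      have "M.indep_vars (\<lambda>_. borel) (W n) {i, j}"
        unfolding W_def by (rule M.indep_vars_compose2[OF M.indep_vars_subset[OF ind]]) auto
      from M.indep_vars_lebesgue_integral[OF _ this] Wi show ?thesis using that by (simp add: W0)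
    qed
    have var: "(\<integral>\<omega>. (\<Sum>j<n. W n j \<omega>)\<^sup>2 \<partial>M) \<le> q n 1" for n
    proof -
      have "(\<integral>\<omega>. (\<Sum>j<n. W n j \<omega>)\<^sup>2 \<partial>M) = (\<Sum>i<n. \<Sum>j<n. \<integral>\<omega>. W n i \<omega> * W n j \<omega> \<partial>M)"
        by (simp add: power2_eq_square sum_product WWi)
      also have "\<dots> = (\<Sum>i<n. \<Sum>j<n. if i = j then \<integral>\<omega>. W n i \<omega> * W n i \<omega> \<partial>M else 0)"
        by (intro sum.cong) (auto simp: Wij)
      also have "\<dots> = (\<Sum>i<n. \<integral>\<omega>. W n i \<omega> * W n i \<omega> \<partial>M)" by simp
      also have "\<dots> \<le> (\<Sum>i<n. \<integral>x. (1 - cos (1 / a n * x))\<^sup>2 \<partial>\<mu>)" by (intro sum_mono W2)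
      finally show ?thesis by (simp add: q_def)
    qed
    have "D n \<le> 2 * q n 1 + 2 * (real n * v n - 1 / 2)\<^sup>2" for n
    proof -
      have iS: "integrable M (\<lambda>\<omega>. (\<Sum>j<n. W n j \<omega>)\<^sup>2)"
        by (simp add: power2_eq_square sum_product WWi)
      have eq: "H n \<omega> = (\<Sum>j<n. W n j \<omega>) + real n * v n" for \<omega>
        by (simp add: W_def H_def sum_subtractf)
      have "(H n \<omega> - 1 / 2)\<^sup>2 \<le> 2 * (\<Sum>j<n. W n j \<omega>)\<^sup>2 + 2 * (real n * v n - 1 / 2)\<^sup>2" for \<omega>
        unfolding eq using sum_squares_bound[of "\<Sum>j<n. W n j \<omega>" "real n * v n - 1 / 2"]
        by (simp add: power2_eq_square algebra_simps)
      then have "D n \<le> (\<integral>\<omega>. 2 * (\<Sum>j<n. W n j \<omega>)\<^sup>2 + 2 * (real n * v n - 1 / 2)\<^sup>2 \<partial>M)"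
        unfolding D_def using iS HD by (intro integral_mono) auto
      also have "\<dots> = 2 * (\<integral>\<omega>. (\<Sum>j<n. W n j \<omega>)\<^sup>2 \<partial>M) + 2 * (real n * v n - 1 / 2)\<^sup>2"
        using iS M.prob_space by simp
      finally show ?thesis using var[of n] by linarith
    qed
    moreover have "(\<lambda>n. 2 * q n 1 + 2 * (real n * v n - 1 / 2)\<^sup>2) \<longlonglongrightarrow> 2 * 0 + 2 * (1\<^sup>2 / 2 - 1 / 2)\<^sup>2"
      unfolding v_def by (intro tendsto_intros q_tendsto_0 n_one_minus_cchar_tendsto)
    ultimately show ?thesis
      by (intro tendsto_sandwich[OF _ _ tendsto_const, of 0 D]) (auto simp: D_def)
  qed
  have H_le: "2 * (a n)\<^sup>2 * H n \<omega> \<le> (\<Sum>l<n. (V l \<omega>)\<^sup>2)" for n \<omega>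
  proof -
    have "2 * (a n)\<^sup>2 * (1 - cos (1 / a n * V l \<omega>)) \<le> (V l \<omega>)\<^sup>2" for l
    proof -
      have "1 - cos (1 / a n * V l \<omega>) \<le> (1 / a n * V l \<omega>)\<^sup>2 / 2"
      proof -
        have "1 - cos z \<le> z\<^sup>2 / 2" for z :: real
        proof -
          have "1 - cos z = 2 * (sin (z / 2))\<^sup>2" using cos_double_sin[of "z / 2"] by simp
          also have "\<dots> \<le> 2 * (z / 2)\<^sup>2"
            using abs_sin_x_le_abs_x[of "z / 2"] by (simp add: abs_le_square_iff[symmetric])
          finally show ?thesis by (simp add: power2_eq_square)
        qed
        then show ?thesis .
      qed
      then have "2 * (a n)\<^sup>2 * (1 - cos (1 / a n * V l \<omega>)) \<le> 2 * (a n)\<^sup>2 * ((1 / a n * V l \<omega>)\<^sup>2 / 2)"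
        by (intro mult_left_mono) auto
      also have "\<dots> = (V l \<omega>)\<^sup>2" using a_pos[of n] by (simp add: power_mult_distrib power_divide)
      finally show ?thesis .
    qed
    then show ?thesis unfolding H_def sum_distrib_left by (intro sum_mono)
  qed
  \<comment> \<open>The squares of a self-normalized row sum to 1 unless the row vanishes, so the
    second claim says that vanishing rows become improbable.\<close>
  have ysum: "(\<Sum>j<n. (y n j \<omega>)\<^sup>2) = (if (\<Sum>l<n. (V l \<omega>)\<^sup>2) = 0 then 0 else 1)" for n \<omega>
    by (simp add: y_def power_divide sum_nonneg flip: sum_divide_distrib)
  have y1: "\<bar>y n j \<omega>\<bar> \<le> 1" if "j < n" for n j \<omega>
  proof -
    have "(y n j \<omega>)\<^sup>2 \<le> (\<Sum>j<n. (y n j \<omega>)\<^sup>2)" using that by (intro member_le_sum) auto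
    also have "\<dots> \<le> 1" by (simp add: ysum)
    finally show ?thesis by (simp add: abs_square_le_1)
  qed
  have y4: "(\<Sum>j<n. (y n j \<omega>) ^ 4) \<le> 1" for n \<omega>
  proof -
    have "(\<Sum>j<n. (y n j \<omega>) ^ 4) \<le> (\<Sum>j<n. (y n j \<omega>)\<^sup>2)"
    proof (rule sum_mono)
      fix j assume "j \<in> {..<n}"
      then have "(y n j \<omega>)\<^sup>2 * (y n j \<omega>)\<^sup>2 \<le> (y n j \<omega>)\<^sup>2 * 1"
        using y1[of j n \<omega>] by (intro mult_left_mono) (auto simp: abs_square_le_1)
      then show "(y n j \<omega>) ^ 4 \<le> (y n j \<omega>)\<^sup>2" by (simp add: power4_eq_xxxx power2_eq_square mult.assoc)
    qed
    then show ?thesis by (simp add: ysum split: if_splits)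
  qed
  have i4: "integrable M (\<lambda>\<omega>. \<Sum>j<n. (y n j \<omega>) ^ 4)" for n
    using y4 by (intro M.integrable_const_bound[where B = 1]) (auto simp: sum_nonneg)
  have i2: "integrable M (\<lambda>\<omega>. \<Sum>j<n. (y n j \<omega>)\<^sup>2)" for n
    unfolding ysum[symmetric] by (intro M.integrable_const_bound[where B = 1]) (auto simp: sum_nonneg ysum)
  have "(\<lambda>n. \<integral>\<omega>. (\<Sum>j<n. (y n j \<omega>)\<^sup>2) \<partial>M) \<longlonglongrightarrow> 1"
  proof (rule tendsto_sandwich)
    show "(\<lambda>n. 1 - 16 * D n) \<longlonglongrightarrow> 1" using tendsto_diff[OF tendsto_const tendsto_mult[OF tendsto_const D]] by force
    \<comment> \<open>On a vanishing row \<open>H n \<omega> \<le> 0\<close>, so the subtracted term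
      is at least 4. The factor 16 agrees with the one in the fourth moment estimate, where it is
      dictated by the threshold \<open>H n \<omega> < 1 / 4\<close>.\<close>
    have "1 - 16 * (H n \<omega> - 1 / 2)\<^sup>2 \<le> (\<Sum>j<n. (y n j \<omega>)\<^sup>2)" for n \<omega>
    proof (cases "(\<Sum>l<n. (V l \<omega>)\<^sup>2) = 0")
      case True
      then have "H n \<omega> \<le> 0" using H_le[of n \<omega>] a_pos[of n] by (simp add: mult_le_0_iff not_less)
      then have "(1 / 2)\<^sup>2 \<le> (1 / 2 - H n \<omega>)\<^sup>2" by (intro power_mono) auto
      then show ?thesis using True by (simp add: ysum power2_commute power_divide)
    qed (simp add: ysum)
    then have "(\<integral>\<omega>. 1 - 16 * (H n \<omega> - 1 / 2)\<^sup>2 \<partial>M) \<le> (\<integral>\<omega>. (\<Sum>j<n. (y n j \<omega>)\<^sup>2) \<partial>M)" for n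
      using HD i2 by (intro integral_mono) auto
    then show "\<forall>\<^sub>F n in sequentially. 1 - 16 * D n \<le> (\<integral>\<omega>. (\<Sum>j<n. (y n j \<omega>)\<^sup>2) \<partial>M)"
      using HD M.prob_space by (simp add: D_def)
    have "(\<integral>\<omega>. (\<Sum>j<n. (y n j \<omega>)\<^sup>2) \<partial>M) \<le> (\<integral>\<omega>. 1 \<partial>M)" for n
      using i2 by (intro integral_mono) (auto simp: ysum)
    then show "\<forall>\<^sub>F n in sequentially. (\<integral>\<omega>. (\<Sum>j<n. (y n j \<omega>)\<^sup>2) \<partial>M) \<le> 1"
      using M.prob_space by simp
  qed simp
  then show ?B unfolding y_def .
  have "(\<lambda>n. \<integral>\<omega>. (\<Sum>j<n. (y n j \<omega>) ^ 4) \<partial>M) \<longlonglongrightarrow> 0"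
  proof (rule LIMSEQ_I)
    fix e :: real assume e: "e > 0"
    define \<epsilon> where "\<epsilon> = sqrt (e / 8)"
    have eps: "\<epsilon> > 0" "2 * \<epsilon>\<^sup>2 = e / 4" using e by (auto simp: \<epsilon>_def)
    let ?B = "\<lambda>n. {x. \<epsilon> * a n < \<bar>x\<bar>}"
    have B [measurable]: "?B n \<in> sets borel" for n by measurable
    \<comment> \<open>Three cases. If some entry exceeds \<open>\<epsilon> * a n\<close>, the sum of
      indicators is at least 1. If not, but \<open>H n \<omega> < 1 / 4\<close>, the last term is at
      least 1. In the remaining case the sum of squares is at least
      \<open>(a n)\<^sup>2 / 2\<close>, so each squared normalized entry is at most
      \<open>2 * \<epsilon>\<^sup>2\<close> and can be taken out of the fourth power.\<close>
    have pt: "(\<Sum>j<n. (y n j \<omega>) ^ 4) \<le> 2 * \<epsilon>\<^sup>2 + (\<Sum>j<n. indicator (?B n) (V j \<omega>)) + 16 * (H n \<omega> - 1 / 2)\<^sup>2" for n \<omega>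
    proof -
      have i0: "0 \<le> (\<Sum>j<n. indicator (?B n) (V j \<omega>) :: real)" by (intro sum_nonneg) auto
      show ?thesis
      proof (cases "\<exists>j<n. V j \<omega> \<in> ?B n")
        case True
        then obtain j where j: "j < n" "V j \<omega> \<in> ?B n" by blast
        then have "1 \<le> (\<Sum>j<n. indicator (?B n) (V j \<omega>) :: real)"
          using member_le_sum[of j "{..<n}" "\<lambda>j. indicator (?B n) (V j \<omega>) :: real"] by simp
        moreover have "0 \<le> 2 * \<epsilon>\<^sup>2" "0 \<le> 16 * (H n \<omega> - 1 / 2)\<^sup>2" by auto
        ultimately show ?thesis using y4[of n \<omega>] by linarith
      next
        case False
        show ?thesis
        proof (cases "H n \<omega> < 1 / 4")
          case True
          then have "(1 / 4)\<^sup>2 \<le> (1 / 2 - H n \<omega>)\<^sup>2" by (intro power_mono) auto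
          then have "1 \<le> 16 * (H n \<omega> - 1 / 2)\<^sup>2" by (simp add: power2_commute power_divide)
          moreover have "0 \<le> 2 * \<epsilon>\<^sup>2" by simp
          ultimately show ?thesis using y4[of n \<omega>] i0 by linarith
        next
          case H: False
          let ?S = "\<Sum>l<n. (V l \<omega>)\<^sup>2"
          have "2 * (a n)\<^sup>2 * (1 / 4) \<le> 2 * (a n)\<^sup>2 * H n \<omega>" using H by (intro mult_left_mono) auto
          then have S: "(a n)\<^sup>2 / 2 \<le> ?S" using H_le[of n \<omega>] by linarith
          have S0: "?S > 0" using S a_pos[of n] by (smt (verit) half_gt_zero zero_less_power)
          have "(y n j \<omega>) ^ 4 \<le> 2 * \<epsilon>\<^sup>2 * (y n j \<omega>)\<^sup>2" if j: "j < n" for j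
          proof -
            have "\<bar>V j \<omega>\<bar> \<le> \<epsilon> * a n" using False j by force
            then have "(V j \<omega>)\<^sup>2 \<le> (\<epsilon> * a n)\<^sup>2" using eps a_pos[of n] by (simp add: abs_le_square_iff[symmetric])
            also have "\<dots> = 2 * \<epsilon>\<^sup>2 * ((a n)\<^sup>2 / 2)" by (simp add: power_mult_distrib)
            also have "\<dots> \<le> 2 * \<epsilon>\<^sup>2 * ?S" using S by (intro mult_left_mono) auto
            finally have "(y n j \<omega>)\<^sup>2 \<le> 2 * \<epsilon>\<^sup>2"
              using S0 by (simp add: y_def power_divide pos_divide_le_eq)
            then have "(y n j \<omega>)\<^sup>2 * (y n j \<omega>)\<^sup>2 \<le> 2 * \<epsilon>\<^sup>2 * (y n j \<omega>)\<^sup>2" by (intro mult_right_mono) auto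
            then show ?thesis by (simp add: power4_eq_xxxx power2_eq_square mult.assoc)
          qed
          then have "(\<Sum>j<n. (y n j \<omega>) ^ 4) \<le> (\<Sum>j<n. 2 * \<epsilon>\<^sup>2 * (y n j \<omega>)\<^sup>2)" by (intro sum_mono) auto
          also have "\<dots> \<le> 2 * \<epsilon>\<^sup>2" by (simp add: ysum flip: sum_distrib_left)
          finally show ?thesis using i0 by (smt (verit) zero_le_power2)
        qed
      qed
    qed
    have ii: "integrable M (\<lambda>\<omega>. indicator (?B n) (V j \<omega>) :: real)" for n j
      by (rule M.integrable_const_bound[where B = 1]) auto
    have ei: "(\<integral>\<omega>. indicator (?B n) (V j \<omega>) \<partial>M) = prob (?B n)" for n j
      using transfer[of "indicator (?B n)" j] by simp
    have le: "(\<integral>\<omega>. (\<Sum>j<n. (y n j \<omega>) ^ 4) \<partial>M) \<le> e / 4 + real n * prob (?B n) + 16 * D n" for n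
    proof -
      have "(\<integral>\<omega>. (\<Sum>j<n. (y n j \<omega>) ^ 4) \<partial>M) \<le>
         (\<integral>\<omega>. 2 * \<epsilon>\<^sup>2 + (\<Sum>j<n. indicator (?B n) (V j \<omega>)) + 16 * (H n \<omega> - 1 / 2)\<^sup>2 \<partial>M)"
        using i4 ii HD pt by (intro integral_mono) auto
      also have "\<dots> = 2 * \<epsilon>\<^sup>2 + real n * prob (?B n) + 16 * D n"
        using ii HD M.prob_space by (simp add: ei D_def)
      finally show ?thesis by (simp add: eps)
    qed
    have "\<forall>\<^sub>F n in sequentially. real n * prob (?B n) < e / 4"
      using order_tendstoD(2)[OF tail_tendsto_0[OF eps(1)], of "e / 4"] e by simp
    moreover have "\<forall>\<^sub>F n in sequentially. D n < e / 64"
      using order_tendstoD(2)[OF D, of "e / 64"] e by simp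
    ultimately have "\<forall>\<^sub>F n in sequentially. norm ((\<integral>\<omega>. (\<Sum>j<n. (y n j \<omega>) ^ 4) \<partial>M) - 0) < e"
    proof eventually_elim
      case (elim n)
      have "0 \<le> (\<integral>\<omega>. (\<Sum>j<n. (y n j \<omega>) ^ 4) \<partial>M)"
        by (rule Bochner_Integration.integral_nonneg) (auto intro: sum_nonneg)
      then show ?case using le[of n] elim e by simp
    qed
    then show "\<exists>n0. \<forall>n\<ge>n0. norm ((\<integral>\<omega>. (\<Sum>j<n. (y n j \<omega>) ^ 4) \<partial>M) - 0) < e"
      by (simp add: eventually_sequentially)
  qed
  then show ?A unfolding y_def .
qed

end

section \<open>Closed walks as cyclic words\<close>

text \<open>Edges of the closed walk that visits the letters of \<open>xs\<close> in turn and
  returns to its start. The trace of a power of a matrix is the sum over words of the entry products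
  along these edges.\<close>

definition cyc :: "'a list \<Rightarrow> ('a \<times> 'a) list" where
  "cyc xs = zip xs (rotate1 xs)"

text \<open>The columns that a walk uses in row \<open>i\<close>, with multiplicity. Rows are the
  independent units of the matrix, so moments are organized by these lists.\<close>

definition targets :: "'a \<Rightarrow> ('a \<times> 'b) list \<Rightarrow> 'b list" where
  "targets i es = map snd (filter (\<lambda>e. fst e = i) es)"

definition even_edges :: "('a \<times> 'b) list \<Rightarrow> bool" where
  "even_edges es \<longleftrightarrow> (\<forall>e. even (count_list es e))"

lemma map_fst_cyc [simp]: "map fst (cyc xs) = xs"
  by (simp add: cyc_def)

lemma map_snd_cyc: "map snd (cyc xs) = rotate1 xs"
  by (simp add: cyc_def)

lemma fst_set_cyc [simp]: "fst ` set (cyc xs) = set xs"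
  by (metis list.set_map map_fst_cyc)

lemma snd_set_cyc [simp]: "snd ` set (cyc xs) = set xs"
  by (metis list.set_map map_snd_cyc set_rotate1)

lemma length_cyc [simp]: "length (cyc xs) = length xs"
  by (simp add: cyc_def)

lemma nth_cyc: "s < length xs \<Longrightarrow> cyc xs ! s = (xs ! s, xs ! (Suc s mod length xs))"
  by (simp add: cyc_def nth_rotate1)

lemma nth_in_set_cyc: "s < length xs \<Longrightarrow> (xs ! s, xs ! (Suc s mod length xs)) \<in> set (cyc xs)"
  by (metis length_cyc nth_cyc nth_mem)

lemma cyc_double: "cyc (b @ b) = cyc b @ cyc b"
proof (cases b)
  case (Cons a l)
  have "zip ((a # l) @ (a # l)) ((l @ [a]) @ (l @ [a])) = zip (a # l) (l @ [a]) @ zip (a # l) (l @ [a])"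
    by (rule zip_append) simp
  then show ?thesis by (simp add: cyc_def Cons)
qed (simp add: cyc_def)

lemma cyc_rotate1: "cyc (rotate1 xs) = rotate1 (cyc xs)"
proof (rule nth_equalityI)
  fix s assume s: "s < length (cyc (rotate1 xs))"
  then have s': "s < length xs" by simp
  have "Suc s mod length xs < length xs" by (intro mod_less_divisor le_less_trans[OF le0 s'])
  with s show "cyc (rotate1 xs) ! s = rotate1 (cyc xs) ! s"
    by (simp add: nth_cyc nth_rotate1 mod_Suc_eq)
qed simp

lemma cyc_rotate: "cyc (rotate r xs) = rotate r (cyc xs)"
  by (induction r) (simp_all add: cyc_rotate1)

text \<open>A closed walk reaches each of its letters from each other one, and by assumption no edge
  leaves \<open>A\<close>. Positions are taken modulo the length to follow the walk past its
  end.\<close>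

lemma set_subset_if_closed:
  assumes "x \<in> A" "x \<in> set xs" "\<And>i j. i \<in> A \<Longrightarrow> (i, j) \<in> set (cyc xs) \<Longrightarrow> j \<in> A"
  shows "set xs \<subseteq> A"
proof -
  let ?k = "length xs"
  obtain s where s: "s < ?k" "xs ! s = x" using assms(2) by (auto simp: in_set_conv_nth)
  have "xs ! ((s + m) mod ?k) \<in> A" for m
  proof (induction m)
    case 0
    then show ?case using s assms by simp
  next
    case (Suc m)
    have "(xs ! ((s + m) mod ?k), xs ! (Suc ((s + m) mod ?k) mod ?k)) \<in> set (cyc xs)"
      by (intro nth_in_set_cyc mod_less_divisor le_less_trans[OF le0 s(1)])
    from assms(3)[OF Suc this] show ?case by (simp add: mod_Suc_eq)
  qed
  note * = this
  show ?thesis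
  proof
    fix y assume "y \<in> set xs"
    then obtain t where t: "t < ?k" "xs ! t = y" by (auto simp: in_set_conv_nth)
    have "(s + (t + ?k - s)) mod ?k = t" using s t by simp
    with *[of "t + ?k - s"] t show "y \<in> A" by simp
  qed
qed

lemma targets_append [simp]: "targets i (es @ fs) = targets i es @ targets i fs"
  by (simp add: targets_def)

lemma set_targets: "set (targets i es) = {j. (i, j) \<in> set es}"
  by (force simp: targets_def)

lemma targets_eq_Nil_iff: "targets i es = [] \<longleftrightarrow> i \<notin> fst ` set es"
  by (force simp: targets_def filter_empty_conv)

lemma length_targets: "length (targets i es) = count_list (map fst es) i"
  by (simp add: targets_def count_list_eq_length_filter filter_map o_def eq_commute)

lemma count_targets: "count_list (targets i es) j = count_list es (i, j)"
  by (induction es) (auto simp: targets_def)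

lemma length_targets_cyc_ge_1: "i \<in> set xs \<Longrightarrow> 1 \<le> length (targets i (cyc xs))"
  using targets_eq_Nil_iff[of i "cyc xs"] by (simp add: Suc_le_eq)

lemma distinct_if_count_list_le_1: "(\<And>i. count_list xs i \<le> 1) \<Longrightarrow> distinct xs"
proof (induction xs)
  case (Cons x xs)
  have "count_list xs i \<le> 1" for i using Cons.prems[of i] by (auto split: if_splits)
  moreover have "x \<notin> set xs" using Cons.prems[of x] by (simp add: count_list_0_iff)
  ultimately show ?case using Cons.IH by simp
qed simp

lemma length_targets_cyc_distinct:
  assumes "distinct xs"
  shows "length (targets i (cyc xs)) = of_bool (i \<in> set xs)"
proof -
  have "count_list xs i = of_bool (i \<in> set xs)"
    using assms by (induction xs) auto
  then show ?thesis by (simp add: length_targets)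
qed

section \<open>Parity, light rows and uniqueness of successors\<close>

lemma even_length_targets:
  assumes "even_edges es"
  shows "even (length (targets i es))"
proof -
  have "length (targets i es) = (\<Sum>j\<in>set (targets i es). count_list (targets i es) j)"
    by (rule sum_count_set[symmetric]) auto
  also have "even \<dots>"
    using assms unfolding even_edges_def by (intro dvd_sum) (simp only: count_targets)
  finally show ?thesis .
qed

lemma count_list_add_le: "x \<noteq> y \<Longrightarrow> count_list xs x + count_list xs y \<le> length xs"
  by (induction xs) auto

text \<open>By parity every edge in use occurs at least twice, so two different targets would need
  four edges out of row \<open>i\<close>. In such a light row the walk has no choice, which is the
  source of all rigidity below.\<close>

lemma unique_target:
  assumes "even_edges es" "length (targets i es) \<le> 3" "(i, j) \<in> set es" "(i, j') \<in> set es"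
  shows "j = j'"
proof (rule ccontr)
  assume "j \<noteq> j'"
  then have "count_list es (i, j) + count_list es (i, j') \<le> 3"
    using count_list_add_le[of j j' "targets i es"] assms(2) by (simp add: count_targets)
  moreover have "2 \<le> count_list es e" if "e \<in> set es" for e
  proof -
    have "count_list es e \<noteq> 0" using that by (simp add: count_list_0_iff)
    moreover have "even (count_list es e)" using assms(1) unfolding even_edges_def by blast
    ultimately show ?thesis by presburger
  qed
  from this[OF assms(3)] this[OF assms(4)] calculation show False by linarith
qed

text \<open>If all rows were light, successors would be unique in the combined edge list. Two words
  with a common vertex would then have the same vertex set, so a vertex that they share with a third
  word would be left three times, hence by parity four times.\<close>

lemma connected_heavy:
  assumes even: "even_edges es" and es: "es = cyc xs1 @ cyc xs2 @ cyc xs3 @ cyc xs4"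
    and x: "x \<in> set xs1" "x \<in> set xs2"
    and y: "y \<in> set xs1 \<union> set xs2" "y \<in> set xs3 \<union> set xs4"
  shows "\<exists>i. 3 < length (targets i es)"
proof (rule ccontr)
  assume "\<not> ?thesis"
  then have le: "length (targets i es) \<le> 3" for i by (simp add: not_less)
  have "set xs1 \<subseteq> set xs1 \<inter> set xs2"
  proof (rule set_subset_if_closed)
    fix i j assume i: "i \<in> set xs1 \<inter> set xs2" and e: "(i, j) \<in> set (cyc xs1)"
    obtain j' where j': "(i, j') \<in> set (cyc xs2)"
      using i fst_set_cyc[of xs2] by (metis IntD2 imageE prod.collapse)
    have "j = j'" using e j' by (intro unique_target[OF even le]) (auto simp: es)
    then show "j \<in> set xs1 \<inter> set xs2"
      using e j' snd_set_cyc[of xs1] snd_set_cyc[of xs2] by (metis IntI image_eqI snd_conv)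
  qed (use x in auto)
  moreover have "set xs2 \<subseteq> set xs1 \<inter> set xs2"
  proof (rule set_subset_if_closed)
    fix i j assume i: "i \<in> set xs1 \<inter> set xs2" and e: "(i, j) \<in> set (cyc xs2)"
    obtain j' where j': "(i, j') \<in> set (cyc xs1)"
      using i fst_set_cyc[of xs1] by (metis IntD1 imageE prod.collapse)
    have "j = j'" using e j' by (intro unique_target[OF even le]) (auto simp: es)
    then show "j \<in> set xs1 \<inter> set xs2"
      using e j' snd_set_cyc[of xs1] snd_set_cyc[of xs2] by (metis IntI image_eqI snd_conv)
  qed (use x in auto)
  ultimately have "y \<in> set xs1" "y \<in> set xs2" using y by auto
  then have "3 \<le> length (targets y es)"
    using y(2) length_targets_cyc_ge_1[of y xs1] length_targets_cyc_ge_1[of y xs2]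
      length_targets_cyc_ge_1[of y xs3] length_targets_cyc_ge_1[of y xs4] by (auto simp: es)
  moreover have "even (length (targets y es))" by (rule even_length_targets[OF even])
  ultimately show False using le[of y] by (metis le_antisym odd_numeral)
qed

text \<open>Unique successors turn one repetition at distance \<open>d\<close> into a period
  \<open>d\<close> of the whole cyclic word. Every letter occurs at most twice, so the length must
  be \<open>2 * d\<close>. The companion \<open>ys\<close> is present because parity holds for a
  pair of words, as it arises in a second moment.\<close>

lemma light_walk_double:
  assumes even: "even_edges (cyc xs @ cyc ys)"
    and le: "\<And>i. length (targets i (cyc xs @ cyc ys)) \<le> 3"
    and nd: "\<not> distinct xs"
  shows "\<exists>b. distinct b \<and> xs = b @ b"
proof -
  let ?k = "length xs"
  have le2: "count_list xs i \<le> 2" for i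
  proof -
    have "length (targets i (cyc xs @ cyc ys)) \<noteq> 3"
      using even_length_targets[OF even, of i] by (metis odd_numeral)
    with le[of i] have "length (targets i (cyc xs @ cyc ys)) \<le> 2" by linarith
    then show ?thesis by (simp add: length_targets)
  qed
  obtain p q where pq: "p < q" "q < ?k" "xs ! p = xs ! q"
    using nd by (metis distinct_conv_nth linorder_neqE_nat)
  define d where "d = q - p"
  have d: "0 < d" "d < ?k" using pq by (auto simp: d_def)
  have k: "?k > 0" using pq by linarith
  have per: "xs ! ((p + m) mod ?k) = xs ! ((q + m) mod ?k)" for m
  proof (induction m)
    case 0
    then show ?case using pq by simp
  next
    case (Suc m)
    have e1: "(xs ! ((p + m) mod ?k), xs ! (Suc ((p + m) mod ?k) mod ?k)) \<in> set (cyc xs)"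
      using k by (intro nth_in_set_cyc) simp
    have e2: "(xs ! ((q + m) mod ?k), xs ! (Suc ((q + m) mod ?k) mod ?k)) \<in> set (cyc xs)"
      using k by (intro nth_in_set_cyc) simp
    have "xs ! (Suc ((p + m) mod ?k) mod ?k) = xs ! (Suc ((q + m) mod ?k) mod ?k)"
      using e1 e2 Suc by (intro unique_target[OF even le, of "xs ! ((p + m) mod ?k)"]) auto
    then show ?case by (simp add: mod_Suc_eq)
  qed
  \<comment> \<open>The periodicity found from position \<open>p\<close> on is restated for an
    arbitrary position by walking \<open>?k - p\<close> steps further, back to position 0.\<close>
  have per': "xs ! (s mod ?k) = xs ! ((s + d) mod ?k)" for s
  proof -
    have "(p + (s + (?k - p))) mod ?k = s mod ?k"
      using pq by (simp add: mod_add_self2)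
    moreover have "q + (s + (?k - p)) = s + d + ?k" using pq by (simp add: d_def)
    then have "(q + (s + (?k - p))) mod ?k = (s + d) mod ?k" by (simp only: mod_add_self2)
    ultimately show ?thesis using per[of "s + (?k - p)"] by simp
  qed
  have card2: "card {t. t < ?k \<and> xs ! t = i} \<le> 2" for i
    using le2[of i] by (simp add: count_list_eq_length_filter length_filter_conv_card eq_commute)
  have k2: "?k = 2 * d"
  proof (rule ccontr)
    assume ne: "?k \<noteq> 2 * d"
    \<comment> \<open>If the length differs from \<open>2 * d\<close>, these positions are pairwise
      distinct but carry the same letter, one occurrence too many.\<close>
    let ?T = "{0, d mod ?k, (d + d) mod ?k}"
    have sub: "?T \<subseteq> {t. t < ?k \<and> xs ! t = xs ! 0}"
      using per'[of 0] per'[of d] k by auto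
    have "(d + d) mod ?k \<noteq> 0"
    proof
      assume "(d + d) mod ?k = 0"
      then have "?k dvd 2 * d" by (simp add: mult_2 dvd_eq_mod_eq_0)
      then obtain c where c: "2 * d = ?k * c" by (elim dvdE)
      have "c \<noteq> 0" using c d by (cases c) auto
      moreover have "c < 2"
      proof (rule ccontr)
        assume "\<not> c < 2"
        then have "?k * 2 \<le> ?k * c" by (intro mult_le_mono2) simp
        with c d show False by linarith
      qed
      ultimately have "c = 1" by linarith
      with c ne show False by simp
    qed
    moreover have "(d + d) mod ?k \<noteq> d"
    proof (cases "d + d < ?k")
      case False
      then have "(d + d) mod ?k = d + d - ?k" 
        using d le_mod_geq[of ?k "d + d"] mod_less[of "d + d - ?k" ?k] by linarith
      then show ?thesis using d False by linarith
    qed (use d in simp)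
    ultimately have "card ?T = 3" using d by simp
    moreover have "card ?T \<le> card {t. t < ?k \<and> xs ! t = xs ! 0}"
      by (rule card_mono[OF _ sub]) simp
    ultimately show False using card2[of "xs ! 0"] by linarith
  qed
  define b where "b = take d xs"
  have lb: "length b = d" using d by (simp add: b_def)
  have "xs = b @ b"
  proof (rule nth_equalityI)
    show "length xs = length (b @ b)" using k2 lb by simp
    fix s assume s: "s < ?k"
    show "xs ! s = (b @ b) ! s"
    proof (cases "s < d")
      case True
      then show ?thesis using lb by (simp add: nth_append b_def)
    next
      case False
      have "xs ! s = xs ! (((s - d) + d) mod ?k)" using False s by simp
      also have "\<dots> = xs ! ((s - d) mod ?k)" by (rule per'[symmetric])
      also have "\<dots> = xs ! (s - d)" using s by simp
      finally show ?thesis using False lb s k2 by (simp add: nth_append b_def)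
    qed
  qed
  moreover have "distinct b"
  proof -
    have "count_list b i \<le> 1" for i
      using le2[of i] \<open>xs = b @ b\<close> by simp
    then show ?thesis by (rule distinct_if_count_list_le_1)
  qed
  ultimately show ?thesis by blast
qed

text \<open>From the common vertex on, both words follow the same unique successors, so they agree
  up to a shift. As letters do not repeat, each length divides the other.\<close>

lemma rotation_if_even:
  assumes c: "distinct c" "c \<noteq> []" and d: "distinct d" and hd: "hd c \<in> set d"
    and even: "even_edges (cyc c @ cyc d)"
  shows "d \<in> (\<lambda>r. rotate r c) ` {..<length c}"
proof -
  let ?k = "length c" and ?l = "length d"
  have le: "length (targets i (cyc c @ cyc d)) \<le> 3" for i
    using c d by (simp add: length_targets_cyc_distinct of_bool_def)
  obtain r where r: "r < ?l" "d ! r = c ! 0" using hd c by (auto simp: in_set_conv_nth hd_conv_nth)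
  have k: "?k > 0" using c by simp
  have l: "?l > 0" using r by linarith
  have eq: "c ! (s mod ?k) = d ! ((r + s) mod ?l)" for s
  proof (induction s)
    case 0
    then show ?case using r by simp
  next
    case (Suc s)
    have e1: "(c ! (s mod ?k), c ! (Suc (s mod ?k) mod ?k)) \<in> set (cyc c)"
      using k by (intro nth_in_set_cyc) simp
    have e2: "(d ! ((r + s) mod ?l), d ! (Suc ((r + s) mod ?l) mod ?l)) \<in> set (cyc d)"
      using l by (intro nth_in_set_cyc) simp
    have "c ! (Suc (s mod ?k) mod ?k) = d ! (Suc ((r + s) mod ?l) mod ?l)"
      using e1 e2 Suc by (intro unique_target[OF even le, of "c ! (s mod ?k)"]) auto
    then show ?case by (simp add: mod_Suc_eq)
  qed
  have "?k = ?l"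
  proof (rule dvd_antisym)
    have "c ! (?l mod ?k) = c ! (0 mod ?k)" using eq[of ?l] eq[of 0] by simp
    then have "?l mod ?k = 0" using c k by (simp add: nth_eq_iff_index_eq)
    then show "?k dvd ?l" by auto
    have "d ! ((r + ?k) mod ?l) = d ! r" using eq[of ?k] r k by simp
    then have "(r + ?k) mod ?l = r mod ?l"
      using nth_eq_iff_index_eq[OF d(1) mod_less_divisor[OF l] r(1)] r by simp
    then have "(r + ?k) mod ?l = (r + 0) mod ?l" by simp
    then show "?l dvd ?k" using mod_eq_dvd_iff_nat[of r "r + ?k" ?l] by simp
  qed
  \<comment> \<open>Letter 0 of \<open>c\<close> stands at position \<open>r\<close> of
    \<open>d\<close>, so \<open>c\<close> has to be rotated by \<open>?k - r\<close>; the remainder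
    takes care of \<open>r = 0\<close>.\<close>
  then have "d = rotate ((?k - r) mod ?k) c"
  proof (intro nth_equalityI)
    assume kl: "?k = ?l"
    fix s assume s: "s < ?l"
    have "rotate ((?k - r) mod ?k) c ! s = c ! (((?k - r) mod ?k + s) mod ?k)"
      using s kl by (simp add: nth_rotate)
    also have "\<dots> = c ! ((?k - r + s) mod ?k)" by (simp add: mod_simps)
    also have "\<dots> = d ! ((r + (?k - r + s)) mod ?l)" by (rule eq)
    also have "r + (?k - r + s) = ?k + s" using r kl by simp
    finally show "d ! s = rotate ((?k - r) mod ?k) c ! s" using s kl by simp
  qed simp
  then show ?thesis using k by auto
qed

lemma inj_on_rotate:
  assumes "distinct c"
  shows "inj_on (\<lambda>r. rotate r c) {..<length c}"
proof (rule inj_onI)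
  fix r s assume rs: "r \<in> {..<length c}" "s \<in> {..<length c}" "rotate r c = rotate s c"
  then have "c ! r = c ! s"
    using nth_rotate[of 0 c r] nth_rotate[of 0 c s] by (cases c) auto
  then show "r = s" using rs assms by (simp add: nth_eq_iff_index_eq)
qed

text \<open>Rotating a word permutes the edges of its closed walk, so every edge occurs equally
  often in both halves.\<close>

lemma even_edges_rotate: "even_edges (cyc c @ cyc (rotate r c))"
proof -
  have "mset (rotate1 xs) = mset xs" for xs :: "('a \<times> 'a) list" by (cases xs) auto
  then have "mset (rotate r xs) = mset xs" for xs :: "('a \<times> 'a) list" by (induction r) simp_all
  then have "count_list (rotate r xs) e = count_list xs e" for xs :: "('a \<times> 'a) list" and e
    by (metis count_mset)
  then show ?thesis by (auto simp: even_edges_def cyc_rotate)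
qed

section \<open>Sums over words, weighted by the number of visited vertices\<close>

definition words :: "nat \<Rightarrow> nat \<Rightarrow> nat list set" where
  "words n k = {xs. set xs \<subseteq> {..<n} \<and> length xs = k}"

definition short_words :: "nat \<Rightarrow> nat \<Rightarrow> nat list set" where
  "short_words n K = {xs. set xs \<subseteq> {..<n} \<and> length xs \<le> K}"

lemma finite_words [simp]: "finite (words n k)"
  unfolding words_def by (rule finite_lists_length_eq) simp

lemma finite_short_words [simp]: "finite (short_words n K)"
  unfolding short_words_def by (rule finite_lists_length_le) simp

lemma words_Suc: "words n (Suc k) = (\<lambda>(x, xs). x # xs) ` ({..<n} \<times> words n k)"
  by (auto simp: words_def length_Suc_conv image_iff)

lemma short_words_eq: "short_words n K = (\<Union>k\<le>K. words n k)"
  by (auto simp: words_def short_words_def)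

text \<open>A new vertex is chosen in at most \<open>n\<close> ways and costs a factor \<open>1 / n\<close>; an old one is chosen in
  boundedly many ways.\<close>

lemma sum_insert_weight:
  assumes "finite B"
  shows "(\<Sum>x<n. (1 / real n) ^ card (insert x B)) \<le> (1 + real (card B)) * (1 / real n) ^ card B"
proof (cases "n = 0")
  case False
  have "(\<Sum>x<n. (1 / real n) ^ card (insert x B)) \<le>
      (\<Sum>x<n. (1 / real n) ^ card B * (1 / real n + indicator B x))"
    using assms False
    by (intro sum_mono) (auto simp: card_insert_if indicator_def algebra_simps)
  also have "\<dots> = (1 / real n) ^ card B * (1 + real (card ({..<n} \<inter> B)))"
    using False by (simp add: sum_distrib_left[symmetric] sum.distrib indicator_def of_bool_def[symmetric] sum.If_cases)
  also have "\<dots> \<le> (1 / real n) ^ card B * (1 + real (card B))"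
    using assms by (intro mult_left_mono) (auto intro: card_mono)
  finally show ?thesis by (simp add: mult.commute)
qed simp

text \<open>Induction over the letters with \<open>B\<close> collecting the vertices met so far.
  Each letter contributes a factor bounded in terms of \<open>k\<close> and \<open>card B\<close>
  and without any power of \<open>n\<close>. Hence a sum over all words stays bounded as soon as the
  summand has a factor \<open>1 / n\<close> for each vertex.\<close>

lemma sum_words_weight:
  assumes "finite B"
  shows "(\<Sum>xs\<in>words n k. (1 / real n) ^ card (set xs \<union> B))
    \<le> (1 + real k + real (card B)) ^ k * (1 / real n) ^ card B"
  using assms
proof (induction k arbitrary: B)
  case 0
  have "words n 0 = {[]}" by (auto simp: words_def)
  then show ?case by simp
next
  case (Suc k)
  have "(\<Sum>xs\<in>words n (Suc k). (1 / real n) ^ card (set xs \<union> B)) =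
      (\<Sum>x<n. \<Sum>xs\<in>words n k. (1 / real n) ^ card (set xs \<union> insert x B))"
    unfolding words_Suc
    by (subst sum.reindex) (auto simp: inj_on_def sum.cartesian_product intro!: sum.cong
        arg_cong[where f = "\<lambda>S. (1 / real n) ^ card S"])
  also have "\<dots> \<le> (\<Sum>x<n. (1 + real k + real (card (insert x B))) ^ k * (1 / real n) ^ card (insert x B))"
    using Suc by (intro sum_mono Suc.IH) auto
  also have "\<dots> \<le> (\<Sum>x<n. (1 + real (Suc k) + real (card B)) ^ k * (1 / real n) ^ card (insert x B))"
    using Suc.prems by (intro sum_mono mult_right_mono power_mono) (auto simp: card_insert_if)
  also have "\<dots> = (1 + real (Suc k) + real (card B)) ^ k * (\<Sum>x<n. (1 / real n) ^ card (insert x B))"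
    by (simp add: sum_distrib_left)
  also have "\<dots> \<le> (1 + real (Suc k) + real (card B)) ^ k * ((1 + real (card B)) * (1 / real n) ^ card B)"
    using Suc.prems by (intro mult_left_mono sum_insert_weight) auto
  also have "\<dots> \<le> (1 + real (Suc k) + real (card B)) ^ k * ((1 + real (Suc k) + real (card B)) * (1 / real n) ^ card B)"
    by (intro mult_left_mono mult_right_mono) auto
  finally show ?case by (simp only: power_Suc2 mult.assoc)
qed

lemma sum_short_words_weight:
  assumes "finite B" "card B \<le> m"
  shows "(\<Sum>xs\<in>short_words n K. (1 / real n) ^ card (set xs \<union> B))
    \<le> (1 + real K) * (1 + real K + real m) ^ K * (1 / real n) ^ card B"
proof -
  have "(\<Sum>xs\<in>short_words n K. (1 / real n) ^ card (set xs \<union> B)) =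
      (\<Sum>k\<le>K. \<Sum>xs\<in>words n k. (1 / real n) ^ card (set xs \<union> B))"
    unfolding short_words_eq by (rule sum.UNION_disjoint) (auto simp: words_def[abs_def] intro: finite_words[unfolded words_def])
  also have "\<dots> \<le> (\<Sum>k\<le>K. (1 + real K + real m) ^ K * (1 / real n) ^ card B)"
  proof (rule sum_mono)
    fix k assume k: "k \<in> {..K}"
    have "(\<Sum>xs\<in>words n k. (1 / real n) ^ card (set xs \<union> B))
      \<le> (1 + real k + real (card B)) ^ k * (1 / real n) ^ card B"
      by (rule sum_words_weight[OF assms(1)])
    also have "\<dots> \<le> (1 + real K + real m) ^ k * (1 / real n) ^ card B"
      using k assms by (intro mult_right_mono power_mono add_mono) auto
    also have "\<dots> \<le> (1 + real K + real m) ^ K * (1 / real n) ^ card B"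
      using k by (intro mult_right_mono power_increasing) auto
    finally show "(\<Sum>xs\<in>words n k. (1 / real n) ^ card (set xs \<union> B))
      \<le> (1 + real K + real m) ^ K * (1 / real n) ^ card B" .
  qed
  finally show ?thesis by (simp add: algebra_simps)
qed

section \<open>Moments of the self-normalized entries\<close>

lemma prod_list_map_eq_prod_count:
  fixes f :: "'a \<Rightarrow> 'b :: comm_monoid_mult"
  assumes "finite A" "set xs \<subseteq> A"
  shows "prod_list (map f xs) = (\<Prod>x\<in>A. f x ^ count_list xs x)"
  using assms(2)
proof (induction xs)
  case (Cons x xs)
  then have x: "x \<in> A" and IH: "prod_list (map f xs) = (\<Prod>x\<in>A. f x ^ count_list xs x)" by auto
  have "(\<Prod>y\<in>A. f y ^ count_list (x # xs) y) = (\<Prod>y\<in>A. (if y = x then f x else 1) * f y ^ count_list xs y)"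
    by (intro prod.cong) auto
  also have "\<dots> = f x * (\<Prod>y\<in>A. f y ^ count_list xs y)"
    using assms(1) x by (simp add: prod.distrib)
  finally show ?case by (simp add: IH)
qed simp

lemma prod_list_map_targets:
  fixes f :: "'a \<times> 'b \<Rightarrow> 'c :: comm_monoid_mult"
  assumes "finite R" "fst ` set es \<subseteq> R"
  shows "prod_list (map f es) = (\<Prod>i\<in>R. prod_list (map (\<lambda>j. f (i, j)) (targets i es)))"
  using assms(2)
proof (induction es)
  case (Cons e es)
  obtain i0 j0 where e: "e = (i0, j0)" by (cases e)
  have i0: "i0 \<in> R" and IH: "prod_list (map f es) = (\<Prod>i\<in>R. prod_list (map (\<lambda>j. f (i, j)) (targets i es)))"
    using Cons e by auto
  have "(\<Prod>i\<in>R. prod_list (map (\<lambda>j. f (i, j)) (targets i (e # es))))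
      = (\<Prod>i\<in>R. (if i = i0 then f (i0, j0) else 1) * prod_list (map (\<lambda>j. f (i, j)) (targets i es)))"
    by (intro prod.cong) (auto simp: targets_def e)
  also have "\<dots> = f (i0, j0) * (\<Prod>i\<in>R. prod_list (map (\<lambda>j. f (i, j)) (targets i es)))"
    using assms(1) i0 by (simp add: prod.distrib)
  finally show ?case by (simp add: IH e)
qed (simp add: targets_def)

locale iid_symmetric_matrix = prob_space M + law: symmetric_distribution \<mu>
  for M :: "'a measure" and \<mu> :: "real measure" +
  fixes X :: "nat \<Rightarrow> nat \<Rightarrow> 'a \<Rightarrow> real"
  assumes indep: "indep_vars (\<lambda>_. borel) (\<lambda>(i, j). X i j) (UNIV :: (nat \<times> nat) set)"
    and ident: "\<And>i j. distr M borel (X i j) = \<mu>"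
begin

definition Y :: "nat \<Rightarrow> nat \<times> nat \<Rightarrow> 'a \<Rightarrow> real" where
  "Y n p \<omega> = X (fst p) (snd p) \<omega> / sqrt (\<Sum>l<n. (X (fst p) l \<omega>)\<^sup>2)"

definition sq :: "nat \<Rightarrow> (nat \<times> nat) set" where
  "sq n = {..<n} \<times> {..<n}"

lemma finite_sq [simp]: "finite (sq n)" by (simp add: sq_def)

lemma X_measurable [measurable]: "X i j \<in> borel_measurable M"
  using indep unfolding indep_vars_def by (auto dest: bspec[of _ _ "(i, j)"])

lemma Y_measurable [measurable]: "Y n p \<in> borel_measurable M"
  unfolding Y_def by measurable

lemma sum_Y_squared: "(\<Sum>j<n. (Y n (i, j) \<omega>)\<^sup>2) = (if (\<Sum>l<n. (X i l \<omega>)\<^sup>2) = 0 then 0 else 1)"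
  by (simp add: Y_def power_divide sum_nonneg flip: sum_divide_distrib)

lemma abs_Y_le_1:
  assumes "p \<in> sq n"
  shows "\<bar>Y n p \<omega>\<bar> \<le> 1"
proof -
  obtain i j where p: "p = (i, j)" "j < n" using assms by (auto simp: sq_def)
  have "(Y n (i, j) \<omega>)\<^sup>2 \<le> (\<Sum>j<n. (Y n (i, j) \<omega>)\<^sup>2)" using p by (intro member_le_sum) auto
  also have "\<dots> \<le> 1" by (simp add: sum_Y_squared)
  finally show ?thesis by (simp add: abs_square_le_1 p)
qed

text \<open>Row normalization as a function of the raw array, so that identities in law for the
  independent entries \<open>X\<close> carry over to the dependent entries \<open>Y\<close> by a
  change of variables.\<close>

definition yv :: "nat \<Rightarrow> (nat \<times> nat \<Rightarrow> real) \<Rightarrow> nat \<times> nat \<Rightarrow> real" where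
  "yv n x p = x p / sqrt (\<Sum>l<n. (x (fst p, l))\<^sup>2)"

lemma yv_restrict: "p \<in> sq n \<Longrightarrow> yv n (restrict x (sq n)) p = yv n x p"
  by (auto simp: yv_def sq_def intro!: arg_cong2[where f = "(/)"] arg_cong[where f = sqrt] sum.cong)

lemma yv_X: "yv n (\<lambda>p. X (fst p) (snd p) \<omega>) p = Y n p \<omega>"
  by (simp add: yv_def Y_def)

lemma yv_measurable:
  assumes "p \<in> sq n"
  shows "(\<lambda>x. yv n x p) \<in> borel_measurable (PiM (sq n) (\<lambda>_. borel))"
proof -
  have [measurable]: "(\<lambda>x. x q) \<in> borel_measurable (PiM (sq n) (\<lambda>_. borel))" if "q \<in> sq n" for q
    using that by (rule measurable_component_singleton)
  have "(\<lambda>x. x (fst p, l)) \<in> borel_measurable (PiM (sq n) (\<lambda>_. borel))" if "l < n" for l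
    using assms that by (intro measurable_component_singleton) (auto simp: sq_def)
  then have "(\<lambda>x. sqrt (\<Sum>l<n. (x (fst p, l))\<^sup>2)) \<in> borel_measurable (PiM (sq n) (\<lambda>_. borel))"
    by (intro measurable_compose[OF _ borel_measurable_sqrt] borel_measurable_sum borel_measurable_power) auto
  then show ?thesis
    unfolding yv_def using measurable_component_singleton[OF assms, of "\<lambda>_. borel"] by (intro borel_measurable_divide) auto
qed

lemma yarray_measurable:
  "(\<lambda>x. \<lambda>p\<in>sq n. yv n x p) \<in> measurable (PiM (sq n) (\<lambda>_. borel)) (PiM (sq n) (\<lambda>_. borel))"
  by (rule measurable_restrict) (rule yv_measurable)

section \<open>Sign changes and permutations of the array\<close>

lemma distr_signed_array:
  assumes n: "n > 0" and s: "\<And>p. s p = 1 \<or> s p = (- 1 :: real)"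
  shows "distr M (PiM (sq n) (\<lambda>_. borel)) (\<lambda>\<omega>. \<lambda>p\<in>sq n. s p * X (fst p) (snd p) \<omega>) = PiM (sq n) (\<lambda>_. \<mu>)"
proof -
  have ind: "indep_vars (\<lambda>_. borel) (\<lambda>p \<omega>. s p * X (fst p) (snd p) \<omega>) (sq n)"
    by (rule indep_vars_compose2[OF indep_vars_subset[OF indep[unfolded case_prod_unfold]]]) auto
  have law: "distr M borel (\<lambda>\<omega>. s p * X (fst p) (snd p) \<omega>) = \<mu>" for p
  proof (cases "s p = 1")
    case True
    then show ?thesis using ident[of "fst p" "snd p"] by simp
  next
    case False
    then have "distr M borel (\<lambda>\<omega>. s p * X (fst p) (snd p) \<omega>) = distr (distr M borel (X (fst p) (snd p))) borel uminus"
      using s[of p] by (subst distr_distr) (auto simp: o_def)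
    then show ?thesis by (simp add: ident law.symmetric)
  qed
  have "sq n \<noteq> {}" using n by (auto simp: sq_def)
  from indep_vars_iff_distr_eq_PiM'[OF this, where M' = "\<lambda>_. borel" and X = "\<lambda>p \<omega>. s p * X (fst p) (snd p) \<omega>"] ind
  show ?thesis by (simp add: law)
qed

lemma distr_permuted_array:
  assumes n: "n > 0" and \<pi>: "inj_on \<pi> (sq n)" "\<pi> \<in> sq n \<rightarrow> sq n"
  shows "distr M (PiM (sq n) (\<lambda>_. borel)) (\<lambda>\<omega>. \<lambda>p\<in>sq n. X (fst (\<pi> p)) (snd (\<pi> p)) \<omega>) = PiM (sq n) (\<lambda>_. \<mu>)"
proof -
  let ?P = "PiM (sq n) (\<lambda>_. borel) :: (nat \<times> nat \<Rightarrow> real) measure"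
  have 1: "distr M ?P (\<lambda>\<omega>. \<lambda>p\<in>sq n. X (fst p) (snd p) \<omega>) = PiM (sq n) (\<lambda>_. \<mu>)"
    using distr_signed_array[OF n, of "\<lambda>_. 1"] by simp
  have m: "(\<lambda>x. \<lambda>p\<in>sq n. x (\<pi> p)) \<in> measurable ?P ?P"
    using \<pi> by (intro measurable_restrict measurable_component_singleton) auto
  have "distr M ?P (\<lambda>\<omega>. \<lambda>p\<in>sq n. X (fst (\<pi> p)) (snd (\<pi> p)) \<omega>) =
      distr (distr M ?P (\<lambda>\<omega>. \<lambda>p\<in>sq n. X (fst p) (snd p) \<omega>)) ?P (\<lambda>x. \<lambda>p\<in>sq n. x (\<pi> p))"
  proof (subst distr_distr[OF m])
    show "(\<lambda>\<omega>. \<lambda>p\<in>sq n. X (fst p) (snd p) \<omega>) \<in> measurable M ?P"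
      by (intro measurable_restrict) measurable
    show "distr M ?P (\<lambda>\<omega>. \<lambda>p\<in>sq n. X (fst (\<pi> p)) (snd (\<pi> p)) \<omega>) =
        distr M ?P ((\<lambda>x. \<lambda>p\<in>sq n. x (\<pi> p)) \<circ> (\<lambda>\<omega>. \<lambda>p\<in>sq n. X (fst p) (snd p) \<omega>))"
      using \<pi>(2) by (intro arg_cong[where f = "distr M ?P"] ext) (auto simp: restrict_def Pi_iff)
  qed
  also have "\<dots> = distr (PiM (sq n) (\<lambda>_. \<mu>)) (PiM (sq n) (\<lambda>_. \<mu>)) (\<lambda>x. \<lambda>p\<in>sq n. x (\<pi> p))"
    unfolding 1 by (rule distr_cong) (auto intro!: sets_PiM_cong)
  also have "\<dots> = PiM (sq n) (\<lambda>_. \<mu>)"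
    using distr_PiM_reindex[of "sq n" "\<lambda>_. \<mu>" \<pi> "sq n"] \<pi> law.prob_space_axioms by simp
  finally show ?thesis .
qed

text \<open>Row norms depend on squares only, so signs pass through the normalization, and the raw
  array keeps its law because its entries are independent and symmetric.\<close>

lemma expectation_sign_change:
  fixes F :: "(nat \<times> nat \<Rightarrow> real) \<Rightarrow> 'c :: {banach, second_countable_topology}"
  assumes n: "n > 0" and s: "\<And>p. s p = 1 \<or> s p = (- 1 :: real)"
    and F: "F \<in> borel_measurable (PiM (sq n) (\<lambda>_. borel))"
  shows "expectation (\<lambda>\<omega>. F (\<lambda>p\<in>sq n. s p * Y n p \<omega>)) = expectation (\<lambda>\<omega>. F (\<lambda>p\<in>sq n. Y n p \<omega>))"
proof -
  let ?P = "PiM (sq n) (\<lambda>_. borel) :: (nat \<times> nat \<Rightarrow> real) measure"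
  let ?G = "\<lambda>x. F (\<lambda>p\<in>sq n. yv n x p)"
  have G: "?G \<in> borel_measurable ?P"
    by (rule measurable_compose[OF yarray_measurable F])
  have m: "(\<lambda>\<omega>. \<lambda>p\<in>sq n. s p * X (fst p) (snd p) \<omega>) \<in> measurable M ?P" for s
    by (intro measurable_restrict) measurable
  have s2: "(s p)\<^sup>2 = 1" for p using s[of p] by auto
  have e1: "(\<lambda>p\<in>sq n. yv n (\<lambda>p\<in>sq n. s p * X (fst p) (snd p) \<omega>) p) = (\<lambda>p\<in>sq n. s p * Y n p \<omega>)" for \<omega>
  proof (rule restrict_ext)
    fix p assume "p \<in> sq n"
    then have "yv n (\<lambda>p\<in>sq n. s p * X (fst p) (snd p) \<omega>) p = yv n (\<lambda>p. s p * X (fst p) (snd p) \<omega>) p"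
      by (rule yv_restrict)
    also have "\<dots> = s p * Y n p \<omega>" by (simp add: yv_def Y_def power_mult_distrib s2)
    finally show "yv n (\<lambda>p\<in>sq n. s p * X (fst p) (snd p) \<omega>) p = s p * Y n p \<omega>" .
  qed
  have e2: "(\<lambda>p\<in>sq n. yv n (\<lambda>p\<in>sq n. 1 * X (fst p) (snd p) \<omega>) p) = (\<lambda>p\<in>sq n. Y n p \<omega>)" for \<omega>
    by (rule restrict_ext) (simp add: yv_restrict yv_X)
  have "expectation (\<lambda>\<omega>. F (\<lambda>p\<in>sq n. s p * Y n p \<omega>)) =
      integral\<^sup>L (distr M ?P (\<lambda>\<omega>. \<lambda>p\<in>sq n. s p * X (fst p) (snd p) \<omega>)) ?G"
    by (subst integral_distr[OF m G]) (simp only: e1)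
  also have "\<dots> = integral\<^sup>L (distr M ?P (\<lambda>\<omega>. \<lambda>p\<in>sq n. 1 * X (fst p) (snd p) \<omega>)) ?G"
    using distr_signed_array[OF n s] distr_signed_array[OF n, of "\<lambda>_. 1"] by simp
  also have "\<dots> = expectation (\<lambda>\<omega>. F (\<lambda>p\<in>sq n. Y n p \<omega>))"
    by (subst integral_distr[OF m G]) (simp only: e2)
  finally show ?thesis .
qed

text \<open>The permutation has product form: \<open>f\<close> moves whole rows, and
  \<open>g\<close> rearranges the summands of every row norm in the same way. So it commutes with
  the normalization.\<close>

lemma expectation_permute:
  fixes F :: "(nat \<times> nat \<Rightarrow> real) \<Rightarrow> real"
  assumes n: "n > 0" and f: "f permutes {..<n}" and g: "g permutes {..<n}"
    and F: "F \<in> borel_measurable (PiM (sq n) (\<lambda>_. borel))"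
  shows "expectation (\<lambda>\<omega>. F (\<lambda>p\<in>sq n. Y n (f (fst p), g (snd p)) \<omega>)) = expectation (\<lambda>\<omega>. F (\<lambda>p\<in>sq n. Y n p \<omega>))"
proof -
  let ?P = "PiM (sq n) (\<lambda>_. borel) :: (nat \<times> nat \<Rightarrow> real) measure"
  let ?G = "\<lambda>x. F (\<lambda>p\<in>sq n. yv n x p)" and ?\<pi> = "\<lambda>p. (f (fst p), g (snd p))"
  have G: "?G \<in> borel_measurable ?P"
    by (rule measurable_compose[OF yarray_measurable F])
  have m: "(\<lambda>\<omega>. \<lambda>p\<in>sq n. X (fst (\<pi> p)) (snd (\<pi> p)) \<omega>) \<in> measurable M ?P" for \<pi>
    by (intro measurable_restrict) measurable
  have \<pi>: "inj_on ?\<pi> (sq n)" "?\<pi> \<in> sq n \<rightarrow> sq n"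
  proof -
    show "inj_on ?\<pi> (sq n)"
      by (auto simp: inj_on_def inj_eq[OF permutes_inj[OF f]] inj_eq[OF permutes_inj[OF g]])
    show "?\<pi> \<in> sq n \<rightarrow> sq n"
    proof (rule funcsetI)
      fix p assume "p \<in> sq n"
      then show "?\<pi> p \<in> sq n"
        using permutes_in_image[OF f, of "fst p"] permutes_in_image[OF g, of "snd p"]
        unfolding sq_def mem_Times_iff fst_conv snd_conv by blast
    qed
  qed
  have \<pi>': "inj_on (\<lambda>p. p) (sq n)" "(\<lambda>p. p) \<in> sq n \<rightarrow> sq n" by auto
  have e1: "(\<lambda>p\<in>sq n. yv n (\<lambda>p\<in>sq n. X (fst (?\<pi> p)) (snd (?\<pi> p)) \<omega>) p) = (\<lambda>p\<in>sq n. Y n (?\<pi> p) \<omega>)" for \<omega>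
  proof (rule restrict_ext)
    fix p assume "p \<in> sq n"
    then have "yv n (\<lambda>p\<in>sq n. X (fst (?\<pi> p)) (snd (?\<pi> p)) \<omega>) p = yv n (\<lambda>p. X (fst (?\<pi> p)) (snd (?\<pi> p)) \<omega>) p"
      by (rule yv_restrict)
    also have "\<dots> = Y n (?\<pi> p) \<omega>"
      using sum.permute[OF g, of "\<lambda>l. (X (f (fst p)) l \<omega>)\<^sup>2"]
      unfolding yv_def Y_def o_def fst_conv snd_conv by (simp only:)
    finally show "yv n (\<lambda>p\<in>sq n. X (fst (?\<pi> p)) (snd (?\<pi> p)) \<omega>) p = Y n (?\<pi> p) \<omega>" .
  qed
  have e2: "(\<lambda>p\<in>sq n. yv n (\<lambda>p\<in>sq n. X (fst p) (snd p) \<omega>) p) = (\<lambda>p\<in>sq n. Y n p \<omega>)" for \<omega>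
    by (rule restrict_ext) (simp add: yv_restrict yv_X)
  have "expectation (\<lambda>\<omega>. F (\<lambda>p\<in>sq n. Y n (?\<pi> p) \<omega>)) =
      integral\<^sup>L (distr M ?P (\<lambda>\<omega>. \<lambda>p\<in>sq n. X (fst (?\<pi> p)) (snd (?\<pi> p)) \<omega>)) ?G"
    by (subst integral_distr[OF m G]) (simp only: e1)
  also have "\<dots> = integral\<^sup>L (distr M ?P (\<lambda>\<omega>. \<lambda>p\<in>sq n. X (fst p) (snd p) \<omega>)) ?G"
    using distr_permuted_array[OF n \<pi>] distr_permuted_array[OF n \<pi>'] by simp
  also have "\<dots> = expectation (\<lambda>\<omega>. F (\<lambda>p\<in>sq n. Y n p \<omega>))"
    by (subst integral_distr[OF m[of "\<lambda>p. p"] G]) (simp only: e2)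
  finally show ?thesis .
qed

section \<open>Monomials and their factorization over rows\<close>

definition mon :: "nat \<Rightarrow> (nat \<times> nat) list \<Rightarrow> 'a \<Rightarrow> real" where
  "mon n es \<omega> = prod_list (map (\<lambda>e. Y n e \<omega>) es)"

lemma mon_append: "mon n (es @ fs) \<omega> = mon n es \<omega> * mon n fs \<omega>"
  by (simp add: mon_def)

lemma mon_measurable [measurable]: "mon n es \<in> borel_measurable M"
  unfolding mon_def by (induction es) auto

lemma abs_mon_le_1: "set es \<subseteq> sq n \<Longrightarrow> \<bar>mon n es \<omega>\<bar> \<le> 1"
  unfolding mon_def by (induction es) (auto simp: abs_mult intro!: mult_le_one abs_Y_le_1)

lemma integrable_mon: "set es \<subseteq> sq n \<Longrightarrow> integrable M (mon n es)"
  using abs_mon_le_1 by (intro integrable_const_bound[where B = 1]) auto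

text \<open>Flip the sign of a single entry of odd multiplicity: the law of the array is preserved
  while the monomial changes its sign.\<close>

lemma expectation_mon_not_even:
  assumes n: "n > 0" and es: "set es \<subseteq> sq n" and odd: "\<not> even_edges es"
  shows "expectation (mon n es) = 0"
proof -
  obtain e where e: "odd (count_list es e)" using odd by (auto simp: even_edges_def)
  define s where "s p = (if p = e then -1 else 1 :: real)" for p
  let ?F = "\<lambda>x. prod_list (map x es) :: real"
  have F: "?F \<in> borel_measurable (PiM (sq n) (\<lambda>_. borel))"
    using es
  proof (induction es)
    case (Cons a es)
    then have "(\<lambda>x. x a) \<in> borel_measurable (PiM (sq n) (\<lambda>_. borel))"
      by (intro measurable_component_singleton) auto
    with Cons show ?case by simp
  qed simp
  have E: "?F (\<lambda>p\<in>sq n. y p) = prod_list (map y es)" for y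
    using es by (intro arg_cong[where f = prod_list] map_cong) auto
  have S: "prod_list (map (\<lambda>p. s p * y p) es) = - prod_list (map y es)" for y
  proof -
    have "prod_list (map (\<lambda>p. s p * y p) es) = prod_list (map s es) * prod_list (map y es)"
      by (induction es) auto
    also have "prod_list (map s es) = (- 1) ^ count_list es e"
      by (induction es) (auto simp: s_def)
    finally show ?thesis using e by simp
  qed
  have "expectation (\<lambda>\<omega>. ?F (\<lambda>p\<in>sq n. s p * Y n p \<omega>)) = expectation (\<lambda>\<omega>. ?F (\<lambda>p\<in>sq n. Y n p \<omega>))"
    by (rule expectation_sign_change[OF n _ F]) (auto simp: s_def)
  then show ?thesis unfolding E S mon_def by simp
qed

definition rowmon :: "nat \<Rightarrow> nat \<Rightarrow> nat list \<Rightarrow> 'a \<Rightarrow> real" where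
  "rowmon n i cs \<omega> = prod_list (map (\<lambda>j. Y n (i, j) \<omega>) cs)"

lemma rowmon_measurable [measurable]: "rowmon n i cs \<in> borel_measurable M"
  unfolding rowmon_def by (induction cs) auto

lemma abs_rowmon_le_1: "i < n \<Longrightarrow> set cs \<subseteq> {..<n} \<Longrightarrow> \<bar>rowmon n i cs \<omega>\<bar> \<le> 1"
  unfolding rowmon_def by (induction cs) (auto simp: abs_mult sq_def intro!: mult_le_one abs_Y_le_1)

text \<open>The norm dividing an entry involves only the row of that entry, so functions of
  different rows are independent, whereas entries of one row are coupled through their norm and must
  be kept together.\<close>

lemma expectation_mon_rows:
  assumes es: "set es \<subseteq> sq n"
  shows "expectation (mon n es) = (\<Prod>i<n. expectation (rowmon n i (targets i es)))"
proof -
  have cs: "set (targets i es) \<subseteq> {..<n}" for i using es by (auto simp: set_targets sq_def)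
  have "mon n es = (\<lambda>\<omega>. \<Prod>i<n. rowmon n i (targets i es) \<omega>)"
    unfolding mon_def[abs_def] rowmon_def using es by (intro ext prod_list_map_targets) (auto simp: sq_def)
  moreover have "indep_vars (\<lambda>_. borel) (\<lambda>i. rowmon n i (targets i es)) {..<n}"
  proof -
    let ?K = "\<lambda>i::nat. {i} \<times> {..<n}"
    \<comment> \<open>The raw entries are grouped into one independent block per row; each row
      monomial is a measurable function of its own block.\<close>
    have I: "indep_vars (\<lambda>i. PiM (?K i) (\<lambda>_. borel)) (\<lambda>i \<omega>. \<lambda>p\<in>?K i. X (fst p) (snd p) \<omega>) {..<n}"
      by (rule indep_vars_restrict[OF indep[unfolded case_prod_unfold]]) (auto simp: disjoint_family_on_def)
    have "indep_vars (\<lambda>_. borel) (\<lambda>i \<omega>. (\<lambda>x. prod_list (map (\<lambda>j. yv n x (i, j)) (targets i es)))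
        (\<lambda>p\<in>?K i. X (fst p) (snd p) \<omega>)) {..<n}"
    proof (rule indep_vars_compose2[OF I])
      fix i
      have y: "(\<lambda>x. yv n x (i, j)) \<in> borel_measurable (PiM (?K i) (\<lambda>_. borel))" if "j < n" for j
      proof -
        have "(\<lambda>x. x (i, l)) \<in> borel_measurable (PiM (?K i) (\<lambda>_. borel))" if "l < n" for l
          using that by (intro measurable_component_singleton) auto
        then show ?thesis unfolding yv_def fst_conv using that
          by (intro borel_measurable_divide measurable_compose[OF _ borel_measurable_sqrt] borel_measurable_sum borel_measurable_power) auto
      qed
      have "(\<lambda>x. prod_list (map (\<lambda>j. yv n x (i, j)) c)) \<in> borel_measurable (PiM (?K i) (\<lambda>_. borel))"
        if "set c \<subseteq> {..<n}" for c
        using that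
      proof (induction c)
        case (Cons j c)
        then have "(\<lambda>x. yv n x (i, j)) \<in> borel_measurable (PiM (?K i) (\<lambda>_. borel))" by (intro y) auto
        with Cons show ?case by simp
      qed simp
      then show "(\<lambda>x. prod_list (map (\<lambda>j. yv n x (i, j)) (targets i es))) \<in> borel_measurable (PiM (?K i) (\<lambda>_. borel))"
        using cs by blast
    qed
    moreover have "prod_list (map (\<lambda>j. yv n (\<lambda>p\<in>?K i. X (fst p) (snd p) \<omega>) (i, j)) (targets i es)) = rowmon n i (targets i es) \<omega>" for i \<omega>
      unfolding rowmon_def using cs[of i]
      by (intro arg_cong[where f = prod_list] map_cong)
        (auto simp: yv_def Y_def subset_iff intro!: arg_cong2[where f = "(/)"] arg_cong[where f = sqrt] sum.cong)
    ultimately show ?thesis by simp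
  qed
  moreover have "integrable M (rowmon n i (targets i es))" if "i \<in> {..<n}" for i
    using that abs_rowmon_le_1[OF _ cs] by (intro integrable_const_bound[where B = 1]) auto
  ultimately show ?thesis
    using indep_vars_lebesgue_integral[of "{..<n}" "\<lambda>i. rowmon n i (targets i es)"] by simp
qed

lemma expectation_mon_append_disjoint:
  assumes "set es \<subseteq> sq n" "set fs \<subseteq> sq n" "fst ` set es \<inter> fst ` set fs = {}"
  shows "expectation (mon n (es @ fs)) = expectation (mon n es) * expectation (mon n fs)"
proof -
  have nil: "rowmon n i [] = (\<lambda>_. 1)" for i by (auto simp: rowmon_def)
  have "expectation (rowmon n i (targets i es @ targets i fs)) =
      expectation (rowmon n i (targets i es)) * expectation (rowmon n i (targets i fs))" for i
    using assms(3) targets_eq_Nil_iff[of i es] targets_eq_Nil_iff[of i fs]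
    by (cases "i \<in> fst ` set es") (auto simp: nil prob_space)
  then show ?thesis
    using assms by (simp add: expectation_mon_rows prod.distrib)
qed

section \<open>Moment parameters of one row\<close>

definition rho2 :: "nat \<Rightarrow> real" where
  "rho2 n = expectation (\<lambda>\<omega>. (Y n (0, 0) \<omega>)\<^sup>2)"

definition rho4 :: "nat \<Rightarrow> real" where
  "rho4 n = expectation (\<lambda>\<omega>. (Y n (0, 0) \<omega>) ^ 4)"

definition rho22 :: "nat \<Rightarrow> real" where
  "rho22 n = expectation (\<lambda>\<omega>. (Y n (0, 0) \<omega>)\<^sup>2 * (Y n (0, 1) \<omega>)\<^sup>2)"

text \<open>What a row with at least four factors gains over the ordinary cost \<open>1 / n\<close>:
  such a row contains a fourth power or two different squares, and each alternative has its own
  parameter.\<close>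

definition delta :: "nat \<Rightarrow> real" where
  "delta n = real n * (rho4 n + rho22 n)"

lemma rho_nonneg: "0 \<le> rho2 n" "0 \<le> rho4 n" "0 \<le> rho22 n" "0 \<le> delta n"
proof -
  show "0 \<le> rho2 n" unfolding rho2_def by (rule Bochner_Integration.integral_nonneg) auto
  show *: "0 \<le> rho4 n" unfolding rho4_def by (rule Bochner_Integration.integral_nonneg) auto
  show **: "0 \<le> rho22 n" unfolding rho22_def by (rule Bochner_Integration.integral_nonneg) auto
  show "0 \<le> delta n" unfolding delta_def using * ** by simp
qed

lemma integrable_Y_power:
  assumes "p \<in> sq n"
  shows "integrable M (\<lambda>\<omega>. (Y n p \<omega>) ^ k)"
proof (rule integrable_const_bound[where B = 1])
  show "AE \<omega> in M. norm ((Y n p \<omega>) ^ k) \<le> 1"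
    using abs_Y_le_1[OF assms] by (auto simp: power_abs intro!: power_le_one)
qed measurable

lemma expectation_Y_power:
  assumes "p \<in> sq n"
  shows "expectation (\<lambda>\<omega>. (Y n p \<omega>) ^ k) = expectation (\<lambda>\<omega>. (Y n (0, 0) \<omega>) ^ k)"
proof -
  obtain i j where p: "p = (i, j)" "i < n" "j < n" using assms by (auto simp: sq_def)
  then have n: "n > 0" and 0: "(0, 0) \<in> sq n" by (auto simp: sq_def)
  have "(\<lambda>x. x (0, 0) :: real) \<in> borel_measurable (PiM (sq n) (\<lambda>_. borel))"
    using 0 by (rule measurable_component_singleton)
  then have F: "(\<lambda>x. x (0, 0) ^ k :: real) \<in> borel_measurable (PiM (sq n) (\<lambda>_. borel))" by simp
  have t: "Transposition.transpose 0 i permutes {..<n}" "Transposition.transpose 0 j permutes {..<n}"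
    using p by (auto intro!: permutes_swap_id)
  show ?thesis using expectation_permute[OF n t F] 0 by (simp add: p)
qed

lemma expectation_Y_square_pair:
  assumes i: "i < n" and j: "j < n" "j' < n" "j \<noteq> j'"
  shows "expectation (\<lambda>\<omega>. (Y n (i, j) \<omega>)\<^sup>2 * (Y n (i, j') \<omega>)\<^sup>2) = rho22 n"
proof -
  have n: "n > 0" and 0: "(0, 0) \<in> sq n" "(0, 1) \<in> sq n" using assms by (auto simp: sq_def)
  have m: "(\<lambda>x. x (0, 0) :: real) \<in> borel_measurable (PiM (sq n) (\<lambda>_. borel))"
      "(\<lambda>x. x (0, 1) :: real) \<in> borel_measurable (PiM (sq n) (\<lambda>_. borel))"
    using 0 by (auto intro!: measurable_component_singleton)
  then have F: "(\<lambda>x. (x (0, 0))\<^sup>2 * (x (0, 1))\<^sup>2 :: real) \<in> borel_measurable (PiM (sq n) (\<lambda>_. borel))"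
    by (intro borel_measurable_times borel_measurable_power)
  \<comment> \<open>\<open>c\<close> is the index that the exchange of 0 and \<open>j\<close> sends
    to \<open>j'\<close>. Exchanging 1 with \<open>c\<close> beforehand yields a permutation that
    sends 0 to \<open>j\<close> and 1 to \<open>j'\<close>; it fixes 0 in the inner step because
    \<open>c \<noteq> 0\<close>.\<close>
  define c where "c = Transposition.transpose 0 j j'"
  have c: "c \<noteq> 0" "c < n" using j n by (auto simp: c_def Transposition.transpose_def)
  define g where "g = Transposition.transpose 0 j \<circ> Transposition.transpose 1 c"
  have g: "g 0 = j" "g 1 = j'" using c j by (auto simp: g_def c_def Transposition.transpose_def)
  have t: "Transposition.transpose 0 i permutes {..<n}" "g permutes {..<n}"
    unfolding g_def using i j c by (auto intro!: permutes_swap_id permutes_compose)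
  show ?thesis using expectation_permute[OF n t F] 0 g by (simp add: rho22_def)
qed

lemma expectation_sum_Y_power:
  assumes n: "n > 0"
  shows "expectation (\<lambda>\<omega>. \<Sum>j<n. (Y n (0, j) \<omega>) ^ k) = real n * expectation (\<lambda>\<omega>. (Y n (0, 0) \<omega>) ^ k)"
proof -
  have p: "(0, j) \<in> sq n" if "j < n" for j using that n by (simp add: sq_def)
  have "expectation (\<lambda>\<omega>. \<Sum>j<n. (Y n (0, j) \<omega>) ^ k) = (\<Sum>j<n. expectation (\<lambda>\<omega>. (Y n (0, j) \<omega>) ^ k))"
    using p by (intro Bochner_Integration.integral_sum integrable_Y_power) auto
  also have "\<dots> = (\<Sum>j<n. expectation (\<lambda>\<omega>. (Y n (0, 0) \<omega>) ^ k))"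
    by (intro sum.cong[OF refl] expectation_Y_power p) simp
  finally show ?thesis by simp
qed

lemma n_rho2: "n > 0 \<Longrightarrow> real n * rho2 n = expectation (\<lambda>\<omega>. \<Sum>j<n. (Y n (0, j) \<omega>)\<^sup>2)"
  unfolding rho2_def by (rule expectation_sum_Y_power[symmetric])

lemma n_rho4: "n > 0 \<Longrightarrow> real n * rho4 n = expectation (\<lambda>\<omega>. \<Sum>j<n. (Y n (0, j) \<omega>) ^ 4)"
  unfolding rho4_def by (rule expectation_sum_Y_power[symmetric])

lemma rho2_le: "n > 0 \<Longrightarrow> rho2 n \<le> 1 / real n"
proof -
  assume n: "n > 0"
  have "real n * rho2 n \<le> expectation (\<lambda>\<omega>. 1)"
    unfolding n_rho2[OF n]
  proof (rule integral_mono)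
    show "integrable M (\<lambda>\<omega>. \<Sum>j<n. (Y n (0, j) \<omega>)\<^sup>2)"
      using n by (intro Bochner_Integration.integrable_sum integrable_Y_power) (auto simp: sq_def)
  qed (auto simp: sum_Y_squared)
  then show ?thesis using n by (simp add: prob_space field_simps)
qed

text \<open>The \<open>n * (n - 1)\<close> ordered pairs of different columns all have the same
  mean, and the sum over them is at most the square of the row sum of squares, hence at most
  1.\<close>

lemma n_rho22_le: "n \<ge> 2 \<Longrightarrow> real n * rho22 n \<le> 1 / (real n - 1)"
proof -
  assume n: "n \<ge> 2"
  have i22: "integrable M (\<lambda>\<omega>. (Y n (0, j) \<omega>)\<^sup>2 * (Y n (0, j') \<omega>)\<^sup>2)" if "j < n" "j' < n" for j j'
    using integrable_mon[of "[(0, j), (0, j), (0, j'), (0, j')]" n] that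
    by (simp add: mon_def[abs_def] sq_def power2_eq_square mult.assoc)
  have "(\<Sum>j<n. \<Sum>j'\<in>{..<n} - {j}. rho22 n)
      = (\<Sum>j<n. \<Sum>j'\<in>{..<n} - {j}. expectation (\<lambda>\<omega>. (Y n (0, j) \<omega>)\<^sup>2 * (Y n (0, j') \<omega>)\<^sup>2))"
    using n by (intro sum.cong) (auto simp: expectation_Y_square_pair)
  also have "\<dots> = expectation (\<lambda>\<omega>. \<Sum>j<n. \<Sum>j'\<in>{..<n} - {j}. (Y n (0, j) \<omega>)\<^sup>2 * (Y n (0, j') \<omega>)\<^sup>2)" (is "_ = ?E")
  proof -
    have "?E = (\<Sum>j<n. expectation (\<lambda>\<omega>. \<Sum>j'\<in>{..<n} - {j}. (Y n (0, j) \<omega>)\<^sup>2 * (Y n (0, j') \<omega>)\<^sup>2))"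
      by (intro Bochner_Integration.integral_sum Bochner_Integration.integrable_sum i22) auto
    also have "\<dots> = (\<Sum>j<n. \<Sum>j'\<in>{..<n} - {j}. expectation (\<lambda>\<omega>. (Y n (0, j) \<omega>)\<^sup>2 * (Y n (0, j') \<omega>)\<^sup>2))"
      by (intro sum.cong[OF refl] Bochner_Integration.integral_sum i22) auto
    finally show ?thesis by (rule sym)
  qed
  also have "\<dots> \<le> expectation (\<lambda>_. 1)"
  proof (rule integral_mono)
    fix \<omega>
    have "(\<Sum>j<n. \<Sum>j'\<in>{..<n} - {j}. (Y n (0, j) \<omega>)\<^sup>2 * (Y n (0, j') \<omega>)\<^sup>2)
        \<le> (\<Sum>j<n. \<Sum>j'<n. (Y n (0, j) \<omega>)\<^sup>2 * (Y n (0, j') \<omega>)\<^sup>2)"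
      by (intro sum_mono sum_mono2) auto
    also have "\<dots> \<le> 1" unfolding sum_product[symmetric] sum_Y_squared by simp
    finally show "(\<Sum>j<n. \<Sum>j'\<in>{..<n} - {j}. (Y n (0, j) \<omega>)\<^sup>2 * (Y n (0, j') \<omega>)\<^sup>2) \<le> 1" .
  qed (auto intro!: Bochner_Integration.integrable_sum i22)
  finally have "real n * (real n - 1) * rho22 n \<le> 1"
    using n by (simp add: prob_space of_nat_diff)
  then show ?thesis using n by (simp add: pos_le_divide_eq mult_ac)
qed

lemma abs_prod_list_le:
  fixes y :: "nat \<Rightarrow> real"
  assumes "\<And>x. x \<in> set cs \<Longrightarrow> \<bar>y x\<bar> \<le> 1" "S \<subseteq> set cs"
  shows "\<bar>prod_list (map y cs)\<bar> \<le> (\<Prod>x\<in>S. \<bar>y x\<bar> ^ count_list cs x)"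
proof -
  have "\<bar>prod_list (map y cs)\<bar> = (\<Prod>x\<in>set cs. \<bar>y x\<bar> ^ count_list cs x)"
    by (simp add: prod_list_map_eq_prod_count[of "set cs"] abs_prod power_abs)
  also have "\<dots> = (\<Prod>x\<in>S. \<bar>y x\<bar> ^ count_list cs x) * (\<Prod>x\<in>set cs - S. \<bar>y x\<bar> ^ count_list cs x)"
    using assms(2) by (simp add: prod.subset_diff mult.commute)
  also have "\<dots> \<le> (\<Prod>x\<in>S. \<bar>y x\<bar> ^ count_list cs x) * 1"
    using assms(1) by (intro mult_left_mono prod_le_1 prod_nonneg) (auto intro: power_le_one)
  finally show ?thesis by simp
qed

lemma abs_expectation_rowmon_le:
  assumes i: "i < n" and cs: "set cs \<subseteq> {..<n}" "cs \<noteq> []" and even: "\<And>j. even (count_list cs j)"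
  shows "\<bar>expectation (rowmon n i cs)\<bar> \<le> 1 / real n"
    and "3 < length cs \<Longrightarrow> \<bar>expectation (rowmon n i cs)\<bar> \<le> delta n / real n"
proof -
  have n: "n > 0" using i by simp
  have ir: "integrable M (rowmon n i cs)"
    using abs_rowmon_le_1[OF i cs(1)] by (intro integrable_const_bound[where B = 1]) auto
  have Y1: "\<bar>Y n (i, x) \<omega>\<bar> \<le> 1" if "x \<in> set cs" for x \<omega>
    using that i cs by (intro abs_Y_le_1) (auto simp: sq_def)
  have p: "(i, x) \<in> sq n" if "x \<in> set cs" for x using that i cs by (auto simp: sq_def)
  have c2: "2 \<le> count_list cs j" if "j \<in> set cs" for j
  proof -
    have "count_list cs j \<noteq> 0" using that by (simp add: count_list_0_iff)
    then show ?thesis using even[of j] by presburger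
  qed
  have le: "\<bar>expectation (rowmon n i cs)\<bar> \<le> expectation g"
    if "integrable M g" "\<And>\<omega>. \<bar>rowmon n i cs \<omega>\<bar> \<le> g \<omega>" for g
  proof -
    have "\<bar>expectation (rowmon n i cs)\<bar> \<le> expectation (\<lambda>\<omega>. \<bar>rowmon n i cs \<omega>\<bar>)"
      by (rule integral_abs_bound)
    also have "\<dots> \<le> expectation g" using ir that by (intro integral_mono) auto
    finally show ?thesis .
  qed
  have pw: "\<bar>Y n (i, j) \<omega>\<bar> ^ c \<le> (Y n (i, j) \<omega>) ^ m" if "j \<in> set cs" "m \<le> c" "even m" for j c m \<omega>
    using power_decreasing[OF that(2) abs_ge_zero Y1[OF that(1)]] that(3) by (simp add: power_even_abs)
  have single: "\<bar>rowmon n i cs \<omega>\<bar> \<le> (Y n (i, j) \<omega>) ^ m" if "j \<in> set cs" "m \<le> count_list cs j" "even m" for j m \<omega>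
  proof -
    have "\<bar>rowmon n i cs \<omega>\<bar> \<le> \<bar>Y n (i, j) \<omega>\<bar> ^ count_list cs j"
      unfolding rowmon_def using abs_prod_list_le[of cs "\<lambda>x. Y n (i, x) \<omega>" "{j}"] Y1 that by simp
    also have "\<dots> \<le> (Y n (i, j) \<omega>) ^ m" by (rule pw[OF that])
    finally show ?thesis .
  qed
  obtain j where j: "j \<in> set cs" using cs(2) by (cases cs) auto
  have "\<bar>expectation (rowmon n i cs)\<bar> \<le> expectation (\<lambda>\<omega>. (Y n (i, j) \<omega>)\<^sup>2)"
    by (rule le[OF integrable_Y_power[OF p[OF j]] single[OF j c2[OF j]]]) simp
  also have "\<dots> = rho2 n" unfolding rho2_def by (rule expectation_Y_power[OF p[OF j]])
  finally show "\<bar>expectation (rowmon n i cs)\<bar> \<le> 1 / real n" using rho2_le[OF n] by linarith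
  assume len: "3 < length cs"
  have "\<bar>expectation (rowmon n i cs)\<bar> \<le> rho4 n + rho22 n"
  proof (cases "\<exists>j\<in>set cs. 3 \<le> count_list cs j")
    case True
    then obtain j where j: "j \<in> set cs" "3 \<le> count_list cs j" by blast
    then have c4: "4 \<le> count_list cs j" using even[of j] by presburger
    have "\<bar>expectation (rowmon n i cs)\<bar> \<le> expectation (\<lambda>\<omega>. (Y n (i, j) \<omega>) ^ 4)"
      by (rule le[OF integrable_Y_power[OF p[OF j(1)]] single[OF j(1) c4]]) simp
    also have "\<dots> = rho4 n" unfolding rho4_def by (rule expectation_Y_power[OF p[OF j(1)]])
    finally show ?thesis using rho_nonneg(3)[of n] by linarith
  next
    case False
    have "length cs = (\<Sum>j\<in>set cs. count_list cs j)" by (simp add: sum_count_set)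
    also have "\<dots> \<le> (\<Sum>j\<in>set cs. 2)" using False by (intro sum_mono) force
    finally have "card (set cs) \<ge> 2" using len by simp
    then obtain j j' where j: "j \<in> set cs" "j' \<in> set cs" "j \<noteq> j'"
      by (metis card_2_iff' obtain_subset_with_card_n subset_iff)
    have "\<bar>rowmon n i cs \<omega>\<bar> \<le> (Y n (i, j) \<omega>)\<^sup>2 * (Y n (i, j') \<omega>)\<^sup>2" for \<omega>
    proof -
      have "\<bar>rowmon n i cs \<omega>\<bar> \<le> \<bar>Y n (i, j) \<omega>\<bar> ^ count_list cs j * \<bar>Y n (i, j') \<omega>\<bar> ^ count_list cs j'"
        unfolding rowmon_def using abs_prod_list_le[of cs "\<lambda>x. Y n (i, x) \<omega>" "{j, j'}"] Y1 j by simp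
      also have "\<dots> \<le> (Y n (i, j) \<omega>)\<^sup>2 * (Y n (i, j') \<omega>)\<^sup>2"
        using j c2 by (intro mult_mono pw) auto
      finally show ?thesis .
    qed
    moreover have "integrable M (\<lambda>\<omega>. (Y n (i, j) \<omega>)\<^sup>2 * (Y n (i, j') \<omega>)\<^sup>2)"
      using integrable_mon[of "[(i, j), (i, j), (i, j'), (i, j')]" n] p j
      by (simp add: mon_def[abs_def] power2_eq_square mult.assoc)
    ultimately have "\<bar>expectation (rowmon n i cs)\<bar> \<le> expectation (\<lambda>\<omega>. (Y n (i, j) \<omega>)\<^sup>2 * (Y n (i, j') \<omega>)\<^sup>2)"
      by (intro le)
    also have "\<dots> = rho22 n" using j cs i by (intro expectation_Y_square_pair) auto
    finally show ?thesis using rho_nonneg(2)[of n] by linarith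
  qed
  then show "\<bar>expectation (rowmon n i cs)\<bar> \<le> delta n / real n" using n by (simp add: delta_def)
qed

lemma expectation_rowmon_Nil: "expectation (rowmon n i []) = 1"
  by (simp add: rowmon_def[abs_def] prob_space)

lemma prod_rows_weight:
  fixes c :: real
  assumes "set es \<subseteq> sq n"
  shows "(\<Prod>i<n. if i \<in> fst ` set es then c else 1) = c ^ card (fst ` set es)"
proof -
  have "fst ` set es \<subseteq> {..<n}" using assms by (auto simp: sq_def)
  then have "{..<n} \<inter> fst ` set es = fst ` set es" by blast
  then show ?thesis by (simp add: prod.If_cases)
qed

text \<open>Each visited row contributes \<open>1 / n\<close> by independence of the rows, unless
  parity fails and the mean is 0. The number of visited rows is the number of vertices of the walks,
  matching the weights of the word sums.\<close>

lemma abs_expectation_mon_le: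
  assumes es: "set es \<subseteq> sq n"
  shows "\<bar>expectation (mon n es)\<bar> \<le> (1 / real n) ^ card (fst ` set es)"
proof (cases "even_edges es \<and> n > 0")
  case True
  have cs: "set (targets i es) \<subseteq> {..<n}" for i using es by (auto simp: set_targets sq_def)
  have ev: "even (count_list (targets i es) j)" for i j
    using True unfolding even_edges_def count_targets by blast
  have "\<bar>expectation (mon n es)\<bar> = (\<Prod>i<n. \<bar>expectation (rowmon n i (targets i es))\<bar>)"
    by (simp add: expectation_mon_rows[OF es] abs_prod)
  also have "\<dots> \<le> (\<Prod>i<n. if i \<in> fst ` set es then 1 / real n else 1)"
  proof (intro prod_mono conjI)
    fix i assume i: "i \<in> {..<n}"
    show "\<bar>expectation (rowmon n i (targets i es))\<bar> \<le> (if i \<in> fst ` set es then 1 / real n else 1)"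
    proof (cases "i \<in> fst ` set es")
      case True
      then have "targets i es \<noteq> []" by (simp add: targets_eq_Nil_iff)
      from abs_expectation_rowmon_le(1)[OF _ cs this ev] i True show ?thesis by simp
    next
      case False
      then have "targets i es = []" by (simp add: targets_eq_Nil_iff)
      then show ?thesis using False by (simp add: expectation_rowmon_Nil)
    qed
  qed simp
  also have "\<dots> = (1 / real n) ^ card (fst ` set es)" by (rule prod_rows_weight[OF es])
  finally show ?thesis .
next
  case False
  show ?thesis
  proof (cases "n > 0")
    case True
    with False show ?thesis using expectation_mon_not_even[OF True es] by simp
  next
    case False
    with es have "es = []" by (auto simp: sq_def)
    then show ?thesis by (simp add: mon_def[abs_def] prob_space)
  qed
qed

text \<open>One row is replaced by its improved bound. Heaviness is assumed under the parity
  condition, the only case in which the mean can differ from 0; the lemmas on words deliver it in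
  exactly this form.\<close>

lemma abs_expectation_mon_heavy_le:
  assumes es: "set es \<subseteq> sq n" and n: "n > 0"
    and heavy: "even_edges es \<Longrightarrow> \<exists>i. 3 < length (targets i es)"
  shows "\<bar>expectation (mon n es)\<bar> \<le> delta n * (1 / real n) ^ card (fst ` set es)"
proof (cases "even_edges es")
  case True
  have cs: "set (targets i es) \<subseteq> {..<n}" for i using es by (auto simp: set_targets sq_def)
  have ev: "even (count_list (targets i es) j)" for i j
    using True unfolding even_edges_def count_targets by blast
  obtain i0 where i0: "3 < length (targets i0 es)" using heavy[OF True] by blast
  then have "targets i0 es \<noteq> []" by auto
  then have i0': "i0 \<in> fst ` set es" by (simp add: targets_eq_Nil_iff)
  then have i0n: "i0 \<in> {..<n}" using es by (auto simp: sq_def)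
  let ?g = "\<lambda>i. (if i = i0 then delta n else 1) * (if i \<in> fst ` set es then 1 / real n else 1)"
  have "\<bar>expectation (mon n es)\<bar> = (\<Prod>i<n. \<bar>expectation (rowmon n i (targets i es))\<bar>)"
    by (simp add: expectation_mon_rows[OF es] abs_prod)
  also have "\<dots> \<le> (\<Prod>i<n. ?g i)"
  proof (intro prod_mono conjI)
    fix i assume i: "i \<in> {..<n}"
    show "\<bar>expectation (rowmon n i (targets i es))\<bar> \<le> ?g i"
    proof (cases "i \<in> fst ` set es")
      case True
      then have ne: "targets i es \<noteq> []" by (simp add: targets_eq_Nil_iff)
      show ?thesis
      proof (cases "i = i0")
        case i0e: True
        show ?thesis
          using abs_expectation_rowmon_le(2)[OF _ cs ne ev] i True i0 by (simp add: i0e)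
      next
        case False
        with abs_expectation_rowmon_le(1)[OF _ cs ne ev] i True show ?thesis by simp
      qed
    next
      case False
      then have "targets i es = []" by (simp add: targets_eq_Nil_iff)
      moreover have "i \<noteq> i0" using False i0' by blast
      ultimately show ?thesis using False by (simp add: expectation_rowmon_Nil)
    qed
  qed simp
  also have "\<dots> = delta n * (1 / real n) ^ card (fst ` set es)"
    using i0n by (simp add: prod.distrib prod_rows_weight[OF es])
  finally show ?thesis .
next
  case False
  then show ?thesis using expectation_mon_not_even[OF n es] rho_nonneg(4)[of n] by simp
qed

lemma expectation_mon_double:
  assumes es: "set es \<subseteq> sq n" and d: "\<And>i. i \<in> fst ` set es \<Longrightarrow> \<exists>j. targets i es = [j, j]"
  shows "expectation (mon n es) = rho2 n ^ card (fst ` set es)"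
proof -
  have "expectation (mon n es) = (\<Prod>i<n. expectation (rowmon n i (targets i es)))"
    by (rule expectation_mon_rows[OF es])
  also have "\<dots> = (\<Prod>i<n. if i \<in> fst ` set es then rho2 n else 1)"
  proof (rule prod.cong)
    fix i assume i: "i \<in> {..<n}"
    show "expectation (rowmon n i (targets i es)) = (if i \<in> fst ` set es then rho2 n else 1)"
    proof (cases "i \<in> fst ` set es")
      case True
      then obtain j where j: "targets i es = [j, j]" using d by blast
      then have "j \<in> set (targets i es)" by simp
      then have "(i, j) \<in> sq n" using es by (auto simp: set_targets)
      from expectation_Y_power[OF this, of 2] True j show ?thesis
        by (simp add: rowmon_def[abs_def] rho2_def power2_eq_square)
    next
      case False
      then have "targets i es = []" by (simp add: targets_eq_Nil_iff)
      then show ?thesis using False by (simp add: expectation_rowmon_Nil)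
    qed
  qed simp
  also have "\<dots> = rho2 n ^ card (fst ` set es)" by (rule prod_rows_weight[OF es])
  finally show ?thesis .
qed

end

section \<open>Limits of the moment parameters\<close>

locale iid_attracted_matrix = iid_symmetric_matrix M \<mu> X + attracted_distribution \<mu> a
  for M :: "'a measure" and \<mu> and X and a
begin

lemma row_indep: "indep_vars (\<lambda>_. borel) (X 0) UNIV"
proof -
  let ?K = "\<lambda>j :: nat. {(0 :: nat, j)}"
  have "indep_vars (\<lambda>j. PiM (?K j) (\<lambda>_. borel)) (\<lambda>j \<omega>. \<lambda>p\<in>?K j. X (fst p) (snd p) \<omega>) UNIV"
    by (rule indep_vars_restrict[OF indep[unfolded case_prod_unfold]]) (auto simp: disjoint_family_on_def)
  then have "indep_vars (\<lambda>_. borel) (\<lambda>j \<omega>. (\<lambda>p\<in>?K j. X (fst p) (snd p) \<omega>) (0, j)) UNIV"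
    by (rule indep_vars_compose2) (intro measurable_component_singleton, simp)
  then show ?thesis by simp
qed

lemma n_rho2_tendsto: "(\<lambda>n. real n * rho2 n) \<longlonglongrightarrow> 1"
proof -
  have "(\<lambda>n. expectation (\<lambda>\<omega>. \<Sum>j<n. (Y n (0, j) \<omega>)\<^sup>2)) \<longlonglongrightarrow> 1"
    using self_normalized_moments(2)[OF prob_space_axioms row_indep ident] by (simp add: Y_def)
  then show ?thesis
    by (rule Lim_transform_eventually) (auto intro!: eventually_mono[OF eventually_gt_at_top[of 0]] simp: n_rho2)
qed

text \<open>The fourth moments are handled by the domain of attraction, the mixed squares by the
  bound \<open>1 / (n - 1)\<close>.\<close>

lemma delta_tendsto: "delta \<longlonglongrightarrow> 0"
proof -
  have "(\<lambda>n. expectation (\<lambda>\<omega>. \<Sum>j<n. (Y n (0, j) \<omega>) ^ 4)) \<longlonglongrightarrow> 0"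
    using self_normalized_moments(1)[OF prob_space_axioms row_indep ident] by (simp add: Y_def)
  then have 4: "(\<lambda>n. real n * rho4 n) \<longlonglongrightarrow> 0"
    by (rule Lim_transform_eventually) (auto intro!: eventually_mono[OF eventually_gt_at_top[of 0]] simp: n_rho4)
  have 22: "(\<lambda>n. real n * rho22 n) \<longlonglongrightarrow> 0"
  proof (rule tendsto_sandwich[OF _ _ tendsto_const])
    show "(\<lambda>n. 1 / (real n - 1)) \<longlonglongrightarrow> 0" by real_asymp
    show "\<forall>\<^sub>F n in sequentially. real n * rho22 n \<le> 1 / (real n - 1)"
      using eventually_ge_at_top[of 2] by eventually_elim (rule n_rho22_le)
  qed (auto simp: rho_nonneg)
  from tendsto_add[OF 4 22] show ?thesis by (simp add: delta_def[abs_def] distrib_left)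
qed

end

section \<open>Sums over simple cycles\<close>

text \<open>All variables of interest are built from finitely many entries of absolute value at most
  1, so they are bounded at every sample point. With this notion integrability is preserved by all
  the algebraic operations that occur.\<close>

definition (in prob_space) bounded_rv :: "('a \<Rightarrow> 'b :: {banach, second_countable_topology}) \<Rightarrow> bool" where
  "bounded_rv f \<longleftrightarrow> f \<in> borel_measurable M \<and> (\<exists>B. \<forall>\<omega>. norm (f \<omega>) \<le> B)"

context prob_space
begin

lemma bounded_rvI: "f \<in> borel_measurable M \<Longrightarrow> (\<And>\<omega>. norm (f \<omega>) \<le> B) \<Longrightarrow> bounded_rv f"
  by (auto simp: bounded_rv_def)

lemma bounded_rv_measurable: "bounded_rv f \<Longrightarrow> f \<in> borel_measurable M"
  by (simp add: bounded_rv_def)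

lemma bounded_rv_integrable: "bounded_rv f \<Longrightarrow> integrable M f"
  unfolding bounded_rv_def by (auto intro: integrable_const_bound)

lemma bounded_rv_const: "bounded_rv (\<lambda>_. c)"
  by (rule bounded_rvI[where B = "norm c"]) auto

lemma bounded_rv_add:
  assumes "bounded_rv f" "bounded_rv g"
  shows "bounded_rv (\<lambda>\<omega>. f \<omega> + g \<omega>)"
proof -
  from assms obtain A B where "\<And>\<omega>. norm (f \<omega>) \<le> A" "\<And>\<omega>. norm (g \<omega>) \<le> B"
    by (auto simp: bounded_rv_def)
  then have "norm (f \<omega> + g \<omega>) \<le> A + B" for \<omega> by (meson add_mono norm_triangle_le)
  with assms show ?thesis by (auto simp: bounded_rv_def)
qed

lemma bounded_rv_mult:
  fixes f g :: "'a \<Rightarrow> 'b :: {banach, second_countable_topology, real_normed_algebra}"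
  assumes "bounded_rv f" "bounded_rv g"
  shows "bounded_rv (\<lambda>\<omega>. f \<omega> * g \<omega>)"
proof -
  from assms obtain A B where AB: "\<And>\<omega>. norm (f \<omega>) \<le> A" "\<And>\<omega>. norm (g \<omega>) \<le> B"
    by (auto simp: bounded_rv_def)
  have "norm (f \<omega> * g \<omega>) \<le> A * B" for \<omega>
    using norm_mult_ineq[of "f \<omega>" "g \<omega>"] mult_mono'[OF AB[of \<omega>] norm_ge_zero norm_ge_zero] by linarith
  with assms show ?thesis by (auto simp: bounded_rv_def)
qed

lemma bounded_rv_diff:
  assumes "bounded_rv f" "bounded_rv g"
  shows "bounded_rv (\<lambda>\<omega>. f \<omega> - g \<omega>)"
proof -
  from assms obtain A B where "\<And>\<omega>. norm (f \<omega>) \<le> A" "\<And>\<omega>. norm (g \<omega>) \<le> B"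
    by (auto simp: bounded_rv_def)
  then have "norm (f \<omega> - g \<omega>) \<le> A + B" for \<omega> by (meson add_mono norm_triangle_le_diff)
  with assms show ?thesis by (auto simp: bounded_rv_def)
qed

lemma bounded_rv_sum: "(\<And>i. i \<in> I \<Longrightarrow> bounded_rv (f i)) \<Longrightarrow> bounded_rv (\<lambda>\<omega>. \<Sum>i\<in>I. f i \<omega>)"
  by (induction I rule: infinite_finite_induct) (auto intro: bounded_rv_const bounded_rv_add)

lemma bounded_rv_power:
  fixes f :: "'a \<Rightarrow> real"
  shows "bounded_rv f \<Longrightarrow> bounded_rv (\<lambda>\<omega>. f \<omega> ^ k)"
  by (induction k) (auto intro: bounded_rv_const bounded_rv_mult)

lemma bounded_rv_abs: "bounded_rv f \<Longrightarrow> bounded_rv (\<lambda>\<omega>. \<bar>f \<omega> :: real\<bar>)"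
  by (auto simp: bounded_rv_def)

lemma bounded_rv_of_real: "bounded_rv f \<Longrightarrow> bounded_rv (\<lambda>\<omega>. complex_of_real (f \<omega>))"
  by (auto simp: bounded_rv_def)

lemma bounded_rv_cis: "f \<in> borel_measurable M \<Longrightarrow> bounded_rv (\<lambda>\<omega>. cis (f \<omega>))"
  by (rule bounded_rvI[where B = 1]) (auto simp: cis_conv_exp)

lemmas bounded_rv_intros = bounded_rv_const bounded_rv_add bounded_rv_mult bounded_rv_diff
  bounded_rv_sum bounded_rv_power bounded_rv_abs bounded_rv_of_real bounded_rv_cis

text \<open>The variance of \<open>\<bar>f \<omega>\<bar>\<close> is nonnegative. This is the
  passage from second moments, which the word sums control, to the absolute first moments in the
  final estimates.\<close>

lemma expectation_abs_le_sqrt: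
  assumes "bounded_rv f"
  shows "expectation (\<lambda>\<omega>. \<bar>f \<omega> :: real\<bar>) \<le> sqrt (expectation (\<lambda>\<omega>. (f \<omega>)\<^sup>2))"
proof -
  let ?m = "expectation (\<lambda>\<omega>. \<bar>f \<omega>\<bar>)"
  have i: "integrable M (\<lambda>\<omega>. \<bar>f \<omega>\<bar>)" "integrable M (\<lambda>\<omega>. (f \<omega>)\<^sup>2)"
    by (intro bounded_rv_integrable bounded_rv_intros assms)+
  have "0 \<le> expectation (\<lambda>\<omega>. (\<bar>f \<omega>\<bar> - ?m)\<^sup>2)" by (rule Bochner_Integration.integral_nonneg) auto
  also have "\<dots> = expectation (\<lambda>\<omega>. (f \<omega>)\<^sup>2 - 2 * ?m * \<bar>f \<omega>\<bar> + ?m\<^sup>2)"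
    by (simp add: power2_diff algebra_simps)
  also have "\<dots> = expectation (\<lambda>\<omega>. (f \<omega>)\<^sup>2) - 2 * ?m * ?m + ?m\<^sup>2"
    using i by (simp add: prob_space)
  finally have "?m\<^sup>2 \<le> expectation (\<lambda>\<omega>. (f \<omega>)\<^sup>2)" by (simp add: power2_eq_square)
  then show ?thesis by (rule real_le_rsqrt)
qed

end

lemma cis_taylor: "norm (1 - cis (- y) - \<i> * of_real y) \<le> y\<^sup>2 / 2"
proof -
  have "norm (iexp (- y) - (\<Sum>k\<le>1. (\<i> * (- y))^k / fact k)) \<le> \<bar>- y\<bar>^(Suc 1) / fact (Suc 1)"
    by (rule iexp_approx1)
  also have "iexp (- y) - (\<Sum>k\<le>1. (\<i> * (- y))^k / fact k) = - (1 - cis (- y) - \<i> * of_real y)"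
    by (simp add: cis_conv_exp)
  finally show ?thesis unfolding norm_minus_cancel by (simp add: power2_eq_square)
qed

text \<open>The constant of \<open>sum_short_words_weight\<close> for \<open>3 * K\<close> vertices
  already present, as many as three words of length at most \<open>K\<close> can have.\<close>

definition quad_const :: "nat \<Rightarrow> real" where
  "quad_const K = ((1 + real K) * (1 + real K + real (3 * K)) ^ K)"

lemma quad_const_ge_1: "1 \<le> quad_const K"
proof -
  have "1 \<le> (1 + real K + real (3 * K)) ^ K" by (rule one_le_power) simp
  then have "1 * 1 \<le> (1 + real K) * (1 + real K + real (3 * K)) ^ K" by (intro mult_mono) auto
  then show ?thesis by (simp add: quad_const_def)
qed

lemma sum_short_words_weight':
  assumes "finite B" "card B \<le> 3 * K"
  shows "(\<Sum>xs\<in>short_words n K. (1 / real n) ^ card (set xs \<union> B)) \<le> quad_const K * (1 / real n) ^ card B"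
  unfolding quad_const_def by (rule sum_short_words_weight[OF assms])

lemma card_short_word: "xs \<in> short_words n K \<Longrightarrow> card (set xs) \<le> K"
  unfolding short_words_def using card_length[of xs] by auto

lemma sum_pairs_weight:
  "(\<Sum>a\<in>short_words n K. \<Sum>b\<in>short_words n K. (1 / real n) ^ card (set a \<union> set b)) \<le> quad_const K ^ 2"
proof -
  have "(\<Sum>a\<in>short_words n K. \<Sum>b\<in>short_words n K. (1 / real n) ^ card (set a \<union> set b)) \<le>
      (\<Sum>a\<in>short_words n K. quad_const K * (1 / real n) ^ card (set a))"
    using sum_short_words_weight'[of "set a" K n for a] card_short_word[of _ n K]
    by (intro sum_mono) (force simp: Un_commute)
  also have "\<dots> \<le> quad_const K * (quad_const K * (1 / real n) ^ card ({} :: nat set))"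
    unfolding sum_distrib_left[symmetric] using sum_short_words_weight'[of "{}" K n] quad_const_ge_1[of K]
    by (intro mult_left_mono) auto
  finally show ?thesis by (simp add: power2_eq_square)
qed

text \<open>The last word is summed out against the union of the other three, then the third one
  against the union of two, which leaves the sum over pairs.\<close>

lemma sum_quadruples_weight:
  "(\<Sum>a\<in>short_words n K. \<Sum>b\<in>short_words n K. \<Sum>c\<in>short_words n K. \<Sum>d\<in>short_words n K.
     (1 / real n) ^ card (set a \<union> set b \<union> set c \<union> set d)) \<le> quad_const K ^ 4"
proof -
  let ?S = "short_words n K" and ?q = "quad_const K"
  have q: "0 \<le> ?q" using quad_const_ge_1[of K] by linarith
  have step: "(\<Sum>d\<in>?S. (1 / real n) ^ card (B \<union> set d)) \<le> ?q * (1 / real n) ^ card B"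
    if "finite B" "card B \<le> 3 * K" for B
    using sum_short_words_weight'[OF that, of n] by (simp add: Un_commute)
  have "(\<Sum>a\<in>?S. \<Sum>b\<in>?S. \<Sum>c\<in>?S. \<Sum>d\<in>?S. (1 / real n) ^ card (set a \<union> set b \<union> set c \<union> set d))
      \<le> (\<Sum>a\<in>?S. \<Sum>b\<in>?S. \<Sum>c\<in>?S. ?q * (1 / real n) ^ card (set a \<union> set b \<union> set c))"
  proof (intro sum_mono step)
    fix a b c assume "a \<in> ?S" "b \<in> ?S" "c \<in> ?S"
    then show "card (set a \<union> set b \<union> set c) \<le> 3 * K"
      using card_short_word[of a n K] card_short_word[of b n K] card_short_word[of c n K]
        card_Un_le[of "set a \<union> set b" "set c"] card_Un_le[of "set a" "set b"] by linarith
  qed auto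
  also have "\<dots> = (\<Sum>a\<in>?S. \<Sum>b\<in>?S. ?q * (\<Sum>c\<in>?S. (1 / real n) ^ card (set a \<union> set b \<union> set c)))"
    by (simp only: sum_distrib_left)
  also have "\<dots> \<le> (\<Sum>a\<in>?S. \<Sum>b\<in>?S. ?q * (?q * (1 / real n) ^ card (set a \<union> set b)))"
  proof (intro sum_mono mult_left_mono q step)
    fix a b assume "a \<in> ?S" "b \<in> ?S"
    then show "card (set a \<union> set b) \<le> 3 * K"
      using card_short_word[of a n K] card_short_word[of b n K] card_Un_le[of "set a" "set b"] by linarith
  qed auto
  also have "\<dots> = ?q * (?q * (\<Sum>a\<in>?S. \<Sum>b\<in>?S. (1 / real n) ^ card (set a \<union> set b)))"
    by (simp add: sum_distrib_left)
  also have "\<dots> \<le> ?q * (?q * ?q ^ 2)" by (intro mult_left_mono q sum_pairs_weight)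
  finally show ?thesis by (simp add: power4_eq_xxxx power2_eq_square mult.assoc)
qed

section \<open>Covariances of products of cycles\<close>

context iid_symmetric_matrix
begin

lemma bounded_rv_mon: "set es \<subseteq> sq n \<Longrightarrow> bounded_rv (mon n es)"
  using abs_mon_le_1 by (intro bounded_rvI[where B = 1]) auto

lemma set_cyc_subset_sq: "set xs \<subseteq> {..<n} \<Longrightarrow> set (cyc xs) \<subseteq> sq n"
proof
  fix e assume xs: "set xs \<subseteq> {..<n}" and e: "e \<in> set (cyc xs)"
  have "fst e \<in> set xs" "snd e \<in> set xs"
    using e fst_set_cyc[of xs] snd_set_cyc[of xs] by blast+
  then show "e \<in> sq n" using xs by (auto simp: sq_def mem_Times_iff)
qed

lemma short_word_cyc: "xs \<in> short_words n K \<Longrightarrow> set (cyc xs) \<subseteq> sq n"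
  by (rule set_cyc_subset_sq) (simp add: short_words_def)

text \<open>The common vertex \<open>x\<close> ties two words together and \<open>y\<close> ties
  them to a third one. By \<open>connected_heavy\<close> some row is then heavy as soon as parity
  holds.\<close>

lemma expectation_cyc4_le:
  assumes n: "n > 0" and S: "a \<in> short_words n K" "b \<in> short_words n K" "c \<in> short_words n K" "d \<in> short_words n K"
    and x: "x \<in> set a" "x \<in> set b" and y: "y \<in> set a \<union> set b" "y \<in> set c \<union> set d"
  shows "\<bar>expectation (mon n (cyc a @ cyc b @ cyc c @ cyc d))\<bar>
    \<le> delta n * (1 / real n) ^ card (set a \<union> set b \<union> set c \<union> set d)"
proof -
  have "\<bar>expectation (mon n (cyc a @ cyc b @ cyc c @ cyc d))\<bar>
      \<le> delta n * (1 / real n) ^ card (fst ` set (cyc a @ cyc b @ cyc c @ cyc d))"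
    using short_word_cyc[OF S(1)] short_word_cyc[OF S(2)] short_word_cyc[OF S(3)] short_word_cyc[OF S(4)] x y
    by (intro abs_expectation_mon_heavy_le n connected_heavy[OF _ refl]) auto
  then show ?thesis by (simp add: image_Un Un_assoc)
qed

text \<open>The vertex shared by two words makes the union of the two pairs smaller than the sum of their
  sizes, which gains a factor \<open>1 / n\<close> in the product of the means.\<close>

lemma abs_covariance_cyc_le:
  assumes n: "n > 0" and S: "a \<in> short_words n K" "b \<in> short_words n K" "c \<in> short_words n K" "d \<in> short_words n K"
    and x: "set a \<inter> set b \<noteq> {}"
  shows "\<bar>expectation (mon n (cyc a @ cyc b @ cyc c @ cyc d))
      - expectation (mon n (cyc a @ cyc b)) * expectation (mon n (cyc c @ cyc d))\<bar>
    \<le> (delta n + 1 / real n) * (1 / real n) ^ card (set a \<union> set b \<union> set c \<union> set d)"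
proof (cases "(set a \<union> set b) \<inter> (set c \<union> set d) = {}")
  case True
  have "expectation (mon n ((cyc a @ cyc b) @ (cyc c @ cyc d))) =
      expectation (mon n (cyc a @ cyc b)) * expectation (mon n (cyc c @ cyc d))"
    using short_word_cyc[OF S(1)] short_word_cyc[OF S(2)] short_word_cyc[OF S(3)] short_word_cyc[OF S(4)] True
    by (intro expectation_mon_append_disjoint) (auto simp: image_Un)
  then show ?thesis using rho_nonneg(4)[of n] by simp
next
  case False
  then obtain y where y: "y \<in> set a \<union> set b" "y \<in> set c \<union> set d" by blast
  obtain x where x: "x \<in> set a" "x \<in> set b" using x by blast
  let ?A = "set a \<union> set b" and ?B = "set c \<union> set d"
  have 1: "\<bar>expectation (mon n (cyc a @ cyc b @ cyc c @ cyc d))\<bar>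
    \<le> delta n * (1 / real n) ^ card (set a \<union> set b \<union> set c \<union> set d)"
    by (rule expectation_cyc4_le[OF n S x y])
  have A: "\<bar>expectation (mon n (cyc a @ cyc b))\<bar> \<le> (1 / real n) ^ card ?A"
    using abs_expectation_mon_le[of "cyc a @ cyc b" n] short_word_cyc[OF S(1)] short_word_cyc[OF S(2)]
    by (simp add: image_Un)
  have B: "\<bar>expectation (mon n (cyc c @ cyc d))\<bar> \<le> (1 / real n) ^ card ?B"
    using abs_expectation_mon_le[of "cyc c @ cyc d" n] short_word_cyc[OF S(3)] short_word_cyc[OF S(4)]
    by (simp add: image_Un)
  have "card (?A \<inter> ?B) > 0" using y by (auto simp: card_gt_0_iff)
  then have cd: "Suc (card (?A \<union> ?B)) \<le> card ?A + card ?B" using card_Un_Int[of ?A ?B] by simp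
  have "\<bar>expectation (mon n (cyc a @ cyc b)) * expectation (mon n (cyc c @ cyc d))\<bar>
      \<le> (1 / real n) ^ card ?A * (1 / real n) ^ card ?B"
    unfolding abs_mult using A B by (intro mult_mono) auto
  also have "\<dots> = (1 / real n) ^ (card ?A + card ?B)" by (simp add: power_add)
  also have "\<dots> \<le> (1 / real n) ^ Suc (card (?A \<union> ?B))" using n by (intro power_decreasing[OF cd]) auto
  finally have 2: "\<bar>expectation (mon n (cyc a @ cyc b)) * expectation (mon n (cyc c @ cyc d))\<bar>
      \<le> 1 / real n * (1 / real n) ^ card (set a \<union> set b \<union> set c \<union> set d)" by (simp add: Un_assoc)
  show ?thesis using 1 2 unfolding distrib_right by linarith
qed

text \<open>Two index pairs without a common vertex are uncorrelated, touching ones are covered by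
  \<open>abs_covariance_cyc_le\<close>, and the weights of all quadruples sum to a constant. The
  bound serves the quadratic sum of Stein's method as well as the doubled cycles.\<close>

lemma variance_pairs_le:
  assumes n: "n > 0" and P: "P \<subseteq> {(a, b). a \<in> short_words n K \<and> b \<in> short_words n K \<and> set a \<inter> set b \<noteq> {}}"
    and w: "\<And>p. \<bar>w p\<bar> \<le> B"
  defines "W \<equiv> \<lambda>\<omega>. \<Sum>p\<in>P. w p * mon n (cyc (fst p) @ cyc (snd p)) \<omega>"
  shows "expectation (\<lambda>\<omega>. (W \<omega> - expectation W)\<^sup>2) \<le> B\<^sup>2 * ((delta n + 1 / real n) * quad_const K ^ 4)"
proof -
  let ?S = "short_words n K"
  let ?T = "\<lambda>p. mon n (cyc (fst p) @ cyc (snd p))"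
  let ?wt = "\<lambda>p q. (1 / real n) ^ card (set (fst p) \<union> set (snd p) \<union> set (fst q) \<union> set (snd q))"
  have PS: "P \<subseteq> ?S \<times> ?S" using P by auto
  have pP: "fst p \<in> ?S \<and> snd p \<in> ?S \<and> set (fst p) \<inter> set (snd p) \<noteq> {}" if "p \<in> P" for p
    using P that by (cases p) auto
  from PS have finP: "finite P" by (rule finite_subset) simp
  have T: "bounded_rv (?T p)" if "p \<in> P" for p
    using that PS short_word_cyc by (intro bounded_rv_mon) force
  have EW: "expectation W = (\<Sum>p\<in>P. w p * expectation (?T p))"
    unfolding W_def by (subst Bochner_Integration.integral_sum) (auto intro!: bounded_rv_integrable bounded_rv_intros T)
  let ?cov = "\<lambda>p q. expectation (mon n (cyc (fst p) @ cyc (snd p) @ cyc (fst q) @ cyc (snd q))) - expectation (?T p) * expectation (?T q)"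
  have cov: "expectation (\<lambda>\<omega>. (?T p \<omega> - expectation (?T p)) * (?T q \<omega> - expectation (?T q))) = ?cov p q"
    if "p \<in> P" "q \<in> P" for p q
  proof -
    have i: "integrable M (\<lambda>\<omega>. ?T p \<omega> * ?T q \<omega>)" "integrable M (?T p)" "integrable M (?T q)"
      using that by (auto intro!: bounded_rv_integrable bounded_rv_intros T)
    have "expectation (\<lambda>\<omega>. (?T p \<omega> - expectation (?T p)) * (?T q \<omega> - expectation (?T q)))
        = expectation (\<lambda>\<omega>. ?T p \<omega> * ?T q \<omega> - expectation (?T q) * ?T p \<omega> - expectation (?T p) * ?T q \<omega> + expectation (?T p) * expectation (?T q))"
      by (simp add: algebra_simps)
    also have "\<dots> = expectation (\<lambda>\<omega>. ?T p \<omega> * ?T q \<omega>) - expectation (?T p) * expectation (?T q)"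
      using i by (simp add: prob_space)
    also have "(\<lambda>\<omega>. ?T p \<omega> * ?T q \<omega>) = mon n (cyc (fst p) @ cyc (snd p) @ cyc (fst q) @ cyc (snd q))"
      by (simp add: mon_append fun_eq_iff mult.assoc)
    finally show ?thesis .
  qed
  have "W \<omega> - expectation W = (\<Sum>p\<in>P. w p * (?T p \<omega> - expectation (?T p)))" for \<omega>
    unfolding EW by (simp add: W_def sum_subtractf algebra_simps)
  then have "expectation (\<lambda>\<omega>. (W \<omega> - expectation W)\<^sup>2)
      = expectation (\<lambda>\<omega>. \<Sum>p\<in>P. \<Sum>q\<in>P. w p * w q * ((?T p \<omega> - expectation (?T p)) * (?T q \<omega> - expectation (?T q))))"
    by (simp add: power2_eq_square sum_product mult_ac)
  also have "\<dots> = (\<Sum>p\<in>P. \<Sum>q\<in>P. w p * w q * expectation (\<lambda>\<omega>. (?T p \<omega> - expectation (?T p)) * (?T q \<omega> - expectation (?T q))))"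
  proof -
    have i: "integrable M (\<lambda>\<omega>. w p * w q * ((?T p \<omega> - expectation (?T p)) * (?T q \<omega> - expectation (?T q))))"
      if "p \<in> P" "q \<in> P" for p q
      using that by (intro bounded_rv_integrable bounded_rv_intros T)
    have "expectation (\<lambda>\<omega>. \<Sum>p\<in>P. \<Sum>q\<in>P. w p * w q * ((?T p \<omega> - expectation (?T p)) * (?T q \<omega> - expectation (?T q))))
      = (\<Sum>p\<in>P. expectation (\<lambda>\<omega>. \<Sum>q\<in>P. w p * w q * ((?T p \<omega> - expectation (?T p)) * (?T q \<omega> - expectation (?T q)))))"
      by (intro Bochner_Integration.integral_sum Bochner_Integration.integrable_sum i)
    also have "\<dots> = (\<Sum>p\<in>P. \<Sum>q\<in>P. expectation (\<lambda>\<omega>. w p * w q * ((?T p \<omega> - expectation (?T p)) * (?T q \<omega> - expectation (?T q)))))"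
      by (intro sum.cong[OF refl] Bochner_Integration.integral_sum i)
    finally show ?thesis by (simp only: integral_mult_right_zero)
  qed
  also have "\<dots> = (\<Sum>p\<in>P. \<Sum>q\<in>P. w p * w q * ?cov p q)"
    by (intro sum.cong refl arg_cong2[where f = "(*)"] cov)
  also have "\<dots> \<le> (\<Sum>p\<in>P. \<Sum>q\<in>P. B\<^sup>2 * ((delta n + 1 / real n) * ?wt p q))"
  proof (intro sum_mono)
    fix p q assume pq: "p \<in> P" "q \<in> P"
    have "\<bar>w p * w q\<bar> \<le> B\<^sup>2" unfolding abs_mult power2_eq_square using w by (intro mult_mono) (auto intro: order_trans[OF abs_ge_zero])
    moreover have "\<bar>?cov p q\<bar> \<le> (delta n + 1 / real n) * ?wt p q"
      using pP[OF pq(1)] pP[OF pq(2)] by (intro abs_covariance_cyc_le[OF n, where K = K]) auto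
    ultimately have "\<bar>w p * w q * ?cov p q\<bar> \<le> B\<^sup>2 * ((delta n + 1 / real n) * ?wt p q)"
      unfolding abs_mult[of "w p * w q"] by (intro mult_mono) auto
    then show "w p * w q * ?cov p q \<le> B\<^sup>2 * ((delta n + 1 / real n) * ?wt p q)" by linarith
  qed
  also have "\<dots> = B\<^sup>2 * ((delta n + 1 / real n) * (\<Sum>p\<in>P. \<Sum>q\<in>P. ?wt p q))"
    by (simp add: sum_distrib_left)
  also have "\<dots> \<le> B\<^sup>2 * ((delta n + 1 / real n) * quad_const K ^ 4)"
  proof (intro mult_left_mono)
    have "(\<Sum>p\<in>P. \<Sum>q\<in>P. ?wt p q) \<le> (\<Sum>p\<in>?S \<times> ?S. \<Sum>q\<in>P. ?wt p q)"
      by (rule sum_mono2) (use PS in \<open>auto intro!: sum_nonneg\<close>)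
    also have "\<dots> \<le> (\<Sum>p\<in>?S \<times> ?S. \<Sum>q\<in>?S \<times> ?S. ?wt p q)"
      by (intro sum_mono sum_mono2) (use PS in auto)
    also have "\<dots> = (\<Sum>a\<in>?S. \<Sum>b\<in>?S. \<Sum>c\<in>?S. \<Sum>d\<in>?S. (1 / real n) ^ card (set a \<union> set b \<union> set c \<union> set d))"
      by (simp add: sum.cartesian_product')
    also have "\<dots> \<le> quad_const K ^ 4" by (rule sum_quadruples_weight)
    finally show "(\<Sum>p\<in>P. \<Sum>q\<in>P. ?wt p q) \<le> quad_const K ^ 4" .
  qed (use rho_nonneg(4)[of n] in auto)
  finally show ?thesis .
qed

section \<open>Simple cycles and Stein's identity\<close>

definition simple :: "nat \<Rightarrow> nat \<Rightarrow> nat list set" where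
  "simple n K = {xs \<in> short_words n K. distinct xs \<and> xs \<noteq> []}"

lemma finite_simple [simp]: "finite (simple n K)"
  unfolding simple_def by simp

lemma simple_short: "xs \<in> simple n K \<Longrightarrow> xs \<in> short_words n K"
  by (simp add: simple_def)

lemma bounded_rv_simple: "xs \<in> simple n K \<Longrightarrow> bounded_rv (mon n (cyc xs))"
  by (intro bounded_rv_mon short_word_cyc simple_short)

text \<open>Each of the two words leaves \<open>i\<close> exactly once, and by parity the two
  targets agree.\<close>

lemma targets_double_if_rotation:
  assumes "distinct c" "i \<in> set c"
  shows "\<exists>j. targets i (cyc c @ cyc (rotate r c)) = [j, j]"
proof -
  have 1: "length (targets i (cyc c)) = 1" "length (targets i (cyc (rotate r c))) = 1"
    using assms by (simp_all add: length_targets_cyc_distinct)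
  then obtain j j' where j: "targets i (cyc c) = [j]" "targets i (cyc (rotate r c)) = [j']"
    by (auto simp: length_Suc_conv)
  have e: "even_edges (cyc c @ cyc (rotate r c))" by (rule even_edges_rotate)
  have "(i, j) \<in> set (cyc c @ cyc (rotate r c))" "(i, j') \<in> set (cyc c @ cyc (rotate r c))"
    using j set_targets[of i "cyc c"] set_targets[of i "cyc (rotate r c)"] by auto
  then have "j = j'" using j by (intro unique_target[OF e]) auto
  then show ?thesis using j by simp
qed

lemma expectation_rotation:
  assumes "distinct c" "set c \<subseteq> {..<n}"
  shows "expectation (mon n (cyc c @ cyc (rotate r c))) = rho2 n ^ length c"
proof -
  have "expectation (mon n (cyc c @ cyc (rotate r c))) = rho2 n ^ card (fst ` set (cyc c @ cyc (rotate r c)))"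
  proof (rule expectation_mon_double)
    show "set (cyc c @ cyc (rotate r c)) \<subseteq> sq n"
      using set_cyc_subset_sq[of c n] set_cyc_subset_sq[of "rotate r c" n] assms by auto
  qed (use assms targets_double_if_rotation in \<open>auto simp: image_Un\<close>)
  then show ?thesis using assms by (simp add: image_Un distinct_card)
qed

text \<open>Among the words through the first letter of \<open>a\<close>, parity leaves only the
  rotations of \<open>a\<close>, and there are \<open>length a\<close> different ones. As words
  carry a starting point, this factor is the origin of the variance \<open>k\<close> in the limit
  law.\<close>

lemma sum_expectation_pairs:
  assumes n: "n > 0" and a: "a \<in> simple n K"
  shows "(\<Sum>b | b \<in> simple n K \<and> hd a \<in> set b. t (length b) * expectation (mon n (cyc a @ cyc b)))
    = t (length a) * (real (length a) * rho2 n ^ length a)"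
proof -
  have ad: "distinct a" "a \<noteq> []" "set a \<subseteq> {..<n}" "length a \<le> K" using a by (auto simp: simple_def short_words_def)
  let ?R = "(\<lambda>r. rotate r a) ` {..<length a}"
  have "(\<Sum>b | b \<in> simple n K \<and> hd a \<in> set b. t (length b) * expectation (mon n (cyc a @ cyc b)))
      = (\<Sum>b\<in>?R. t (length b) * expectation (mon n (cyc a @ cyc b)))"
  proof (rule sum.mono_neutral_right)
    show "?R \<subseteq> {b. b \<in> simple n K \<and> hd a \<in> set b}"
      using ad by (auto simp: simple_def short_words_def)
    show "\<forall>b\<in>{b. b \<in> simple n K \<and> hd a \<in> set b} - ?R. t (length b) * expectation (mon n (cyc a @ cyc b)) = 0"
    proof
      fix b assume b: "b \<in> {b. b \<in> simple n K \<and> hd a \<in> set b} - ?R"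
      then have bd: "distinct b" "hd a \<in> set b" "set b \<subseteq> {..<n}" by (auto simp: simple_def short_words_def)
      have "\<not> even_edges (cyc a @ cyc b)" using rotation_if_even[OF ad(1,2) bd(1,2)] b by blast
      then have "expectation (mon n (cyc a @ cyc b)) = 0"
        using set_cyc_subset_sq[OF ad(3)] set_cyc_subset_sq[OF bd(3)]
        by (intro expectation_mon_not_even n) auto
      then show "t (length b) * expectation (mon n (cyc a @ cyc b)) = 0" by simp
    qed
  qed simp
  also have "\<dots> = (\<Sum>r<length a. t (length a) * rho2 n ^ length a)"
    by (subst sum.reindex[OF inj_on_rotate[OF ad(1)]]) (simp add: expectation_rotation ad)
  finally show ?thesis by simp
qed

text \<open>The weight depends on the length only, so for all simple words this is a linear
  combination of the simple-cycle parts of the traces, as required for a joint limit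
  theorem.\<close>

definition cyc_sum :: "nat \<Rightarrow> nat list set \<Rightarrow> (nat \<Rightarrow> real) \<Rightarrow> 'a \<Rightarrow> real" where
  "cyc_sum n A t \<omega> = (\<Sum>c\<in>A. t (length c) * mon n (cyc c) \<omega>)"

lemma bounded_rv_cyc_sum: "A \<subseteq> simple n K \<Longrightarrow> bounded_rv (cyc_sum n A t)"
  unfolding cyc_sum_def by (intro bounded_rv_intros bounded_rv_simple[of _ n K]) auto

text \<open>Changing the signs in row \<open>m\<close> reverses the sign of the first factor and fixes the second one.\<close>

lemma expectation_row_times_cis:
  assumes m: "m < n"
  shows "expectation (\<lambda>\<omega>. complex_of_real (cyc_sum n {c \<in> simple n K. hd c = m} t \<omega>)
      * cis (s * cyc_sum n {c \<in> simple n K. m \<notin> set c} t \<omega>)) = 0"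
proof -
  let ?A = "{c \<in> simple n K. hd c = m}" and ?B = "{c \<in> simple n K. m \<notin> set c}"
  let ?P = "PiM (sq n) (\<lambda>_. borel) :: (nat \<times> nat \<Rightarrow> real) measure"
  have n: "n > 0" using m by simp
  define cs where "cs A x = (\<Sum>c\<in>A. t (length c) * prod_list (map x (cyc c)))" for A and x :: "nat \<times> nat \<Rightarrow> real"
  define sg where "sg p = (if fst p = m then -1 else 1 :: real)" for p :: "nat \<times> nat"
  define F where "F x = complex_of_real (cs ?A x) * cis (s * cs ?B x)" for x
  have sub: "set (cyc c) \<subseteq> sq n" if "c \<in> simple n K" for c
    using that by (intro short_word_cyc simple_short)
  have pm: "(\<lambda>x. prod_list (map x es)) \<in> borel_measurable ?P" if "set es \<subseteq> sq n" for es
    using that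
  proof (induction es)
    case (Cons a es)
    then have "(\<lambda>x. x a) \<in> borel_measurable ?P"
      by (intro measurable_component_singleton) auto
    with Cons show ?case by simp
  qed simp
  have csm: "cs A \<in> borel_measurable ?P" if "A \<subseteq> simple n K" for A
    unfolding cs_def using that sub by (intro borel_measurable_sum borel_measurable_times pm borel_measurable_const) auto
  have Fm: "F \<in> borel_measurable ?P"
  proof -
    have [measurable]: "cs ?A \<in> borel_measurable ?P" "cs ?B \<in> borel_measurable ?P" by (auto intro!: csm)
    show ?thesis unfolding F_def cis_conv_exp by measurable
  qed
  have csr: "cs A (\<lambda>p\<in>sq n. y p) = cs A y" if "A \<subseteq> simple n K" for A y
    unfolding cs_def using that sub
    by (intro sum.cong refl arg_cong2[where f = "(*)"] arg_cong[where f = prod_list] map_cong) (auto simp: subset_iff)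
  have pl: "prod_list (map (\<lambda>p. sg p * y p) (cyc c)) = (- 1) ^ count_list c m * prod_list (map y (cyc c))" for y c
  proof -
    have "prod_list (map (\<lambda>p. sg p * y p) es) = (- 1) ^ count_list (map fst es) m * prod_list (map y es)" for es
      by (induction es) (auto simp: sg_def)
    from this[of "cyc c"] show ?thesis by simp
  qed
  \<comment> \<open>A word without repetition leaves its first letter once, so every monomial here
    contains exactly one entry of row \<open>m\<close>.\<close>
  have csA: "cs ?A (\<lambda>p. sg p * y p) = - cs ?A y" for y
  proof -
    have "count_list c m = 1" if "c \<in> ?A" for c
      using that length_targets_cyc_distinct[of c m] by (auto simp: simple_def length_targets)
    then show ?thesis unfolding cs_def pl sum_negf[symmetric] by (intro sum.cong) auto
  qed
  have csB: "cs ?B (\<lambda>p. sg p * y p) = cs ?B y" for y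
    unfolding cs_def pl by (intro sum.cong) auto
  have Fneg: "F (\<lambda>p\<in>sq n. sg p * y p) = - F (\<lambda>p\<in>sq n. y p)" for y
    unfolding F_def by (simp add: csr csA csB)
  have "expectation (\<lambda>\<omega>. F (\<lambda>p\<in>sq n. sg p * Y n p \<omega>)) = expectation (\<lambda>\<omega>. F (\<lambda>p\<in>sq n. Y n p \<omega>))"
    by (rule expectation_sign_change[OF n _ Fm]) (auto simp: sg_def)
  then have "expectation (\<lambda>\<omega>. F (\<lambda>p\<in>sq n. Y n p \<omega>)) = 0"
    unfolding Fneg by simp
  moreover have "F (\<lambda>p\<in>sq n. Y n p \<omega>) = complex_of_real (cyc_sum n ?A t \<omega>) * cis (s * cyc_sum n ?B t \<omega>)" for \<omega>
    unfolding F_def by (simp add: csr) (simp add: cs_def cyc_sum_def mon_def)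
  ultimately show ?thesis by simp
qed

text \<open>\<open>D' m\<close> sorts the words by first letter and so splits \<open>S\<close>
  without repetition, while \<open>D m\<close> contains every word that uses row \<open>m\<close>.
  With \<open>D m\<close> removed from the exponent the product with \<open>D' m\<close> has mean 0.
  Restoring it by a Taylor expansion gives the quadratic term and a remainder of third
  order.\<close>

lemma stein_identity:
  fixes s :: real and t :: "nat \<Rightarrow> real" and K :: nat
  assumes n: "n > 0"
  defines "S \<equiv> cyc_sum n (simple n K) t"
    and "D \<equiv> \<lambda>m. cyc_sum n {c \<in> simple n K. m \<in> set c} t"
    and "D' \<equiv> \<lambda>m. cyc_sum n {c \<in> simple n K. hd c = m} t"
  shows "norm (expectation (\<lambda>\<omega>. \<i> * of_real (S \<omega>) * cis (s * S \<omega>))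
      + of_real s * expectation (\<lambda>\<omega>. of_real (\<Sum>m<n. D' m \<omega> * D m \<omega>) * cis (s * S \<omega>)))
    \<le> s\<^sup>2 / 2 * (\<Sum>m<n. expectation (\<lambda>\<omega>. \<bar>D' m \<omega>\<bar> * (D m \<omega>)\<^sup>2))"
proof -
  have hdset: "hd c \<in> set c" "hd c < n" if "c \<in> simple n K" for c
  proof -
    show "hd c \<in> set c" using that by (auto simp: simple_def)
    then show "hd c < n" using that by (cases c) (auto simp: simple_def short_words_def)
  qed
  have b: "bounded_rv S" "bounded_rv (D m)" "bounded_rv (D' m)" for m
    unfolding S_def D_def D'_def by (auto intro!: bounded_rv_cyc_sum[of _ n K])
  note meas = b[THEN bounded_rv_measurable]
  have Ssum: "S \<omega> = (\<Sum>m<n. D' m \<omega>)" for \<omega>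
  proof -
    have "S \<omega> = (\<Sum>m<n. \<Sum>c | c \<in> simple n K \<and> hd c = m. t (length c) * mon n (cyc c) \<omega>)"
      unfolding S_def cyc_sum_def by (rule sum.group[symmetric]) (use hdset in auto)
    then show ?thesis by (simp add: D'_def cyc_sum_def)
  qed
  have SD: "cyc_sum n {c \<in> simple n K. m \<notin> set c} t \<omega> = S \<omega> - D m \<omega>" for m \<omega>
  proof -
    have "S \<omega> = (\<Sum>c\<in>{c \<in> simple n K. m \<in> set c} \<union> {c \<in> simple n K. m \<notin> set c}. t (length c) * mon n (cyc c) \<omega>)"
      unfolding S_def cyc_sum_def by (intro sum.cong) auto
    also have "\<dots> = D m \<omega> + cyc_sum n {c \<in> simple n K. m \<notin> set c} t \<omega>"
      unfolding D_def cyc_sum_def by (rule sum.union_disjoint) auto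
    finally show ?thesis by simp
  qed
  have bs: "bounded_rv (\<lambda>\<omega>. cis (s * S \<omega>))" "bounded_rv (\<lambda>\<omega>. cis (s * (S \<omega> - D m \<omega>)))" for m
    using meas by (auto intro!: bounded_rv_cis)
  \<comment> \<open>The Taylor remainder for the increment \<open>s * D m \<omega>\<close>, weighted
    by \<open>D' m \<omega>\<close>. Since the shifted exponential has mean 0 against
    \<open>D' m\<close>, its expectation consists of the terms of the identity up to the factor
    \<open>\<i>\<close>.\<close>
  let ?e = "\<lambda>m \<omega>. complex_of_real (D' m \<omega>) * (cis (s * S \<omega>) - cis (s * (S \<omega> - D m \<omega>)) - \<i> * of_real (s * D m \<omega>) * cis (s * S \<omega>))"
  have be: "bounded_rv (?e m)" for m by (intro bounded_rv_intros b bs)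
  have e_bound: "norm (?e m \<omega>) \<le> s\<^sup>2 / 2 * (\<bar>D' m \<omega>\<bar> * (D m \<omega>)\<^sup>2)" for m \<omega>
  proof -
    let ?x = "s * S \<omega>" and ?y = "s * D m \<omega>"
    have "cis (s * (S \<omega> - D m \<omega>)) = cis ?x * cis (- ?y)"
      by (simp add: cis_mult right_diff_distrib)
    then have "cis ?x - cis (s * (S \<omega> - D m \<omega>)) - \<i> * of_real ?y * cis ?x = cis ?x * (1 - cis (- ?y) - \<i> * of_real ?y)"
      by (simp add: algebra_simps)
    then have "norm (?e m \<omega>) = \<bar>D' m \<omega>\<bar> * norm (1 - cis (- ?y) - \<i> * of_real ?y)"
      by (simp only: norm_mult norm_cis norm_of_real mult_1)
    also have "\<dots> \<le> \<bar>D' m \<omega>\<bar> * (?y\<^sup>2 / 2)" by (intro mult_left_mono cis_taylor) auto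
    finally show ?thesis by (simp add: power_mult_distrib mult_ac)
  qed
  have e1: "expectation (\<lambda>\<omega>. \<i> * of_real (S \<omega>) * cis (s * S \<omega>))
      = (\<Sum>m<n. \<i> * expectation (\<lambda>\<omega>. of_real (D' m \<omega>) * cis (s * S \<omega>)))"
  proof -
    have "expectation (\<lambda>\<omega>. \<i> * of_real (S \<omega>) * cis (s * S \<omega>)) = expectation (\<lambda>\<omega>. \<Sum>m<n. \<i> * (of_real (D' m \<omega>) * cis (s * S \<omega>)))"
      by (simp add: Ssum sum_distrib_left sum_distrib_right mult.assoc)
    also have "\<dots> = (\<Sum>m<n. expectation (\<lambda>\<omega>. \<i> * (of_real (D' m \<omega>) * cis (s * S \<omega>))))"
      by (intro Bochner_Integration.integral_sum bounded_rv_integrable bounded_rv_intros b bs)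
    finally show ?thesis by simp
  qed
  have e2: "expectation (\<lambda>\<omega>. of_real (\<Sum>m<n. D' m \<omega> * D m \<omega>) * cis (s * S \<omega>))
      = (\<Sum>m<n. expectation (\<lambda>\<omega>. of_real (D' m \<omega> * D m \<omega>) * cis (s * S \<omega>)))"
  proof -
    have "expectation (\<lambda>\<omega>. of_real (\<Sum>m<n. D' m \<omega> * D m \<omega>) * cis (s * S \<omega>))
      = expectation (\<lambda>\<omega>. \<Sum>m<n. of_real (D' m \<omega> * D m \<omega>) * cis (s * S \<omega>))"
      by (simp add: sum_distrib_right)
    also have "\<dots> = (\<Sum>m<n. expectation (\<lambda>\<omega>. of_real (D' m \<omega> * D m \<omega>) * cis (s * S \<omega>)))"
      by (intro Bochner_Integration.integral_sum bounded_rv_integrable bounded_rv_intros b bs)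
    finally show ?thesis .
  qed
  have em: "expectation (?e m) = expectation (\<lambda>\<omega>. of_real (D' m \<omega>) * cis (s * S \<omega>))
      - \<i> * of_real s * expectation (\<lambda>\<omega>. of_real (D' m \<omega> * D m \<omega>) * cis (s * S \<omega>))" if "m < n" for m
  proof -
    have z: "expectation (\<lambda>\<omega>. of_real (D' m \<omega>) * cis (s * (S \<omega> - D m \<omega>))) = 0"
      using expectation_row_times_cis[OF that, of K t s] by (simp only: SD D'_def)
    have i: "integrable M (\<lambda>\<omega>. of_real (D' m \<omega>) * cis (s * S \<omega>))"
       "integrable M (\<lambda>\<omega>. of_real (D' m \<omega>) * cis (s * (S \<omega> - D m \<omega>)))"
       "integrable M (\<lambda>\<omega>. of_real (D' m \<omega> * D m \<omega>) * cis (s * S \<omega>))"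
      by (intro bounded_rv_integrable bounded_rv_intros b bs)+
    have "?e m = (\<lambda>\<omega>. of_real (D' m \<omega>) * cis (s * S \<omega>) - of_real (D' m \<omega>) * cis (s * (S \<omega> - D m \<omega>))
        - \<i> * of_real s * (of_real (D' m \<omega> * D m \<omega>) * cis (s * S \<omega>)))"
      by (auto simp: fun_eq_iff algebra_simps)
    then show ?thesis
      using i z by (simp only: Bochner_Integration.integral_diff Bochner_Integration.integrable_diff
          integral_mult_right_zero integrable_mult_right diff_0_right)
  qed
  have norm_ii: "norm (\<i> * z) = norm z" for z :: complex by (simp add: norm_mult)
  have alg: "\<i> * a + r * b = \<i> * (a - \<i> * r * b)" for a b r :: complex
    by (simp add: algebra_simps)
  have eq: "expectation (\<lambda>\<omega>. \<i> * of_real (S \<omega>) * cis (s * S \<omega>))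
      + of_real s * expectation (\<lambda>\<omega>. of_real (\<Sum>m<n. D' m \<omega> * D m \<omega>) * cis (s * S \<omega>))
      = (\<Sum>m<n. \<i> * expectation (?e m))"
    unfolding e1 e2 sum_distrib_left sum.distrib[symmetric]
  proof (intro sum.cong refl)
    fix m assume "m \<in> {..<n}"
    then have m: "m < n" by simp
    show "\<i> * expectation (\<lambda>\<omega>. of_real (D' m \<omega>) * cis (s * S \<omega>))
        + of_real s * expectation (\<lambda>\<omega>. of_real (D' m \<omega> * D m \<omega>) * cis (s * S \<omega>)) = \<i> * expectation (?e m)"
      unfolding em[OF m] by (rule alg)
  qed
  have "norm (\<Sum>m<n. \<i> * expectation (?e m)) \<le> (\<Sum>m<n. norm (\<i> * expectation (?e m)))" by (rule norm_sum)
  also have "\<dots> \<le> (\<Sum>m<n. s\<^sup>2 / 2 * expectation (\<lambda>\<omega>. \<bar>D' m \<omega>\<bar> * (D m \<omega>)\<^sup>2))"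
  proof (rule sum_mono)
    fix m
    have "norm (\<i> * expectation (?e m)) = norm (expectation (?e m))" by (rule norm_ii)
    also have "\<dots> \<le> expectation (\<lambda>\<omega>. norm (?e m \<omega>))" by (rule integral_norm_bound)
    also have "\<dots> \<le> expectation (\<lambda>\<omega>. s\<^sup>2 / 2 * (\<bar>D' m \<omega>\<bar> * (D m \<omega>)\<^sup>2))"
      by (rule integral_mono[OF _ _ e_bound]) (intro bounded_rv_integrable bounded_rv_intros b integrable_norm be)+
    finally show "norm (\<i> * expectation (?e m)) \<le> s\<^sup>2 / 2 * expectation (\<lambda>\<omega>. \<bar>D' m \<omega>\<bar> * (D m \<omega>)\<^sup>2)"
      by (simp only: integral_mult_right_zero)
  qed
  finally show ?thesis unfolding eq sum_distrib_left .
qed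

text \<open>Words are grouped by their first letter, so each \<open>a\<close> belongs to one
  \<open>m\<close> only and the total is dominated by the sum over all pairs. The bound is uniform
  in \<open>n\<close> but does not vanish.\<close>

lemma sum_second_moment_le:
  assumes n: "n > 0" and t: "\<And>k. \<bar>t k\<bar> \<le> B"
  shows "(\<Sum>m<n. expectation (\<lambda>\<omega>. (cyc_sum n {c \<in> simple n K. hd c = m} t \<omega>)\<^sup>2)) \<le> B\<^sup>2 * quad_const K ^ 2"
proof -
  let ?S = "short_words n K" and ?A = "\<lambda>m. {c \<in> simple n K. hd c = m}"
  let ?M = "\<lambda>a b. mon n (cyc a @ cyc b)"
  let ?wt = "\<lambda>a b. (1 / real n) ^ card (set a \<union> set b)"
  have B0: "0 \<le> B" using t[of 0] by linarith
  have bm: "bounded_rv (?M a b)" if "a \<in> simple n K" "b \<in> simple n K" for a b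
    using short_word_cyc[OF simple_short[OF that(1)]] short_word_cyc[OF simple_short[OF that(2)]]
    by (intro bounded_rv_mon) auto
  have "(\<Sum>m<n. expectation (\<lambda>\<omega>. (cyc_sum n (?A m) t \<omega>)\<^sup>2)) \<le> (\<Sum>m<n. \<Sum>a\<in>?A m. \<Sum>b\<in>?S. B\<^sup>2 * ?wt a b)"
  proof (rule sum_mono)
    fix m
    have "expectation (\<lambda>\<omega>. (cyc_sum n (?A m) t \<omega>)\<^sup>2)
        = expectation (\<lambda>\<omega>. \<Sum>a\<in>?A m. \<Sum>b\<in>?A m. t (length a) * t (length b) * ?M a b \<omega>)"
      by (simp add: cyc_sum_def power2_eq_square sum_product mon_append mult_ac)
    also have "\<dots> = (\<Sum>a\<in>?A m. expectation (\<lambda>\<omega>. \<Sum>b\<in>?A m. t (length a) * t (length b) * ?M a b \<omega>))"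
      by (intro Bochner_Integration.integral_sum bounded_rv_integrable bounded_rv_intros bm) auto
    also have "\<dots> = (\<Sum>a\<in>?A m. \<Sum>b\<in>?A m. expectation (\<lambda>\<omega>. t (length a) * t (length b) * ?M a b \<omega>))"
      by (intro sum.cong[OF refl] Bochner_Integration.integral_sum bounded_rv_integrable bounded_rv_intros bm) auto
    also have "\<dots> \<le> (\<Sum>a\<in>?A m. \<Sum>b\<in>?A m. B\<^sup>2 * ?wt a b)"
    proof (intro sum_mono)
      fix a b assume ab: "a \<in> ?A m" "b \<in> ?A m"
      have "\<bar>expectation (?M a b)\<bar> \<le> (1 / real n) ^ card (fst ` set (cyc a @ cyc b))"
        using ab short_word_cyc[OF simple_short, of a n K] short_word_cyc[OF simple_short, of b n K]
        by (intro abs_expectation_mon_le) auto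
      then have "\<bar>t (length a) * t (length b)\<bar> * \<bar>expectation (?M a b)\<bar> \<le> B\<^sup>2 * ?wt a b"
        unfolding abs_mult power2_eq_square using t B0 by (intro mult_mono) (auto simp: image_Un)
      then show "expectation (\<lambda>\<omega>. t (length a) * t (length b) * ?M a b \<omega>) \<le> B\<^sup>2 * ?wt a b"
        unfolding integral_mult_right_zero abs_mult[symmetric] by linarith
    qed
    also have "\<dots> \<le> (\<Sum>a\<in>?A m. \<Sum>b\<in>?S. B\<^sup>2 * ?wt a b)"
      by (intro sum_mono sum_mono2) (auto simp: simple_def)
    finally show "expectation (\<lambda>\<omega>. (cyc_sum n (?A m) t \<omega>)\<^sup>2) \<le> (\<Sum>a\<in>?A m. \<Sum>b\<in>?S. B\<^sup>2 * ?wt a b)" .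
  qed
  also have "\<dots> = (\<Sum>a\<in>simple n K. \<Sum>b\<in>?S. B\<^sup>2 * ?wt a b)"
  proof (rule sum.group)
    show "hd ` simple n K \<subseteq> {..<n}"
      by (auto simp: simple_def short_words_def neq_Nil_conv)
  qed auto
  also have "\<dots> \<le> (\<Sum>a\<in>?S. \<Sum>b\<in>?S. B\<^sup>2 * ?wt a b)"
    by (rule sum_mono2) (auto simp: simple_def intro!: sum_nonneg)
  also have "\<dots> = B\<^sup>2 * (\<Sum>a\<in>?S. \<Sum>b\<in>?S. ?wt a b)" by (simp only: sum_distrib_left)
  also have "\<dots> \<le> B\<^sup>2 * quad_const K ^ 2" by (intro mult_left_mono sum_pairs_weight) auto
  finally show ?thesis .
qed

text \<open>Four cycles through \<open>m\<close> share a vertex, which forces a heavy row and gives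
  the factor \<open>delta n\<close>. Summation over \<open>m\<close> repeats a quadruple at most
  \<open>K\<close> times, once for each vertex of \<open>a\<close>.\<close>

lemma sum_fourth_moment_le:
  assumes n: "n > 0" and t: "\<And>k. \<bar>t k\<bar> \<le> B"
  shows "(\<Sum>m<n. expectation (\<lambda>\<omega>. (cyc_sum n {c \<in> simple n K. m \<in> set c} t \<omega>) ^ 4))
    \<le> B ^ 4 * (delta n * (real K * quad_const K ^ 4))"
proof -
  let ?S = "short_words n K" and ?A = "\<lambda>m. {c \<in> simple n K. m \<in> set c}"
  let ?M = "\<lambda>a b c d. mon n (cyc a @ cyc b @ cyc c @ cyc d)"
  let ?wt = "\<lambda>a b c d. (1 / real n) ^ card (set a \<union> set b \<union> set c \<union> set d)"
  let ?t = "\<lambda>a b c d. t (length a) * t (length b) * t (length c) * t (length d)"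
  have B0: "0 \<le> B" using t[of 0] by linarith
  have bm: "bounded_rv (?M a b c d)" if "a \<in> ?A m" "b \<in> ?A m" "c \<in> ?A m" "d \<in> ?A m" for a b c d m
  proof (rule bounded_rv_mon)
    have s: "set (cyc a) \<subseteq> sq n" if "a \<in> ?A m" for a
      using that by (intro short_word_cyc[OF simple_short]) auto
    show "set (cyc a @ cyc b @ cyc c @ cyc d) \<subseteq> sq n"
      using s[OF that(1)] s[OF that(2)] s[OF that(3)] s[OF that(4)] by auto
  qed
  have "expectation (\<lambda>\<omega>. (cyc_sum n (?A m) t \<omega>) ^ 4) \<le>
     (\<Sum>a\<in>?A m. \<Sum>b\<in>?S. \<Sum>c\<in>?S. \<Sum>d\<in>?S. B ^ 4 * (delta n * ?wt a b c d))" for m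
  proof -
    have "expectation (\<lambda>\<omega>. (cyc_sum n (?A m) t \<omega>) ^ 4)
        = expectation (\<lambda>\<omega>. \<Sum>a\<in>?A m. \<Sum>b\<in>?A m. \<Sum>c\<in>?A m. \<Sum>d\<in>?A m. ?t a b c d * ?M a b c d \<omega>)"
    proof (intro Bochner_Integration.integral_cong refl)
      fix \<omega>
      let ?f = "\<lambda>c. t (length c) * mon n (cyc c) \<omega>"
      have "(cyc_sum n (?A m) t \<omega>) ^ 4 = (\<Sum>a\<in>?A m. ?f a) * ((\<Sum>b\<in>?A m. ?f b) * ((\<Sum>c\<in>?A m. ?f c) * (\<Sum>d\<in>?A m. ?f d)))"
        by (simp add: cyc_sum_def power4_eq_xxxx mult.assoc)
      also have "\<dots> = (\<Sum>a\<in>?A m. \<Sum>b\<in>?A m. \<Sum>c\<in>?A m. \<Sum>d\<in>?A m. ?f a * (?f b * (?f c * ?f d)))"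
        by (simp only: sum_product sum_distrib_left sum_distrib_right)
          (intro sum.cong refl, simp add: mult_ac)
      also have "\<dots> = (\<Sum>a\<in>?A m. \<Sum>b\<in>?A m. \<Sum>c\<in>?A m. \<Sum>d\<in>?A m. ?t a b c d * ?M a b c d \<omega>)"
        by (intro sum.cong refl) (simp add: mon_append mult_ac)
      finally show "(cyc_sum n (?A m) t \<omega>) ^ 4 = (\<Sum>a\<in>?A m. \<Sum>b\<in>?A m. \<Sum>c\<in>?A m. \<Sum>d\<in>?A m. ?t a b c d * ?M a b c d \<omega>)" .
    qed
    also have "\<dots> = (\<Sum>a\<in>?A m. expectation (\<lambda>\<omega>. \<Sum>b\<in>?A m. \<Sum>c\<in>?A m. \<Sum>d\<in>?A m. ?t a b c d * ?M a b c d \<omega>))"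
      by (intro Bochner_Integration.integral_sum bounded_rv_integrable bounded_rv_intros bm)
    also have "\<dots> = (\<Sum>a\<in>?A m. \<Sum>b\<in>?A m. expectation (\<lambda>\<omega>. \<Sum>c\<in>?A m. \<Sum>d\<in>?A m. ?t a b c d * ?M a b c d \<omega>))"
      by (intro sum.cong[OF refl] Bochner_Integration.integral_sum bounded_rv_integrable bounded_rv_intros bm)
    also have "\<dots> = (\<Sum>a\<in>?A m. \<Sum>b\<in>?A m. \<Sum>c\<in>?A m. expectation (\<lambda>\<omega>. \<Sum>d\<in>?A m. ?t a b c d * ?M a b c d \<omega>))"
      by (intro sum.cong[OF refl] Bochner_Integration.integral_sum bounded_rv_integrable bounded_rv_intros bm)
    also have "\<dots> = (\<Sum>a\<in>?A m. \<Sum>b\<in>?A m. \<Sum>c\<in>?A m. \<Sum>d\<in>?A m. expectation (\<lambda>\<omega>. ?t a b c d * ?M a b c d \<omega>))"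
      by (intro sum.cong[OF refl] Bochner_Integration.integral_sum bounded_rv_integrable bounded_rv_intros bm)
    also have "\<dots> \<le> (\<Sum>a\<in>?A m. \<Sum>b\<in>?A m. \<Sum>c\<in>?A m. \<Sum>d\<in>?A m. B ^ 4 * (delta n * ?wt a b c d))"
    proof (intro sum_mono)
      fix a b c d assume abcd: "a \<in> ?A m" "b \<in> ?A m" "c \<in> ?A m" "d \<in> ?A m"
      have "\<bar>expectation (?M a b c d)\<bar> \<le> delta n * ?wt a b c d"
        using abcd by (intro expectation_cyc4_le[OF n, where K = K and x = m and y = m]) (auto simp: simple_def)
      moreover have "\<bar>?t a b c d\<bar> \<le> B * B * B * B"
        unfolding abs_mult using t B0 by (intro mult_mono) auto
      ultimately have "\<bar>?t a b c d\<bar> * \<bar>expectation (?M a b c d)\<bar> \<le> B ^ 4 * (delta n * ?wt a b c d)"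
        unfolding power4_eq_xxxx using B0 by (intro mult_mono) auto
      then show "expectation (\<lambda>\<omega>. ?t a b c d * ?M a b c d \<omega>) \<le> B ^ 4 * (delta n * ?wt a b c d)"
        unfolding integral_mult_right_zero abs_mult[symmetric] by linarith
    qed
    also have "\<dots> \<le> (\<Sum>a\<in>?A m. \<Sum>b\<in>?S. \<Sum>c\<in>?S. \<Sum>d\<in>?S. B ^ 4 * (delta n * ?wt a b c d))"
    proof -
      have sub: "?A m \<subseteq> ?S" by (auto simp: simple_def)
      have nn: "0 \<le> B ^ 4 * (delta n * ?wt a b c d)" for a b c d
        using B0 rho_nonneg(4)[of n] by simp
      have mono: "sum f (?A m) \<le> sum g ?S" if "\<And>x. x \<in> ?A m \<Longrightarrow> f x \<le> g x" "\<And>x. 0 \<le> g x" for f g :: "nat list \<Rightarrow> real"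
        using sum_mono[of "?A m" f g] sum_mono2[of ?S "?A m" g] sub that by (meson finite_short_words order_trans)
      show ?thesis by (intro sum_mono mono order_refl sum_nonneg nn)
    qed
    finally show ?thesis .
  qed
  then have "(\<Sum>m<n. expectation (\<lambda>\<omega>. (cyc_sum n (?A m) t \<omega>) ^ 4)) \<le>
     (\<Sum>m<n. \<Sum>a\<in>?A m. \<Sum>b\<in>?S. \<Sum>c\<in>?S. \<Sum>d\<in>?S. B ^ 4 * (delta n * ?wt a b c d))"
    by (rule sum_mono)
  also have "\<dots> = (\<Sum>a\<in>simple n K. \<Sum>m\<in>set a. \<Sum>b\<in>?S. \<Sum>c\<in>?S. \<Sum>d\<in>?S. B ^ 4 * (delta n * ?wt a b c d))"
  proof (subst sum.swap_restrict)
    show "(\<Sum>a\<in>simple n K. \<Sum>m | m \<in> {..<n} \<and> m \<in> set a. \<Sum>b\<in>?S. \<Sum>c\<in>?S. \<Sum>d\<in>?S. B ^ 4 * (delta n * ?wt a b c d))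
      = (\<Sum>a\<in>simple n K. \<Sum>m\<in>set a. \<Sum>b\<in>?S. \<Sum>c\<in>?S. \<Sum>d\<in>?S. B ^ 4 * (delta n * ?wt a b c d))"
      by (intro sum.cong refl) (auto simp: simple_def short_words_def)
  qed auto
  also have "\<dots> \<le> (\<Sum>a\<in>simple n K. real K * (\<Sum>b\<in>?S. \<Sum>c\<in>?S. \<Sum>d\<in>?S. B ^ 4 * (delta n * ?wt a b c d)))"
  proof (rule sum_mono)
    fix a assume "a \<in> simple n K"
    then have "real (card (set a)) \<le> real K" using card_short_word[of a n K] by (simp add: simple_def)
    then show "(\<Sum>m\<in>set a. \<Sum>b\<in>?S. \<Sum>c\<in>?S. \<Sum>d\<in>?S. B ^ 4 * (delta n * ?wt a b c d))
        \<le> real K * (\<Sum>b\<in>?S. \<Sum>c\<in>?S. \<Sum>d\<in>?S. B ^ 4 * (delta n * ?wt a b c d))"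
      unfolding sum_constant using B0 rho_nonneg(4)[of n] by (intro mult_right_mono sum_nonneg) auto
  qed
  also have "\<dots> \<le> (\<Sum>a\<in>?S. real K * (\<Sum>b\<in>?S. \<Sum>c\<in>?S. \<Sum>d\<in>?S. B ^ 4 * (delta n * ?wt a b c d)))"
    using B0 rho_nonneg(4)[of n] by (intro sum_mono2 mult_nonneg_nonneg sum_nonneg) (auto simp: simple_def)
  also have "\<dots> = B ^ 4 * (delta n * (real K * (\<Sum>a\<in>?S. \<Sum>b\<in>?S. \<Sum>c\<in>?S. \<Sum>d\<in>?S. ?wt a b c d)))"
    by (simp add: sum_distrib_left mult_ac)
  also have "\<dots> \<le> B ^ 4 * (delta n * (real K * quad_const K ^ 4))"
    using B0 rho_nonneg(4)[of n] by (intro mult_left_mono sum_quadruples_weight) auto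
  finally show ?thesis .
qed

end

section \<open>Central limit theorem for traces of powers\<close>

text \<open>The integrating factor \<open>exp (v * s\<^sup>2 / 2)\<close> turns the approximate
  equation into a small derivative. On the unit interval it is at most its final value
  \<open>exp (v / 2)\<close>, which cancels on both sides.\<close>

lemma gaussian_ode_bound:
  fixes \<psi> :: "real \<Rightarrow> complex"
  assumes \<psi>: "\<And>s. (\<psi> has_vector_derivative \<psi>' s) (at s)" and 0: "\<psi> 0 = 1" and v: "v \<ge> 0"
    and bound: "\<And>s. 0 \<le> s \<Longrightarrow> s \<le> 1 \<Longrightarrow> norm (\<psi>' s + of_real (s * v) * \<psi> s) \<le> e"
  shows "norm (\<psi> 1 - of_real (exp (- v / 2))) \<le> e"
proof -
  define g where "g s = exp (v * s\<^sup>2 / 2) *\<^sub>R \<psi> s" for s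
  define g' where "g' s = exp (v * s\<^sup>2 / 2) *\<^sub>R (\<psi>' s + of_real (s * v) * \<psi> s)" for s
  have dg: "(g has_vector_derivative g' s) (at s)" for s
  proof -
    have "((\<lambda>s. exp (v * s\<^sup>2 / 2)) has_field_derivative exp (v * s\<^sup>2 / 2) * (s * v)) (at s)"
      by (auto intro!: derivative_eq_intros)
    from has_vector_derivative_scaleR[OF this \<psi>] show ?thesis
      unfolding g_def g'_def by (rule has_vector_derivative_eq_rhs) (simp add: scaleR_conv_of_real algebra_simps)
  qed
  have "norm (g 1 - g 0) \<le> exp (v / 2) * e * 1 - exp (v / 2) * e * 0"
  proof (rule differentiable_bound_general[where f' = g' and \<phi> = "\<lambda>s. exp (v / 2) * e * s" and \<phi>' = "\<lambda>_. exp (v / 2) * e"])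
    show "continuous_on {0..1} g"
      by (intro continuous_at_imp_continuous_on ballI has_vector_derivative_continuous[OF dg])
    show "continuous_on {0..1} (\<lambda>s. exp (v / 2) * e * s)" by (intro continuous_intros)
    show "((\<lambda>s. exp (v / 2) * e * s) has_vector_derivative exp (v / 2) * e) (at x)" for x
      unfolding has_real_derivative_iff_has_vector_derivative[symmetric] by (auto intro!: derivative_eq_intros)
    fix x :: real assume x: "0 < x" "x < 1"
    have "x\<^sup>2 \<le> 1" using x by (simp add: power_le_one)
    then have "v * x\<^sup>2 \<le> v" using v by (simp add: mult_left_le)
    then have "exp (v * x\<^sup>2 / 2) * norm (\<psi>' x + of_real (x * v) * \<psi> x) \<le> exp (v / 2) * e"
      using bound[of x] x by (intro mult_mono) auto
    then show "norm (g' x) \<le> exp (v / 2) * e" by (simp add: g'_def)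
  qed (auto intro: dg)
  moreover have "g 1 - g 0 = exp (v / 2) *\<^sub>R (\<psi> 1 - of_real (exp (- v / 2)))"
  proof -
    have "complex_of_real (exp (v / 2)) * complex_of_real (exp (- v / 2)) = 1"
      unfolding of_real_mult[symmetric] exp_add[symmetric] by simp
    then show ?thesis by (simp add: g_def 0 scaleR_conv_of_real right_diff_distrib)
  qed
  ultimately show ?thesis by simp
qed

text \<open>A bounded \<open>S\<close> makes the second-order Taylor remainder uniform in the sample
  point, so the derivative is read off from a quadratic estimate for the mean.\<close>

lemma (in prob_space) has_vector_derivative_expectation_cis:
  assumes S: "bounded_rv S"
  shows "((\<lambda>s. expectation (\<lambda>\<omega>. cis (s * S \<omega>))) has_vector_derivative
    expectation (\<lambda>\<omega>. \<i> * of_real (S \<omega>) * cis (s * S \<omega>))) (at s)"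
proof -
  obtain C where C: "\<And>\<omega>. \<bar>S \<omega>\<bar> \<le> C" using S by (auto simp: bounded_rv_def)
  have C0: "C \<ge> 0" using C[of undefined] by linarith
  have [measurable]: "S \<in> borel_measurable M" by (rule bounded_rv_measurable[OF S])
  let ?\<psi> = "\<lambda>s. expectation (\<lambda>\<omega>. cis (s * S \<omega>))"
  let ?d = "expectation (\<lambda>\<omega>. \<i> * of_real (S \<omega>) * cis (s * S \<omega>))"
  have bc: "bounded_rv (\<lambda>\<omega>. cis (r * S \<omega>))" for r by (rule bounded_rv_cis) measurable
  have est: "norm (?\<psi> r - ?\<psi> s - (r - s) *\<^sub>R ?d) \<le> (r - s)\<^sup>2 * C\<^sup>2 / 2" for r
  proof -
    let ?f = "\<lambda>\<omega>. cis (r * S \<omega>) - cis (s * S \<omega>) - of_real (r - s) * (\<i> * of_real (S \<omega>) * cis (s * S \<omega>))"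
    have bf: "bounded_rv ?f" by (intro bounded_rv_intros bc S)
    have "?\<psi> r - ?\<psi> s - (r - s) *\<^sub>R ?d = expectation ?f"
    proof -
      have i: "integrable M (\<lambda>\<omega>. cis (r * S \<omega>))" "integrable M (\<lambda>\<omega>. cis (s * S \<omega>))"
        "integrable M (\<lambda>\<omega>. \<i> * of_real (S \<omega>) * cis (s * S \<omega>))"
        by (intro bounded_rv_integrable bounded_rv_intros bc S)+
      then show ?thesis
        by (simp only: Bochner_Integration.integral_diff Bochner_Integration.integrable_diff
            integral_mult_right_zero integrable_mult_right scaleR_conv_of_real)
    qed
    also have "norm (expectation ?f) \<le> expectation (\<lambda>\<omega>. norm (?f \<omega>))" by (rule integral_norm_bound)
    also have "\<dots> \<le> expectation (\<lambda>_. (r - s)\<^sup>2 * C\<^sup>2 / 2)"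
    proof (rule integral_mono)
      show "integrable M (\<lambda>\<omega>. norm (?f \<omega>))" by (intro integrable_norm bounded_rv_integrable bf)
      fix \<omega>
      let ?y = "(s - r) * S \<omega>"
      have "cis (r * S \<omega>) = cis (s * S \<omega>) * cis (- ?y)" by (simp add: cis_mult algebra_simps)
      then have "?f \<omega> = - (cis (s * S \<omega>) * (1 - cis (- ?y) - \<i> * of_real ?y))" by (simp add: algebra_simps)
      then have "norm (?f \<omega>) = norm (1 - cis (- ?y) - \<i> * of_real ?y)"
        by (simp only: norm_minus_cancel norm_mult norm_cis mult_1)
      also have "\<dots> \<le> ?y\<^sup>2 / 2" by (rule cis_taylor)
      also have "\<dots> \<le> (r - s)\<^sup>2 * C\<^sup>2 / 2"
        using power_mono[OF C abs_ge_zero, where n = 2] by (auto simp: power_mult_distrib power2_commute intro!: mult_left_mono)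
      finally show "norm (?f \<omega>) \<le> (r - s)\<^sup>2 * C\<^sup>2 / 2" .
    qed simp
    finally show ?thesis by (simp add: prob_space)
  qed
  show ?thesis
    unfolding has_vector_derivative_def has_derivative_at_alt
  proof (intro conjI allI impI)
    show "bounded_linear (\<lambda>x. x *\<^sub>R ?d)" by (rule bounded_linear_scaleR_left)
    fix e :: real assume e: "e > 0"
    show "\<exists>d>0. \<forall>y. norm (y - s) < d \<longrightarrow> norm (?\<psi> y - ?\<psi> s - (y - s) *\<^sub>R ?d) \<le> e * norm (y - s)"
    \<comment> \<open>The added 1 keeps the denominator positive when \<open>S\<close> is
      identically 0.\<close>
    proof (intro exI[of _ "e / (C\<^sup>2 + 1)"] conjI allI impI)
      show "0 < e / (C\<^sup>2 + 1)" using e by (intro divide_pos_pos) (auto intro: add_nonneg_pos)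
      fix y assume y: "norm (y - s) < e / (C\<^sup>2 + 1)"
      have p: "0 < C\<^sup>2 + 1" by (auto intro: add_nonneg_pos)
      have "norm (?\<psi> y - ?\<psi> s - (y - s) *\<^sub>R ?d) \<le> (y - s)\<^sup>2 * C\<^sup>2 / 2" by (rule est)
      also have "\<dots> \<le> (y - s)\<^sup>2 * (C\<^sup>2 + 1)"
      proof -
        have "C\<^sup>2 / 2 \<le> C\<^sup>2 + 1" using zero_le_power2[of C] by linarith
        then have "(y - s)\<^sup>2 * (C\<^sup>2 / 2) \<le> (y - s)\<^sup>2 * (C\<^sup>2 + 1)" by (intro mult_left_mono) auto
        then show ?thesis by simp
      qed
      also have "\<dots> = norm (y - s) * (norm (y - s) * (C\<^sup>2 + 1))" by (simp add: power2_eq_square abs_mult_self_eq mult.assoc[symmetric])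
      also have "\<dots> \<le> norm (y - s) * e"
        using y p by (intro mult_left_mono) (auto simp: pos_less_divide_eq less_imp_le)
      finally show "norm (?\<psi> y - ?\<psi> s - (y - s) *\<^sub>R ?d) \<le> e * norm (y - s)" by (simp add: mult.commute)
    qed
  qed
qed

definition simple_words :: "nat \<Rightarrow> nat \<Rightarrow> nat list set" where
  "simple_words n k = {xs \<in> words n k. distinct xs}"

lemma finite_simple_words [simp]: "finite (simple_words n k)"
  by (simp add: simple_words_def)

text \<open>The number is the falling factorial, which for \<open>n \<ge> k\<close> lies between
  \<open>(n - k) ^ k\<close> and \<open>n ^ k\<close>.\<close>

lemma card_simple_words_tendsto: "(\<lambda>n. real (card (simple_words n k)) / real n ^ k) \<longlonglongrightarrow> 1"
proof (rule tendsto_sandwich)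
  have "(\<lambda>n. (real n - real k) / real n) \<longlonglongrightarrow> 1" by real_asymp
  from tendsto_power[OF this, of k] show "(\<lambda>n. ((real n - real k) / real n) ^ k) \<longlonglongrightarrow> 1" by simp
  show "\<forall>\<^sub>F n in sequentially. ((real n - real k) / real n) ^ k \<le> real (card (simple_words n k)) / real n ^ k"
    using eventually_ge_at_top[of k]
  proof eventually_elim
    case (elim n)
    have eq: "simple_words n k = {xs. length xs = k \<and> distinct xs \<and> set xs \<subseteq> {..<n}}"
      by (auto simp: simple_words_def words_def)
    have "(n - k) ^ k = (\<Prod>i\<in>{n - k + 1..n}. n - k)" using elim by simp
    also have "\<dots> \<le> \<Prod>{n - k + 1..n}" by (rule prod_mono) auto
    also have "\<dots> = card (simple_words n k)"
      unfolding eq using card_lists_distinct_length_eq[of "{..<n}" k] elim by simp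
    finally have "real ((n - k) ^ k) \<le> real (card (simple_words n k))" by (rule of_nat_mono)
    then show ?case using elim by (simp add: power_divide divide_right_mono of_nat_diff)
  qed
  show "\<forall>\<^sub>F n in sequentially. real (card (simple_words n k)) / real n ^ k \<le> 1"
    using eventually_gt_at_top[of 0]
  proof eventually_elim
    case (elim n)
    have "card (simple_words n k) \<le> card (words n k)"
      by (rule card_mono) (auto simp: simple_words_def)
    also have "\<dots> = n ^ k"
      using card_lists_length_eq[of "{..<n}" k] by (simp add: words_def)
    finally have "real (card (simple_words n k)) \<le> real (n ^ k)" by (rule of_nat_mono)
    then show ?case using elim by (simp add: divide_le_eq)
  qed
qed simp

section \<open>The quadratic sum and the Gaussian approximation\<close>

context iid_symmetric_matrix
begin

lemma simple_eq: "simple n K = (\<Union>k\<in>{1..K}. simple_words n k)"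
  by (auto simp: simple_def short_words_def simple_words_def words_def Suc_le_eq)

lemma sum_simple: "(\<Sum>a\<in>simple n K. f a) = (\<Sum>k=1..K. \<Sum>a\<in>simple_words n k. f a)"
  unfolding simple_eq by (rule sum.UNION_disjoint, simp, simp) (auto simp: simple_words_def words_def)

definition pair_index :: "nat \<Rightarrow> nat \<Rightarrow> (nat list \<times> nat list) set" where
  "pair_index n K = (SIGMA a:simple n K. {b. b \<in> simple n K \<and> hd a \<in> set b})"

text \<open>The random coefficient that Stein's identity puts in place of the variance. The
  approximation works because its mean converges to the variance of the limit and its fluctuation
  vanishes.\<close>

definition pair_sum :: "nat \<Rightarrow> nat \<Rightarrow> (nat \<Rightarrow> real) \<Rightarrow> 'a \<Rightarrow> real" where
  "pair_sum n K t \<omega> = (\<Sum>m<n. cyc_sum n {c \<in> simple n K. hd c = m} t \<omega> * cyc_sum n {c \<in> simple n K. m \<in> set c} t \<omega>)"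

lemma hd_simple: "c \<in> simple n K \<Longrightarrow> hd c \<in> set c \<and> hd c < n"
  by (cases c) (auto simp: simple_def short_words_def)

lemma pair_sum_eq: "pair_sum n K t \<omega> =
  (\<Sum>p\<in>pair_index n K. (t (length (fst p)) * t (length (snd p))) * mon n (cyc (fst p) @ cyc (snd p)) \<omega>)"
proof -
  let ?g = "\<lambda>a b. (t (length a) * t (length b)) * mon n (cyc a @ cyc b) \<omega>"
  have "pair_sum n K t \<omega> = (\<Sum>m<n. \<Sum>a | a \<in> simple n K \<and> hd a = m. \<Sum>b | b \<in> simple n K \<and> m \<in> set b. ?g a b)"
    by (simp add: pair_sum_def cyc_sum_def sum_product mon_append mult_ac)
  also have "\<dots> = (\<Sum>m<n. \<Sum>a | a \<in> simple n K \<and> hd a = m. \<Sum>b | b \<in> simple n K \<and> hd a \<in> set b. ?g a b)"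
    by (intro sum.cong refl) auto
  also have "\<dots> = (\<Sum>a\<in>simple n K. \<Sum>b | b \<in> simple n K \<and> hd a \<in> set b. ?g a b)"
    by (rule sum.group) (use hd_simple in auto)
  also have "\<dots> = (\<Sum>p\<in>pair_index n K. ?g (fst p) (snd p))"
    unfolding pair_index_def by (subst sum.Sigma) (auto simp: case_prod_unfold)
  finally show ?thesis .
qed

text \<open>For a word of length \<open>k\<close>, its \<open>k\<close> rotations each contribute
  \<open>rho2 n ^ k\<close>; different lengths never pair up, which makes the Gaussian limits for
  different \<open>k\<close> independent.\<close>

lemma expectation_pair_sum:
  assumes n: "n > 0"
  shows "expectation (pair_sum n K t) = (\<Sum>k=1..K. (t k)\<^sup>2 * real k * (real (card (simple_words n k)) * rho2 n ^ k))"
proof -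
  let ?g = "\<lambda>a b. (t (length a) * t (length b)) * expectation (mon n (cyc a @ cyc b))"
  have bm: "bounded_rv (mon n (cyc a @ cyc b))" if "a \<in> simple n K" "b \<in> simple n K" for a b
    using short_word_cyc[OF simple_short[OF that(1)]] short_word_cyc[OF simple_short[OF that(2)]]
    by (intro bounded_rv_mon) auto
  have "expectation (pair_sum n K t) = (\<Sum>p\<in>pair_index n K. ?g (fst p) (snd p))"
    unfolding pair_sum_eq
    by (subst Bochner_Integration.integral_sum)
      (auto simp: pair_index_def intro!: bounded_rv_integrable bounded_rv_intros bm)
  also have "\<dots> = (\<Sum>a\<in>simple n K. \<Sum>b | b \<in> simple n K \<and> hd a \<in> set b. ?g a b)"
    unfolding pair_index_def by (subst sum.Sigma) (auto simp: case_prod_unfold)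
  also have "\<dots> = (\<Sum>a\<in>simple n K. t (length a) * (\<Sum>b | b \<in> simple n K \<and> hd a \<in> set b. t (length b) * expectation (mon n (cyc a @ cyc b))))"
    by (simp add: sum_distrib_left mult.assoc)
  also have "\<dots> = (\<Sum>a\<in>simple n K. t (length a) * (t (length a) * (real (length a) * rho2 n ^ length a)))"
    by (intro sum.cong refl arg_cong2[where f = "(*)"] sum_expectation_pairs[OF n])
  also have "\<dots> = (\<Sum>k=1..K. \<Sum>a\<in>simple_words n k. t (length a) * (t (length a) * (real (length a) * rho2 n ^ length a)))"
    by (rule sum_simple)
  also have "\<dots> = (\<Sum>k=1..K. \<Sum>a\<in>simple_words n k. t k * (t k * (real k * rho2 n ^ k)))"
    by (intro sum.cong refl) (auto simp: simple_words_def words_def)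
  finally show ?thesis by (simp add: power2_eq_square mult_ac)
qed

lemma variance_pair_sum_le:
  assumes n: "n > 0" and t: "\<And>k. \<bar>t k\<bar> \<le> B"
  shows "expectation (\<lambda>\<omega>. (pair_sum n K t \<omega> - expectation (pair_sum n K t))\<^sup>2)
    \<le> (B * B)\<^sup>2 * ((delta n + 1 / real n) * quad_const K ^ 4)"
  unfolding pair_sum_eq
proof (rule variance_pairs_le[OF n])
  show "pair_index n K \<subseteq> {(a, b). a \<in> short_words n K \<and> b \<in> short_words n K \<and> set a \<inter> set b \<noteq> {}}"
  proof (clarify, intro conjI)
    fix a b assume "(a, b) \<in> pair_index n K"
    then have ab: "a \<in> simple n K" "b \<in> simple n K" "hd a \<in> set b" by (auto simp: pair_index_def)
    then show "a \<in> short_words n K" "b \<in> short_words n K" by (auto simp: simple_def)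
    show "set a \<inter> set b \<noteq> {}" using ab hd_simple[of a n K] by blast
  qed
  have "0 \<le> B" using t[of 0] by linarith
  then show "\<bar>t (length (fst p)) * t (length (snd p))\<bar> \<le> B * B" for p :: "nat list \<times> nat list"
    unfolding abs_mult using t by (intro mult_mono) auto
qed

lemma bounded_rv_pair_sum: "bounded_rv (pair_sum n K t)"
  unfolding pair_sum_def by (intro bounded_rv_intros bounded_rv_cyc_sum[of _ n K]) auto

text \<open>Error budget of the approximate differential equation: fluctuation of
  \<open>pair_sum\<close>, distance of its mean from \<open>v\<close>, and Taylor remainder, in this
  order.\<close>

definition clt_error :: "nat \<Rightarrow> nat \<Rightarrow> (nat \<Rightarrow> real) \<Rightarrow> real \<Rightarrow> real \<Rightarrow> real" where
  "clt_error n K t B v = sqrt ((B * B)\<^sup>2 * ((delta n + 1 / real n) * quad_const K ^ 4))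
     + \<bar>expectation (pair_sum n K t) - v\<bar>
     + ((sqrt (delta n) + 1 / real n) * (B\<^sup>2 * quad_const K ^ 2) + sqrt (delta n) * (B ^ 4 * (real K * quad_const K ^ 4)))"

text \<open>The inequality \<open>x * y \<le> h * x\<^sup>2 + y\<^sup>2 / h\<close> splits the
  third-order term into second and fourth moments. Taking \<open>h\<close> close to
  \<open>sqrt (delta n)\<close> balances a bounded sum against one of order \<open>delta n\<close>;
  the summand \<open>1 / n\<close> keeps \<open>h\<close> positive when \<open>delta n\<close> is
  0.\<close>

lemma third_moment_le:
  fixes K :: nat and t :: "nat \<Rightarrow> real"
  assumes n: "n > 0" and t: "\<And>k. \<bar>t k\<bar> \<le> B"
  defines "D \<equiv> \<lambda>m. cyc_sum n {c \<in> simple n K. m \<in> set c} t"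
    and "D' \<equiv> \<lambda>m. cyc_sum n {c \<in> simple n K. hd c = m} t"
  shows "(\<Sum>m<n. expectation (\<lambda>\<omega>. \<bar>D' m \<omega>\<bar> * (D m \<omega>)\<^sup>2))
    \<le> (sqrt (delta n) + 1 / real n) * (B\<^sup>2 * quad_const K ^ 2) + sqrt (delta n) * (B ^ 4 * (real K * quad_const K ^ 4))"
proof -
  define h where "h = sqrt (delta n) + 1 / real n"
  have d0: "0 \<le> delta n" by (rule rho_nonneg)
  have h: "h > 0" unfolding h_def using n d0 by (intro add_nonneg_pos) auto
  have b: "bounded_rv (D m)" "bounded_rv (D' m)" for m
    unfolding D_def D'_def by (auto intro!: bounded_rv_cyc_sum[of _ n K])
  have "expectation (\<lambda>\<omega>. \<bar>D' m \<omega>\<bar> * (D m \<omega>)\<^sup>2) \<le> h * expectation (\<lambda>\<omega>. (D' m \<omega>)\<^sup>2) + expectation (\<lambda>\<omega>. (D m \<omega>) ^ 4) / h" for m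
  proof -
    have le: "x * y \<le> h * x\<^sup>2 + y\<^sup>2 / h" if "0 \<le> x" "0 \<le> y" for x y :: real
    proof -
      have "0 \<le> (h * x - y)\<^sup>2" by simp
      then have "2 * (h * (x * y)) \<le> h * (h * x\<^sup>2) + y\<^sup>2" by (simp add: power2_eq_square algebra_simps)
      moreover have "0 \<le> h * (x * y)" using h that by simp
      ultimately have "h * (x * y) \<le> h * (h * x\<^sup>2) + y\<^sup>2" by linarith
      then have "h * (x * y) / h \<le> (h * (h * x\<^sup>2) + y\<^sup>2) / h" using h by (intro divide_right_mono) auto
      then show ?thesis using h by (simp add: add_divide_distrib)
    qed
    have "expectation (\<lambda>\<omega>. \<bar>D' m \<omega>\<bar> * (D m \<omega>)\<^sup>2) \<le> expectation (\<lambda>\<omega>. h * (D' m \<omega>)\<^sup>2 + (D m \<omega>) ^ 4 * (1 / h))"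
    proof (rule integral_mono)
      show "\<bar>D' m \<omega>\<bar> * (D m \<omega>)\<^sup>2 \<le> h * (D' m \<omega>)\<^sup>2 + (D m \<omega>) ^ 4 * (1 / h)" for \<omega>
        using le[of "\<bar>D' m \<omega>\<bar>" "(D m \<omega>)\<^sup>2"] by simp
    qed (intro bounded_rv_integrable bounded_rv_intros b)+
    also have "\<dots> = expectation (\<lambda>\<omega>. h * (D' m \<omega>)\<^sup>2) + expectation (\<lambda>\<omega>. (D m \<omega>) ^ 4 * (1 / h))"
      by (intro Bochner_Integration.integral_add bounded_rv_integrable bounded_rv_intros b)
    finally show ?thesis by simp
  qed
  then have "(\<Sum>m<n. expectation (\<lambda>\<omega>. \<bar>D' m \<omega>\<bar> * (D m \<omega>)\<^sup>2))
      \<le> (\<Sum>m<n. h * expectation (\<lambda>\<omega>. (D' m \<omega>)\<^sup>2) + expectation (\<lambda>\<omega>. (D m \<omega>) ^ 4) / h)"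
    by (rule sum_mono)
  also have "\<dots> = h * (\<Sum>m<n. expectation (\<lambda>\<omega>. (D' m \<omega>)\<^sup>2)) + (\<Sum>m<n. expectation (\<lambda>\<omega>. (D m \<omega>) ^ 4)) / h"
    by (simp add: sum.distrib sum_distrib_left sum_divide_distrib)
  also have "\<dots> \<le> h * (B\<^sup>2 * quad_const K ^ 2) + (B ^ 4 * (delta n * (real K * quad_const K ^ 4))) / h"
    unfolding D_def D'_def using h
    by (intro add_mono mult_left_mono divide_right_mono sum_second_moment_le[OF n t] sum_fourth_moment_le[OF n t]) auto
  also have "(B ^ 4 * (delta n * (real K * quad_const K ^ 4))) / h \<le> sqrt (delta n) * (B ^ 4 * (real K * quad_const K ^ 4))"
  proof -
    have "delta n = sqrt (delta n) * sqrt (delta n)" using d0 by simp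
    also have "\<dots> \<le> sqrt (delta n) * h" unfolding h_def using d0 by (intro mult_left_mono) auto
    finally have "delta n / h \<le> sqrt (delta n)" using h by (simp add: pos_divide_le_eq)
    then have "delta n / h * (B ^ 4 * (real K * quad_const K ^ 4)) \<le> sqrt (delta n) * (B ^ 4 * (real K * quad_const K ^ 4))"
      using quad_const_ge_1[of K] by (intro mult_right_mono) auto
    then show ?thesis by (simp add: mult_ac)
  qed
  finally show ?thesis by (simp add: h_def)
qed

lemma char_cyc_sum_error:
  assumes n: "n > 0" and t: "\<And>k. \<bar>t k\<bar> \<le> B" and v: "v \<ge> 0"
  shows "norm (expectation (\<lambda>\<omega>. cis (cyc_sum n (simple n K) t \<omega>)) - of_real (exp (- v / 2))) \<le> clt_error n K t B v"
proof -
  let ?S = "cyc_sum n (simple n K) t" and ?W = "pair_sum n K t"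
  define \<psi> where "\<psi> s = expectation (\<lambda>\<omega>. cis (s * ?S \<omega>))" for s
  define \<psi>' where "\<psi>' s = expectation (\<lambda>\<omega>. \<i> * of_real (?S \<omega>) * cis (s * ?S \<omega>))" for s
  have bS: "bounded_rv ?S" by (rule bounded_rv_cyc_sum[of _ n K]) simp
  note bW = bounded_rv_pair_sum[of n K t]
  have bc: "bounded_rv (\<lambda>\<omega>. cis (s * ?S \<omega>))" for s
    using bounded_rv_measurable[OF bS] by (intro bounded_rv_cis) measurable
  let ?T = "(sqrt (delta n) + 1 / real n) * (B\<^sup>2 * quad_const K ^ 2) + sqrt (delta n) * (B ^ 4 * (real K * quad_const K ^ 4))"
  have W1: "expectation (\<lambda>\<omega>. \<bar>?W \<omega> - v\<bar>) \<le> sqrt ((B * B)\<^sup>2 * ((delta n + 1 / real n) * quad_const K ^ 4)) + \<bar>expectation ?W - v\<bar>"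
  proof -
    have "expectation (\<lambda>\<omega>. \<bar>?W \<omega> - v\<bar>) \<le> expectation (\<lambda>\<omega>. \<bar>?W \<omega> - expectation ?W\<bar> + \<bar>expectation ?W - v\<bar>)"
      by (intro integral_mono bounded_rv_integrable bounded_rv_intros bW) auto
    also have "\<dots> = expectation (\<lambda>\<omega>. \<bar>?W \<omega> - expectation ?W\<bar>) + \<bar>expectation ?W - v\<bar>"
      by (subst Bochner_Integration.integral_add) (auto intro!: bounded_rv_integrable bounded_rv_intros bW simp: prob_space)
    also have "expectation (\<lambda>\<omega>. \<bar>?W \<omega> - expectation ?W\<bar>) \<le> sqrt (expectation (\<lambda>\<omega>. (?W \<omega> - expectation ?W)\<^sup>2))"
      by (intro expectation_abs_le_sqrt bounded_rv_intros bW)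
    also have "\<dots> \<le> sqrt ((B * B)\<^sup>2 * ((delta n + 1 / real n) * quad_const K ^ 4))"
      by (intro real_sqrt_le_mono variance_pair_sum_le[OF n t])
    finally show ?thesis by simp
  qed
  have "norm (\<psi> 1 - of_real (exp (- v / 2))) \<le> clt_error n K t B v"
  proof (rule gaussian_ode_bound[OF _ _ v])
    show "(\<psi> has_vector_derivative \<psi>' s) (at s)" for s
      unfolding \<psi>_def \<psi>'_def by (rule has_vector_derivative_expectation_cis[OF bS])
    show "\<psi> 0 = 1" by (simp add: \<psi>_def prob_space)
    fix s :: real assume s: "0 \<le> s" "s \<le> 1"
    \<comment> \<open>The constant \<open>v\<close> is exchanged for the random \<open>?W\<close>.
      The bracket is what \<open>stein_identity\<close> bounds, and the correction is at most the
      mean of \<open>\<bar>?W - v\<bar>\<close>, because the exponential has modulus 1 and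
      \<open>s \<le> 1\<close>.\<close>
    have eq: "\<psi>' s + of_real (s * v) * \<psi> s =
        (\<psi>' s + of_real s * expectation (\<lambda>\<omega>. of_real (?W \<omega>) * cis (s * ?S \<omega>)))
        - of_real s * expectation (\<lambda>\<omega>. of_real (?W \<omega> - v) * cis (s * ?S \<omega>))"
    proof -
      have i: "integrable M (\<lambda>\<omega>. of_real (?W \<omega>) * cis (s * ?S \<omega>))" "integrable M (\<lambda>\<omega>. cis (s * ?S \<omega>))"
        by (intro bounded_rv_integrable bounded_rv_intros bW bc)+
      have "expectation (\<lambda>\<omega>. of_real (?W \<omega> - v) * cis (s * ?S \<omega>))
        = expectation (\<lambda>\<omega>. of_real (?W \<omega>) * cis (s * ?S \<omega>) - of_real v * cis (s * ?S \<omega>))"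
        by (simp add: left_diff_distrib)
      also have "\<dots> = expectation (\<lambda>\<omega>. of_real (?W \<omega>) * cis (s * ?S \<omega>)) - of_real v * \<psi> s"
        using i by (simp only: Bochner_Integration.integral_diff integrable_mult_right integral_mult_right_zero \<psi>_def)
      finally have E: "expectation (\<lambda>\<omega>. of_real (?W \<omega> - v) * cis (s * ?S \<omega>)) =
          expectation (\<lambda>\<omega>. of_real (?W \<omega>) * cis (s * ?S \<omega>)) - of_real v * \<psi> s" .
      have alg: "p + (r * u) * z = (p + r * w) - r * (w - u * z)" for p r u z w :: complex
        by (simp add: algebra_simps)
      show ?thesis unfolding E of_real_mult by (rule alg)
    qed
    have n1: "norm (\<psi>' s + of_real (s * v) * \<psi> s) \<le> norm (\<psi>' s + of_real s * expectation (\<lambda>\<omega>. of_real (?W \<omega>) * cis (s * ?S \<omega>)))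
        + norm (of_real s * expectation (\<lambda>\<omega>. of_real (?W \<omega> - v) * cis (s * ?S \<omega>)))" unfolding eq by (rule norm_triangle_ineq4)
    have n2: "norm (\<psi>' s + of_real s * expectation (\<lambda>\<omega>. of_real (?W \<omega>) * cis (s * ?S \<omega>))) \<le> ?T"
    proof -
      let ?X = "\<Sum>m<n. expectation (\<lambda>\<omega>. \<bar>cyc_sum n {c \<in> simple n K. hd c = m} t \<omega>\<bar> * (cyc_sum n {c \<in> simple n K. m \<in> set c} t \<omega>)\<^sup>2)"
      have X0: "0 \<le> ?X" by (intro sum_nonneg Bochner_Integration.integral_nonneg) auto
      have "norm (\<psi>' s + of_real s * expectation (\<lambda>\<omega>. of_real (?W \<omega>) * cis (s * ?S \<omega>))) \<le> s\<^sup>2 / 2 * ?X"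
        unfolding \<psi>'_def pair_sum_def by (rule stein_identity[OF n])
      also have "\<dots> \<le> 1 * ?X"
      proof (intro mult_right_mono X0)
        have "s\<^sup>2 \<le> 1" using s by (simp add: power_le_one)
        then show "s\<^sup>2 / 2 \<le> 1" by simp
      qed
      also have "\<dots> \<le> ?T" using third_moment_le[OF n t, of K] by simp
      finally show ?thesis .
    qed
    have n3: "norm (of_real s * expectation (\<lambda>\<omega>. of_real (?W \<omega> - v) * cis (s * ?S \<omega>))) \<le> expectation (\<lambda>\<omega>. \<bar>?W \<omega> - v\<bar>)"
    proof -
      have "norm (expectation (\<lambda>\<omega>. of_real (?W \<omega> - v) * cis (s * ?S \<omega>))) \<le> expectation (\<lambda>\<omega>. norm (of_real (?W \<omega> - v) * cis (s * ?S \<omega>)))"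
        by (rule integral_norm_bound)
      also have "\<dots> = expectation (\<lambda>\<omega>. \<bar>?W \<omega> - v\<bar>)" by (simp only: norm_mult norm_of_real norm_cis mult_1_right)
      finally have 1: "norm (expectation (\<lambda>\<omega>. of_real (?W \<omega> - v) * cis (s * ?S \<omega>))) \<le> expectation (\<lambda>\<omega>. \<bar>?W \<omega> - v\<bar>)" .
      have "norm (of_real s * expectation (\<lambda>\<omega>. of_real (?W \<omega> - v) * cis (s * ?S \<omega>))) =
        s * norm (expectation (\<lambda>\<omega>. of_real (?W \<omega> - v) * cis (s * ?S \<omega>)))" using s by (simp add: norm_mult)
      also have "\<dots> \<le> 1 * norm (expectation (\<lambda>\<omega>. of_real (?W \<omega> - v) * cis (s * ?S \<omega>)))"
        using s by (intro mult_right_mono) auto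
      finally show ?thesis using 1 by linarith
    qed
    show "norm (\<psi>' s + of_real (s * v) * \<psi> s) \<le> clt_error n K t B v"
      using W1 n1 n2 n3 unfolding clt_error_def by linarith
  qed
  then show ?thesis by (simp add: \<psi>_def)
qed

end

context iid_attracted_matrix
begin

lemma card_simple_words_rho2_tendsto: "(\<lambda>n. real (card (simple_words n k)) * rho2 n ^ k) \<longlonglongrightarrow> 1"
proof -
  have "(\<lambda>n. real (card (simple_words n k)) / real n ^ k * (real n * rho2 n) ^ k) \<longlonglongrightarrow> 1 * 1 ^ k"
    by (intro tendsto_intros card_simple_words_tendsto n_rho2_tendsto)
  then have "(\<lambda>n. real (card (simple_words n k)) / real n ^ k * (real n * rho2 n) ^ k) \<longlonglongrightarrow> 1" by simp
  then show ?thesis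
  proof (rule Lim_transform_eventually)
    show "\<forall>\<^sub>F n in sequentially. real (card (simple_words n k)) / real n ^ k * (real n * rho2 n) ^ k =
        real (card (simple_words n k)) * rho2 n ^ k"
      using eventually_gt_at_top[of 0] by eventually_elim (simp add: power_mult_distrib)
  qed
qed

lemma char_cyc_sum_tendsto:
  assumes t: "\<And>k. \<bar>t k\<bar> \<le> B"
  shows "(\<lambda>n. expectation (\<lambda>\<omega>. cis (cyc_sum n (simple n K) t \<omega>)))
    \<longlonglongrightarrow> of_real (exp (- (\<Sum>k=1..K. (t k)\<^sup>2 * real k) / 2))"
proof -
  let ?v = "\<Sum>k=1..K. (t k)\<^sup>2 * real k"
  have v: "0 \<le> ?v" by (intro sum_nonneg) auto
  have "(\<lambda>n. \<Sum>k=1..K. (t k)\<^sup>2 * real k * (real (card (simple_words n k)) * rho2 n ^ k)) \<longlonglongrightarrow> (\<Sum>k=1..K. (t k)\<^sup>2 * real k * 1)"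
    by (intro tendsto_intros card_simple_words_rho2_tendsto)
  then have "(\<lambda>n. \<Sum>k=1..K. (t k)\<^sup>2 * real k * (real (card (simple_words n k)) * rho2 n ^ k)) \<longlonglongrightarrow> ?v" by simp
  then have W: "(\<lambda>n. expectation (pair_sum n K t)) \<longlonglongrightarrow> ?v"
  proof (rule Lim_transform_eventually)
    show "\<forall>\<^sub>F n in sequentially. (\<Sum>k=1..K. (t k)\<^sup>2 * real k * (real (card (simple_words n k)) * rho2 n ^ k)) =
        expectation (pair_sum n K t)"
      using eventually_gt_at_top[of 0] by eventually_elim (rule expectation_pair_sum[symmetric])
  qed
  have n0: "(\<lambda>n. 1 / real n) \<longlonglongrightarrow> 0" by real_asymp
  have "(\<lambda>n. clt_error n K t B ?v) \<longlonglongrightarrow>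
     sqrt ((B * B)\<^sup>2 * ((0 + 0) * quad_const K ^ 4)) + \<bar>?v - ?v\<bar>
     + ((sqrt 0 + 0) * (B\<^sup>2 * quad_const K ^ 2) + sqrt 0 * (B ^ 4 * (real K * quad_const K ^ 4)))"
    unfolding clt_error_def by (intro tendsto_intros W n0 delta_tendsto)
  then have e: "(\<lambda>n. clt_error n K t B ?v) \<longlonglongrightarrow> 0" by simp
  have "(\<lambda>n. expectation (\<lambda>\<omega>. cis (cyc_sum n (simple n K) t \<omega>)) - of_real (exp (- ?v / 2))) \<longlonglongrightarrow> 0"
  proof (rule Lim_null_comparison[OF _ e])
    show "\<forall>\<^sub>F n in sequentially. norm (expectation (\<lambda>\<omega>. cis (cyc_sum n (simple n K) t \<omega>)) - of_real (exp (- ?v / 2)))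
        \<le> clt_error n K t B ?v"
      using eventually_gt_at_top[of 0] by eventually_elim (rule char_cyc_sum_error[OF _ t v])
  qed
  then show ?thesis by (simp add: LIM_zero_iff)
qed

section \<open>Simple, doubled and remaining walks\<close>

definition closed_walks :: "nat \<Rightarrow> nat \<Rightarrow> 'a \<Rightarrow> real" where
  "closed_walks n k \<omega> = (\<Sum>xs\<in>words n k. mon n (cyc xs) \<omega>)"

definition double_words :: "nat \<Rightarrow> nat \<Rightarrow> nat list set" where
  "double_words n k = (\<lambda>b. b @ b) ` {b. distinct b \<and> set b \<subseteq> {..<n} \<and> 2 * length b = k}"

lemma word_short: "xs \<in> words n k \<Longrightarrow> xs \<in> short_words n k"
  by (auto simp: words_def short_words_def)

lemma bounded_rv_word: "xs \<in> words n k \<Longrightarrow> bounded_rv (mon n (cyc xs))"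
  by (intro bounded_rv_mon short_word_cyc word_short)

text \<open>A remaining word is neither simple nor doubled. By \<open>light_walk_double\<close> a
  pair starting with it can satisfy parity only if some row is heavy, so every term of the second
  moment carries the factor \<open>delta n\<close>.\<close>

lemma light_remainder:
  assumes k: "k \<ge> 1"
  defines "A \<equiv> \<lambda>n. words n k - simple_words n k - double_words n k"
  shows "(\<lambda>n. expectation (\<lambda>\<omega>. \<bar>\<Sum>xs\<in>A n. mon n (cyc xs) \<omega>\<bar>)) \<longlonglongrightarrow> 0"
proof -
  have bound: "expectation (\<lambda>\<omega>. (\<Sum>xs\<in>A n. mon n (cyc xs) \<omega>)\<^sup>2) \<le> delta n * quad_const k ^ 2" if n: "n > 0" for n
  proof -
    let ?wt = "\<lambda>a b. (1 / real n) ^ card (set a \<union> set b)"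
    have AS: "A n \<subseteq> short_words n k" by (auto simp: A_def intro: word_short)
    have finA: "finite (A n)" by (rule finite_subset[OF AS]) simp
    have bm: "bounded_rv (mon n (cyc a @ cyc b))" if "a \<in> A n" "b \<in> A n" for a b
      using that AS short_word_cyc[of a n k] short_word_cyc[of b n k] by (intro bounded_rv_mon) auto
    have "expectation (\<lambda>\<omega>. (\<Sum>xs\<in>A n. mon n (cyc xs) \<omega>)\<^sup>2) = expectation (\<lambda>\<omega>. \<Sum>a\<in>A n. \<Sum>b\<in>A n. mon n (cyc a @ cyc b) \<omega>)"
      by (simp add: power2_eq_square sum_product mon_append)
    also have "\<dots> = (\<Sum>a\<in>A n. expectation (\<lambda>\<omega>. \<Sum>b\<in>A n. mon n (cyc a @ cyc b) \<omega>))"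
      by (intro Bochner_Integration.integral_sum bounded_rv_integrable bounded_rv_intros bm)
    also have "\<dots> = (\<Sum>a\<in>A n. \<Sum>b\<in>A n. expectation (mon n (cyc a @ cyc b)))"
      by (intro sum.cong[OF refl] Bochner_Integration.integral_sum bounded_rv_integrable bm)
    also have "\<dots> \<le> (\<Sum>a\<in>A n. \<Sum>b\<in>A n. delta n * ?wt a b)"
    proof (intro sum_mono)
      fix a b assume ab: "a \<in> A n" "b \<in> A n"
      have "\<bar>expectation (mon n (cyc a @ cyc b))\<bar> \<le> delta n * (1 / real n) ^ card (fst ` set (cyc a @ cyc b))"
      proof (rule abs_expectation_mon_heavy_le[OF _ n])
        show "set (cyc a @ cyc b) \<subseteq> sq n"
          using ab AS short_word_cyc[of a n k] short_word_cyc[of b n k] by auto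
        assume ev: "even_edges (cyc a @ cyc b)"
        show "\<exists>i. 3 < length (targets i (cyc a @ cyc b))"
        proof (rule ccontr)
          assume "\<not> ?thesis"
          moreover have "\<not> distinct a" using ab by (auto simp: A_def simple_words_def)
          ultimately obtain c where "distinct c" "a = c @ c"
            using light_walk_double[OF ev] by (meson not_less)
          then have "a \<in> double_words n k" using ab by (auto simp: A_def words_def double_words_def)
          with ab show False by (simp add: A_def)
        qed
      qed
      then show "expectation (mon n (cyc a @ cyc b)) \<le> delta n * ?wt a b" by (simp add: image_Un)
    qed
    also have "\<dots> = delta n * (\<Sum>a\<in>A n. \<Sum>b\<in>A n. ?wt a b)" by (simp only: sum_distrib_left)
    also have "\<dots> \<le> delta n * quad_const k ^ 2"
    proof (intro mult_left_mono)
      have "(\<Sum>a\<in>A n. \<Sum>b\<in>A n. ?wt a b) \<le> (\<Sum>a\<in>A n. \<Sum>b\<in>short_words n k. ?wt a b)"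
        using AS by (intro sum_mono sum_mono2) auto
      also have "\<dots> \<le> (\<Sum>a\<in>short_words n k. \<Sum>b\<in>short_words n k. ?wt a b)"
        using AS by (intro sum_mono2) (auto intro!: sum_nonneg)
      also have "\<dots> \<le> quad_const k ^ 2" by (rule sum_pairs_weight)
      finally show "(\<Sum>a\<in>A n. \<Sum>b\<in>A n. ?wt a b) \<le> quad_const k ^ 2" .
    qed (rule rho_nonneg)
    finally show ?thesis .
  qed
  have bA: "bounded_rv (\<lambda>\<omega>. \<Sum>xs\<in>A n. mon n (cyc xs) \<omega>)" for n
    by (intro bounded_rv_intros bounded_rv_word[of _ n k]) (auto simp: A_def)
  show ?thesis
  proof (rule Lim_null_comparison)
    have "(\<lambda>n. sqrt (delta n * quad_const k ^ 2)) \<longlonglongrightarrow> sqrt (0 * quad_const k ^ 2)"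
      by (intro tendsto_intros delta_tendsto)
    then show "(\<lambda>n. sqrt (delta n * quad_const k ^ 2)) \<longlonglongrightarrow> 0" by simp
    show "\<forall>\<^sub>F n in sequentially. norm (expectation (\<lambda>\<omega>. \<bar>\<Sum>xs\<in>A n. mon n (cyc xs) \<omega>\<bar>)) \<le> sqrt (delta n * quad_const k ^ 2)"
      using eventually_gt_at_top[of 0]
    proof eventually_elim
      case (elim n)
      have "0 \<le> expectation (\<lambda>\<omega>. \<bar>\<Sum>xs\<in>A n. mon n (cyc xs) \<omega>\<bar>)" by (rule Bochner_Integration.integral_nonneg) auto
      moreover have "expectation (\<lambda>\<omega>. \<bar>\<Sum>xs\<in>A n. mon n (cyc xs) \<omega>\<bar>) \<le> sqrt (expectation (\<lambda>\<omega>. (\<Sum>xs\<in>A n. mon n (cyc xs) \<omega>)\<^sup>2))"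
        by (rule expectation_abs_le_sqrt[OF bA])
      moreover have "\<dots> \<le> sqrt (delta n * quad_const k ^ 2)" by (intro real_sqrt_le_mono bound elim)
      ultimately show ?case unfolding real_norm_def by linarith
    qed
  qed
qed

text \<open>A doubled word is the pair \<open>(b, b)\<close>, so the sum falls under the variance
  bound for pairs. Its mean is the number of simple words of half the length times a power of
  \<open>rho2 n\<close>, with limit 1. For odd \<open>k\<close> there are no doubled words.\<close>

lemma double_sum_tendsto:
  assumes k: "k \<ge> 1"
  shows "(\<lambda>n. expectation (\<lambda>\<omega>. \<bar>(\<Sum>xs\<in>double_words n k. mon n (cyc xs) \<omega>) - of_bool (even k)\<bar>)) \<longlonglongrightarrow> 0"
proof (cases "even k")
  case False
  have "double_words n k = {}" for n using False by (auto simp: double_words_def)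
  then show ?thesis using False by simp
next
  case True
  then obtain h where h: "k = 2 * h" by (elim evenE)
  with k have h1: "h \<ge> 1" by simp
  let ?P = "\<lambda>n. (\<lambda>b. (b, b)) ` simple_words n h"
  let ?Q = "\<lambda>n \<omega>. \<Sum>p\<in>?P n. 1 * mon n (cyc (fst p) @ cyc (snd p)) \<omega>"
  have Q: "(\<Sum>xs\<in>double_words n k. mon n (cyc xs) \<omega>) = ?Q n \<omega>" for n \<omega>
  proof -
    have D: "double_words n k = (\<lambda>b. b @ b) ` simple_words n h"
      by (auto simp: double_words_def h simple_words_def words_def)
    have inj: "inj_on (\<lambda>b. b @ b) (simple_words n h)"
      by (auto simp: inj_on_def simple_words_def words_def)
    show ?thesis unfolding D
      by (subst sum.reindex[OF inj], subst sum.reindex) (auto simp: inj_on_def cyc_double)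
  qed
  have bQ: "bounded_rv (?Q n)" for n
    by (intro bounded_rv_intros bounded_rv_mon) (auto simp: simple_words_def words_def dest!: set_cyc_subset_sq)
  have var: "expectation (\<lambda>\<omega>. (?Q n \<omega> - expectation (?Q n))\<^sup>2) \<le> 1\<^sup>2 * ((delta n + 1 / real n) * quad_const h ^ 4)" if n: "n > 0" for n
  proof (rule variance_pairs_le[OF n])
    show "?P n \<subseteq> {(a, b). a \<in> short_words n h \<and> b \<in> short_words n h \<and> set a \<inter> set b \<noteq> {}}"
      using h1 by (auto simp: simple_words_def words_def short_words_def)
  qed simp
  have mean: "expectation (?Q n) = real (card (simple_words n h)) * rho2 n ^ h" for n
  proof -
    have "expectation (?Q n) = (\<Sum>b\<in>simple_words n h. expectation (mon n (cyc b @ cyc b)))"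
      by (subst sum.reindex, simp add: inj_on_def, subst Bochner_Integration.integral_sum)
        (auto intro!: bounded_rv_integrable bounded_rv_mon simp: simple_words_def words_def dest!: set_cyc_subset_sq)
    also have "\<dots> = (\<Sum>b\<in>simple_words n h. rho2 n ^ h)"
    proof (rule sum.cong[OF refl])
      fix b assume "b \<in> simple_words n h"
      then show "expectation (mon n (cyc b @ cyc b)) = rho2 n ^ h"
        using expectation_rotation[of b n 0] by (simp add: simple_words_def words_def)
    qed
    finally show ?thesis by simp
  qed
  show ?thesis
  proof (rule Lim_null_comparison)
    let ?e = "\<lambda>n. sqrt (1\<^sup>2 * ((delta n + 1 / real n) * quad_const h ^ 4)) + \<bar>real (card (simple_words n h)) * rho2 n ^ h - 1\<bar>"
    have n0: "(\<lambda>n. 1 / real n) \<longlonglongrightarrow> 0" by real_asymp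
    have "?e \<longlonglongrightarrow> sqrt (1\<^sup>2 * ((0 + 0) * quad_const h ^ 4)) + \<bar>1 - 1\<bar>"
      by (intro tendsto_intros delta_tendsto n0 card_simple_words_rho2_tendsto)
    then show "?e \<longlonglongrightarrow> 0" by simp
    show "\<forall>\<^sub>F n in sequentially. norm (expectation (\<lambda>\<omega>. \<bar>(\<Sum>xs\<in>double_words n k. mon n (cyc xs) \<omega>) - of_bool (even k)\<bar>)) \<le> ?e n"
      using eventually_gt_at_top[of 0]
    proof eventually_elim
      case (elim n)
      have "0 \<le> expectation (\<lambda>\<omega>. \<bar>?Q n \<omega> - 1\<bar>)" by (rule Bochner_Integration.integral_nonneg) auto
      moreover have "expectation (\<lambda>\<omega>. \<bar>?Q n \<omega> - 1\<bar>) \<le> expectation (\<lambda>\<omega>. \<bar>?Q n \<omega> - expectation (?Q n)\<bar> + \<bar>expectation (?Q n) - 1\<bar>)"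
        by (rule integral_mono; (intro bounded_rv_integrable bounded_rv_abs bounded_rv_add bounded_rv_diff bounded_rv_const bQ)?) linarith
      moreover have "\<dots> = expectation (\<lambda>\<omega>. \<bar>?Q n \<omega> - expectation (?Q n)\<bar>) + \<bar>expectation (?Q n) - 1\<bar>"
      proof -
        have "integrable M (\<lambda>\<omega>. \<bar>?Q n \<omega> - expectation (?Q n)\<bar>)"
          by (intro bounded_rv_integrable bounded_rv_abs bounded_rv_diff bounded_rv_const bQ)
        then show ?thesis by (subst Bochner_Integration.integral_add) (simp_all add: prob_space)
      qed
      moreover have "expectation (\<lambda>\<omega>. \<bar>?Q n \<omega> - expectation (?Q n)\<bar>) \<le> sqrt (expectation (\<lambda>\<omega>. (?Q n \<omega> - expectation (?Q n))\<^sup>2))"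
        by (intro expectation_abs_le_sqrt bounded_rv_diff bounded_rv_const bQ)
      moreover have "\<dots> \<le> sqrt (1\<^sup>2 * ((delta n + 1 / real n) * quad_const h ^ 4))"
        by (intro real_sqrt_le_mono var elim)
      ultimately have "norm (expectation (\<lambda>\<omega>. \<bar>?Q n \<omega> - 1\<bar>)) \<le> sqrt (1\<^sup>2 * ((delta n + 1 / real n) * quad_const h ^ 4)) + \<bar>expectation (?Q n) - 1\<bar>"
        unfolding real_norm_def by linarith
      then show ?case unfolding Q mean using True by simp
    qed
  qed
qed

text \<open>For \<open>k \<ge> 1\<close> a doubled word repeats a letter, so the simple and the
  doubled words are disjoint and the sum over all words splits into three.\<close>

lemma closed_walks_tendsto:
  assumes k: "k \<ge> 1"
  shows "(\<lambda>n. expectation (\<lambda>\<omega>. \<bar>closed_walks n k \<omega> - of_bool (even k) - (\<Sum>xs\<in>simple_words n k. mon n (cyc xs) \<omega>)\<bar>)) \<longlonglongrightarrow> 0"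
proof (rule Lim_null_comparison)
  let ?A = "\<lambda>n \<omega>. \<Sum>xs\<in>words n k - simple_words n k - double_words n k. mon n (cyc xs) \<omega>"
  let ?D = "\<lambda>n \<omega>. (\<Sum>xs\<in>double_words n k. mon n (cyc xs) \<omega>)"
  have sub: "simple_words n k \<subseteq> words n k" "double_words n k \<subseteq> words n k - simple_words n k" for n
  proof -
    show "simple_words n k \<subseteq> words n k" by (auto simp: simple_words_def)
    show "double_words n k \<subseteq> words n k - simple_words n k"
      using k by (auto simp: double_words_def words_def simple_words_def)
  qed
  have eq: "closed_walks n k \<omega> - of_bool (even k) - (\<Sum>xs\<in>simple_words n k. mon n (cyc xs) \<omega>) = ?A n \<omega> + (?D n \<omega> - of_bool (even k))" for n \<omega>
    unfolding closed_walks_def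
    using sum.subset_diff[OF sub(1), of n "\<lambda>xs. mon n (cyc xs) \<omega>"] sum.subset_diff[OF sub(2), of n "\<lambda>xs. mon n (cyc xs) \<omega>"]
    by simp
  show "(\<lambda>n. expectation (\<lambda>\<omega>. \<bar>?A n \<omega>\<bar>) + expectation (\<lambda>\<omega>. \<bar>?D n \<omega> - of_bool (even k)\<bar>)) \<longlonglongrightarrow> 0"
    using tendsto_add[OF light_remainder[OF k] double_sum_tendsto[OF k]] by simp
  have b: "bounded_rv (?A n)" "bounded_rv (?D n)" for n
    using sub[of n] by (auto intro!: bounded_rv_sum bounded_rv_word[of _ n k])
  have "norm (expectation (\<lambda>\<omega>. \<bar>?A n \<omega> + (?D n \<omega> - of_bool (even k))\<bar>)) \<le>
      expectation (\<lambda>\<omega>. \<bar>?A n \<omega>\<bar>) + expectation (\<lambda>\<omega>. \<bar>?D n \<omega> - of_bool (even k)\<bar>)" for n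
  proof -
    have i: "integrable M (\<lambda>\<omega>. \<bar>?A n \<omega>\<bar>)" "integrable M (\<lambda>\<omega>. \<bar>?D n \<omega> - of_bool (even k)\<bar>)"
      "integrable M (\<lambda>\<omega>. \<bar>?A n \<omega> + (?D n \<omega> - of_bool (even k))\<bar>)"
      by (intro bounded_rv_integrable bounded_rv_abs bounded_rv_add bounded_rv_diff bounded_rv_const b)+
    have "expectation (\<lambda>\<omega>. \<bar>?A n \<omega> + (?D n \<omega> - of_bool (even k))\<bar>) \<le> expectation (\<lambda>\<omega>. \<bar>?A n \<omega>\<bar> + \<bar>?D n \<omega> - of_bool (even k)\<bar>)"
      using i by (intro integral_mono Bochner_Integration.integrable_add) auto
    then show ?thesis using i by (simp add: Bochner_Integration.integral_nonneg)
  qed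
  then show "\<forall>\<^sub>F n in sequentially. norm (expectation (\<lambda>\<omega>. \<bar>closed_walks n k \<omega> - of_bool (even k) - (\<Sum>xs\<in>simple_words n k. mon n (cyc xs) \<omega>)\<bar>))
      \<le> expectation (\<lambda>\<omega>. \<bar>?A n \<omega>\<bar>) + expectation (\<lambda>\<omega>. \<bar>?D n \<omega> - of_bool (even k)\<bar>)"
    unfolding eq by simp
qed

lemma bounded_rv_closed_walks: "bounded_rv (closed_walks n k)"
  unfolding closed_walks_def by (intro bounded_rv_sum bounded_rv_word)

text \<open>The map \<open>cis\<close> is 1-Lipschitz, so errors that vanish in mean absolute value
  do not change the limit of the characteristic functions. The parity terms are deterministic and
  come out as a phase.\<close>

lemma char_closed_walks_tendsto:
  "(\<lambda>n. expectation (\<lambda>\<omega>. cis (\<Sum>k=1..K. t k * closed_walks n k \<omega>)))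
    \<longlonglongrightarrow> cis (\<Sum>k=1..K. t k * of_bool (even k)) * of_real (exp (- (\<Sum>k=1..K. (t k)\<^sup>2 * real k) / 2))"
proof -
  \<comment> \<open>The central limit estimate asks for a bound \<open>B\<close> on the coefficients
    at all indices, hence the cutoff outside \<open>{1..K}\<close>.\<close>
  define t' where "t' k = (if k \<in> {1..K} then t k else 0)" for k
  define B where "B = (\<Sum>k=1..K. \<bar>t k\<bar>)"
  have t': "\<bar>t' k\<bar> \<le> B" for k
    unfolding t'_def B_def by (auto intro: sum_nonneg member_le_sum[of k "{1..K}" "\<lambda>k. \<bar>t k\<bar>", simplified])
  let ?c = "\<Sum>k=1..K. t k * of_bool (even k)"
  let ?S = "\<lambda>n. cyc_sum n (simple n K) t'"
  have S: "?S n \<omega> = (\<Sum>k=1..K. t k * (\<Sum>xs\<in>simple_words n k. mon n (cyc xs) \<omega>))" for n \<omega>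
    unfolding cyc_sum_def sum_simple sum_distrib_left
    by (intro sum.cong refl) (auto simp: t'_def simple_words_def words_def)
  have "(\<lambda>n. expectation (\<lambda>\<omega>. cis (?S n \<omega>))) \<longlonglongrightarrow> of_real (exp (- (\<Sum>k=1..K. (t' k)\<^sup>2 * real k) / 2))"
    by (rule char_cyc_sum_tendsto[OF t'])
  also have "(\<Sum>k=1..K. (t' k)\<^sup>2 * real k) = (\<Sum>k=1..K. (t k)\<^sup>2 * real k)"
    by (intro sum.cong) (auto simp: t'_def)
  finally have A: "(\<lambda>n. cis ?c * expectation (\<lambda>\<omega>. cis (?S n \<omega>))) \<longlonglongrightarrow> cis ?c * of_real (exp (- (\<Sum>k=1..K. (t k)\<^sup>2 * real k) / 2))"
    by (rule tendsto_mult_left)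
  have bS: "bounded_rv (?S n)" for n by (rule bounded_rv_cyc_sum[of _ n K]) simp
  let ?r = "\<lambda>n k \<omega>. \<bar>closed_walks n k \<omega> - of_bool (even k) - (\<Sum>xs\<in>simple_words n k. mon n (cyc xs) \<omega>)\<bar>"
  have br: "bounded_rv (?r n k)" for n k
    by (intro bounded_rv_abs bounded_rv_diff bounded_rv_const bounded_rv_closed_walks bounded_rv_sum bounded_rv_word[of _ n k])
      (simp add: simple_words_def)
  have "(\<lambda>n. expectation (\<lambda>\<omega>. cis (\<Sum>k=1..K. t k * closed_walks n k \<omega>)) - cis ?c * expectation (\<lambda>\<omega>. cis (?S n \<omega>))) \<longlonglongrightarrow> 0"
  proof (rule Lim_null_comparison[OF always_eventually])
    have "(\<lambda>n. \<Sum>k=1..K. \<bar>t k\<bar> * expectation (?r n k)) \<longlonglongrightarrow> (\<Sum>k=1..K. \<bar>t k\<bar> * 0)"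
      by (intro tendsto_intros closed_walks_tendsto) auto
    then show "(\<lambda>n. \<Sum>k=1..K. \<bar>t k\<bar> * expectation (?r n k)) \<longlonglongrightarrow> 0" by simp
    show "\<forall>n. norm (expectation (\<lambda>\<omega>. cis (\<Sum>k=1..K. t k * closed_walks n k \<omega>)) - cis ?c * expectation (\<lambda>\<omega>. cis (?S n \<omega>)))
        \<le> (\<Sum>k=1..K. \<bar>t k\<bar> * expectation (?r n k))"
    proof
      fix n
      let ?T = "\<lambda>\<omega>. \<Sum>k=1..K. t k * closed_walks n k \<omega>"
      have bT: "bounded_rv ?T" by (intro bounded_rv_intros bounded_rv_closed_walks)
      have bcT: "bounded_rv (\<lambda>\<omega>. cis (?T \<omega>))" by (rule bounded_rv_cis[OF bounded_rv_measurable[OF bT]])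
      have bcS: "bounded_rv (\<lambda>\<omega>. cis (?S n \<omega>))" by (rule bounded_rv_cis[OF bounded_rv_measurable[OF bS]])
      have "norm (expectation (\<lambda>\<omega>. cis (?T \<omega>)) - cis ?c * expectation (\<lambda>\<omega>. cis (?S n \<omega>)))
          = norm (expectation (\<lambda>\<omega>. cis (?T \<omega>) - cis ?c * cis (?S n \<omega>)))"
        using bounded_rv_integrable[OF bcT] bounded_rv_integrable[OF bcS] by simp
      also have "\<dots> \<le> expectation (\<lambda>\<omega>. norm (cis (?T \<omega>) - cis ?c * cis (?S n \<omega>)))" by (rule integral_norm_bound)
      also have "\<dots> \<le> expectation (\<lambda>\<omega>. \<Sum>k=1..K. \<bar>t k\<bar> * ?r n k \<omega>)"
      proof (rule integral_mono)
        show "integrable M (\<lambda>\<omega>. norm (cis (?T \<omega>) - cis ?c * cis (?S n \<omega>)))"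
          by (intro integrable_norm bounded_rv_integrable bounded_rv_diff bounded_rv_mult bounded_rv_const bcT bcS)
        show "integrable M (\<lambda>\<omega>. \<Sum>k=1..K. \<bar>t k\<bar> * ?r n k \<omega>)"
          by (intro bounded_rv_integrable bounded_rv_sum bounded_rv_mult bounded_rv_const br)
        fix \<omega>
        have lip: "norm (cis x - cis y) \<le> \<bar>x - y\<bar>" for x y :: real
        proof -
          have "norm (cis x - cis y) = norm (cis y * (cis (x - y) - 1))"
            by (simp add: right_diff_distrib cis_mult)
          also have "\<dots> = norm (cis (x - y) - 1)" by (simp only: norm_mult norm_cis mult_1)
          also have "\<dots> = norm (iexp (x - y) - 1)" by (simp only: cis_conv_exp)
          also have "\<dots> \<le> \<bar>x - y\<bar>" using iexp_approx1[of "x - y" 0] by simp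
          finally show ?thesis .
        qed
        have "norm (cis (?T \<omega>) - cis ?c * cis (?S n \<omega>)) \<le> \<bar>?T \<omega> - (?c + ?S n \<omega>)\<bar>"
          unfolding cis_mult by (rule lip)
        also have "?T \<omega> - (?c + ?S n \<omega>) = (\<Sum>k=1..K. t k * (closed_walks n k \<omega> - of_bool (even k) - (\<Sum>xs\<in>simple_words n k. mon n (cyc xs) \<omega>)))"
          unfolding S by (simp add: right_diff_distrib sum_subtractf)
        also have "\<bar>\<dots>\<bar> \<le> (\<Sum>k=1..K. \<bar>t k\<bar> * ?r n k \<omega>)"
          unfolding abs_mult[symmetric] by (rule sum_abs)
        finally show "norm (cis (?T \<omega>) - cis ?c * cis (?S n \<omega>)) \<le> (\<Sum>k=1..K. \<bar>t k\<bar> * ?r n k \<omega>)" .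
      qed
      also have "\<dots> = (\<Sum>k=1..K. expectation (\<lambda>\<omega>. \<bar>t k\<bar> * ?r n k \<omega>))"
        by (intro Bochner_Integration.integral_sum bounded_rv_integrable bounded_rv_mult bounded_rv_const br)
      finally show "norm (expectation (\<lambda>\<omega>. cis (?T \<omega>)) - cis ?c * expectation (\<lambda>\<omega>. cis (?S n \<omega>))) \<le> (\<Sum>k=1..K. \<bar>t k\<bar> * expectation (?r n k))"
        by simp
    qed
  qed
  from tendsto_add[OF this A] show ?thesis by simp
qed

end

section \<open>Newton identities\<close>

text \<open>The coefficient of \<open>z ^ k\<close> in
  \<open>exp (- (T 1 * z + T 2 * z^2 / 2 + ...))\<close>, by the recursion that comes from the
  logarithmic derivative. For power sums these are the elementary symmetric polynomials with
  alternating signs.\<close>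

fun newton :: "(nat \<Rightarrow> 'a :: field_char_0) \<Rightarrow> nat \<Rightarrow> 'a" where
  "newton T 0 = 1"
| "newton T (Suc k) = - (\<Sum>i\<le>k. newton T i * T (Suc k - i)) / of_nat (Suc k)"

lemma newton_cong: "(\<And>i. 1 \<le> i \<Longrightarrow> i \<le> k \<Longrightarrow> T i = T' i) \<Longrightarrow> newton T k = newton T' k"
proof (induction k rule: less_induct)
  case (less k)
  show ?case
  proof (cases k)
    case (Suc m)
    have "newton T i * T (Suc m - i) = newton T' i * T' (Suc m - i)" if "i \<le> m" for i
      using less.IH[of i] less.prems that Suc by simp
    then show ?thesis by (simp add: Suc)
  qed simp
qed

lemma newton_of_real: "newton (\<lambda>k. of_real (T k) :: complex) k = of_real (newton T k)"
proof (induction k rule: less_induct)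
  case (less k)
  show ?case
  proof (cases k)
    case (Suc m)
    have "(\<Sum>i\<le>m. newton (\<lambda>k. complex_of_real (T k)) i * of_real (T (Suc m - i))) = of_real (\<Sum>i\<le>m. newton T i * T (Suc m - i))"
      unfolding of_real_sum of_real_mult by (intro sum.cong refl arg_cong2[where f = "(*)"] less.IH) (simp add: Suc)
    then show ?thesis
      unfolding Suc newton.simps by (simp only: of_real_divide of_real_minus of_real_of_nat_eq)
  qed simp
qed

text \<open>Comparison of coefficients in the differential equation reproduces the recursion. The
  same criterion identifies the determinant and, later, the limiting random function.\<close>

lemma fps_nth_eq_newton:
  fixes F :: "'a :: field_char_0 fps"
  assumes 0: "fps_nth F 0 = 1" and F: "fps_deriv F = - F * Abs_fps (\<lambda>k. T (Suc k))"
  shows "fps_nth F k = newton T k"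
proof (induction k rule: less_induct)
  case (less k)
  show ?case
  proof (cases k)
    case 0
    then show ?thesis using assms by simp
  next
    case (Suc m)
    have "of_nat (Suc m) * fps_nth F (Suc m) = fps_nth (fps_deriv F) m" by simp
    also have "\<dots> = - (\<Sum>i=0..m. fps_nth F i * T (Suc (m - i)))"
      unfolding F by (simp add: fps_mult_nth sum_negf)
    also have "(\<Sum>i=0..m. fps_nth F i * T (Suc (m - i))) = (\<Sum>i\<le>m. newton T i * T (Suc m - i))"
      by (rule sum.cong) (auto simp: less.IH Suc Suc_diff_le)
    finally have e: "of_nat (Suc m) * fps_nth F (Suc m) = - (\<Sum>i\<le>m. newton T i * T (Suc m - i))" .
    have "fps_nth F (Suc m) = of_nat (Suc m) * fps_nth F (Suc m) / of_nat (Suc m)"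
      by (simp del: of_nat_Suc)
    then show ?thesis unfolding e by (simp only: Suc newton.simps)
  qed
qed

text \<open>A factor \<open>1 - e * z\<close> contributes \<open>- e / (1 - e * z)\<close> to the
  logarithmic derivative, which generates the powers \<open>e ^ (k + 1)\<close> up to sign;
  \<open>geo\<close> is this geometric series without division.\<close>

lemma linear_factors_newton:
  fixes es :: "'a :: field_char_0 list"
  shows "coeff (\<Prod>e\<leftarrow>es. [:1, - e:]) k = newton (\<lambda>k. \<Sum>e\<leftarrow>es. e ^ k) k"
proof -
  define F where "F es = fps_of_poly (\<Prod>e\<leftarrow>es. [:1, - e:])" for es :: "'a list"
  define P where "P es = Abs_fps (\<lambda>k. \<Sum>e\<leftarrow>es. e ^ Suc k)" for es :: "'a list"
  have F_Cons: "F (e # es) = (1 - fps_const e * fps_X) * F es" for e es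
    unfolding F_def by (simp add: fps_of_poly_mult fps_of_poly_pCons mult.commute)
  have geo: "(1 - fps_const e * fps_X) * Abs_fps (\<lambda>k. e ^ Suc k) = fps_const e" for e :: 'a
  proof (rule fps_ext)
    fix k
    have "fps_nth ((1 - fps_const e * fps_X) * Abs_fps (\<lambda>k. e ^ Suc k)) k =
        e ^ Suc k - e * (if k = 0 then 0 else e ^ k)"
      by (cases k) (simp_all add: left_diff_distrib mult.assoc fps_mult_left_const_nth)
    then show "fps_nth ((1 - fps_const e * fps_X) * Abs_fps (\<lambda>k. e ^ Suc k)) k = fps_nth (fps_const e) k"
      by (cases k) simp_all
  qed
  have P_Cons: "P (e # es) = Abs_fps (\<lambda>k. e ^ Suc k) + P es" for e es
    by (simp add: P_def fps_eq_iff)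
  have deriv: "fps_deriv (F es) = - F es * P es" for es
  proof (induction es)
    case Nil
    have "P [] = 0" by (simp add: P_def fps_eq_iff)
    then show ?case by (simp add: F_def)
  next
    case (Cons e es)
    let ?l = "1 - fps_const e * fps_X" and ?g = "Abs_fps (\<lambda>k. e ^ Suc k)"
    have "fps_deriv (F (e # es)) = ?l * fps_deriv (F es) - fps_const e * F es"
      unfolding F_Cons by (simp add: fps_deriv_mult del: fps_const_neg)
    also have "\<dots> = ?l * (- F es * P es) - (?l * ?g) * F es"
      unfolding Cons geo ..
    also have "\<dots> = - (?l * F es) * (?g + P es)" by (simp add: algebra_simps)
    finally show ?case unfolding F_Cons P_Cons .
  qed
  have "coeff (\<Prod>e\<leftarrow>es. [:1, - e:]) 0 = 1"
    by (induction es) (simp_all add: coeff_mult)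
  then have "fps_nth (F es) k = newton (\<lambda>k. \<Sum>e\<leftarrow>es. e ^ k) k"
    using deriv[of es] unfolding P_def by (intro fps_nth_eq_newton) (simp_all add: F_def)
  then show ?thesis by (simp add: F_def)
qed

text \<open>The polynomial is the reversed characteristic polynomial: for
  \<open>z \<noteq> 0\<close> a factor \<open>z ^ n\<close> is extracted and the characteristic
  polynomial is evaluated at \<open>1 / z\<close>, which is why the origin is treated
  separately.\<close>

lemma det_one_minus_smult:
  fixes A :: "complex mat"
  assumes A: "A \<in> carrier_mat n n" and es: "char_poly A = (\<Prod>e\<leftarrow>es. [:- e, 1:])" "length es = n"
  shows "det (1\<^sub>m n - z \<cdot>\<^sub>m A) = poly (\<Prod>e\<leftarrow>es. [:1, - e:]) z"
proof (cases "z = 0")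
  case True
  have "1\<^sub>m n - 0 \<cdot>\<^sub>m A = 1\<^sub>m n" using A by (intro eq_matI) auto
  moreover have "poly (\<Prod>e\<leftarrow>es. [:1, - e:]) 0 = 1" by (induction es) auto
  ultimately show ?thesis using True by simp
next
  case False
  have "1\<^sub>m n - z \<cdot>\<^sub>m A = z \<cdot>\<^sub>m (- char_matrix A (1 / z))"
    using A False by (intro eq_matI) (auto simp: char_matrix_def field_simps)
  then have "det (1\<^sub>m n - z \<cdot>\<^sub>m A) = z ^ n * det (- char_matrix A (1 / z))"
    using A by (simp add: char_matrix_def)
  also have "det (- char_matrix A (1 / z)) = poly (char_poly A) (1 / z)"
    using char_poly_matrix[OF A, of "1 / z"] by simp
  also have "z ^ n * poly (char_poly A) (1 / z) = poly (\<Prod>e\<leftarrow>es. [:1, - e:]) z"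
    unfolding es(1) es(2)[symmetric]
    by (induction es) (use False in \<open>auto simp: field_simps\<close>)
  finally show ?thesis .
qed

lemma mat_trace_mult_commute:
  fixes A B :: "'a :: comm_ring_1 mat"
  assumes "A \<in> carrier_mat n n" "B \<in> carrier_mat n n"
  shows "mat_trace (A * B) = mat_trace (B * A)"
proof -
  have "mat_trace (A * B) = (\<Sum>i<n. \<Sum>j<n. A $$ (i, j) * B $$ (j, i))"
    using assms by (simp add: mat_trace_def scalar_prod_def atLeast0LessThan)
  also have "\<dots> = (\<Sum>j<n. \<Sum>i<n. B $$ (j, i) * A $$ (i, j))"
    by (subst sum.swap) (simp add: mult.commute)
  also have "\<dots> = mat_trace (B * A)"
    using assms by (simp add: mat_trace_def scalar_prod_def atLeast0LessThan)
  finally show ?thesis .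
qed

lemma upper_triangular_power:
  fixes B :: "'a :: comm_ring_1 mat"
  assumes B: "B \<in> carrier_mat n n" and u: "upper_triangular B"
  shows "upper_triangular (B ^\<^sub>m k) \<and> (\<forall>i<n. (B ^\<^sub>m k) $$ (i, i) = (B $$ (i, i)) ^ k)"
proof (induction k)
  case 0
  then show ?case using B by auto
next
  case (Suc k)
  have C: "B ^\<^sub>m k \<in> carrier_mat n n" using B by simp
  have entry: "(B ^\<^sub>m k * B) $$ (i, j) = (\<Sum>l<n. (B ^\<^sub>m k) $$ (i, l) * B $$ (l, j))" if "i < n" "j < n" for i j
    using that B C by (simp add: scalar_prod_def atLeast0LessThan)
  have z1: "(B ^\<^sub>m k) $$ (i, l) = 0" if "l < i" "i < n" for i l
    using Suc that C by (auto elim: upper_triangularD)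
  have z2: "B $$ (l, j) = 0" if "j < l" "l < n" for j l
    using u that B by (auto elim: upper_triangularD)
  have "(B ^\<^sub>m k * B) $$ (i, j) = 0" if "j < i" "i < n" for i j
  proof -
    have "(B ^\<^sub>m k) $$ (i, l) * B $$ (l, j) = 0" if "l < n" for l
      using z1[of l i] z2[of j l] that \<open>j < i\<close> \<open>i < n\<close> by (cases "l < i") auto
    then show ?thesis using entry[of i j] that by simp
  qed
  moreover have "(B ^\<^sub>m k * B) $$ (i, i) = (B $$ (i, i)) ^ Suc k" if i: "i < n" for i
  proof -
    have "(\<Sum>l<n. (B ^\<^sub>m k) $$ (i, l) * B $$ (l, i)) = (\<Sum>l\<in>{i}. (B ^\<^sub>m k) $$ (i, l) * B $$ (l, i))"
    proof (rule sum.mono_neutral_right)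
      show "\<forall>l\<in>{..<n} - {i}. (B ^\<^sub>m k) $$ (i, l) * B $$ (l, i) = 0"
      proof
        fix l assume "l \<in> {..<n} - {i}"
        then show "(B ^\<^sub>m k) $$ (i, l) * B $$ (l, i) = 0"
          using z1[of l i] z2[of i l] i by (cases "l < i") auto
      qed
    qed (use i in auto)
    then show ?thesis using entry[OF i i] Suc i by (simp add: mult.commute)
  qed
  ultimately show ?case using B by (auto intro!: upper_triangularI)
qed

text \<open>Schur triangularization: the trace is invariant under similarity, and a power of a
  triangular matrix has the powers of the eigenvalues on its diagonal.\<close>

lemma mat_trace_power_eigenvalues:
  fixes A :: "complex mat"
  assumes A: "A \<in> carrier_mat n n" and es: "char_poly A = (\<Prod>e\<leftarrow>es. [:- e, 1:])"
  shows "mat_trace (A ^\<^sub>m k) = (\<Sum>e\<leftarrow>es. e ^ k)"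
proof -
  obtain B P Q where d: "schur_decomposition A es = (B, P, Q)" by (cases "schur_decomposition A es") auto
  from schur_decomposition[OF A es d]
  have w: "similar_mat_wit A B P Q" and u: "upper_triangular B" and diag: "diag_mat B = es" by auto
  from similar_mat_witD2[OF A w] have c: "B \<in> carrier_mat n n" "P \<in> carrier_mat n n" "Q \<in> carrier_mat n n" and QP: "Q * P = 1\<^sub>m n" by auto
  have Bk: "B ^\<^sub>m k \<in> carrier_mat n n" using c by simp
  have "A ^\<^sub>m k = P * B ^\<^sub>m k * Q" by (rule similar_mat_wit_pow_id[OF w])
  then have "mat_trace (A ^\<^sub>m k) = mat_trace ((P * B ^\<^sub>m k) * Q)" by simp
  also have "\<dots> = mat_trace (Q * (P * B ^\<^sub>m k))"
    using c Bk by (intro mat_trace_mult_commute) auto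
  also have "Q * (P * B ^\<^sub>m k) = B ^\<^sub>m k"
    using c Bk QP by (subst assoc_mult_mat[symmetric, of _ n n _ n _ n]) auto
  also have "mat_trace (B ^\<^sub>m k) = (\<Sum>i<n. (B $$ (i, i)) ^ k)"
    using upper_triangular_power[OF c(1) u, of k] c by (simp add: mat_trace_def)
  also have "\<dots> = (\<Sum>e\<leftarrow>es. e ^ k)"
    using c diag[symmetric] by (simp add: diag_mat_def interv_sum_list_conv_sum_set_nat atLeast0LessThan o_def)
  finally show ?thesis .
qed

section \<open>Expansion of the determinant over principal minors\<close>

definition det_coeff :: "nat \<Rightarrow> (nat \<times> nat \<Rightarrow> 'a :: comm_ring_1) \<Rightarrow> nat \<Rightarrow> 'a" where
  "det_coeff n y k = (- 1) ^ k * (\<Sum>S | S \<subseteq> {..<n} \<and> card S = k. \<Sum>\<sigma> | \<sigma> permutes S. signof \<sigma> * (\<Prod>i\<in>S. y (i, \<sigma> i)))"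

text \<open>The product over rows is expanded: \<open>S\<close> is the set of rows from which the
  entry of \<open>- z A\<close> is taken. The rows outside \<open>S\<close> supply identity entries,
  so the permutation has to fix them and is a permutation of \<open>S\<close>, which leaves a
  principal minor.\<close>

lemma det_one_minus_smult_expand:
  fixes A :: "'a :: comm_ring_1 mat"
  assumes A: "A \<in> carrier_mat n n"
  shows "det (1\<^sub>m n - z \<cdot>\<^sub>m A) = (\<Sum>k\<le>n. det_coeff n (\<lambda>p. A $$ p) k * z ^ k)"
proof -
  let ?N = "{..<n}"
  let ?d = "\<lambda>i j. if i = j then 1 else 0 :: 'a"
  have finN: "finite {\<sigma>. \<sigma> permutes ?N}" by (simp add: finite_permutations)
  have restr: "(\<Prod>i\<in>?N - S. ?d i (\<sigma> i)) = (if \<sigma> permutes S then 1 else 0)" if S: "S \<subseteq> ?N" and \<sigma>: "\<sigma> permutes ?N" for S \<sigma>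
  proof (cases "\<sigma> permutes S")
    case True
    then have "\<sigma> i = i" if "i \<notin> S" for i using that by (simp add: permutes_not_in)
    then show ?thesis using True by simp
  next
    case False
    have "\<exists>i\<in>?N - S. \<sigma> i \<noteq> i"
    proof (rule ccontr)
      assume "\<not> ?thesis"
      then have "\<sigma> permutes S" using \<sigma> by (intro permutes_superset[OF \<sigma>]) auto
      with False show False ..
    qed
    then obtain i where i: "i \<in> ?N - S" "\<sigma> i \<noteq> i" by blast
    then have "(\<Prod>i\<in>?N - S. ?d i (\<sigma> i)) = 0" by (intro prod_zero bexI[of _ i]) auto
    then show ?thesis using False by simp
  qed
  have "det (1\<^sub>m n - z \<cdot>\<^sub>m A) = (\<Sum>\<sigma> | \<sigma> permutes ?N. signof \<sigma> * (\<Prod>i\<in>?N. (1\<^sub>m n - z \<cdot>\<^sub>m A) $$ (i, \<sigma> i)))"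
    using A by (subst det_def'[of _ n]) (auto simp: atLeast0LessThan)
  also have "\<dots> = (\<Sum>\<sigma> | \<sigma> permutes ?N. signof \<sigma> * (\<Prod>i\<in>?N. (- z * A $$ (i, \<sigma> i)) + ?d i (\<sigma> i)))"
  proof (intro sum.cong refl arg_cong2[where f = "(*)"] prod.cong)
    fix \<sigma> i assume "\<sigma> \<in> {\<sigma>. \<sigma> permutes ?N}" "i \<in> ?N"
    then have "i < n" "\<sigma> i < n" using permutes_in_image[of \<sigma> ?N i] by auto
    then show "(1\<^sub>m n - z \<cdot>\<^sub>m A) $$ (i, \<sigma> i) = - z * A $$ (i, \<sigma> i) + ?d i (\<sigma> i)" using A by auto
  qed
  also have "\<dots> = (\<Sum>\<sigma> | \<sigma> permutes ?N. \<Sum>S\<in>Pow ?N. signof \<sigma> * ((\<Prod>i\<in>S. - z * A $$ (i, \<sigma> i)) * (if \<sigma> permutes S then 1 else 0)))"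
  proof (rule sum.cong[OF refl])
    fix \<sigma> assume "\<sigma> \<in> {\<sigma>. \<sigma> permutes ?N}"
    then have \<sigma>: "\<sigma> permutes ?N" by simp
    have "(\<Prod>i\<in>?N. - z * A $$ (i, \<sigma> i) + ?d i (\<sigma> i)) = (\<Sum>S\<in>Pow ?N. (\<Prod>i\<in>S. - z * A $$ (i, \<sigma> i)) * (\<Prod>i\<in>?N - S. ?d i (\<sigma> i)))"
      by (rule prod_add) simp
    also have "\<dots> = (\<Sum>S\<in>Pow ?N. (\<Prod>i\<in>S. - z * A $$ (i, \<sigma> i)) * (if \<sigma> permutes S then 1 else 0))"
      by (rule sum.cong[OF refl], rule arg_cong2[where f = "(*)", OF refl restr[OF _ \<sigma>]]) simp
    finally show "signof \<sigma> * (\<Prod>i\<in>?N. - z * A $$ (i, \<sigma> i) + ?d i (\<sigma> i)) =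
        (\<Sum>S\<in>Pow ?N. signof \<sigma> * ((\<Prod>i\<in>S. - z * A $$ (i, \<sigma> i)) * (if \<sigma> permutes S then 1 else 0)))"
      by (simp only: sum_distrib_left)
  qed
  also have "\<dots> = (\<Sum>S\<in>Pow ?N. \<Sum>\<sigma> | \<sigma> permutes ?N. signof \<sigma> * ((\<Prod>i\<in>S. - z * A $$ (i, \<sigma> i)) * (if \<sigma> permutes S then 1 else 0)))"
    by (rule sum.swap)
  also have "\<dots> = (\<Sum>S\<in>Pow ?N. \<Sum>\<sigma> | \<sigma> permutes S. signof \<sigma> * (\<Prod>i\<in>S. - z * A $$ (i, \<sigma> i)))"
  proof (rule sum.cong[OF refl])
    fix S assume S: "S \<in> Pow ?N"
    show "(\<Sum>\<sigma> | \<sigma> permutes ?N. signof \<sigma> * ((\<Prod>i\<in>S. - z * A $$ (i, \<sigma> i)) * (if \<sigma> permutes S then 1 else 0)))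
        = (\<Sum>\<sigma> | \<sigma> permutes S. signof \<sigma> * (\<Prod>i\<in>S. - z * A $$ (i, \<sigma> i)))"
      using S permutes_subset[of _ S ?N] by (intro sum.mono_neutral_cong_right finN) auto
  qed
  also have "\<dots> = (\<Sum>S\<in>Pow ?N. (- z) ^ card S * (\<Sum>\<sigma> | \<sigma> permutes S. signof \<sigma> * (\<Prod>i\<in>S. A $$ (i, \<sigma> i))))"
    unfolding prod.distrib by (intro sum.cong refl) (simp add: sum_distrib_left mult_ac)
  also have "\<dots> = (\<Sum>k\<le>n. \<Sum>S | S \<in> Pow ?N \<and> card S = k. (- z) ^ card S * (\<Sum>\<sigma> | \<sigma> permutes S. signof \<sigma> * (\<Prod>i\<in>S. A $$ (i, \<sigma> i))))"
  proof (rule sum.group[symmetric])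
    show "card ` Pow ?N \<subseteq> {..n}" using card_mono[of ?N] by auto
  qed auto
  also have "\<dots> = (\<Sum>k\<le>n. det_coeff n (\<lambda>p. A $$ p) k * z ^ k)"
  proof (rule sum.cong[OF refl])
    fix k
    have "(\<Sum>S | S \<in> Pow ?N \<and> card S = k. (- z) ^ card S * (\<Sum>\<sigma> | \<sigma> permutes S. signof \<sigma> * (\<Prod>i\<in>S. A $$ (i, \<sigma> i))))
      = (\<Sum>S | S \<subseteq> ?N \<and> card S = k. (- z) ^ k * (\<Sum>\<sigma> | \<sigma> permutes S. signof \<sigma> * (\<Prod>i\<in>S. A $$ (i, \<sigma> i))))"
      by (intro sum.cong) auto
    also have "\<dots> = (- z) ^ k * (\<Sum>S | S \<subseteq> ?N \<and> card S = k. \<Sum>\<sigma> | \<sigma> permutes S. signof \<sigma> * (\<Prod>i\<in>S. A $$ (i, \<sigma> i)))"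
      by (simp add: sum_distrib_left)
    also have "(- z) ^ k = (- 1) ^ k * z ^ k" by (rule power_minus)
    finally show "(\<Sum>S | S \<in> Pow ?N \<and> card S = k. (- z) ^ card S * (\<Sum>\<sigma> | \<sigma> permutes S. signof \<sigma> * (\<Prod>i\<in>S. A $$ (i, \<sigma> i))))
      = det_coeff n (\<lambda>p. A $$ p) k * z ^ k" by (simp add: det_coeff_def mult_ac)
  qed
  finally show ?thesis .
qed

text \<open>Two expansions of one polynomial, over principal minors and over the eigenvalues. They
  agree at every complex \<open>z\<close>, hence coefficientwise. The minors give second moments,
  the eigenvalues give traces.\<close>

lemma det_coeff_eq_newton:
  fixes A :: "complex mat"
  assumes A: "A \<in> carrier_mat n n" and k: "k \<le> n"
  shows "det_coeff n (\<lambda>p. A $$ p) k = newton (\<lambda>k. mat_trace (A ^\<^sub>m k)) k"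
proof -
  obtain es where es: "char_poly A = (\<Prod>e\<leftarrow>es. [:- e, 1:])" "length es = n"
    using char_poly_factorized[OF A] by blast
  let ?p = "\<Sum>k\<le>n. monom (det_coeff n (\<lambda>p. A $$ p) k) k"
  have "poly ?p = poly (\<Prod>e\<leftarrow>es. [:1, - e:])"
    using det_one_minus_smult[OF A es] det_one_minus_smult_expand[OF A]
    by (auto simp: poly_sum poly_monom)
  then have "?p = (\<Prod>e\<leftarrow>es. [:1, - e:])" by (simp add: poly_eq_poly_eq_iff)
  then have "coeff ?p k = newton (\<lambda>k. \<Sum>e\<leftarrow>es. e ^ k) k" using linear_factors_newton[of es k] by simp
  moreover have "coeff ?p k = det_coeff n (\<lambda>p. A $$ p) k"
    using k by (simp add: coeff_sum)
  ultimately show ?thesis by (simp add: mat_trace_power_eigenvalues[OF A es(1)])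
qed

section \<open>Traces of powers as sums over words\<close>

lemma mat_power_Suc_left:
  assumes A: "A \<in> carrier_mat n n"
  shows "A ^\<^sub>m Suc k = A * A ^\<^sub>m k"
proof (induction k)
  case 0
  then show ?case using A by simp
next
  case (Suc k)
  have "A ^\<^sub>m Suc (Suc k) = (A * A ^\<^sub>m k) * A" using Suc by simp
  also have "\<dots> = A * (A ^\<^sub>m k * A)" using A by (intro assoc_mult_mat[of _ n n _ n _ n]) auto
  finally show ?case by simp
qed

text \<open>Multiplication unrolled from the left; \<open>xs\<close> lists the \<open>k\<close>
  intermediate indices of a walk from \<open>i\<close> to \<open>j\<close>, so the power has
  exponent \<open>Suc k\<close>.\<close>

lemma mat_power_entry:
  fixes A :: "'a :: comm_semiring_1 mat"
  assumes A: "A \<in> carrier_mat n n" and ij: "i < n" "j < n"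
  shows "(A ^\<^sub>m Suc k) $$ (i, j) = (\<Sum>xs\<in>words n k. \<Prod>p\<leftarrow>zip (i # xs) (xs @ [j]). A $$ p)"
  using ij(1)
proof (induction k arbitrary: i)
  case 0
  have "words n 0 = {[]}" by (auto simp: words_def)
  then show ?case using A by simp
next
  case (Suc k)
  have "(A ^\<^sub>m Suc (Suc k)) $$ (i, j) = (A * A ^\<^sub>m Suc k) $$ (i, j)"
    using mat_power_Suc_left[OF A, of "Suc k"] by simp
  also have "\<dots> = (\<Sum>x<n. A $$ (i, x) * (A ^\<^sub>m Suc k) $$ (x, j))"
    using A ij Suc.prems by (subst index_mult_mat) (auto simp: scalar_prod_def atLeast0LessThan simp del: pow_mat.simps)
  also have "\<dots> = (\<Sum>x<n. \<Sum>xs\<in>words n k. A $$ (i, x) * (\<Prod>p\<leftarrow>zip (x # xs) (xs @ [j]). A $$ p))"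
    by (intro sum.cong refl) (simp only: Suc.IH lessThan_iff sum_distrib_left)
  also have "\<dots> = (\<Sum>xs\<in>words n (Suc k). \<Prod>p\<leftarrow>zip (i # xs) (xs @ [j]). A $$ p)"
    unfolding words_Suc by (subst sum.reindex) (auto simp: inj_on_def sum.cartesian_product intro!: sum.cong)
  finally show ?case .
qed

lemma mat_trace_power_eq_words:
  fixes A :: "'a :: comm_semiring_1 mat"
  assumes A: "A \<in> carrier_mat n n" and k: "k \<ge> 1"
  shows "mat_trace (A ^\<^sub>m k) = (\<Sum>xs\<in>words n k. \<Prod>p\<leftarrow>cyc xs. A $$ p)"
proof -
  obtain m where m: "k = Suc m" using k by (cases k) auto
  have "mat_trace (A ^\<^sub>m k) = (\<Sum>i<n. \<Sum>xs\<in>words n m. \<Prod>p\<leftarrow>zip (i # xs) (xs @ [i]). A $$ p)"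
    using A unfolding m mat_trace_def by (intro sum.cong) (auto simp del: pow_mat.simps simp: mat_power_entry)
  also have "\<dots> = (\<Sum>xs\<in>words n k. \<Prod>p\<leftarrow>cyc xs. A $$ p)"
    unfolding words_Suc m by (subst sum.reindex) (auto simp: inj_on_def cyc_def sum.cartesian_product intro!: sum.cong)
  finally show ?thesis .
qed

section \<open>Random power series on the disc\<close>

definition disc_coeffs :: "(nat \<Rightarrow> real) \<Rightarrow> bool" where
  "disc_coeffs x \<longleftrightarrow> (\<forall>r. 0 \<le> r \<longrightarrow> r < 1 \<longrightarrow> summable (\<lambda>k. \<bar>x k\<bar> * r ^ k))"

definition power_series :: "(nat \<Rightarrow> real) \<Rightarrow> complex \<Rightarrow> complex" where
  "power_series x = (\<lambda>z\<in>ball 0 1. \<Sum>k. of_real (x k) * z ^ k)"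

lemma disc_coeffs_summable_norm:
  assumes "disc_coeffs x" "norm z < 1"
  shows "summable (\<lambda>k. norm (complex_of_real (x k) * z ^ k))"
  using assms unfolding disc_coeffs_def by (simp add: norm_mult norm_power)

lemma disc_coeffs_summable:
  assumes "disc_coeffs x" "norm z < 1"
  shows "summable (\<lambda>k. complex_of_real (x k) * z ^ k)"
  by (rule summable_norm_cancel[OF disc_coeffs_summable_norm[OF assms]])

lemma disc_coeffs_if_bounded:
  assumes b: "disc_coeffs b" and le: "\<And>k. \<bar>x k\<bar> \<le> \<bar>b k\<bar>"
  shows "disc_coeffs x"
  unfolding disc_coeffs_def
proof (intro allI impI)
  fix r :: real assume r: "0 \<le> r" "r < 1"
  then have "summable (\<lambda>k. \<bar>b k\<bar> * r ^ k)" using b by (simp add: disc_coeffs_def)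
  then show "summable (\<lambda>k. \<bar>x k\<bar> * r ^ k)"
    by (rule summable_comparison_test'[where N = 0]) (use r le in \<open>auto intro!: mult_right_mono\<close>)
qed

text \<open>This envelope is mild enough to converge on the disc, while its inverse squares are
  summable, so that coefficients with second moments at most 1 rarely exceed it.\<close>

lemma disc_coeffs_linear: "disc_coeffs (\<lambda>k. A * (real k + 1))"
  unfolding disc_coeffs_def
proof (intro allI impI)
  fix r :: real assume "0 \<le> r" "r < 1"
  then have "summable (\<lambda>k. of_nat (Suc k) * r ^ k)"
    using geometric_deriv_sums[of r] by (auto simp: sums_iff)
  then have "summable (\<lambda>k. \<bar>A\<bar> * (of_nat (Suc k) * r ^ k))" by (rule summable_mult)
  moreover have "\<bar>A * (real k + 1)\<bar> * r ^ k = \<bar>A\<bar> * (of_nat (Suc k) * r ^ k)" for k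
    by (simp add: abs_mult)
  ultimately show "summable (\<lambda>k. \<bar>A * (real k + 1)\<bar> * r ^ k)" by (simp only:)
qed

lemma power_series_holomorphic:
  assumes "disc_coeffs x"
  shows "power_series x \<in> disc_holomorphic"
proof -
  let ?f = "\<lambda>z. \<Sum>k. complex_of_real (x k) * z ^ k"
  have "(?f has_field_derivative (\<Sum>k. diffs (\<lambda>k. complex_of_real (x k)) k * z ^ k)) (at z)" if "norm z < 1" for z
    using disc_coeffs_summable[OF assms] that by (rule termdiffs_strong')
  then have "?f holomorphic_on ball 0 1"
    unfolding holomorphic_on_open[OF open_ball] by (metis mem_ball_0)
  then have "power_series x holomorphic_on ball 0 1"
    by (rule holomorphic_transform) (simp add: power_series_def)
  then show ?thesis by (simp add: disc_holomorphic_def power_series_def)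
qed

text \<open>A weighted \<open>l1\<close> distance of the coefficients controls the functions
  uniformly on the disc of radius \<open>r\<close>. All topological statements below are reduced to
  it.\<close>

lemma power_series_diff_le:
  assumes x: "disc_coeffs x" and y: "disc_coeffs y" and z: "norm z \<le> r" "r < 1"
  shows "norm (power_series x z - power_series y z) \<le> (\<Sum>k. \<bar>x k - y k\<bar> * r ^ k)"
proof -
  have r: "0 \<le> r" using z(1) norm_ge_zero order_trans by blast
  have zb: "norm z < 1" using z by simp
  have sxy: "summable (\<lambda>k. \<bar>x k - y k\<bar> * r ^ k)"
  proof (rule summable_comparison_test'[where N = 0])
    show "summable (\<lambda>k. \<bar>x k\<bar> * r ^ k + \<bar>y k\<bar> * r ^ k)"
      using x y r z by (intro summable_add) (auto simp: disc_coeffs_def)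
    show "norm (\<bar>x k - y k\<bar> * r ^ k) \<le> \<bar>x k\<bar> * r ^ k + \<bar>y k\<bar> * r ^ k" for k
      using mult_right_mono[OF abs_triangle_ineq4[of "x k" "y k"], of "r ^ k"] r by (simp add: distrib_right)
  qed
  have le: "norm (complex_of_real (x k) * z ^ k - complex_of_real (y k) * z ^ k) \<le> \<bar>x k - y k\<bar> * r ^ k" for k
  proof -
    have "norm (complex_of_real (x k) * z ^ k - complex_of_real (y k) * z ^ k) = norm (complex_of_real (x k - y k) * z ^ k)"
      by (simp add: left_diff_distrib)
    also have "\<dots> = \<bar>x k - y k\<bar> * norm z ^ k" by (simp only: norm_mult norm_power norm_of_real)
    also have "\<dots> \<le> \<bar>x k - y k\<bar> * r ^ k" using z by (intro mult_left_mono power_mono) auto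
    finally show ?thesis .
  qed
  have "power_series x z - power_series y z = (\<Sum>k. complex_of_real (x k) * z ^ k - complex_of_real (y k) * z ^ k)"
    using zb disc_coeffs_summable[OF x zb] disc_coeffs_summable[OF y zb] by (simp add: power_series_def suminf_diff)
  also have "norm \<dots> \<le> (\<Sum>k. \<bar>x k - y k\<bar> * r ^ k)"
    by (rule norm_suminf_le[OF le sxy])
  finally show ?thesis .
qed

lemma compact_subset_cball:
  assumes "compact K" "K \<subseteq> ball (0 :: complex) 1"
  obtains r where "0 \<le> r" "r < 1" "K \<subseteq> cball 0 r"
proof (cases "K = {}")
  case True
  then show ?thesis using that[of 0] by simp
next
  case False
  have "\<exists>z\<in>K. \<forall>w\<in>K. norm w \<le> norm z"
    using assms(1) False by (intro continuous_attains_sup continuous_intros) auto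
  then obtain z where "z \<in> K" "\<forall>w\<in>K. norm w \<le> norm z" by blast
  then show ?thesis using assms(2) by (intro that[of "norm z"]) auto
qed

text \<open>The common majorant lets Tannery's theorem interchange the limit with the series at a
  radius \<open>r\<close> whose disc contains the given compact set.\<close>

lemma power_series_limitin:
  assumes b: "disc_coeffs b" and le: "\<And>n k. \<bar>x n k\<bar> \<le> \<bar>b k\<bar>"
    and lim: "\<And>k. (\<lambda>n. x n k) \<longlonglongrightarrow> y k"
  shows "limitin disc_holomorphic_topology (\<lambda>n. power_series (x n)) (power_series y) sequentially"
  unfolding limitin_disc_holomorphic_topology
proof (intro conjI allI impI always_eventually)
  have xn: "disc_coeffs (x n)" for n by (rule disc_coeffs_if_bounded[OF b le])
  have "\<bar>y k\<bar> \<le> \<bar>b k\<bar>" for k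
    by (rule LIMSEQ_le_const2[OF tendsto_rabs[OF lim]]) (use le in auto)
  then have y: "disc_coeffs y" by (rule disc_coeffs_if_bounded[OF b])
  show "power_series y \<in> disc_holomorphic" by (rule power_series_holomorphic[OF y])
  show "power_series (x n) \<in> disc_holomorphic" for n by (rule power_series_holomorphic[OF xn])
  fix K :: "complex set" assume "compact K \<and> K \<subseteq> ball 0 1"
  then obtain r where r: "0 \<le> r" "r < 1" "K \<subseteq> cball 0 r" using compact_subset_cball by metis
  have "(\<lambda>n. \<Sum>k. \<bar>x n k - y k\<bar> * r ^ k) \<longlonglongrightarrow> (\<Sum>k. 0)"
  proof -
    have sM: "summable (\<lambda>k. (\<bar>b k\<bar> + \<bar>y k\<bar>) * r ^ k)"
      unfolding distrib_right using b y r by (intro summable_add) (auto simp: disc_coeffs_def)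
    have "norm (\<bar>x n k - y k\<bar> * r ^ k) \<le> (\<bar>b k\<bar> + \<bar>y k\<bar>) * r ^ k" for n k
    proof -
      have "\<bar>x n k - y k\<bar> \<le> \<bar>b k\<bar> + \<bar>y k\<bar>" using le[of n k] by linarith
      then show ?thesis using r by (simp add: abs_mult mult_right_mono)
    qed
    then have bd: "eventually (\<lambda>(k, n). norm (\<bar>x n k - y k\<bar> * r ^ k) \<le> (\<bar>b k\<bar> + \<bar>y k\<bar>) * r ^ k) (at_top \<times>\<^sub>F sequentially)"
      by (intro always_eventually) auto
    have "(\<lambda>n. \<bar>x n k - y k\<bar> * r ^ k) \<longlonglongrightarrow> 0" for k
    proof -
      have "(\<lambda>n. \<bar>x n k - y k\<bar> * r ^ k) \<longlonglongrightarrow> \<bar>y k - y k\<bar> * r ^ k" by (intro tendsto_intros lim)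
      then show ?thesis by simp
    qed
    from tannerys_theorem[OF this bd sM] show ?thesis by simp
  qed
  then have S: "(\<lambda>n. \<Sum>k. \<bar>x n k - y k\<bar> * r ^ k) \<longlonglongrightarrow> 0" by simp
  show "uniform_limit K (\<lambda>n. power_series (x n)) (power_series y) sequentially"
    unfolding uniform_limit_iff
  proof (intro allI impI)
    fix e :: real assume "e > 0"
    from order_tendstoD(2)[OF S this]
    show "\<forall>\<^sub>F n in sequentially. \<forall>z\<in>K. dist (power_series (x n) z) (power_series y z) < e"
    proof eventually_elim
      case (elim n)
      show ?case
      proof
        fix z assume "z \<in> K"
        then have "norm z \<le> r" using r by auto
        from power_series_diff_le[OF xn[of n] y this r(2)] elim
        show "dist (power_series (x n) z) (power_series y z) < e" by (simp add: dist_norm)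
      qed
    qed
  qed
qed

text \<open>An open set is the countable union of the sets of functions close on \<open>cball 0 (1 - 1/(m+1))\<close> to
  a polynomial with rational coefficients.\<close>

lemma measurable_power_series:
  assumes x: "\<And>k. (\<lambda>\<omega>. x \<omega> k) \<in> borel_measurable M" and good: "\<And>\<omega>. disc_coeffs (x \<omega>)"
  shows "(\<lambda>\<omega>. power_series (x \<omega>)) \<in> measurable M (borel_of disc_holomorphic_topology)"
  unfolding borel_of_def
proof (rule measurable_measure_of)
  let ?T = disc_holomorphic_topology
  show "{U. openin ?T U} \<subseteq> Pow (topspace ?T)" using openin_subset[of ?T] by blast
  show "(\<lambda>\<omega>. power_series (x \<omega>)) \<in> space M \<rightarrow> topspace ?T"
    using good by (auto simp: topspace_disc_holomorphic_topology power_series_holomorphic)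
  fix U assume "U \<in> {U. openin ?T U}"
  then have U: "openin_disc_holomorphic U" by (simp add: openin_disc_holomorphic_topology)
  define qc :: "rat list \<Rightarrow> nat \<Rightarrow> real" where "qc q k = (if k < length q then of_rat (q ! k) else 0)" for q k
  define rr where "rr m = 1 - 1 / (real m + 1)" for m :: nat
  have rr: "0 \<le> rr m" "rr m < 1" for m by (auto simp: rr_def field_simps)
  have qg: "disc_coeffs (qc q)" for q
    unfolding disc_coeffs_def
  proof (intro allI impI)
    fix r :: real
    show "summable (\<lambda>k. \<bar>qc q k\<bar> * r ^ k)"
      by (rule summable_finite[of "{..<length q}"]) (auto simp: qc_def)
  qed
  define \<I> where "\<I> = {(q, m, j :: nat). \<forall>h\<in>disc_holomorphic.
      (\<forall>z. norm z \<le> rr m \<longrightarrow> norm (h z - power_series (qc q) z) \<le> 1 / (real j + 1)) \<longrightarrow> h \<in> U}"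
  define E where "E q m j = {\<omega>\<in>space M. (\<Sum>k. \<bar>x \<omega> k - qc q k\<bar> * rr m ^ k) \<le> 1 / (real j + 1)}" for q m and j :: nat
  have cI: "countable \<I>" by simp
  have EM: "E q m j \<in> sets M" for q m j
  proof -
    have [measurable]: "(\<lambda>\<omega>. x \<omega> k) \<in> borel_measurable M" for k by (rule x)
    show ?thesis unfolding E_def by measurable
  qed
  have "(\<lambda>\<omega>. power_series (x \<omega>)) -` U \<inter> space M = (\<Union>(q, m, j)\<in>\<I>. E q m j)"
  proof (intro equalityI subsetI)
    fix \<omega> assume "\<omega> \<in> (\<lambda>\<omega>. power_series (x \<omega>)) -` U \<inter> space M"
    then have \<omega>: "power_series (x \<omega>) \<in> U" "\<omega> \<in> space M" by auto
    obtain K e where K: "compact K" "K \<subseteq> ball 0 1" "0 < e"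
      "\<And>g. g \<in> disc_holomorphic \<Longrightarrow> (\<forall>z\<in>K. dist (power_series (x \<omega>) z) (g z) < e) \<Longrightarrow> g \<in> U"
      using U \<omega>(1) unfolding openin_disc_holomorphic_def by meson
    obtain r where r: "0 \<le> r" "r < 1" "K \<subseteq> cball 0 r" using compact_subset_cball[OF K(1,2)] .
    obtain m where m: "inverse (real (Suc m)) < 1 - r" using reals_Archimedean[of "1 - r"] r by auto
    have rm: "r \<le> rr m" using m by (simp add: rr_def inverse_eq_divide add.commute)
    obtain j where j: "inverse (real (Suc j)) < e / 2" using reals_Archimedean[of "e / 2"] K(3) by auto
    \<comment> \<open>Twice the tolerance has to stay below \<open>e\<close>: one share for the
      distance from the random series to the rational polynomial, one for the distance from
      \<open>h\<close> to it.\<close>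
    define d where "d = 1 / (real j + 1)"
    have d: "d > 0" "2 * d < e" using j by (auto simp: d_def inverse_eq_divide add.commute)
    have sx: "summable (\<lambda>k. \<bar>x \<omega> k\<bar> * rr m ^ k)" using good rr by (auto simp: disc_coeffs_def)
    obtain n where n: "(\<Sum>k. \<bar>x \<omega> (k + n)\<bar> * rr m ^ (k + n)) < d / 2"
    proof -
      have "(\<lambda>n. \<Sum>k. \<bar>x \<omega> (k + n)\<bar> * rr m ^ (k + n)) \<longlonglongrightarrow> 0"
        by (rule suminf_exist_split2[OF sx])
      from order_tendstoD(2)[OF this, of "d / 2"] d that show ?thesis
        by (auto dest: eventually_happens)
    qed
    \<comment> \<open>Half of \<open>d\<close> is reserved for the tail from index \<open>n\<close>
      on, the other half is divided among the \<open>n\<close> rational approximations.\<close>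
    define d' where "d' = d / (2 * (real n + 1))"
    have d': "d' > 0" using d by (simp add: d'_def)
    have "\<exists>q :: rat. \<bar>x \<omega> k - of_rat q\<bar> < d'" for k
    proof -
      obtain q where "x \<omega> k < of_rat q" "of_rat q < x \<omega> k + d'"
        using of_rat_dense[of "x \<omega> k" "x \<omega> k + d'"] d' by auto
      then show ?thesis by (intro exI[of _ q]) auto
    qed
    then obtain qf where qf: "\<And>k. \<bar>x \<omega> k - of_rat (qf k)\<bar> < d'" by metis
    define q where "q = map qf [0..<n]"
    have s: "summable (\<lambda>k. \<bar>x \<omega> k - qc q k\<bar> * rr m ^ k)"
      by (subst summable_iff_shift[of _ n, symmetric])
        (use summable_ignore_initial_segment[OF sx, of n] in \<open>simp add: qc_def q_def\<close>)
    have "(\<Sum>k. \<bar>x \<omega> k - qc q k\<bar> * rr m ^ k) =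
        (\<Sum>k. \<bar>x \<omega> (k + n) - qc q (k + n)\<bar> * rr m ^ (k + n)) + (\<Sum>k<n. \<bar>x \<omega> k - qc q k\<bar> * rr m ^ k)"
      by (rule suminf_split_initial_segment[OF s])
    also have "(\<Sum>k. \<bar>x \<omega> (k + n) - qc q (k + n)\<bar> * rr m ^ (k + n)) \<le> d / 2"
      using n by (simp add: qc_def q_def)
    also have "(\<Sum>k<n. \<bar>x \<omega> k - qc q k\<bar> * rr m ^ k) \<le> (\<Sum>k<n. d' * 1)"
      using qf rr[of m] d' by (intro sum_mono mult_mono power_le_one) (auto simp: qc_def q_def less_imp_le)
    also have "\<dots> \<le> (real n + 1) * d'" using d' by simp
    also have "\<dots> = d / 2"
    proof -
      have *: "c * (d / (2 * c)) = d / 2" if "c \<noteq> 0" for c :: real using that by simp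
      have "real n + 1 \<noteq> 0" using of_nat_0_le_iff[of n, where 'a = real] by linarith
      from *[OF this] show ?thesis by (simp only: d'_def)
    qed
    finally have le: "(\<Sum>k. \<bar>x \<omega> k - qc q k\<bar> * rr m ^ k) \<le> d" by simp
    have "(q, m, j) \<in> \<I>"
      unfolding \<I>_def
    proof (clarify)
      fix h assume h: "h \<in> disc_holomorphic"
        and hz: "\<forall>z. norm z \<le> rr m \<longrightarrow> norm (h z - power_series (qc q) z) \<le> 1 / (real j + 1)"
      show "h \<in> U"
      proof (rule K(4)[OF h], rule ballI)
        fix z assume "z \<in> K"
        then have z: "norm z \<le> rr m" using r rm by auto
        have "norm (power_series (x \<omega>) z - power_series (qc q) z) \<le> d"
          using power_series_diff_le[OF good qg z rr(2)] le by (rule order_trans)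
        moreover have "norm (h z - power_series (qc q) z) \<le> d" using hz z by (simp add: d_def)
        ultimately have "dist (power_series (x \<omega>) z) (h z) \<le> 2 * d"
          using norm_triangle_ineq4[of "power_series (x \<omega>) z - power_series (qc q) z" "h z - power_series (qc q) z"]
          by (simp add: dist_norm)
        then show "dist (power_series (x \<omega>) z) (h z) < e" using d by linarith
      qed
    qed
    moreover have "\<omega> \<in> E q m j" using le \<omega> by (simp add: E_def d_def)
    ultimately show "\<omega> \<in> (\<Union>(q, m, j)\<in>\<I>. E q m j)" by blast
  next
    fix \<omega> assume "\<omega> \<in> (\<Union>(q, m, j)\<in>\<I>. E q m j)"
    then obtain q m j where qmj: "(q, m, j) \<in> \<I>" "\<omega> \<in> E q m j" by auto
    have "norm (power_series (x \<omega>) z - power_series (qc q) z) \<le> 1 / (real j + 1)" if "norm z \<le> rr m" for z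
      using power_series_diff_le[OF good[of \<omega>] qg[of q] that rr(2)] qmj(2) by (simp add: E_def)
    then have "power_series (x \<omega>) \<in> U"
      using qmj(1) power_series_holomorphic[OF good[of \<omega>]] by (auto simp: \<I>_def)
    then show "\<omega> \<in> (\<lambda>\<omega>. power_series (x \<omega>)) -` U \<inter> space M" using qmj(2) by (simp add: E_def)
  qed
  also have "\<dots> \<in> sets M"
    using EM by (intro sets.countable_UN'[OF cI]) auto
  finally show "(\<lambda>\<omega>. power_series (x \<omega>)) -` U \<inter> space M \<in> sets M" .
qed

section \<open>Truncation, uniformly on boxes of coefficients\<close>

definition trunc :: "nat \<Rightarrow> (nat \<Rightarrow> real) \<Rightarrow> nat \<Rightarrow> real" where
  "trunc K x k = (if k \<le> K then x k else 0)"

lemma disc_coeffs_finite: "(\<And>k. k > n \<Longrightarrow> x k = 0) \<Longrightarrow> disc_coeffs x"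
  unfolding disc_coeffs_def by (intro allI impI summable_finite[of "{..n}"]) (auto simp: not_le)

lemma disc_coeffs_trunc: "disc_coeffs (trunc K x)"
  by (rule disc_coeffs_finite[of K]) (simp add: trunc_def)

lemma continuous_map_limitin_real:
  assumes "continuous_map T euclideanreal f" "limitin T s l F"
  shows "((\<lambda>n. f (s n)) \<longlongrightarrow> f l) F"
  using continuous_map_limit[OF assms] by (simp add: o_def)

text \<open>Counterexamples for growing \<open>K\<close> all lie in the compact box cut out by the
  envelope, so a subsequence converges coefficientwise. Under the common majorant the series and
  their truncations converge to the same function, which contradicts the continuity of
  \<open>f\<close>.\<close>

lemma trunc_uniform:
  fixes f :: "(complex \<Rightarrow> complex) \<Rightarrow> real"
  assumes f: "continuous_map disc_holomorphic_topology euclideanreal f" and e: "e > 0"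
  shows "\<exists>K0. \<forall>K\<ge>K0. \<forall>x. (\<forall>k. \<bar>x k\<bar> \<le> A * (real k + 1)) \<longrightarrow> \<bar>f (power_series x) - f (power_series (trunc K x))\<bar> \<le> e"
proof (rule ccontr)
  assume "\<not> ?thesis"
  then have "\<forall>j. \<exists>K x. K \<ge> j \<and> (\<forall>k. \<bar>x k\<bar> \<le> A * (real k + 1)) \<and> \<bar>f (power_series x) - f (power_series (trunc K x))\<bar> > e"
    by (meson not_le)
  then obtain K x where Kx: "\<And>j. K j \<ge> j" "\<And>j k. \<bar>x j k\<bar> \<le> A * (real k + 1)"
    "\<And>j. \<bar>f (power_series (x j)) - f (power_series (trunc (K j) (x j)))\<bar> > e" by metis
  let ?S = "PiE UNIV (\<lambda>k. {- (A * (real k + 1))..A * (real k + 1)})"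
  have "seq_compact ?S"
    unfolding compact_eq_seq_compact_metric[symmetric] by (rule compact_PiE_fun) auto
  moreover have "x j \<in> ?S" for j using Kx(2) by (auto simp: abs_le_iff minus_le_iff)
  ultimately obtain y r where r: "strict_mono r" "(x \<circ> r) \<longlonglongrightarrow> y"
    unfolding seq_compact_def by blast
  have xy: "(\<lambda>n. x (r n) k) \<longlonglongrightarrow> y k" for k
  proof -
    have "isCont (\<lambda>x :: nat \<Rightarrow> real. x k) y"
      by (metis UNIV_I continuous_on_eq_continuous_at continuous_on_product_coordinates open_UNIV)
    from isCont_tendsto_compose[OF this r(2)] show ?thesis by (simp add: o_def)
  qed
  \<comment> \<open>Along the subsequence the truncation levels pass every fixed \<open>k\<close>,
    so truncation leaves the \<open>k\<close>-th limit unchanged.\<close>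
  have "((\<lambda>n. trunc (K (r n)) (x (r n)) k) \<longlongrightarrow> y k) sequentially" for k
  proof (rule Lim_transform_eventually[OF xy])
    show "\<forall>\<^sub>F n in sequentially. x (r n) k = trunc (K (r n)) (x (r n)) k"
      using eventually_ge_at_top[of k]
    proof eventually_elim
      case (elim n)
      have "k \<le> K (r n)" using elim seq_suble[OF r(1), of n] Kx(1)[of "r n"] by linarith
      then show ?case by (simp add: trunc_def)
    qed
  qed
  note ty = this
  have b: "\<bar>x j k\<bar> \<le> \<bar>A * (real k + 1)\<bar>" for j k using Kx(2)[of j k] by linarith
  then have tb: "\<bar>trunc m (x j) k\<bar> \<le> \<bar>A * (real k + 1)\<bar>" for m j k by (simp add: trunc_def)
  have "(\<lambda>n. f (power_series (x (r n)))) \<longlonglongrightarrow> f (power_series y)"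
    by (rule continuous_map_limitin_real[OF f power_series_limitin[OF disc_coeffs_linear b xy]])
  moreover have "(\<lambda>n. f (power_series (trunc (K (r n)) (x (r n))))) \<longlonglongrightarrow> f (power_series y)"
    by (rule continuous_map_limitin_real[OF f power_series_limitin[OF disc_coeffs_linear tb ty]])
  ultimately have "(\<lambda>n. \<bar>f (power_series (x (r n))) - f (power_series (trunc (K (r n)) (x (r n))))\<bar>) \<longlonglongrightarrow> \<bar>f (power_series y) - f (power_series y)\<bar>"
    by (intro tendsto_intros)
  then have "\<forall>\<^sub>F n in sequentially. \<bar>f (power_series (x (r n))) - f (power_series (trunc (K (r n)) (x (r n))))\<bar> < e"
    using e by (intro order_tendstoD(2)) auto
  then obtain n where "\<bar>f (power_series (x (r n))) - f (power_series (trunc (K (r n)) (x (r n))))\<bar> < e"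
    by (auto dest: eventually_happens)
  with Kx(3)[of "r n"] show False by simp
qed

text \<open>For \<open>k \<ge> 1\<close> the term is at most \<open>1 / k - 1 / (k + 1)\<close>, and
  the sum telescopes.\<close>

lemma sum_inverse_squares_le: "(\<Sum>k\<le>n. 1 / (real k + 1)\<^sup>2) \<le> 2 - 1 / (real n + 1)"
proof (induction n)
  case (Suc n)
  have "1 / (real n + 2)\<^sup>2 \<le> 1 / ((real n + 1) * (real n + 2))"
    by (intro divide_left_mono) (auto simp: power2_eq_square intro: mult_right_mono)
  also have "\<dots> = 1 / (real n + 1) - 1 / (real n + 2)" by (simp add: field_simps)
  finally have "1 / (real n + 2)\<^sup>2 \<le> 1 / (real n + 1) - 1 / (real n + 2)" .
  with Suc show ?case by (simp add: add.commute)
qed simp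

text \<open>Up to a small error \<open>f\<close> sees finitely many coefficients, unless some
  coefficient exceeds \<open>A * (k + 1)\<close>. By Chebyshev's inequality the latter event has
  probability at most \<open>2 / A\<^sup>2\<close> for every \<open>n\<close>. For the limit,
  truncations converge at every sample point and dominated convergence suffices.\<close>

lemma power_series_expectation_tendsto:
  fixes C :: "nat \<Rightarrow> 'a \<Rightarrow> nat \<Rightarrow> real" and L :: "'b \<Rightarrow> nat \<Rightarrow> real"
  assumes M: "prob_space M" and N: "prob_space N"
    and C: "\<And>n k. (\<lambda>\<omega>. C n \<omega> k) \<in> borel_measurable M" and L: "\<And>k. (\<lambda>\<omega>. L \<omega> k) \<in> borel_measurable N"
    and Lgood: "\<And>\<omega>. disc_coeffs (L \<omega>)"
    and C0: "\<And>n \<omega> k. k > n \<Longrightarrow> C n \<omega> k = 0"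
    and Cint: "\<And>n k. integrable M (\<lambda>\<omega>. (C n \<omega> k)\<^sup>2)" and C2: "\<And>n k. (\<integral>\<omega>. (C n \<omega> k)\<^sup>2 \<partial>M) \<le> 1"
    and f: "continuous_map disc_holomorphic_topology euclideanreal f" and fB: "\<And>h. h \<in> disc_holomorphic \<Longrightarrow> \<bar>f h\<bar> \<le> B"
    and fd: "\<And>K. (\<lambda>n. \<integral>\<omega>. f (power_series (trunc K (C n \<omega>))) \<partial>M) \<longlonglongrightarrow> (\<integral>\<omega>. f (power_series (trunc K (L \<omega>))) \<partial>N)"
  shows "(\<lambda>n. \<integral>\<omega>. f (power_series (C n \<omega>)) \<partial>M) \<longlonglongrightarrow> (\<integral>\<omega>. f (power_series (L \<omega>)) \<partial>N)"
proof (rule LIMSEQ_I)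
  interpret M: prob_space M by (rule M)
  interpret N: prob_space N by (rule N)
  fix e :: real assume e: "e > 0"
  have Cg: "disc_coeffs (C n \<omega>)" for n \<omega> by (rule disc_coeffs_finite[OF C0])
  have B0: "0 \<le> B" using fB[OF power_series_holomorphic[OF disc_coeffs_trunc[of 0 undefined]]] by linarith
  have trunc_meas: "(\<lambda>\<omega>. trunc K (x \<omega>) k) \<in> borel_measurable P"
    if "\<And>k. (\<lambda>\<omega>. x \<omega> k) \<in> borel_measurable P" for x K k and P :: "'a measure"
    using that by (simp add: trunc_def)
  have fm: "(\<lambda>\<omega>. f (power_series (x \<omega>))) \<in> borel_measurable P"
    if "\<And>k. (\<lambda>\<omega>. x \<omega> k) \<in> borel_measurable P" "\<And>\<omega>. disc_coeffs (x \<omega>)" for x and P :: "'a measure"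
    by (rule measurable_continuous_map_borel_of[OF measurable_power_series f]) (fact that)+
  have fm': "(\<lambda>\<omega>. f (power_series (x \<omega>))) \<in> borel_measurable P"
    if "\<And>k. (\<lambda>\<omega>. x \<omega> k) \<in> borel_measurable P" "\<And>\<omega>. disc_coeffs (x \<omega>)" for x and P :: "'b measure"
    by (rule measurable_continuous_map_borel_of[OF measurable_power_series f]) (fact that)+
  \<comment> \<open>With this choice the exceptional event costs
    \<open>2 * B * (2 / A\<^sup>2) \<le> e / 6\<close>; writing \<open>B + 1\<close> keeps
    \<open>A\<close> positive when \<open>B\<close> is 0.\<close>
  define A where "A = sqrt (24 * (B + 1) / e)"
  have A: "A > 0" "A\<^sup>2 = 24 * (B + 1) / e" using e B0 by (auto simp: A_def)
  have "\<exists>K0. \<forall>K\<ge>K0. \<forall>x. (\<forall>k. \<bar>x k\<bar> \<le> A * (real k + 1)) \<longrightarrow> \<bar>f (power_series x) - f (power_series (trunc K x))\<bar> \<le> e / 6"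
    by (rule trunc_uniform[OF f]) (use e in simp)
  then obtain K0 where K0: "\<And>K x. K \<ge> K0 \<Longrightarrow> (\<And>k. \<bar>x k\<bar> \<le> A * (real k + 1)) \<Longrightarrow> \<bar>f (power_series x) - f (power_series (trunc K x))\<bar> \<le> e / 6"
    by blast
  have fb: "\<bar>f (power_series x)\<bar> \<le> B" if "disc_coeffs x" for x
    using fB[OF power_series_holomorphic[OF that]] .
  have dC: "\<bar>(\<integral>\<omega>. f (power_series (C n \<omega>)) \<partial>M) - (\<integral>\<omega>. f (power_series (trunc K (C n \<omega>))) \<partial>M)\<bar> \<le> e / 3" if K: "K \<ge> K0" for K n
  proof -
    let ?w = "\<lambda>k. A\<^sup>2 * (real k + 1)\<^sup>2"
    have w: "?w k > 0" for k using A by (intro mult_pos_pos zero_less_power) auto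
    let ?h = "\<lambda>\<omega>. e / 6 + 2 * B * (\<Sum>k\<le>n. (C n \<omega> k)\<^sup>2 / ?w k)"
    have i1: "integrable M (\<lambda>\<omega>. f (power_series (C n \<omega>)))"
      using fb[OF Cg] by (intro M.integrable_const_bound[where B = B] fm C Cg) auto
    have i2: "integrable M (\<lambda>\<omega>. f (power_series (trunc K (C n \<omega>))))"
      using fb[OF disc_coeffs_trunc] by (intro M.integrable_const_bound[where B = B] fm trunc_meas C disc_coeffs_trunc) auto
    have i3: "integrable M ?h" using Cint by auto
    have pt: "\<bar>f (power_series (C n \<omega>)) - f (power_series (trunc K (C n \<omega>)))\<bar> \<le> ?h \<omega>" for \<omega>
    proof -
      have s0: "0 \<le> (\<Sum>k\<le>n. (C n \<omega> k)\<^sup>2 / ?w k)" by (intro sum_nonneg) auto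
      show ?thesis
      proof (cases "\<forall>k. \<bar>C n \<omega> k\<bar> \<le> A * (real k + 1)")
        case True
        have "0 \<le> 2 * B * (\<Sum>k\<le>n. (C n \<omega> k)\<^sup>2 / ?w k)" using s0 B0 by (intro mult_nonneg_nonneg) auto
        moreover have "\<bar>f (power_series (C n \<omega>)) - f (power_series (trunc K (C n \<omega>)))\<bar> \<le> e / 6"
          by (rule K0[OF K]) (use True in blast)
        ultimately show ?thesis by linarith
      next
        case False
        then obtain k where k: "\<bar>C n \<omega> k\<bar> > A * (real k + 1)" by (auto simp: not_le)
        have Ak: "0 \<le> A * (real k + 1)" using A by simp
        have kn: "k \<le> n" using k Ak C0[of n k \<omega>] by (cases "k \<le> n") auto
        have "(A * (real k + 1))\<^sup>2 \<le> \<bar>C n \<omega> k\<bar>\<^sup>2" using k Ak by (intro power_mono) auto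
        then have "1 \<le> (C n \<omega> k)\<^sup>2 / ?w k" using w[of k] by (simp add: power_mult_distrib le_divide_eq)
        also have "\<dots> \<le> (\<Sum>k\<le>n. (C n \<omega> k)\<^sup>2 / ?w k)" using kn by (intro member_le_sum) auto
        finally have "2 * B * 1 \<le> 2 * B * (\<Sum>k\<le>n. (C n \<omega> k)\<^sup>2 / ?w k)" using B0 by (intro mult_left_mono) auto
        then show ?thesis using fb[OF Cg[of n \<omega>]] fb[OF disc_coeffs_trunc[of K "C n \<omega>"]] e by linarith
      qed
    qed
    have "\<bar>(\<integral>\<omega>. f (power_series (C n \<omega>)) \<partial>M) - (\<integral>\<omega>. f (power_series (trunc K (C n \<omega>))) \<partial>M)\<bar> \<le> (\<integral>\<omega>. ?h \<omega> \<partial>M)"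
      by (rule expectation_diff_le_integral[OF i1 i2 i3 pt])
    also have "\<dots> = e / 6 + 2 * B * (\<Sum>k\<le>n. (\<integral>\<omega>. (C n \<omega> k)\<^sup>2 \<partial>M) / ?w k)"
      using Cint by (simp add: M.prob_space)
    also have "\<dots> \<le> e / 6 + 2 * B * (2 / A\<^sup>2)"
    proof -
      have "(\<Sum>k\<le>n. (\<integral>\<omega>. (C n \<omega> k)\<^sup>2 \<partial>M) / ?w k) \<le> (\<Sum>k\<le>n. 1 / ?w k)"
        using C2 w by (intro sum_mono divide_right_mono) (auto intro: less_imp_le)
      also have "\<dots> = (\<Sum>k\<le>n. 1 / (real k + 1)\<^sup>2) / A\<^sup>2" by (simp add: sum_divide_distrib mult.commute)
      also have "\<dots> \<le> 2 / A\<^sup>2"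
      proof (rule divide_right_mono)
        have "0 \<le> 1 / (real n + 1)" by simp
        then show "(\<Sum>k\<le>n. 1 / (real k + 1)\<^sup>2) \<le> 2" using sum_inverse_squares_le[of n] by linarith
      qed simp
      finally have "2 * B * (\<Sum>k\<le>n. (\<integral>\<omega>. (C n \<omega> k)\<^sup>2 \<partial>M) / ?w k) \<le> 2 * B * (2 / A\<^sup>2)"
        using B0 by (intro mult_left_mono) auto
      then show ?thesis by linarith
    qed
    also have "\<dots> \<le> e / 6 + e / 6"
    proof -
      have "e / 6 * A\<^sup>2 = 4 * (B + 1)" using e by (simp add: A(2))
      then have "4 * B \<le> e / 6 * A\<^sup>2" by simp
      moreover have "A\<^sup>2 > 0" using A(1) by simp
      ultimately have "4 * B / A\<^sup>2 \<le> e / 6" by (subst pos_divide_le_eq)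
      then show ?thesis by simp
    qed
    finally show ?thesis by simp
  qed
  have "(\<lambda>K. \<integral>\<omega>. f (power_series (trunc K (L \<omega>))) \<partial>N) \<longlonglongrightarrow> (\<integral>\<omega>. f (power_series (L \<omega>)) \<partial>N)"
  proof (rule integral_dominated_convergence[where w = "\<lambda>_. B"])
    show "(\<lambda>\<omega>. f (power_series (L \<omega>))) \<in> borel_measurable N" by (intro fm' L Lgood)
    show "(\<lambda>\<omega>. f (power_series (trunc K (L \<omega>)))) \<in> borel_measurable N" for K
      by (rule fm'[OF _ disc_coeffs_trunc]) (use L in \<open>simp add: trunc_def\<close>)
    show "AE \<omega> in N. (\<lambda>K. f (power_series (trunc K (L \<omega>)))) \<longlonglongrightarrow> f (power_series (L \<omega>))"
    proof (rule AE_I2)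
      fix \<omega>
      have t: "(\<lambda>K. trunc K (L \<omega>) k) \<longlonglongrightarrow> L \<omega> k" for k
      proof (rule tendsto_eventually)
        show "\<forall>\<^sub>F K in sequentially. trunc K (L \<omega>) k = L \<omega> k"
          using eventually_ge_at_top[of k] by eventually_elim (simp add: trunc_def)
      qed
      have "limitin disc_holomorphic_topology (\<lambda>K. power_series (trunc K (L \<omega>))) (power_series (L \<omega>)) sequentially"
        by (rule power_series_limitin[OF Lgood[of \<omega>] _ t]) (simp add: trunc_def)
      from continuous_map_limitin_real[OF f this]
      show "(\<lambda>K. f (power_series (trunc K (L \<omega>)))) \<longlonglongrightarrow> f (power_series (L \<omega>))" .
    qed
    show "AE \<omega> in N. norm (f (power_series (trunc K (L \<omega>)))) \<le> B" for K
      using fb[OF disc_coeffs_trunc] by simp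
  qed simp
  from tendstoD[OF this, of "e / 3"] e
  have "\<forall>\<^sub>F K in sequentially. \<bar>(\<integral>\<omega>. f (power_series (trunc K (L \<omega>))) \<partial>N) - (\<integral>\<omega>. f (power_series (L \<omega>)) \<partial>N)\<bar> < e / 3"
    by (simp add: dist_real_def)
  with eventually_ge_at_top[of K0] have "\<forall>\<^sub>F K in sequentially. K \<ge> K0 \<and> \<bar>(\<integral>\<omega>. f (power_series (trunc K (L \<omega>))) \<partial>N) - (\<integral>\<omega>. f (power_series (L \<omega>)) \<partial>N)\<bar> < e / 3"
    by (rule eventually_conj)
  then obtain K where K: "K \<ge> K0" "\<bar>(\<integral>\<omega>. f (power_series (trunc K (L \<omega>))) \<partial>N) - (\<integral>\<omega>. f (power_series (L \<omega>)) \<partial>N)\<bar> < e / 3"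
    by (auto dest: eventually_happens)
  from tendstoD[OF fd[of K], of "e / 3"] e
  have "\<forall>\<^sub>F n in sequentially. \<bar>(\<integral>\<omega>. f (power_series (trunc K (C n \<omega>))) \<partial>M) - (\<integral>\<omega>. f (power_series (trunc K (L \<omega>))) \<partial>N)\<bar> < e / 3"
    by (simp add: dist_real_def)
  then have "\<forall>\<^sub>F n in sequentially. norm ((\<integral>\<omega>. f (power_series (C n \<omega>)) \<partial>M) - (\<integral>\<omega>. f (power_series (L \<omega>)) \<partial>N)) < e"
  proof eventually_elim
    case (elim n)
    then show ?case using dC[OF K(1), of n] K(2) unfolding real_norm_def by linarith
  qed
  then show "\<exists>n0. \<forall>n\<ge>n0. norm ((\<integral>\<omega>. f (power_series (C n \<omega>)) \<partial>M) - (\<integral>\<omega>. f (power_series (L \<omega>)) \<partial>N)) < e"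
    by (simp add: eventually_sequentially)
qed

text \<open>The logarithmic derivative of \<open>csqrt (1 - z\<^sup>2) * exp (- G z)\<close> is
  \<open>- \<tau> z\<close>, where the Taylor coefficients of \<open>\<tau>\<close> are the shifted
  sequence \<open>T (Suc k)\<close>. So the function satisfies the equation behind the Newton
  recursion. The parity indicator in \<open>T\<close> stems from \<open>z / (1 - z\<^sup>2)\<close>,
  the sum of the odd powers.\<close>

lemma gaussian_exp_newton:
  assumes s: "\<forall>z\<in>ball 0 1. summable (gaussian_series_term \<zeta> z)"
  defines "g \<equiv> newton (\<lambda>k. of_bool (even k) + sqrt (real k) * \<zeta> k)"
  shows "disc_coeffs g \<and> limit_function \<zeta> = power_series g"
proof -
  \<comment> \<open>Index 0 is filled with 0, so that the series starting at index 1 becomes an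
    ordinary power series.\<close>
  define h where "h k = (if k = 0 then 0 else complex_of_real (\<zeta> k / sqrt (real k)))" for k
  define G where "G z = (\<Sum>k. h k * z ^ k)" for z
  define T where "T k = of_bool (even k) + sqrt (real k) * \<zeta> k" for k
  have term_eq: "gaussian_series_term \<zeta> z m = h (Suc m) * z ^ Suc m" for z m
    by (simp add: gaussian_series_term_def h_def Let_def)
  have hs: "summable (\<lambda>k. h k * z ^ k)" if "norm z < 1" for z
  proof -
    have "gaussian_series_term \<zeta> z = (\<lambda>m. h (Suc m) * z ^ Suc m)" by (rule ext) (rule term_eq)
    then have "summable (\<lambda>m. h (Suc m) * z ^ Suc m)" using s that by (metis mem_ball_0)
    then show ?thesis by (subst (asm) summable_Suc_iff[of "\<lambda>k. h k * z ^ k"])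
  qed
  have G_eq: "(\<Sum>m. gaussian_series_term \<zeta> z m) = G z" if "norm z < 1" for z
    unfolding G_def using suminf_split_head[OF hs[OF that]] by (simp add: term_eq[abs_def] h_def del: power_Suc)
  have G': "(G has_field_derivative (\<Sum>k. diffs h k * z ^ k)) (at z)" if "norm z < 1" for z
    unfolding G_def by (rule termdiffs_strong'[OF hs that])
  \<comment> \<open>Differentiation multiplies \<open>\<zeta> k / sqrt k\<close> by
    \<open>k\<close>, which turns the normalization of the limiting function into that of the
    limiting traces.\<close>
  have dh: "diffs h k = complex_of_real (sqrt (real (Suc k)) * \<zeta> (Suc k))" for k
  proof -
    have "real (Suc k) / sqrt (real (Suc k)) = sqrt (real (Suc k))" by (rule real_div_sqrt) simp
    then have e: "real (Suc k) * (\<zeta> (Suc k) / sqrt (real (Suc k))) = sqrt (real (Suc k)) * \<zeta> (Suc k)"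
      by (metis mult.commute times_divide_eq_left times_divide_eq_right)
    have "diffs h k = complex_of_real (real (Suc k)) * complex_of_real (\<zeta> (Suc k) / sqrt (real (Suc k)))"
      by (simp add: diffs_def h_def del: of_nat_Suc)
    also have "\<dots> = complex_of_real (real (Suc k) * (\<zeta> (Suc k) / sqrt (real (Suc k))))"
      by (simp only: of_real_mult)
    finally show ?thesis unfolding e .
  qed
  have ds: "summable (\<lambda>k. diffs h k * z ^ k)" if "norm z < 1" for z
    by (rule termdiff_converges[OF that hs])
  define L where "L z = csqrt (1 - z\<^sup>2) * exp (- G z)" for z
  \<comment> \<open>On the disc \<open>1 - z\<^sup>2\<close> has positive real part, so the
    principal square root is differentiable there.\<close>
  have nz: "1 - z\<^sup>2 \<notin> \<real>\<^sub>\<le>\<^sub>0" if "norm z < 1" for z :: complex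
  proof -
    have "Re (z\<^sup>2) \<le> norm (z\<^sup>2)" by (rule complex_Re_le_cmod)
    also have "\<dots> < 1" using that by (simp add: norm_power power_less_one_iff)
    finally show ?thesis by (auto simp: complex_nonpos_Reals_iff)
  qed
  define \<tau> where "\<tau> z = (\<Sum>k. complex_of_real (T (Suc k)) * z ^ k)" for z
  have \<tau>: "(\<lambda>k. complex_of_real (T (Suc k)) * z ^ k) sums (z / (1 - z\<^sup>2) + (\<Sum>k. diffs h k * z ^ k))" if z: "norm z < 1" for z
  proof -
    have z2: "norm (z\<^sup>2) < 1" using z by (simp add: norm_power power_less_one_iff)
    have "(\<lambda>k. z * (z\<^sup>2) ^ k) sums (z * (1 / (1 - z\<^sup>2)))" by (intro sums_mult geometric_sums z2)
    moreover have "(\<lambda>k. if odd (2 * k + 1) then z ^ (2 * k + 1) else 0) = (\<lambda>k. z * (z\<^sup>2) ^ k)"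
      by (simp add: power_mult)
    moreover have "(\<lambda>k. if odd (2 * k + 1) then z ^ (2 * k + 1) else 0) sums (z / (1 - z\<^sup>2))
        \<longleftrightarrow> (\<lambda>k. if odd k then z ^ k else 0) sums (z / (1 - z\<^sup>2))"
      by (rule sums_mono_reindex) (auto simp: strict_mono_def elim!: oddE)
    ultimately have "(\<lambda>k. if odd k then z ^ k else 0) sums (z / (1 - z\<^sup>2))" by simp
    from sums_add[OF this summable_sums[OF ds[OF z]]] show ?thesis
      by (rule sums_cong[THEN iffD1, rotated]) (auto simp: T_def dh algebra_simps)
  qed
  have L': "(L has_field_derivative (- L z * \<tau> z)) (at z)" if z: "norm z < 1" for z
  proof -
    have c: "csqrt (1 - z\<^sup>2) \<noteq> 0" "1 - z\<^sup>2 \<noteq> 0" using nz[OF z] by auto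
    have cc: "csqrt (1 - z\<^sup>2) * csqrt (1 - z\<^sup>2) = 1 - z\<^sup>2" by (metis power2_csqrt power2_eq_square)
    have D: "(L has_field_derivative
        (- (2 * z) / (2 * csqrt (1 - z\<^sup>2)) * exp (- G z) + csqrt (1 - z\<^sup>2) * (exp (- G z) * - (\<Sum>k. diffs h k * z ^ k)))) (at z)"
      unfolding L_def by (auto intro!: derivative_eq_intros G'[OF z] nz[OF z])
    have e: "- (2 * z) / (2 * csqrt (1 - z\<^sup>2)) = - csqrt (1 - z\<^sup>2) * (z / (1 - z\<^sup>2))"
    proof -
      have "- (2 * z) / (2 * u) = - u * (z / w)" if "u * u = w" "u \<noteq> 0" for u w :: complex
        unfolding that(1)[symmetric] using that(2) by (simp add: field_simps)
      from this[OF cc c(1)] show ?thesis .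
    qed
    have \<tau>z: "\<tau> z = z / (1 - z\<^sup>2) + (\<Sum>k. diffs h k * z ^ k)"
      unfolding \<tau>_def by (rule sums_unique[OF \<tau>[OF z], symmetric])
    have alg: "(- u * q) * E + u * (E * - S) = - (u * E) * (q + S)" for u q E S :: complex
      by (simp add: algebra_simps)
    show ?thesis
      by (rule DERIV_cong[OF D]) (unfold e \<tau>z L_def, rule alg)
  qed
  have Lh: "L holomorphic_on ball 0 1"
    using L' unfolding holomorphic_on_open[OF open_ball] by (metis mem_ball_0)
  define F where "F = fps_expansion L 0"
  have LF: "L has_fps_expansion F"
    unfolding F_def by (rule has_fps_expansion_fps_expansion[OF _ _ Lh]) auto
  have \<tau>F: "\<tau> has_fps_expansion Abs_fps (\<lambda>k. complex_of_real (T (Suc k)))"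
  proof -
    have "summable (\<lambda>k. complex_of_real (T (Suc k)) * (1 / 2) ^ k)"
      using \<tau>[of "1 / 2"] by (auto simp: sums_iff norm_divide)
    from conv_radius_geI[OF this] have "conv_radius (\<lambda>k. complex_of_real (T (Suc k))) > 0"
      by (rule less_le_trans[rotated]) (simp add: norm_divide)
    then show ?thesis by (simp add: has_fps_expansion_def fps_conv_radius_def eval_fps_def \<tau>_def)
  qed
  have ev: "\<forall>\<^sub>F z in nhds 0. deriv L z = - L z * \<tau> z"
  proof -
    have "\<forall>\<^sub>F z in nhds (0 :: complex). z \<in> ball 0 1" by (intro eventually_nhds_in_open) auto
    then show ?thesis by eventually_elim (rule DERIV_imp_deriv[OF L'], simp)
  qed
  have "(\<lambda>z. - L z * \<tau> z) has_fps_expansion (- F * Abs_fps (\<lambda>k. complex_of_real (T (Suc k))))"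
    by (intro fps_expansion_intros LF \<tau>F)
  then have "deriv L has_fps_expansion (- F * Abs_fps (\<lambda>k. complex_of_real (T (Suc k))))"
    using has_fps_expansion_cong[OF ev refl] by blast
  then have F': "fps_deriv F = - F * Abs_fps (\<lambda>k. complex_of_real (T (Suc k)))"
    using fps_expansion_eqI has_fps_expansion_deriv[OF LF] by metis
  have F0: "fps_nth F 0 = 1"
    by (simp add: F_def fps_expansion_def L_def G_def h_def)
  have Fg: "fps_nth F k = complex_of_real (g k)" for k
    unfolding fps_nth_eq_newton[OF F0 F'] newton_of_real g_def T_def[symmetric] ..
  have Lsums: "(\<lambda>k. complex_of_real (g k) * z ^ k) sums L z" if "norm z < 1" for z
    using holomorphic_power_series[OF Lh, of z] that by (simp add: Fg[symmetric] F_def fps_expansion_def)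
  have "disc_coeffs g"
    unfolding disc_coeffs_def
  proof (intro allI impI)
    fix r :: real assume r: "0 \<le> r" "r < 1"
    \<comment> \<open>A radius strictly between \<open>r\<close> and 1: convergence at
      \<open>q\<close> gives absolute convergence at \<open>r\<close>.\<close>
    define q where "q = (r + 1) / 2"
    have q: "0 \<le> q" "q < 1" "r < q" using r by (auto simp: q_def)
    have nq: "norm (complex_of_real q) = q" "norm (complex_of_real r) = r" using q r by simp_all
    have "norm (complex_of_real q) < 1" using nq q by linarith
    then have sq: "summable (\<lambda>k. complex_of_real (g k) * complex_of_real q ^ k)"
      by (rule sums_summable[OF Lsums])
    have "summable (\<lambda>k. norm (complex_of_real (g k) * complex_of_real r ^ k))"
      by (rule powser_insidea[OF sq]) (use nq q in linarith)
    moreover have "norm (complex_of_real (g k) * complex_of_real r ^ k) = \<bar>g k\<bar> * r ^ k" for k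
      by (simp only: norm_mult norm_power norm_of_real nq) (use r in simp)
    ultimately show "summable (\<lambda>k. \<bar>g k\<bar> * r ^ k)" by (simp only:)
  qed
  moreover have "limit_function \<zeta> = power_series g"
  proof
    fix z
    show "limit_function \<zeta> z = power_series g z"
    proof (cases "norm z < 1")
      case True
      then have "power_series g z = L z"
        using sums_unique[OF Lsums[OF True]] by (simp add: power_series_def)
      moreover have "limit_function \<zeta> z = L z"
        using s True G_eq[OF True] by (simp add: limit_function_def L_def)
      ultimately show ?thesis by simp
    next
      case False
      then show ?thesis using s by (simp add: limit_function_def power_series_def)
    qed
  qed
  ultimately show ?thesis ..
qed

section \<open>Convergence of the traces and of the characteristic polynomial\<close>

lemma continuous_map_newton:
  assumes "k \<le> l"
  shows "continuous_map (product_topology (\<lambda>_. euclideanreal) {1..l}) euclideanreal (\<lambda>x. newton x k)"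
  using assms
proof (induction k rule: less_induct)
  case (less k)
  show ?case
  proof (cases k)
    case (Suc m)
    have p: "continuous_map (product_topology (\<lambda>_. euclideanreal) {1..l}) euclideanreal (\<lambda>x. x (Suc m - i))" if "i \<le> m" for i
      using that less.prems Suc by (intro continuous_map_product_projection) auto
    have n: "continuous_map (product_topology (\<lambda>_. euclideanreal) {1..l}) euclideanreal (\<lambda>x. newton x i)" if "i \<le> m" for i
      using that less.prems Suc by (intro less.IH) auto
    have "continuous_map (product_topology (\<lambda>_. euclideanreal) {1..l}) euclideanreal
        (\<lambda>x. - (\<Sum>i\<le>m. newton x i * x (Suc m - i)) * (1 / of_nat (Suc m)))"
      by (intro continuous_map_real_mult continuous_map_minus continuous_map_sum p n) auto
    then show ?thesis by (simp add: Suc)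
  qed simp
qed

lemma measurable_newton:
  fixes T :: "'a \<Rightarrow> nat \<Rightarrow> real"
  assumes T: "\<And>i. 1 \<le> i \<Longrightarrow> (\<lambda>\<omega>. T \<omega> i) \<in> borel_measurable M"
  shows "(\<lambda>\<omega>. newton (T \<omega>) k) \<in> borel_measurable M"
proof (induction k rule: less_induct)
  case (less k)
  show ?case
  proof (cases k)
    case (Suc m)
    have "(\<lambda>\<omega>. - (\<Sum>i\<le>m. newton (T \<omega>) i * T \<omega> (Suc m - i)) / of_nat (Suc m)) \<in> borel_measurable M"
      by (intro borel_measurable_divide borel_measurable_uminus borel_measurable_sum borel_measurable_times less.IH T) (auto simp: Suc)
    then show ?thesis by (simp add: Suc)
  qed simp
qed

text \<open>Only finitely many coefficients vary, and the sum of their changes bounds the distance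
  of the functions uniformly on the disc.\<close>

lemma continuous_map_power_series_trunc:
  assumes c: "\<And>k. k \<le> K \<Longrightarrow> continuous_map T euclideanreal (\<lambda>x. c x k)"
  shows "continuous_map T disc_holomorphic_topology (\<lambda>x. power_series (trunc K (c x)))"
  unfolding continuous_map_def
proof (intro conjI allI impI)
  show "(\<lambda>x. power_series (trunc K (c x))) \<in> topspace T \<rightarrow> topspace disc_holomorphic_topology"
    by (auto simp: topspace_disc_holomorphic_topology power_series_holomorphic disc_coeffs_trunc)
  fix U assume "openin disc_holomorphic_topology U"
  then have U: "openin_disc_holomorphic U" by (simp add: openin_disc_holomorphic_topology)
  show "openin T {x \<in> topspace T. power_series (trunc K (c x)) \<in> U}"
  proof (subst openin_subopen, rule ballI)
    fix x0 assume "x0 \<in> {x \<in> topspace T. power_series (trunc K (c x)) \<in> U}"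
    then have x0: "x0 \<in> topspace T" "power_series (trunc K (c x0)) \<in> U" by auto
    obtain L e where L: "compact L" "L \<subseteq> ball 0 1" "0 < e"
      "\<And>g. g \<in> disc_holomorphic \<Longrightarrow> (\<forall>z\<in>L. dist (power_series (trunc K (c x0)) z) (g z) < e) \<Longrightarrow> g \<in> U"
      using U x0(2) unfolding openin_disc_holomorphic_def by meson
    obtain r where r: "0 \<le> r" "r < 1" "L \<subseteq> cball 0 r" using compact_subset_cball[OF L(1,2)] .
    define V where "V = {x \<in> topspace T. (\<Sum>k\<le>K. \<bar>c x0 k - c x k\<bar>) \<in> {..<e}}"
    have "continuous_map T euclideanreal (\<lambda>x. \<Sum>k\<le>K. \<bar>c x0 k - c x k\<bar>)"
      by (intro continuous_map_sum continuous_map_real_abs continuous_map_diff c) auto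
    then have "openin T V" unfolding V_def by (rule openin_continuous_map_preimage) simp
    moreover have "x0 \<in> V" using x0 L(3) by (simp add: V_def)
    moreover have "V \<subseteq> {x \<in> topspace T. power_series (trunc K (c x)) \<in> U}"
    proof
      fix x assume x: "x \<in> V"
      have "power_series (trunc K (c x)) \<in> U"
      proof (rule L(4), rule power_series_holomorphic[OF disc_coeffs_trunc], rule ballI)
        fix z assume "z \<in> L"
        then have z: "norm z \<le> r" using r by auto
        have "norm (power_series (trunc K (c x0)) z - power_series (trunc K (c x)) z)
            \<le> (\<Sum>k. \<bar>trunc K (c x0) k - trunc K (c x) k\<bar> * r ^ k)"
          by (rule power_series_diff_le[OF disc_coeffs_trunc disc_coeffs_trunc z r(2)])
        also have "\<dots> = (\<Sum>k\<le>K. \<bar>trunc K (c x0) k - trunc K (c x) k\<bar> * r ^ k)"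
          by (rule suminf_finite) (auto simp: trunc_def)
        also have "\<dots> \<le> (\<Sum>k\<le>K. \<bar>c x0 k - c x k\<bar> * 1)"
          using r by (intro sum_mono mult_mono power_le_one) (auto simp: trunc_def)
        also have "\<dots> < e" using x by (simp add: V_def)
        finally show "dist (power_series (trunc K (c x0)) z) (power_series (trunc K (c x)) z) < e"
          by (simp add: dist_norm)
      qed
      then show "x \<in> {x \<in> topspace T. power_series (trunc K (c x)) \<in> U}" using x by (simp add: V_def)
    qed
    ultimately show "\<exists>V. openin T V \<and> x0 \<in> V \<and> V \<subseteq> {x \<in> topspace T. power_series (trunc K (c x)) \<in> U}" by blast
  qed
qed

text \<open>Measurability is the purpose. The condition over uncountably many \<open>z\<close>
  becomes countably many conditions on nonnegative series, because convergence at one radius implies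
  absolute convergence at all smaller ones and the radii \<open>1 - 1 / (j + 1)\<close> exhaust the
  disc.\<close>

lemma gaussian_series_summable_iff:
  "(\<forall>z\<in>ball 0 1. summable (gaussian_series_term \<zeta> z)) \<longleftrightarrow>
   (\<forall>j::nat. (\<Sum>m. ennreal (\<bar>\<zeta> (Suc m)\<bar> / sqrt (real (Suc m)) * (1 - 1 / (real j + 1)) ^ Suc m)) \<noteq> \<infinity>)"
  (is "?L \<longleftrightarrow> (\<forall>j. (\<Sum>m. ennreal (?a j m)) \<noteq> \<infinity>)")
proof -
  define h where "h k = (if k = 0 then 0 else complex_of_real (\<zeta> k / sqrt (real k)))" for k
  have term_eq: "gaussian_series_term \<zeta> z = (\<lambda>m. h (Suc m) * z ^ Suc m)" for z
    by (rule ext) (simp add: gaussian_series_term_def h_def Let_def)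
  have L_iff: "summable (gaussian_series_term \<zeta> z) \<longleftrightarrow> summable (\<lambda>k. h k * z ^ k)" for z
    unfolding term_eq by (rule summable_Suc_iff)
  define r where "r j = 1 - 1 / (real j + 1)" for j :: nat
  have r: "0 \<le> r j" "r j < 1" for j by (auto simp: r_def field_simps)
  have nh: "norm (h (Suc m) * complex_of_real (r j) ^ Suc m) = ?a j m" for j m
  proof -
    have "norm (h (Suc m)) = \<bar>\<zeta> (Suc m)\<bar> / sqrt (real (Suc m))"
      by (simp add: h_def norm_divide del: of_nat_Suc)
    moreover have "norm (complex_of_real (r j) ^ Suc m) = (1 - 1 / (real j + 1)) ^ Suc m"
      using r[of j] by (simp only: norm_power norm_of_real) (simp add: r_def)
    ultimately show ?thesis by (simp only: norm_mult)
  qed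
  have a0: "0 \<le> ?a j m" for j m unfolding nh[symmetric] by (rule norm_ge_zero)
  have fin: "(\<Sum>m. ennreal (?a j m)) \<noteq> \<infinity> \<longleftrightarrow> summable (?a j)" for j
    using summable_suminf_not_top[of "?a j", OF a0] ennreal_suminf_neq_top[of "?a j", OF _ a0]
    unfolding infinity_ennreal_def by blast
  have a_iff: "summable (?a j) \<longleftrightarrow> summable (\<lambda>k. norm (h k * complex_of_real (r j) ^ k))" for j
    unfolding nh[symmetric] by (rule summable_Suc_iff)
  show ?thesis
    unfolding fin a_iff L_iff
  proof
    assume L: "\<forall>z\<in>ball 0 1. summable (\<lambda>k. h k * z ^ k)"
    show "\<forall>j. summable (\<lambda>k. norm (h k * complex_of_real (r j) ^ k))"
    proof
      fix j
      define q where "q = (1 + r j) / 2"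
      have q: "0 \<le> q" "q < 1" "r j < q" using r[of j] by (auto simp: q_def)
      have "complex_of_real q \<in> ball 0 1" using q by simp
      then have "summable (\<lambda>k. h k * complex_of_real q ^ k)" using L by blast
      then show "summable (\<lambda>k. norm (h k * complex_of_real (r j) ^ k))"
        by (rule powser_insidea) (use q r[of j] in simp)
    qed
  next
    assume R: "\<forall>j. summable (\<lambda>k. norm (h k * complex_of_real (r j) ^ k))"
    show "\<forall>z\<in>ball 0 1. summable (\<lambda>k. h k * z ^ k)"
    proof
      fix z :: complex assume "z \<in> ball 0 1"
      then have "norm z < 1" by simp
      then obtain j where j: "inverse (real (Suc j)) < 1 - norm z"
        using reals_Archimedean[of "1 - norm z"] by auto
      then have "norm z < r j" by (simp add: r_def inverse_eq_divide add.commute)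
      then show "summable (\<lambda>k. h k * z ^ k)"
        using r[of j] by (intro powser_inside[OF summable_norm_cancel[OF R[rule_format, of j]]]) simp
    qed
  qed
qed

text \<open>Independence factorizes the mean; each factor is the standard Gaussian characteristic
  function at \<open>s k * sqrt k\<close>. The shifts \<open>c k\<close> only produce a
  phase.\<close>

lemma gaussian_cis_expectation:
  fixes Z :: "nat \<Rightarrow> 'b \<Rightarrow> real"
  assumes N: "prob_space N" and ind: "prob_space.indep_vars N (\<lambda>_. borel) Z {1..}"
    and law: "\<And>k. k \<ge> 1 \<Longrightarrow> distr N borel (Z k) = std_normal_distribution"
  shows "(\<integral>\<omega>. cis (\<Sum>k=1..K. s k * (c k + sqrt (real k) * Z k \<omega>)) \<partial>N)
    = cis (\<Sum>k=1..K. s k * c k) * of_real (exp (- (\<Sum>k=1..K. (s k)\<^sup>2 * real k) / 2))"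
proof -
  interpret N: prob_space N by (rule N)
  have Zm: "Z k \<in> borel_measurable N" if "k \<ge> 1" for k
    using ind that by (auto simp: N.indep_vars_def)
  have ind': "N.indep_vars (\<lambda>_. borel) (\<lambda>k \<omega>. cis (s k * sqrt (real k) * Z k \<omega>)) {1..K}"
    by (rule N.indep_vars_compose2[OF N.indep_vars_subset[OF ind]]) (auto simp: cis_conv_exp)
  have one: "(\<integral>\<omega>. cis (s k * sqrt (real k) * Z k \<omega>) \<partial>N) = of_real (exp (- ((s k)\<^sup>2 * real k) / 2))" if k: "k \<in> {1..K}" for k
  proof -
    have "(\<integral>\<omega>. cis (s k * sqrt (real k) * Z k \<omega>) \<partial>N) = char (distr N borel (Z k)) (s k * sqrt (real k))"
      using Zm[of k] k by (simp add: char_def integral_distr cis_conv_exp)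
    also have "\<dots> = of_real (exp (- ((s k)\<^sup>2 * real k) / 2))"
      using k by (simp add: law char_std_normal_distribution power_mult_distrib)
    finally show ?thesis .
  qed
  have cis_sum: "cis (\<Sum>k\<in>A. f k) = (\<Prod>k\<in>A. cis (f k))" for f :: "nat \<Rightarrow> real" and A
    by (induction A rule: infinite_finite_induct) (auto simp: cis_mult[symmetric])
  have "(\<Sum>k=1..K. s k * (c k + sqrt (real k) * Z k \<omega>)) = (\<Sum>k=1..K. s k * c k) + (\<Sum>k=1..K. s k * sqrt (real k) * Z k \<omega>)" for \<omega>
    by (simp add: distrib_left sum.distrib mult.assoc)
  then have "(\<integral>\<omega>. cis (\<Sum>k=1..K. s k * (c k + sqrt (real k) * Z k \<omega>)) \<partial>N)
      = cis (\<Sum>k=1..K. s k * c k) * (\<integral>\<omega>. (\<Prod>k\<in>{1..K}. cis (s k * sqrt (real k) * Z k \<omega>)) \<partial>N)"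
    by (simp only: cis_mult[symmetric] cis_sum[of "\<lambda>k. s k * sqrt (real k) * Z k _"] integral_mult_right_zero)
  also have "(\<integral>\<omega>. (\<Prod>k\<in>{1..K}. cis (s k * sqrt (real k) * Z k \<omega>)) \<partial>N)
      = (\<Prod>k\<in>{1..K}. \<integral>\<omega>. cis (s k * sqrt (real k) * Z k \<omega>) \<partial>N)"
  proof (rule N.indep_vars_lebesgue_integral[OF _ ind'])
    fix k assume "k \<in> {1..K}"
    then have [measurable]: "Z k \<in> borel_measurable N" by (intro Zm) simp
    show "integrable N (\<lambda>\<omega>. cis (s k * sqrt (real k) * Z k \<omega>))"
      by (intro N.bounded_rv_integrable N.bounded_rv_cis) measurable
  qed simp
  also have "\<dots> = (\<Prod>k\<in>{1..K}. of_real (exp (- ((s k)\<^sup>2 * real k) / 2)))"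
    by (intro prod.cong refl one)
  also have "\<dots> = of_real (exp (\<Sum>k=1..K. - ((s k)\<^sup>2 * real k) / 2))"
    by (simp add: exp_sum)
  also have "(\<Sum>k=1..K. - ((s k)\<^sup>2 * real k) / 2) = - (\<Sum>k=1..K. (s k)\<^sup>2 * real k) / 2"
    by (simp add: sum_negf sum_divide_distrib)
  finally show ?thesis .
qed

section \<open>Second moments of the determinant coefficients\<close>

context iid_symmetric_matrix
begin

definition perm_edges :: "nat set \<Rightarrow> (nat \<Rightarrow> nat) \<Rightarrow> (nat \<times> nat) list" where
  "perm_edges S \<sigma> = map (\<lambda>i. (i, \<sigma> i)) (sorted_list_of_set S)"

definition det_coeff_rv :: "nat \<Rightarrow> 'a \<Rightarrow> nat \<Rightarrow> real" where
  "det_coeff_rv n \<omega> k = (if k \<le> n then det_coeff n (\<lambda>p. Y n p \<omega>) k else 0)"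

definition partial_perms :: "nat \<Rightarrow> nat \<Rightarrow> (nat set \<times> (nat \<Rightarrow> nat)) set" where
  "partial_perms n k = (SIGMA S:{S. S \<subseteq> {..<n} \<and> card S = k}. {\<sigma>. \<sigma> permutes S})"

lemma partial_perms_finite: "finite (partial_perms n k)"
  unfolding partial_perms_def
  by (intro finite_SigmaI) (auto intro: finite_permutations finite_subset)

text \<open>There are \<open>n choose k\<close> index sets with \<open>fact k\<close> permutations
  each. The bound is exactly compensated by the factor \<open>(1 / n) ^ k\<close> in the mean of a
  squared term.\<close>

lemma card_partial_perms_le: "card (partial_perms n k) \<le> n ^ k"
proof -
  have "card (partial_perms n k) = (\<Sum>S | S \<subseteq> {..<n} \<and> card S = k. card {\<sigma>. \<sigma> permutes S})"
    unfolding partial_perms_def by (rule card_SigmaI) (auto intro: finite_permutations finite_subset)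
  also have "\<dots> = (\<Sum>S | S \<subseteq> {..<n} \<and> card S = k. fact k)"
    by (intro sum.cong refl card_permutations) (auto intro: finite_subset)
  also have "\<dots> = (n choose k) * fact k" by (simp add: n_subsets)
  also have "\<dots> \<le> n ^ k" by (rule binomial_fact_pow)
  finally show ?thesis .
qed

lemma det_coeff_eq_mon:
  "det_coeff n (\<lambda>p. Y n p \<omega>) k
    = (\<Sum>P\<in>partial_perms n k. ((- 1) ^ k * signof (snd P)) * mon n (perm_edges (fst P) (snd P)) \<omega>)"
proof -
  have e: "(\<Prod>i\<in>S. Y n (i, \<sigma> i) \<omega>) = mon n (perm_edges S \<sigma>) \<omega>" if "finite S" for S \<sigma>
    using that by (simp add: mon_def perm_edges_def o_def prod.distinct_set_conv_list[symmetric])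
  have "det_coeff n (\<lambda>p. Y n p \<omega>) k = (\<Sum>S | S \<subseteq> {..<n} \<and> card S = k. \<Sum>\<sigma> | \<sigma> permutes S.
      ((- 1) ^ k * signof \<sigma>) * mon n (perm_edges S \<sigma>) \<omega>)"
    unfolding det_coeff_def sum_distrib_left
  proof (intro sum.cong refl)
    fix S \<sigma> assume "S \<in> {S. S \<subseteq> {..<n} \<and> card S = k}"
    then have "finite S" by (auto intro: finite_subset)
    then show "(- 1) ^ k * (signof \<sigma> * (\<Prod>i\<in>S. Y n (i, \<sigma> i) \<omega>)) = ((- 1) ^ k * signof \<sigma>) * mon n (perm_edges S \<sigma>) \<omega>"
      by (simp only: e mult.assoc)
  qed
  also have "\<dots> = (\<Sum>P\<in>partial_perms n k. ((- 1) ^ k * signof (snd P)) * mon n (perm_edges (fst P) (snd P)) \<omega>)"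
    unfolding partial_perms_def
    by (subst sum.Sigma) (auto intro: finite_permutations finite_subset simp: case_prod_unfold)
  finally show ?thesis .
qed

lemma perm_edges_props:
  assumes "finite S"
  shows "map fst (perm_edges S \<sigma>) = sorted_list_of_set S" "set (perm_edges S \<sigma>) = (\<lambda>i. (i, \<sigma> i)) ` S"
    "distinct (perm_edges S \<sigma>)"
  using assms by (auto simp: perm_edges_def o_def distinct_map inj_on_def)

text \<open>The edges of one partial permutation are pairwise distinct, so even multiplicities in
  the union force equal edge sets. The edge set determines the index set and the permutation on
  it.\<close>

lemma perm_edges_even:
  assumes P: "P \<in> partial_perms n k" and Q: "Q \<in> partial_perms n k"
    and even: "even_edges (perm_edges (fst P) (snd P) @ perm_edges (fst Q) (snd Q))"
  shows "P = Q"
proof -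
  obtain S \<sigma> S' \<sigma>' where PQ: "P = (S, \<sigma>)" "Q = (S', \<sigma>')" by (cases P; cases Q) auto
  have fin: "finite S" "finite S'" and perm: "\<sigma> permutes S" "\<sigma>' permutes S'"
    using P Q by (auto simp: PQ partial_perms_def intro: finite_subset)
  have cnt: "count_list (perm_edges S \<sigma>) e = of_bool (e \<in> (\<lambda>i. (i, \<sigma> i)) ` S)" if "finite S" for S \<sigma> e
  proof -
    have "count_list es e = of_bool (e \<in> set es)" if "distinct es" for es :: "(nat \<times> nat) list"
      using that by (induction es) auto
    then show ?thesis using perm_edges_props[OF that] by simp
  qed
  have iff: "e \<in> (\<lambda>i. (i, \<sigma> i)) ` S \<longleftrightarrow> e \<in> (\<lambda>i. (i, \<sigma>' i)) ` S'" for e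
  proof -
    have "even (count_list (perm_edges S \<sigma>) e + count_list (perm_edges S' \<sigma>') e)"
      using even unfolding even_edges_def PQ fst_conv snd_conv count_list_append by blast
    then show ?thesis unfolding cnt[OF fin(1)] cnt[OF fin(2)] by (auto simp: of_bool_def split: if_splits)
  qed
  have sub: "i \<in> S \<longleftrightarrow> i \<in> S'" for i
  proof
    assume "i \<in> S"
    then have "(i, \<sigma> i) \<in> (\<lambda>i. (i, \<sigma>' i)) ` S'" using iff[of "(i, \<sigma> i)"] by blast
    then show "i \<in> S'" by auto
  next
    assume "i \<in> S'"
    then have "(i, \<sigma>' i) \<in> (\<lambda>i. (i, \<sigma> i)) ` S" using iff[of "(i, \<sigma>' i)"] by blast
    then show "i \<in> S" by auto
  qed
  then have SS: "S = S'" by blast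
  have "\<sigma> i = \<sigma>' i" for i
  proof (cases "i \<in> S")
    case True
    then have "(i, \<sigma> i) \<in> (\<lambda>i. (i, \<sigma>' i)) ` S'" using iff[of "(i, \<sigma> i)"] by blast
    then show ?thesis by auto
  next
    case False
    then show ?thesis using perm SS by (simp add: permutes_not_in)
  qed
  then show ?thesis using PQ SS by auto
qed

lemma perm_edges_sq:
  assumes "P \<in> partial_perms n k"
  shows "set (perm_edges (fst P) (snd P)) \<subseteq> sq n"
proof -
  obtain S \<sigma> where P: "P = (S, \<sigma>)" by (cases P)
  have S: "S \<subseteq> {..<n}" "\<sigma> permutes S" using assms by (auto simp: P partial_perms_def)
  then have "finite S" by (auto intro: finite_subset)
  moreover have "\<sigma> i < n" if "i \<in> S" for i
    using permutes_in_image[OF S(2), of i] that S(1) by auto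
  ultimately show ?thesis using S by (auto simp: P perm_edges_props sq_def)
qed

lemma bounded_rv_det_coeff: "bounded_rv (\<lambda>\<omega>. det_coeff_rv n \<omega> k)"
proof (cases "k \<le> n")
  case True
  then show ?thesis
    unfolding det_coeff_rv_def det_coeff_eq_mon
    by simp (intro bounded_rv_intros bounded_rv_mon perm_edges_sq)
next
  case False
  then show ?thesis by (simp add: det_coeff_rv_def bounded_rv_const)
qed

text \<open>By parity the minors are uncorrelated.\<close>

lemma det_coeff_second_moment: "expectation (\<lambda>\<omega>. (det_coeff_rv n \<omega> k)\<^sup>2) \<le> 1"
proof (cases "k \<le> n \<and> n > 0")
  case True
  then have n: "n > 0" by simp
  let ?P = "partial_perms n k"
  let ?e = "\<lambda>P. perm_edges (fst P) (snd P)"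
  let ?s = "\<lambda>P. (- 1) ^ k * signof (snd P) :: real"
  have s1: "?s P * ?s P = 1" for P
    by (simp add: sign_def flip: power_add)
  have bm: "bounded_rv (mon n (?e P @ ?e Q))" if "P \<in> ?P" "Q \<in> ?P" for P Q
    using perm_edges_sq[OF that(1)] perm_edges_sq[OF that(2)] by (intro bounded_rv_mon) auto
  have "expectation (\<lambda>\<omega>. (det_coeff_rv n \<omega> k)\<^sup>2)
      = expectation (\<lambda>\<omega>. \<Sum>P\<in>?P. \<Sum>Q\<in>?P. (?s P * ?s Q) * mon n (?e P @ ?e Q) \<omega>)"
    using True by (simp add: det_coeff_rv_def det_coeff_eq_mon power2_eq_square sum_product mon_append mult_ac)
  also have "\<dots> = (\<Sum>P\<in>?P. expectation (\<lambda>\<omega>. \<Sum>Q\<in>?P. (?s P * ?s Q) * mon n (?e P @ ?e Q) \<omega>))"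
    by (intro Bochner_Integration.integral_sum bounded_rv_integrable bounded_rv_intros bm)
  also have "\<dots> = (\<Sum>P\<in>?P. \<Sum>Q\<in>?P. expectation (\<lambda>\<omega>. (?s P * ?s Q) * mon n (?e P @ ?e Q) \<omega>))"
    by (intro sum.cong[OF refl] Bochner_Integration.integral_sum bounded_rv_integrable bounded_rv_intros bm)
  also have "\<dots> = (\<Sum>P\<in>?P. \<Sum>Q\<in>?P. if P = Q then expectation (mon n (?e P @ ?e P)) else 0)"
  proof (intro sum.cong refl)
    fix P Q assume PQ: "P \<in> ?P" "Q \<in> ?P"
    show "expectation (\<lambda>\<omega>. (?s P * ?s Q) * mon n (?e P @ ?e Q) \<omega>) = (if P = Q then expectation (mon n (?e P @ ?e P)) else 0)"
    proof (cases "P = Q")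
      case True
      then show ?thesis by (simp only: s1 mult_1 refl if_True)
    next
      case False
      then have "\<not> even_edges (?e P @ ?e Q)" using perm_edges_even[OF PQ] by blast
      then have "expectation (mon n (?e P @ ?e Q)) = 0"
        using perm_edges_sq[OF PQ(1)] perm_edges_sq[OF PQ(2)] by (intro expectation_mon_not_even n) auto
      then show ?thesis using False by (simp only: integral_mult_right_zero if_False mult_zero_right)
    qed
  qed
  also have "\<dots> = (\<Sum>P\<in>?P. expectation (mon n (?e P @ ?e P)))"
    using partial_perms_finite by simp
  also have "\<dots> \<le> (\<Sum>P\<in>?P. (1 / real n) ^ k)"
  proof (rule sum_mono)
    fix P assume P: "P \<in> ?P"
    have sub: "fst P \<subseteq> {..<n}" and "card (fst P) = k" using P by (auto simp: partial_perms_def)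
    moreover have "finite (fst P)" using sub by (rule finite_subset) simp
    ultimately have "card (fst ` set (?e P @ ?e P)) = k"
      by (simp add: perm_edges_props image_image)
    then show "expectation (mon n (?e P @ ?e P)) \<le> (1 / real n) ^ k"
      using abs_expectation_mon_le[of "?e P @ ?e P" n] perm_edges_sq[OF P] by auto
  qed
  also have "\<dots> = real (card ?P) * (1 / real n) ^ k" by simp
  also have "\<dots> \<le> real (n ^ k) * (1 / real n) ^ k"
    by (intro mult_right_mono of_nat_mono card_partial_perms_le) auto
  also have "\<dots> = 1" using n by (simp add: power_divide)
  finally show ?thesis .
next
  \<comment> \<open>What remains is the empty matrix, whose coefficient of order 0 is 1, and the
    orders beyond \<open>n\<close>, where the coefficient is 0.\<close>
  case False
  show ?thesis
  proof (cases "k \<le> n")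
    case True
    with False have "n = 0" "k = 0" by auto
    moreover have "{S :: nat set. S = {} \<and> card S = 0} = {{}}" by auto
    ultimately have "det_coeff_rv n \<omega> k = 1" for \<omega>
      by (simp add: det_coeff_rv_def det_coeff_def)
    then show ?thesis by (simp add: prob_space)
  next
    case False
    then show ?thesis by (simp add: det_coeff_rv_def)
  qed
qed

abbreviation Ymat :: "nat \<Rightarrow> 'a \<Rightarrow> real mat" where
  "Ymat n \<omega> \<equiv> self_normalized_mat n (\<lambda>i j. X i j \<omega>)"

lemma Ymat_carrier: "Ymat n \<omega> \<in> carrier_mat n n"
  by (simp add: self_normalized_mat_def)

lemma Ymat_entry: "p \<in> sq n \<Longrightarrow> Ymat n \<omega> $$ p = Y n p \<omega>"
  by (auto simp: self_normalized_mat_def sq_def Y_def)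

end

lemma of_real_prod_list_map: "of_real (\<Prod>p\<leftarrow>ps. f p) = (\<Prod>p\<leftarrow>ps. of_real (f p) :: complex)"
  by (induction ps) auto

text \<open>Off the convergence event the coefficients are 0, in accordance with
  \<open>limit_function\<close>. So they define a holomorphic function at every sample point and not
  merely almost surely.\<close>

definition limit_coeffs :: "(nat \<Rightarrow> real) \<Rightarrow> nat \<Rightarrow> real" where
  "limit_coeffs \<zeta> = (if \<forall>z\<in>ball 0 1. summable (gaussian_series_term \<zeta> z)
     then newton (\<lambda>k. of_bool (even k) + sqrt (real k) * \<zeta> k) else (\<lambda>_. 0))"

lemma disc_coeffs_limit_coeffs: "disc_coeffs (limit_coeffs \<zeta>)"
  using gaussian_exp_newton[of \<zeta>] by (auto simp: limit_coeffs_def intro: disc_coeffs_finite)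

lemma limit_function_eq_power_series: "limit_function \<zeta> = power_series (limit_coeffs \<zeta>)"
proof (cases "\<forall>z\<in>ball 0 1. summable (gaussian_series_term \<zeta> z)")
  case True
  then show ?thesis using gaussian_exp_newton[OF True] by (simp only: limit_coeffs_def if_P[OF True])
next
  case False
  then show ?thesis
    by (simp only: limit_coeffs_def limit_function_def if_False power_series_def of_real_0 mult_zero_left suminf_zero)
qed

lemma measurable_limit_coeffs:
  fixes Z :: "nat \<Rightarrow> 'b \<Rightarrow> real"
  assumes Z: "\<And>k. k \<ge> 1 \<Longrightarrow> Z k \<in> borel_measurable N"
  shows "(\<lambda>\<omega>. limit_coeffs (\<lambda>k. Z k \<omega>) k) \<in> borel_measurable N"
proof -
  have [measurable]: "Z (Suc m) \<in> borel_measurable N" for m by (rule Z) simp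
  have "{\<omega> \<in> space N. \<forall>z\<in>ball 0 1. summable (gaussian_series_term (\<lambda>k. Z k \<omega>) z)} \<in> sets N"
    unfolding gaussian_series_summable_iff by measurable
  moreover have "(\<lambda>\<omega>. newton (\<lambda>k. of_bool (even k) + sqrt (real k) * Z k \<omega>) k) \<in> borel_measurable N"
    by (intro measurable_newton borel_measurable_add borel_measurable_times Z) auto
  ultimately have "(\<lambda>\<omega>. if \<forall>z\<in>ball 0 1. summable (gaussian_series_term (\<lambda>k. Z k \<omega>) z)
      then newton (\<lambda>k. of_bool (even k) + sqrt (real k) * Z k \<omega>) k else 0) \<in> borel_measurable N"
    by (intro measurable_If) auto
  then show ?thesis
    by (rule measurable_cong[THEN iffD1, rotated]) (simp add: limit_coeffs_def)
qed

section \<open>Joint convergence of the traces and of the determinant\<close>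

context iid_attracted_matrix
begin

lemma trace_Ymat:
  assumes "k \<ge> 1"
  shows "mat_trace (Ymat n \<omega> ^\<^sub>m k) = closed_walks n k \<omega>"
  unfolding mat_trace_power_eq_words[OF Ymat_carrier assms] closed_walks_def mon_def
proof (intro sum.cong refl arg_cong[where f = prod_list] map_cong)
  fix xs e assume "xs \<in> words n k" "e \<in> set (cyc xs)"
  then show "Ymat n \<omega> $$ e = Y n e \<omega>"
    using short_word_cyc[OF word_short] by (intro Ymat_entry) blast
qed

abbreviation cYmat :: "nat \<Rightarrow> 'a \<Rightarrow> complex mat" where
  "cYmat n \<omega> \<equiv> map_mat complex_of_real (Ymat n \<omega>)"

lemma cYmat_carrier: "cYmat n \<omega> \<in> carrier_mat n n"
  by (simp add: self_normalized_mat_def)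

lemma cYmat_entry:
  assumes "p \<in> sq n"
  shows "cYmat n \<omega> $$ p = of_real (Y n p \<omega>)"
proof -
  have "cYmat n \<omega> $$ p = of_real (Ymat n \<omega> $$ p)"
    using assms Ymat_carrier[of n \<omega>] by (cases p) (auto simp: sq_def)
  then show ?thesis by (simp only: Ymat_entry[OF assms])
qed

lemma trace_cYmat:
  assumes "k \<ge> 1"
  shows "mat_trace (cYmat n \<omega> ^\<^sub>m k) = of_real (closed_walks n k \<omega>)"
  unfolding mat_trace_power_eq_words[OF cYmat_carrier assms] closed_walks_def mon_def of_real_sum of_real_prod_list_map
proof (intro sum.cong refl arg_cong[where f = prod_list] map_cong)
  fix xs e assume "xs \<in> words n k" "e \<in> set (cyc xs)"
  then show "cYmat n \<omega> $$ e = of_real (Y n e \<omega>)"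
    using short_word_cyc[OF word_short] by (intro cYmat_entry) blast
qed

lemma det_coeff_cYmat: "det_coeff n (\<lambda>p. cYmat n \<omega> $$ p) k = of_real (det_coeff n (\<lambda>p. Y n p \<omega>) k)"
proof -
  have "(\<Prod>i\<in>S. cYmat n \<omega> $$ (i, \<sigma> i)) = of_real (\<Prod>i\<in>S. Y n (i, \<sigma> i) \<omega>)"
    if S: "S \<subseteq> {..<n}" "\<sigma> permutes S" for S \<sigma>
    unfolding of_real_prod
  proof (intro prod.cong refl cYmat_entry)
    fix i assume "i \<in> S"
    then have "i \<in> S" "\<sigma> i \<in> S" using permutes_in_image[OF S(2), of i] by auto
    then show "(i, \<sigma> i) \<in> sq n" using S(1) by (auto simp: sq_def)
  qed
  then have "(\<Sum>S | S \<subseteq> {..<n} \<and> card S = k. \<Sum>\<sigma> | \<sigma> permutes S. signof \<sigma> * (\<Prod>i\<in>S. cYmat n \<omega> $$ (i, \<sigma> i)))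
      = (\<Sum>S | S \<subseteq> {..<n} \<and> card S = k. \<Sum>\<sigma> | \<sigma> permutes S. of_real (signof \<sigma> * (\<Prod>i\<in>S. Y n (i, \<sigma> i) \<omega>)))"
    by (intro sum.cong refl) auto
  then show ?thesis
    unfolding det_coeff_def of_real_mult[of "(- 1) ^ k"] of_real_sum by simp
qed

lemma det_cYmat:
  "(\<lambda>z\<in>ball 0 1. det (1\<^sub>m n - z \<cdot>\<^sub>m cYmat n \<omega>)) = power_series (det_coeff_rv n \<omega>)"
proof -
  have "(\<Sum>k. complex_of_real (det_coeff_rv n \<omega> k) * z ^ k) = det (1\<^sub>m n - z \<cdot>\<^sub>m cYmat n \<omega>)" for z
  proof -
    have "(\<Sum>k. complex_of_real (det_coeff_rv n \<omega> k) * z ^ k) = (\<Sum>k\<le>n. complex_of_real (det_coeff_rv n \<omega> k) * z ^ k)"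
      by (rule suminf_finite) (auto simp: det_coeff_rv_def)
    also have "\<dots> = (\<Sum>k\<le>n. det_coeff n (\<lambda>p. cYmat n \<omega> $$ p) k * z ^ k)"
      by (intro sum.cong refl) (simp add: det_coeff_rv_def det_coeff_cYmat)
    finally show ?thesis by (simp only: det_one_minus_smult_expand[OF cYmat_carrier])
  qed
  then show ?thesis by (simp add: power_series_def)
qed

text \<open>The identity is obtained over the complex numbers, where the characteristic polynomial
  splits, and both sides turn out to be images of reals.\<close>

lemma det_coeff_rv_eq_newton:
  assumes "k \<le> n"
  shows "det_coeff_rv n \<omega> k = newton (\<lambda>k. closed_walks n k \<omega>) k"
proof -
  have "complex_of_real (det_coeff_rv n \<omega> k) = newton (\<lambda>k. mat_trace (cYmat n \<omega> ^\<^sub>m k)) k"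
    using det_coeff_eq_newton[OF cYmat_carrier assms, of \<omega>] assms by (simp add: det_coeff_rv_def det_coeff_cYmat)
  also have "\<dots> = newton (\<lambda>k. of_real (closed_walks n k \<omega>)) k"
    by (intro newton_cong trace_cYmat)
  also have "\<dots> = of_real (newton (\<lambda>k. closed_walks n k \<omega>) k)" by (rule newton_of_real)
  finally show ?thesis by (simp only: of_real_eq_iff)
qed

text \<open>The lengths \<open>k i\<close> may repeat, in which case the same Gaussian appears in
  several coordinates. The coefficients \<open>t i\<close> belonging to one length are therefore
  added up before the limit theorem for the distinct lengths \<open>1, ..., K\<close> is
  applied.\<close>

lemma closed_walks_conv:
  fixes N :: "'b measure" and Z :: "nat \<Rightarrow> 'b \<Rightarrow> real"
  assumes N: "prob_space N" and ind: "prob_space.indep_vars N (\<lambda>_. borel) Z {1..}"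
    and law: "\<And>k. k \<ge> 1 \<Longrightarrow> distr N borel (Z k) = std_normal_distribution"
    and I: "finite (I :: nat set)" and k: "\<And>i. i \<in> I \<Longrightarrow> 1 \<le> k i"
  shows "conv_in_distribution (product_topology (\<lambda>_. euclideanreal) I)
    M (\<lambda>n \<omega>. \<lambda>i\<in>I. closed_walks n (k i) \<omega>) N (\<lambda>\<omega>. \<lambda>i\<in>I. of_bool (even (k i)) + sqrt (real (k i)) * Z (k i) \<omega>)"
proof (rule conv_in_distribution_if_char_tendsto[OF I prob_space_axioms N])
  interpret N: prob_space N by (rule N)
  show "(\<lambda>\<omega>. closed_walks n (k i) \<omega>) \<in> borel_measurable M" for n i
    by (rule bounded_rv_measurable[OF bounded_rv_closed_walks])
  show "(\<lambda>\<omega>. of_bool (even (k i)) + sqrt (real (k i)) * Z (k i) \<omega>) \<in> borel_measurable N" if "i \<in> I" for i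
  proof -
    have [measurable]: "Z (k i) \<in> borel_measurable N" using ind k[OF that] by (auto simp: N.indep_vars_def)
    show ?thesis by measurable
  qed
  fix t :: "nat \<Rightarrow> real"
  define K where "K = (\<Sum>i\<in>I. k i)"
  define s where "s j = (\<Sum>i | i \<in> I \<and> k i = j. t i)" for j
  have kK: "k ` I \<subseteq> {1..K}"
    using k I by (auto simp: K_def intro: member_le_sum)
  have regroup: "(\<Sum>i\<in>I. t i * g (k i)) = (\<Sum>j=1..K. s j * g j)" for g :: "nat \<Rightarrow> real"
  proof -
    have "(\<Sum>j=1..K. s j * g j) = (\<Sum>j=1..K. \<Sum>i | i \<in> I \<and> k i = j. t i * g (k i))"
      unfolding s_def sum_distrib_right by (intro sum.cong refl) auto
    also have "\<dots> = (\<Sum>i\<in>I. t i * g (k i))"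
      by (rule sum.group[OF I _ kK]) simp
    finally show ?thesis by (rule sym)
  qed
  have 1: "(\<Sum>i\<in>I. t i * closed_walks n (k i) \<omega>) = (\<Sum>j=1..K. s j * closed_walks n j \<omega>)" for n \<omega>
    by (rule regroup[of "\<lambda>j. closed_walks n j \<omega>"])
  have 2: "(\<Sum>i\<in>I. t i * (of_bool (even (k i)) + sqrt (real (k i)) * Z (k i) \<omega>))
      = (\<Sum>j=1..K. s j * (of_bool (even j) + sqrt (real j) * Z j \<omega>))" for \<omega>
    by (rule regroup[of "\<lambda>j. of_bool (even j) + sqrt (real j) * Z j \<omega>"])
  have 3: "(\<integral>\<omega>. cis (\<Sum>j=1..K. s j * (of_bool (even j) + sqrt (real j) * Z j \<omega>)) \<partial>N)
      = cis (\<Sum>j=1..K. s j * of_bool (even j)) * of_real (exp (- (\<Sum>j=1..K. (s j)\<^sup>2 * real j) / 2))"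
    by (rule gaussian_cis_expectation[OF N ind law])
  show "(\<lambda>n. \<integral>\<omega>. cis (\<Sum>i\<in>I. t i * closed_walks n (k i) \<omega>) \<partial>M)
      \<longlonglongrightarrow> (\<integral>\<omega>. cis (\<Sum>i\<in>I. t i * (of_bool (even (k i)) + sqrt (real (k i)) * Z (k i) \<omega>)) \<partial>N)"
    unfolding 1 2 3
    by (rule char_closed_walks_tendsto)
qed

text \<open>A truncated series is a continuous function of finitely many traces, so it converges
  together with them; \<open>power_series_expectation_tendsto\<close> removes the
  truncation.\<close>

lemma det_conv:
  fixes N :: "'b measure" and Z :: "nat \<Rightarrow> 'b \<Rightarrow> real"
  assumes N: "prob_space N" and ind: "prob_space.indep_vars N (\<lambda>_. borel) Z {1..}"
    and law: "\<And>k. k \<ge> 1 \<Longrightarrow> distr N borel (Z k) = std_normal_distribution"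
  shows "conv_in_distribution disc_holomorphic_topology
    M (\<lambda>n \<omega>. \<lambda>z\<in>ball 0 1. det (1\<^sub>m n - z \<cdot>\<^sub>m cYmat n \<omega>)) N (\<lambda>\<omega>. limit_function (\<lambda>k. Z k \<omega>))"
  unfolding det_cYmat limit_function_eq_power_series conv_in_distribution_def
proof (intro conjI allI impI)
  interpret N: prob_space N by (rule N)
  let ?T = disc_holomorphic_topology
  let ?L = "\<lambda>\<omega>. limit_coeffs (\<lambda>k. Z k \<omega>)"
  let ?G = "\<lambda>\<omega>. newton (\<lambda>k. of_bool (even k) + sqrt (real k) * Z k \<omega>)"
  have Zm: "Z k \<in> borel_measurable N" if "k \<ge> 1" for k
    using ind that by (auto simp: N.indep_vars_def)
  have Cm: "(\<lambda>\<omega>. det_coeff_rv n \<omega> k) \<in> borel_measurable M" for n k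
    by (rule bounded_rv_measurable[OF bounded_rv_det_coeff])
  have Lm: "(\<lambda>\<omega>. ?L \<omega> k) \<in> borel_measurable N" for k
    by (rule measurable_limit_coeffs[OF Zm])
  have C0: "k > n \<Longrightarrow> det_coeff_rv n \<omega> k = 0" for n \<omega> k by (simp add: det_coeff_rv_def)
  show "(\<lambda>\<omega>. power_series (det_coeff_rv n \<omega>)) \<in> measurable M (borel_of ?T)" for n
    by (intro measurable_power_series Cm disc_coeffs_finite[of n] C0)
  show "(\<lambda>\<omega>. power_series (?L \<omega>)) \<in> measurable N (borel_of ?T)"
    by (intro measurable_power_series Lm disc_coeffs_limit_coeffs)
  fix f :: "(complex \<Rightarrow> complex) \<Rightarrow> real"
  assume "continuous_map ?T euclideanreal f \<and> bounded (f ` topspace ?T)"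
  then have f: "continuous_map ?T euclideanreal f" and "\<exists>B. \<forall>h\<in>disc_holomorphic. \<bar>f h\<bar> \<le> B"
    by (auto simp: bounded_iff topspace_disc_holomorphic_topology)
  then obtain B where B: "\<And>h. h \<in> disc_holomorphic \<Longrightarrow> \<bar>f h\<bar> \<le> B" by blast
  show "(\<lambda>n. \<integral>\<omega>. f (power_series (det_coeff_rv n \<omega>)) \<partial>M) \<longlonglongrightarrow> (\<integral>\<omega>. f (power_series (?L \<omega>)) \<partial>N)"
  proof (rule power_series_expectation_tendsto[OF prob_space_axioms N Cm Lm disc_coeffs_limit_coeffs C0 _ _ f B])
    show "integrable M (\<lambda>\<omega>. (det_coeff_rv n \<omega> k)\<^sup>2)" for n k
      unfolding power2_eq_square by (intro bounded_rv_integrable bounded_rv_intros bounded_rv_det_coeff)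
    show "expectation (\<lambda>\<omega>. (det_coeff_rv n \<omega> k)\<^sup>2) \<le> 1" for n k
      by (rule det_coeff_second_moment)
    fix K
    let ?I = "{1..Suc K}"
    let ?P = "product_topology (\<lambda>_. euclideanreal) ?I"
    define g where "g x = f (power_series (trunc K (newton x)))" for x
    have "continuous_map ?P ?T (\<lambda>x. power_series (trunc K (newton x)))"
      by (intro continuous_map_power_series_trunc continuous_map_newton) simp
    then have cg: "continuous_map ?P euclideanreal g"
      using continuous_map_compose[OF _ f] by (simp add: g_def[abs_def] o_def)
    have gB: "\<bar>g x\<bar> \<le> B" for x
      unfolding g_def by (intro B power_series_holomorphic disc_coeffs_trunc)
    have bg: "bounded (g ` topspace ?P)"
      unfolding bounded_iff using gB by (intro exI[of _ B]) auto
    have g_restrict: "g (\<lambda>i\<in>?I. x i) = g x" for x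
    proof -
      have "trunc K (newton (\<lambda>i\<in>?I. x i)) = trunc K (newton x)"
        by (rule ext) (auto simp: trunc_def intro!: newton_cong)
      then show ?thesis by (simp only: g_def)
    qed
    have "conv_in_distribution ?P M (\<lambda>n \<omega>. \<lambda>i\<in>?I. closed_walks n i \<omega>)
        N (\<lambda>\<omega>. \<lambda>i\<in>?I. of_bool (even i) + sqrt (real i) * Z i \<omega>)"
      by (rule closed_walks_conv[OF N ind law, where k = "\<lambda>i. i"]) auto
    then have "(\<lambda>n. \<integral>\<omega>. g (\<lambda>i\<in>?I. closed_walks n i \<omega>) \<partial>M)
        \<longlonglongrightarrow> (\<integral>\<omega>. g (\<lambda>i\<in>?I. of_bool (even i) + sqrt (real i) * Z i \<omega>) \<partial>N)"
      using cg bg unfolding conv_in_distribution_def by blast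
    then have lim: "(\<lambda>n. \<integral>\<omega>. f (power_series (trunc K (newton (\<lambda>i. closed_walks n i \<omega>)))) \<partial>M)
        \<longlonglongrightarrow> (\<integral>\<omega>. f (power_series (trunc K (?G \<omega>))) \<partial>N)"
      unfolding g_restrict unfolding g_def .
    \<comment> \<open>For \<open>n \<ge> K\<close> all retained coefficients have order at most
      \<open>n\<close>, the range in which Newton's identities were established; finitely many
      smaller \<open>n\<close> do not affect the limit.\<close>
    have tr: "trunc K (newton (\<lambda>i. closed_walks n i \<omega>)) = trunc K (det_coeff_rv n \<omega>)" if "n \<ge> K" for n \<omega>
      using that by (intro ext) (simp add: trunc_def det_coeff_rv_eq_newton)
    have ev: "\<forall>\<^sub>F n in sequentially. (\<integral>\<omega>. f (power_series (trunc K (newton (\<lambda>i. closed_walks n i \<omega>)))) \<partial>M)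
        = (\<integral>\<omega>. f (power_series (trunc K (det_coeff_rv n \<omega>))) \<partial>M)"
      using eventually_ge_at_top[of K] by eventually_elim (simp only: tr)
    have fm: "(\<lambda>\<omega>. f (power_series (trunc K (x \<omega>)))) \<in> borel_measurable N"
      if "\<And>k. (\<lambda>\<omega>. x \<omega> k) \<in> borel_measurable N" for x
    proof -
      have "(\<lambda>\<omega>. trunc K (x \<omega>) k) \<in> borel_measurable N" for k
        using that by (cases "k \<le> K") (simp_all add: trunc_def)
      then show ?thesis
        by (intro measurable_continuous_map_borel_of[OF _ f] measurable_power_series disc_coeffs_trunc)
    qed
    have summ: "AE \<omega> in N. \<forall>z\<in>ball 0 1. summable (gaussian_series_term (\<lambda>k. Z k \<omega>) z)"
      by (rule AE_summable_gaussian_series[where Z = Z, OF Zm law])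
    \<comment> \<open>The Newton polynomials of the Gaussians and the coefficients of the limiting
      function can differ only on the null event where the series fails to converge.\<close>
    have "AE \<omega> in N. f (power_series (trunc K (?G \<omega>))) = f (power_series (trunc K (?L \<omega>)))"
      using summ
    proof eventually_elim
      case (elim \<omega>)
      show ?case by (simp only: limit_coeffs_def if_P[OF elim])
    qed
    then have "(\<integral>\<omega>. f (power_series (trunc K (?G \<omega>))) \<partial>N) = (\<integral>\<omega>. f (power_series (trunc K (?L \<omega>))) \<partial>N)"
      by (intro integral_cong_AE fm Lm measurable_newton borel_measurable_add borel_measurable_times Zm) auto
    then show "(\<lambda>n. \<integral>\<omega>. f (power_series (trunc K (det_coeff_rv n \<omega>))) \<partial>M)
        \<longlonglongrightarrow> (\<integral>\<omega>. f (power_series (trunc K (?L \<omega>))) \<partial>N)"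
      using Lim_transform_eventually[OF lim ev] by (simp only:)
  qed
qed

end

theorem theorem2p12:
  fixes M :: "'a measure" and X :: "nat \<Rightarrow> nat \<Rightarrow> 'a \<Rightarrow> real"
    and N :: "'b measure" and Z :: "nat \<Rightarrow> 'b \<Rightarrow> real"
  assumes "prob_space M"
    and "prob_space.indep_vars M (\<lambda>_. borel) (\<lambda>(i, j). X i j) (UNIV :: (nat \<times> nat) set)"
    and "\<And>i j. distr M borel (X i j) = distr M borel (X 0 0)"
    and "distr M borel (\<lambda>\<omega>. - X 0 0 \<omega>) = distr M borel (X 0 0)"
    and "normal_domain_of_attraction (distr M borel (X 0 0))"
    and "prob_space N"
    and "prob_space.indep_vars N (\<lambda>_. borel) Z {1..}"
    and "\<And>k. k \<ge> 1 \<Longrightarrow> distr N borel (Z k) = std_normal_distribution"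
  shows "(\<forall>l\<ge>1. \<forall>k :: nat \<Rightarrow> nat. (\<forall>i\<in>{1..l}. 1 \<le> k i) \<longrightarrow>
        conv_in_distribution (product_topology (\<lambda>_. euclideanreal) {1..l})
          M (\<lambda>n \<omega>. \<lambda>i\<in>{1..l}. mat_trace (self_normalized_mat n (\<lambda>i j. X i j \<omega>) ^\<^sub>m k i))
          N (\<lambda>\<omega>. \<lambda>i\<in>{1..l}. of_bool (2 dvd k i) + sqrt (real (k i)) * Z (k i) \<omega>)) \<and>
      conv_in_distribution disc_holomorphic_topology
        M (\<lambda>n \<omega>. \<lambda>z\<in>ball 0 1.
             det (1\<^sub>m n - z \<cdot>\<^sub>m map_mat complex_of_real (self_normalized_mat n (\<lambda>i j. X i j \<omega>))))
        N (\<lambda>\<omega>. limit_function (\<lambda>k. Z k \<omega>))"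
proof -
  let ?\<mu> = "distr M borel (X 0 0)"
  interpret M: prob_space M by (rule assms(1))
  have Xm: "X i j \<in> borel_measurable M" for i j
    using assms(2) unfolding M.indep_vars_def by (auto dest: bspec[of _ _ "(i, j)"])
  have "distr ?\<mu> borel uminus = ?\<mu>"
    using assms(4) Xm by (simp add: distr_distr o_def)
  then interpret law: symmetric_distribution ?\<mu>
    by (intro symmetric_distribution.intro symmetric_distribution_axioms.intro M.real_distribution_distr Xm)
  obtain a where a: "attracted_distribution ?\<mu> a" by (rule law.attracted_distributionI[OF assms(5)])
  interpret iid_attracted_matrix M ?\<mu> X a
    by (intro iid_attracted_matrix.intro a iid_symmetric_matrix.intro iid_symmetric_matrix_axioms.intro
      assms law.symmetric_distribution_axioms)
  have "conv_in_distribution (product_topology (\<lambda>_. euclideanreal) {1..l})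
      M (\<lambda>n \<omega>. \<lambda>i\<in>{1..l}. mat_trace (Ymat n \<omega> ^\<^sub>m k i))
      N (\<lambda>\<omega>. \<lambda>i\<in>{1..l}. of_bool (2 dvd k i) + sqrt (real (k i)) * Z (k i) \<omega>)"
    if k: "\<forall>i\<in>{1..l}. 1 \<le> k i" for l :: nat and k :: "nat \<Rightarrow> nat"
  proof -
    have "(\<lambda>n \<omega>. \<lambda>i\<in>{1..l}. mat_trace (Ymat n \<omega> ^\<^sub>m k i)) = (\<lambda>n \<omega>. \<lambda>i\<in>{1..l}. closed_walks n (k i) \<omega>)"
      using k by (intro ext restrict_ext trace_Ymat) blast
    then show ?thesis
      using closed_walks_conv[OF assms(6-8), of "{1..l}" k] k by simp
  qed
  then show ?thesis
    using det_conv[OF assms(6-8)] by blast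
qed

end
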